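(* Let $\Omega=(0,1)$, $T>0$, $1<\alpha<2$, $\mu<\frac14$, $p\in L^2(\Omega)$, $q\in L^\infty(0,T)$, and assume $u_0\in\mathcal H^1(\Omega)$, $u_1\in L^2(\Omega)$. Then the problem $$\begin{cases}{}_0^C D_t^\alpha u(x,t)-u_{xx}(x,t)-\dfrac{\mu}{x^2}u(x,t)=p(x)q(t), & (x,t)\in\Omega\times(0,T),\\ u(x,0)=u_0(x),\quad \partial_t u(x,0)=u_1(x), & x\in\Omega,\\ u(0,t)=u(1,t)=0,& t\in(0,T),\end{cases}$$ admits a unique weak solution $u$ (in the sense defined in the context). In particular, $$u\in C([0,T];\mathcal H^1(\Omega))\cap C^1([0,T];\mathcal H^{-1}(\Omega)),\qquad {}_0^C D_t^\alpha u\in L^2(0,T;\mathcal H^{-1}(\Omega)).$$ Moreover, $$\|u\|_{C([0,T];\mathcal H^1)}+\|\partial_t u\|_{C([0,T];\mathcal H^{-1})}+\|{}_0^C D_t^\alpha u\|_{L^2(0,T;\mathcal H^{-1})}\le C\left(\|u_0\|_{\mathcal H^1}+\|u_1\|_{L^2}+\|p\|_{L^2(\Omega)}\|q\|_{L^\infty(0,T)}\right),$$ where $C>0$ depends only on $\alpha$, $T$, $\mu$ and $\Omega$.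
   Context: Here $\mu$ is a real number with $\mu<1/4$ and $\Omega=(0,1)$. For $v,w\in H_0^1(\Omega)$ put $a_\mu(v,w)=\int_0^1 v_xw_x\,dx-\mu\int_0^1\frac{vw}{x^2}\,dx$. By Hardy's inequality $\int_0^1|v|^2/x^2\,dx\le 4\int_0^1|v_x|^2\,dx$ this is a continuous, symmetric, coercive form on $H_0^1(\Omega)$. Let $L_\mu$ be the associated positive self-adjoint operator in $L^2(\Omega)$ (the Friedrichs realization of $-\frac{d^2}{dx^2}-\frac{\mu}{x^2}$ with Dirichlet conditions): $v\in D(L_\mu)$ and $L_\mu v=g$ iff $v\in H_0^1(\Omega)$, $g\in L^2(\Omega)$ and $a_\mu(v,\varphi)=(g,\varphi)_{L^2(\Omega)}$ for all $\varphi\in H_0^1(\Omega)$. $L_\mu$ has compact resolvent; let $\{\phi_n\}_{n\ge1}$ be an orthonormal basis of $L^2(\Omega)$ of eigenfunctions, $L_\mu\phi_n=\lambda_n\phi_n$, $0<\lambda_1\le\lambda_2\le\cdots\to\infty$. For $\sigma\ge0$, $\mathcal H^\sigma(\Omega)=D(L_\mu^{\sigma/2})$ with $\|v\|_{\mathcal H^\sigma}^2=\sum_n\lambda_n^\sigma|(v,\phi_n)_{L^2(\Omega)}|^2$; for $\sigma<0$, $\mathcal H^\sigma(\Omega)$ is the completion of $L^2(\Omega)$ in the norm given by the same formula, equivalently $\mathcal H^{\sigma}=(\mathcal H^{-\sigma})'$ with pivot space $L^2(\Omega)$. In particular $\mathcal H^1(\Omega)=H_0^1(\Omega)$ with the equivalent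 norm $a_\mu(v,v)^{1/2}$. Caputo derivative of order $1<\alpha<2$: ${}_0^C D_t^\alpha u(t)=\frac{1}{\Gamma(2-\alpha)}\int_0^t(t-s)^{1-\alpha}u''(s)\,ds=I_{0+}^{2-\alpha}u''(t)$, where $I_{0+}^{\beta}g(t)=\frac1{\Gamma(\beta)}\int_0^t(t-s)^{\beta-1}g(s)\,ds$. For $u$ that is only $C^1$ in time (with values in $\mathcal H^{-1}(\Omega)$) it is understood as ${}_0^C D_t^\alpha u=\frac{d}{dt}I_{0+}^{2-\alpha}(\partial_tu-\partial_tu(0))$, with $\frac{d}{dt}$ in the sense of $\mathcal H^{-1}(\Omega)$-valued distributions on $(0,T)$, which agrees with the formula above when $u''$ is integrable. Weak solution: with $f(t):=p\,q(t)$, a function $u$ is a weak solution if $u\in C([0,T];\mathcal H^1(\Omega))\cap C^1([0,T];\mathcal H^{-1}(\Omega))$, ${}_0^C D_t^\alpha u\in L^2(0,T;\mathcal H^{-1}(\Omega))$, $u(\cdot,0)=u_0$ in $\mathcal H^1(\Omega)$, $\partial_tu(\cdot,0)=u_1$ in $\mathcal H^{-1}(\Omega)$, and for a.e. $t\in(0,T)$ $$\langle {}_0^C D_t^\alpha u(t),v\rangle_{\mathcal H^{-1},\mathcal H^1}+a_\mu(u(t),v)=(f(t),v)_{L^2(\Omega)}\qquad\forall v\in\mathcal H^1(\Omega).$$ *)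

theory Defs
  imports "HOL-Analysis.Analysis" "HOL-Probability.Essential_Supremum"
begin

text \<open>
  Elements of function spaces are represented by functions; two functions that agree almost
  everywhere represent the same element. All spaces are real. \<open>\<Omega>\<close> is the interval \<open>(0,1)\<close>.
\<close>

abbreviation Omega :: "real measure" where
  "Omega \<equiv> lebesgue_on {0<..<1}"

abbreviation (input) time_interval :: "real \<Rightarrow> real measure" where
  "time_interval T \<equiv> lebesgue_on {0<..<T}"


section \<open>Lebesgue and Sobolev spaces\<close>

definition Ltwo :: "'a measure \<Rightarrow> ('a \<Rightarrow> real) set" where
  "Ltwo M = {f \<in> borel_measurable M. integrable M (\<lambda>x. (f x)\<^sup>2)}"

definition Ltwo_inner :: "'a measure \<Rightarrow> ('a \<Rightarrow> real) \<Rightarrow> ('a \<Rightarrow> real) \<Rightarrow> real" where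
  "Ltwo_inner M f g = (\<integral>x. f x * g x \<partial>M)"

definition Ltwo_norm :: "'a measure \<Rightarrow> ('a \<Rightarrow> real) \<Rightarrow> real" where
  "Ltwo_norm M f = sqrt (Ltwo_inner M f f)"

definition Linf :: "'a measure \<Rightarrow> ('a \<Rightarrow> real) set" where
  "Linf M = {f. f \<in> borel_measurable M \<and> esssup M (\<lambda>x. ereal \<bar>f x\<bar>) < \<infinity>}"

definition Linf_norm :: "'a measure \<Rightarrow> ('a \<Rightarrow> real) \<Rightarrow> real" where
  "Linf_norm M f = real_of_ereal (esssup M (\<lambda>x. ereal \<bar>f x\<bar>))"

text \<open>\<open>C\<^sub>c\<^sup>\<infinity>(a,b)\<close>, extended by zero to the real line.\<close>

definition test_functions :: "real \<Rightarrow> real \<Rightarrow> (real \<Rightarrow> real) set" where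
  "test_functions a b = {\<psi>. (\<forall>k x. (deriv ^^ k) \<psi> field_differentiable at x) \<and>
     (\<exists>c d. a < c \<and> c < d \<and> d < b \<and> (\<forall>x. x \<notin> {c..d} \<longrightarrow> \<psi> x = 0))}"

definition has_weak_deriv :: "(real \<Rightarrow> real) \<Rightarrow> (real \<Rightarrow> real) \<Rightarrow> bool" where
  "has_weak_deriv v g \<longleftrightarrow> g \<in> Ltwo Omega \<and>
     (\<forall>\<psi>\<in>test_functions 0 1. (\<integral>x. v x * deriv \<psi> x \<partial>Omega) = - (\<integral>x. g x * \<psi> x \<partial>Omega))"

definition weak_deriv :: "(real \<Rightarrow> real) \<Rightarrow> real \<Rightarrow> real" where
  "weak_deriv v = (SOME g. has_weak_deriv v g)"

definition sobolev_H1 :: "(real \<Rightarrow> real) set" where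
  "sobolev_H1 = {v \<in> Ltwo Omega. \<exists>g. has_weak_deriv v g}"

definition sobolev_H1_norm :: "(real \<Rightarrow> real) \<Rightarrow> real" where
  "sobolev_H1_norm v = sqrt ((Ltwo_norm Omega v)\<^sup>2 + (Ltwo_norm Omega (weak_deriv v))\<^sup>2)"

definition sobolev_H10 :: "(real \<Rightarrow> real) set" where
  "sobolev_H10 = {v \<in> sobolev_H1. \<exists>\<psi>::nat \<Rightarrow> real \<Rightarrow> real.
     (\<forall>n. \<psi> n \<in> test_functions 0 1) \<and> (\<lambda>n. sobolev_H1_norm (\<lambda>x. \<psi> n x - v x)) \<longlonglongrightarrow> 0}"


section \<open>The operator with inverse-square potential and its spectral scale\<close>

definition a_form :: "real \<Rightarrow> (real \<Rightarrow> real) \<Rightarrow> (real \<Rightarrow> real) \<Rightarrow> real" where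
  "a_form \<mu> v w = (\<integral>x. weak_deriv v x * weak_deriv w x \<partial>Omega) - \<mu> * (\<integral>x. v x * w x / x\<^sup>2 \<partial>Omega)"

text \<open>\<open>L_op \<mu> v g\<close> means \<open>v \<in> D(L\<^sub>\<mu>)\<close> and \<open>L\<^sub>\<mu> v = g\<close>.\<close>

definition L_op :: "real \<Rightarrow> (real \<Rightarrow> real) \<Rightarrow> (real \<Rightarrow> real) \<Rightarrow> bool" where
  "L_op \<mu> v g \<longleftrightarrow> v \<in> sobolev_H10 \<and> g \<in> Ltwo Omega \<and>
     (\<forall>\<phi>\<in>sobolev_H10. a_form \<mu> v \<phi> = Ltwo_inner Omega g \<phi>)"

text \<open>Orthonormal bases of eigenfunctions, with the numbering starting at 0.\<close>

definition eigenbasis :: "real \<Rightarrow> (nat \<Rightarrow> real \<Rightarrow> real) \<Rightarrow> (nat \<Rightarrow> real) \<Rightarrow> bool" where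
  "eigenbasis \<mu> \<phi> \<Lambda> \<longleftrightarrow>
     (\<forall>n. L_op \<mu> (\<phi> n) (\<lambda>x. \<Lambda> n * \<phi> n x)) \<and>
     (\<forall>m n. Ltwo_inner Omega (\<phi> m) (\<phi> n) = (if m = n then 1 else 0)) \<and>
     (\<forall>v\<in>Ltwo Omega.
        (\<lambda>N. Ltwo_norm Omega (\<lambda>x. v x - (\<Sum>n<N. Ltwo_inner Omega v (\<phi> n) * \<phi> n x))) \<longlonglongrightarrow> 0) \<and>
     0 < \<Lambda> 0 \<and> mono \<Lambda> \<and> filterlim \<Lambda> at_top sequentially"

text \<open>One eigenbasis is fixed for each \<open>\<mu>\<close>; the spaces below do not depend on which.\<close>

definition the_basis :: "real \<Rightarrow> (nat \<Rightarrow> real \<Rightarrow> real) \<times> (nat \<Rightarrow> real)" where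
  "the_basis \<mu> = (SOME b. eigenbasis \<mu> (fst b) (snd b))"

definition eigfun :: "real \<Rightarrow> nat \<Rightarrow> real \<Rightarrow> real" where
  "eigfun \<mu> = fst (the_basis \<mu>)"

definition eigval :: "real \<Rightarrow> nat \<Rightarrow> real" where
  "eigval \<mu> = snd (the_basis \<mu>)"

text \<open>\<open>\<H>\<^sup>\<sigma>\<close> and its norm, for \<open>\<sigma> \<ge> 0\<close>.\<close>

definition Hs :: "real \<Rightarrow> real \<Rightarrow> (real \<Rightarrow> real) set" where
  "Hs \<mu> \<sigma> = {v \<in> Ltwo Omega.
     summable (\<lambda>n. eigval \<mu> n powr \<sigma> * (Ltwo_inner Omega v (eigfun \<mu> n))\<^sup>2)}"

definition Hs_norm :: "real \<Rightarrow> real \<Rightarrow> (real \<Rightarrow> real) \<Rightarrow> real" where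
  "Hs_norm \<mu> \<sigma> v = sqrt (\<Sum>n. eigval \<mu> n powr \<sigma> * (Ltwo_inner Omega v (eigfun \<mu> n))\<^sup>2)"

text \<open>
  \<open>\<H>\<^sup>-\<^sup>\<sigma>\<close>, for \<open>\<sigma> > 0\<close>, is realised as the dual of \<open>\<H>\<^sup>\<sigma>\<close> with pivot space \<open>L\<^sup>2\<close>: its elements are functionals
  on functions, of which only the values on \<open>Hs \<mu> \<sigma>\<close> matter, and the duality pairing of \<open>F\<close> and
  \<open>v\<close> is \<open>F v\<close>. In particular the pairing of \<open>F\<close> with the \<open>n\<close>-th eigenfunction replaces the \<open>L\<^sup>2\<close> product in
  the norm. A function \<open>g\<close> is identified with \<open>pivot g\<close>.
\<close>

type_synonym functional = "(real \<Rightarrow> real) \<Rightarrow> real"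

definition pivot :: "(real \<Rightarrow> real) \<Rightarrow> functional" where
  "pivot g = (\<lambda>v. Ltwo_inner Omega g v)"

definition Hdual :: "real \<Rightarrow> real \<Rightarrow> functional set" where
  "Hdual \<mu> \<sigma> = {F.
     (\<forall>v\<in>Hs \<mu> \<sigma>. \<forall>w\<in>Hs \<mu> \<sigma>. F (\<lambda>x. v x + w x) = F v + F w) \<and>
     (\<forall>c. \<forall>v\<in>Hs \<mu> \<sigma>. F (\<lambda>x. c * v x) = c * F v) \<and>
     (\<exists>B. \<forall>v\<in>Hs \<mu> \<sigma>. \<bar>F v\<bar> \<le> B * Hs_norm \<mu> \<sigma> v)}"

definition Hdual_norm :: "real \<Rightarrow> real \<Rightarrow> functional \<Rightarrow> real" where
  "Hdual_norm \<mu> \<sigma> F = sqrt (\<Sum>n. eigval \<mu> n powr (- \<sigma>) * (F (eigfun \<mu> n))\<^sup>2)"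


section \<open>Functions of time with values in \<open>\<H>\<^sup>1\<close> and \<open>\<H>\<^sup>-\<^sup>1\<close>\<close>

definition cont_H1 :: "real \<Rightarrow> real \<Rightarrow> (real \<Rightarrow> real \<Rightarrow> real) \<Rightarrow> bool" where
  "cont_H1 \<mu> T u \<longleftrightarrow> (\<forall>t\<in>{0..T}. u t \<in> Hs \<mu> 1 \<and>
     ((\<lambda>s. Hs_norm \<mu> 1 (\<lambda>x. u s x - u t x)) \<longlongrightarrow> 0) (at t within {0..T}))"

definition cont_dual :: "real \<Rightarrow> real \<Rightarrow> (real \<Rightarrow> functional) \<Rightarrow> bool" where
  "cont_dual \<mu> T U \<longleftrightarrow> (\<forall>t\<in>{0..T}. U t \<in> Hdual \<mu> 1 \<and>
     ((\<lambda>s. Hdual_norm \<mu> 1 (\<lambda>v. U s v - U t v)) \<longlongrightarrow> 0) (at t within {0..T}))"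

definition has_dual_deriv :: "real \<Rightarrow> real \<Rightarrow> (real \<Rightarrow> functional) \<Rightarrow> functional \<Rightarrow> real \<Rightarrow> bool" where
  "has_dual_deriv \<mu> T U F t \<longleftrightarrow> F \<in> Hdual \<mu> 1 \<and>
     ((\<lambda>s. Hdual_norm \<mu> 1 (\<lambda>v. (U s v - U t v) / (s - t) - F v)) \<longlongrightarrow> 0) (at t within {0..T})"

definition Dt :: "real \<Rightarrow> real \<Rightarrow> (real \<Rightarrow> real \<Rightarrow> real) \<Rightarrow> real \<Rightarrow> functional" where
  "Dt \<mu> T u t = (SOME F. has_dual_deriv \<mu> T (\<lambda>s. pivot (u s)) F t)"

definition C1_dual :: "real \<Rightarrow> real \<Rightarrow> (real \<Rightarrow> real \<Rightarrow> real) \<Rightarrow> bool" where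
  "C1_dual \<mu> T u \<longleftrightarrow>
     cont_dual \<mu> T (\<lambda>t. pivot (u t)) \<and>
     (\<forall>t\<in>{0..T}. \<exists>F. has_dual_deriv \<mu> T (\<lambda>s. pivot (u s)) F t) \<and>
     cont_dual \<mu> T (Dt \<mu> T u)"

text \<open>The Bochner space \<open>L\<^sup>2(0,T;\<H>\<^sup>-\<^sup>1)\<close>; the approximation by simple functions is strong measurability.\<close>

definition L2_dual :: "real \<Rightarrow> real \<Rightarrow> (real \<Rightarrow> functional) set" where
  "L2_dual \<mu> T = {G.
     (AE t in time_interval T. G t \<in> Hdual \<mu> 1) \<and>
     (\<exists>S::nat \<Rightarrow> real \<Rightarrow> functional.
        (\<forall>n. simple_function (time_interval T) (S n) \<and> (\<forall>t\<in>{0<..<T}. S n t \<in> Hdual \<mu> 1)) \<and>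
        (AE t in time_interval T. (\<lambda>n. Hdual_norm \<mu> 1 (\<lambda>v. S n t v - G t v)) \<longlonglongrightarrow> 0)) \<and>
     integrable (time_interval T) (\<lambda>t. (Hdual_norm \<mu> 1 (G t))\<^sup>2)}"

definition L2_dual_norm :: "real \<Rightarrow> real \<Rightarrow> (real \<Rightarrow> functional) \<Rightarrow> real" where
  "L2_dual_norm \<mu> T G = sqrt (\<integral>t. (Hdual_norm \<mu> 1 (G t))\<^sup>2 \<partial>time_interval T)"

text \<open>
  Integrals of \<open>\<H>\<^sup>-\<^sup>1\<close>-valued functions are taken after pairing with \<open>v\<close>. Since \<open>\<H>\<^sup>-\<^sup>1\<close> is the dual
  of \<open>\<H>\<^sup>1\<close>, this determines the Bochner integral of every Bochner integrable function.
\<close>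

definition frac_int :: "real \<Rightarrow> (real \<Rightarrow> functional) \<Rightarrow> real \<Rightarrow> functional" where
  "frac_int \<beta> G t = (\<lambda>v. 1 / Gamma \<beta> * (\<integral>s. (t - s) powr (\<beta> - 1) * G s v \<partial>lebesgue_on {0<..<t}))"

definition has_distr_deriv :: "real \<Rightarrow> real \<Rightarrow> (real \<Rightarrow> functional) \<Rightarrow> (real \<Rightarrow> functional) \<Rightarrow> bool" where
  "has_distr_deriv \<mu> T U G \<longleftrightarrow> (\<forall>\<psi>\<in>test_functions 0 T. \<forall>v\<in>Hs \<mu> 1.
     (\<integral>t. deriv \<psi> t * U t v \<partial>time_interval T) = - (\<integral>t. \<psi> t * G t v \<partial>time_interval T))"

text \<open>\<open>G\<close> is the Caputo derivative of order \<open>\<alpha>\<close> of \<open>u\<close> and belongs to \<open>L\<^sup>2(0,T;\<H>\<^sup>-\<^sup>1)\<close>.\<close>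

definition has_caputo :: "real \<Rightarrow> real \<Rightarrow> real \<Rightarrow> (real \<Rightarrow> real \<Rightarrow> real) \<Rightarrow> (real \<Rightarrow> functional) \<Rightarrow> bool" where
  "has_caputo \<mu> \<alpha> T u G \<longleftrightarrow> G \<in> L2_dual \<mu> T \<and>
     has_distr_deriv \<mu> T (frac_int (2 - \<alpha>) (\<lambda>s v. Dt \<mu> T u s v - Dt \<mu> T u 0 v)) G"

definition caputo :: "real \<Rightarrow> real \<Rightarrow> real \<Rightarrow> (real \<Rightarrow> real \<Rightarrow> real) \<Rightarrow> real \<Rightarrow> functional" where
  "caputo \<mu> \<alpha> T u = (SOME G. has_caputo \<mu> \<alpha> T u G)"

definition caputo_in_L2_dual :: "real \<Rightarrow> real \<Rightarrow> real \<Rightarrow> (real \<Rightarrow> real \<Rightarrow> real) \<Rightarrow> bool" where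
  "caputo_in_L2_dual \<mu> \<alpha> T u \<longleftrightarrow> (\<exists>G. has_caputo \<mu> \<alpha> T u G)"

definition weak_solution ::
  "real \<Rightarrow> real \<Rightarrow> real \<Rightarrow> (real \<Rightarrow> real) \<Rightarrow> (real \<Rightarrow> real) \<Rightarrow> (real \<Rightarrow> real) \<Rightarrow> (real \<Rightarrow> real) \<Rightarrow>
   (real \<Rightarrow> real \<Rightarrow> real) \<Rightarrow> bool" where
  "weak_solution \<mu> \<alpha> T p q u0 u1 u \<longleftrightarrow>
     cont_H1 \<mu> T u \<and> C1_dual \<mu> T u \<and> caputo_in_L2_dual \<mu> \<alpha> T u \<and>
     (AE x in Omega. u 0 x = u0 x) \<and>
     (\<forall>v\<in>Hs \<mu> 1. Dt \<mu> T u 0 v = pivot u1 v) \<and>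
     (AE t in time_interval T. \<forall>v\<in>Hs \<mu> 1.
        caputo \<mu> \<alpha> T u t v + a_form \<mu> (u t) v = Ltwo_inner Omega (\<lambda>x. p x * q t) v)"

end

theory Submission
  imports Defs "HOL-Real_Asymp.Real_Asymp" "HOL-Complex_Analysis.Great_Picard"
begin

text \<open>
  Hardy's inequality makes the form coercive and the embedding of \<open>H\<^sub>0\<^sup>1\<close> into \<open>L\<^sup>2\<close> is compact, so
  the form has an eigenbasis and \<open>Hs \<mu> 1 = H\<^sub>0\<^sup>1\<close>. In this basis the problem decouples into scalar equations
  \<open>y + \<lambda> u = f\<close>, where \<open>y\<close> is the Caputo derivative of \<open>u\<close>, that is \<open>u = u\<^sub>0 + u\<^sub>1 t + I\<^sup>\<alpha> (f - \<lambda> u)\<close>;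
  Picard iteration solves this Volterra equation and shows that the solution is unique.

  In place of Mittag-Leffler asymptotics the bounds uniform in \<open>\<lambda>\<close> come from an energy estimate: testing
  with \<open>u'\<close> and using that \<open>\<langle>y, I\<^sup>\<beta> y\<rangle> \<ge> c \<parallel>I\<^sup>b y\<parallel>\<^sup>2\<close> for \<open>\<beta> = \<alpha> - 1 = 2 b < 1\<close> gives
  \<open>\<lambda> u\<^sup>2 \<le> \<lambda> u\<^sub>0\<^sup>2 + C (u\<^sub>1\<^sup>2 + \<parallel>f\<parallel>\<^sub>\<infinity>\<^sup>2)\<close> with \<open>C\<close> independent of \<open>\<lambda>\<close>. This is summable over the modes, and
  dominated convergence for series yields all continuity, differentiability and measurability claims.
  Conversely the coefficients of a weak solution satisfy the Volterra equation, by the lemma of du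
  Bois-Reymond applied to the distributional definition of the Caputo derivative.
\<close>

section \<open>Semi-inner products on spaces of functions\<close>

text \<open>Nothing is divided by null functions: the spaces consist of plain functions, the
  bilinear forms are only positive semidefinite, and \<open>weak_deriv\<close>, \<open>Dt\<close>
  and \<open>caputo\<close> are choices determined only up to null sets or on
  \<open>Hs \<mu> 1\<close>. Limits are therefore unique only up to null functions, and identities
  are transported by inner products or coefficients, which do not see the choice. The scalar
  analysis lives on the whole line, with Borel functions that vanish for s <= 0: fractional
  integrals become convolutions, and Fubini needs no limits of integration. For a mode with initial
  values a, b and source bound F put R = lambda a^2 + b^2 + F^2. The energy controls lambda u^2 by C
  R, so h = f - lambda u and u' have squares at most C R lambda. This is exactly what the weight 1 /
  lambda of the dual norm tolerates, and R is summable by Parseval. The condition b < 1/2 enters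
  twice: the overlap integral converges at infinity, and the kernel of order 1 - b is square
  integrable near 0.\<close>

locale semi_inner =
  fixes S :: "('a \<Rightarrow> real) set" and B :: "('a \<Rightarrow> real) \<Rightarrow> ('a \<Rightarrow> real) \<Rightarrow> real"
  assumes zero_mem: "(\<lambda>x. 0) \<in> S"
    and add_mem: "\<And>f g. f \<in> S \<Longrightarrow> g \<in> S \<Longrightarrow> (\<lambda>x. f x + g x) \<in> S"
    and scale_mem: "\<And>f c. f \<in> S \<Longrightarrow> (\<lambda>x. c * f x) \<in> S"
    and add_left: "\<And>f g h. f \<in> S \<Longrightarrow> g \<in> S \<Longrightarrow> h \<in> S \<Longrightarrow> B (\<lambda>x. f x + g x) h = B f h + B g h"
    and scale_left: "\<And>f h c. f \<in> S \<Longrightarrow> h \<in> S \<Longrightarrow> B (\<lambda>x. c * f x) h = c * B f h"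
    and sym: "\<And>f g. f \<in> S \<Longrightarrow> g \<in> S \<Longrightarrow> B f g = B g f"
    and nonneg: "\<And>f. f \<in> S \<Longrightarrow> 0 \<le> B f f"
begin

lemma add_right: "f \<in> S \<Longrightarrow> g \<in> S \<Longrightarrow> h \<in> S \<Longrightarrow> B h (\<lambda>x. f x + g x) = B h f + B h g"
  by (simp add: sym[of h "\<lambda>x. f x + g x"] sym[of h f] sym[of h g] add_left add_mem)

lemma scale_right: "f \<in> S \<Longrightarrow> h \<in> S \<Longrightarrow> B h (\<lambda>x. c * f x) = c * B h f"
  by (simp add: sym[of h "\<lambda>x. c * f x"] sym[of h f] scale_left scale_mem)

lemma diff_mem: "f \<in> S \<Longrightarrow> g \<in> S \<Longrightarrow> (\<lambda>x. f x - g x) \<in> S"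
  using add_mem[OF _ scale_mem[of g "-1"], of f] by simp

lemma diff_left: "f \<in> S \<Longrightarrow> g \<in> S \<Longrightarrow> h \<in> S \<Longrightarrow> B (\<lambda>x. f x - g x) h = B f h - B g h"
  using add_left[OF _ scale_mem[of g "-1"], of f] scale_left[of g h "-1"] by simp

lemma diff_right: "f \<in> S \<Longrightarrow> g \<in> S \<Longrightarrow> h \<in> S \<Longrightarrow> B h (\<lambda>x. f x - g x) = B h f - B h g"
  by (simp add: sym[of h "\<lambda>x. f x - g x"] sym[of h f] sym[of h g] diff_left diff_mem)

lemma zero_left: "h \<in> S \<Longrightarrow> B (\<lambda>x. 0) h = 0"
  using scale_left[of h h 0] by simp

lemma sum_mem: "(\<And>i. i \<in> I \<Longrightarrow> f i \<in> S) \<Longrightarrow> (\<lambda>x. \<Sum>i\<in>I. f i x) \<in> S"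
  by (induction I rule: infinite_finite_induct) (auto simp: zero_mem add_mem)

lemma sum_left: "(\<And>i. i \<in> I \<Longrightarrow> f i \<in> S) \<Longrightarrow> h \<in> S \<Longrightarrow> B (\<lambda>x. \<Sum>i\<in>I. f i x) h = (\<Sum>i\<in>I. B (f i) h)"
  by (induction I rule: infinite_finite_induct) (auto simp: zero_left add_left sum_mem)

lemma lincomb_mem: "(\<And>i. i \<in> I \<Longrightarrow> f i \<in> S) \<Longrightarrow> (\<lambda>x. \<Sum>i\<in>I. c i * f i x) \<in> S"
  by (rule sum_mem) (auto intro: scale_mem)

lemma lincomb_left: "(\<And>i. i \<in> I \<Longrightarrow> f i \<in> S) \<Longrightarrow> h \<in> S \<Longrightarrow>
    B (\<lambda>x. \<Sum>i\<in>I. c i * f i x) h = (\<Sum>i\<in>I. c i * B (f i) h)"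
  by (subst sum_left) (auto intro: scale_mem simp: scale_left)

lemma lincomb_right: "(\<And>i. i \<in> I \<Longrightarrow> f i \<in> S) \<Longrightarrow> h \<in> S \<Longrightarrow>
    B h (\<lambda>x. \<Sum>i\<in>I. c i * f i x) = (\<Sum>i\<in>I. c i * B h (f i))"
proof -
  assume f: "\<And>i. i \<in> I \<Longrightarrow> f i \<in> S" and h: "h \<in> S"
  have "B h (\<lambda>x. \<Sum>i\<in>I. c i * f i x) = B (\<lambda>x. \<Sum>i\<in>I. c i * f i x) h"
    by (rule sym) (auto intro: h lincomb_mem f)
  also have "\<dots> = (\<Sum>i\<in>I. c i * B (f i) h)"
    by (rule lincomb_left) (auto intro: h f)
  also have "\<dots> = (\<Sum>i\<in>I. c i * B h (f i))"
    by (intro sum.cong refl arg_cong2[where f="(*)"] sym) (auto intro: h f)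
  finally show ?thesis .
qed

lemma add_square: "f \<in> S \<Longrightarrow> g \<in> S \<Longrightarrow>
    B (\<lambda>x. f x + g x) (\<lambda>x. f x + g x) = B f f + 2 * B f g + B g g"
  by (simp add: add_left add_right add_mem sym[of g f])

lemma diff_square: "f \<in> S \<Longrightarrow> g \<in> S \<Longrightarrow>
    B (\<lambda>x. f x - g x) (\<lambda>x. f x - g x) = B f f - 2 * B f g + B g g"
  by (simp add: diff_left diff_right diff_mem sym[of g f])

lemma diff_square_commute: "f \<in> S \<Longrightarrow> g \<in> S \<Longrightarrow>
    B (\<lambda>x. f x - g x) (\<lambda>x. f x - g x) = B (\<lambda>x. g x - f x) (\<lambda>x. g x - f x)"
  by (simp add: diff_square sym[of f g])

lemma parallelogram: "f \<in> S \<Longrightarrow> g \<in> S \<Longrightarrow>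
    B (\<lambda>x. f x - g x) (\<lambda>x. f x - g x) = 2 * B f f + 2 * B g g - B (\<lambda>x. f x + g x) (\<lambda>x. f x + g x)"
  by (simp add: diff_square add_square)

text \<open>The quadratic in t given by \<open>B\<close> on f + t g is never negative. As
  \<open>B\<close> may be degenerate, g can be null without being zero; the quadratic is then affine
  in t, and its slope must vanish.\<close>

lemma Cauchy_Schwarz:
  assumes f: "f \<in> S" and g: "g \<in> S"
  shows "(B f g)\<^sup>2 \<le> B f f * B g g"
proof -
  have quad: "0 \<le> B f f + 2 * (t * B f g) + t\<^sup>2 * B g g" for t
    using nonneg[OF add_mem[OF f scale_mem[OF g, of t]]] f g
    by (simp add: add_square scale_mem scale_left scale_right power2_eq_square)
  show ?thesis
  proof (cases "B g g = 0")
    case True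
    have "B f g = 0"
    proof (rule ccontr)
      assume nz: "B f g \<noteq> 0"
      \<comment> \<open>At this t the affine function takes the value -1.\<close>
      show False using quad[of "- (B f f + 1) / (2 * B f g)"] nz True by (simp add: field_simps)
    qed
    then show ?thesis using True by simp
  next
    case False
    then have pos: "B g g > 0" using nonneg[OF g] by simp
    \<comment> \<open>This t minimises the quadratic.\<close>
    have "0 \<le> B f f + 2 * (- B f g / B g g * B f g) + (- B f g / B g g)\<^sup>2 * B g g"
      by (rule quad)
    also have "\<dots> = B f f - (B f g)\<^sup>2 / B g g"
      using pos by (simp add: power2_eq_square field_simps)
    finally have "(B f g)\<^sup>2 / B g g \<le> B f f" by simp
    then show ?thesis using pos by (simp only: pos_divide_le_eq)
  qed
qed

lemma abs_le_sqrt: "f \<in> S \<Longrightarrow> g \<in> S \<Longrightarrow> \<bar>B f g\<bar> \<le> sqrt (B f f) * sqrt (B g g)"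
  using real_le_rsqrt[of "\<bar>B f g\<bar>" "B f f * B g g"] Cauchy_Schwarz[of f g]
  by (simp only: real_sqrt_mult power2_abs)

lemma square_diff_le:
  assumes f: "f \<in> S" and g: "g \<in> S"
  shows "B (\<lambda>x. f x - g x) (\<lambda>x. f x - g x) \<le> 2 * B f f + 2 * B g g"
  using parallelogram[OF f g] nonneg[OF add_mem[OF f g]] by simp

text \<open>Convergence in the squared seminorm; a limit is determined only up to functions on which
  \<open>B\<close> vanishes.\<close>

definition conv :: "(nat \<Rightarrow> 'a \<Rightarrow> real) \<Rightarrow> ('a \<Rightarrow> real) \<Rightarrow> bool" where
  "conv s v \<longleftrightarrow> (\<lambda>n. B (\<lambda>x. s n x - v x) (\<lambda>x. s n x - v x)) \<longlonglongrightarrow> 0"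

definition cauchy :: "(nat \<Rightarrow> 'a \<Rightarrow> real) \<Rightarrow> bool" where
  "cauchy s \<longleftrightarrow> (\<forall>e>0. \<exists>N. \<forall>m\<ge>N. \<forall>n\<ge>N. B (\<lambda>x. s m x - s n x) (\<lambda>x. s m x - s n x) < e)"

lemma conv_inner:
  assumes s: "\<And>n. s n \<in> S" and v: "v \<in> S" and w: "w \<in> S" and "conv s v"
  shows "(\<lambda>n. B (s n) w) \<longlonglongrightarrow> B v w"
proof -
  have "(\<lambda>n. sqrt (B (\<lambda>x. s n x - v x) (\<lambda>x. s n x - v x)) * sqrt (B w w)) \<longlonglongrightarrow> sqrt 0 * sqrt (B w w)"
    by (intro tendsto_mult tendsto_real_sqrt tendsto_const assms(4)[unfolded conv_def])
  then have lim: "(\<lambda>n. sqrt (B (\<lambda>x. s n x - v x) (\<lambda>x. s n x - v x)) * sqrt (B w w)) \<longlonglongrightarrow> 0" by simp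
  have "norm (B (s n) w - B v w) \<le> sqrt (B (\<lambda>x. s n x - v x) (\<lambda>x. s n x - v x)) * sqrt (B w w)" for n
    using abs_le_sqrt[OF diff_mem[OF s[of n] v] w] by (simp only: diff_left[OF s v w] real_norm_def)
  then have "(\<lambda>n. B (s n) w - B v w) \<longlonglongrightarrow> 0"
    by (intro Lim_null_comparison[OF _ lim] always_eventually) blast
  then show ?thesis by (simp add: LIM_zero_iff)
qed

lemma conv_square:
  assumes s: "\<And>n. s n \<in> S" and v: "v \<in> S" and "conv s v"
  shows "(\<lambda>n. B (s n) (s n)) \<longlonglongrightarrow> B v v"
proof -
  have "(\<lambda>n. B (\<lambda>x. s n x - v x) (\<lambda>x. s n x - v x) + 2 * B (s n) v - B v v) \<longlonglongrightarrow> 0 + 2 * B v v - B v v"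
    by (intro tendsto_add tendsto_diff tendsto_mult tendsto_const conv_inner[OF s v v assms(3)] assms(3)[unfolded conv_def])
  then show ?thesis using s v by (simp add: diff_square)
qed

lemma conv_subseq: "conv s v \<Longrightarrow> strict_mono r \<Longrightarrow> conv (\<lambda>n. s (r n)) v"
  unfolding conv_def by (auto dest: LIMSEQ_subseq_LIMSEQ simp: o_def)

lemma conv_cauchy:
  assumes s: "\<And>n. s n \<in> S" and v: "v \<in> S" and "conv s v"
  shows "cauchy s"
  unfolding cauchy_def
proof (intro allI impI)
  fix e :: real assume e: "e > 0"
  obtain N where N: "\<And>n. n \<ge> N \<Longrightarrow> \<bar>B (\<lambda>x. s n x - v x) (\<lambda>x. s n x - v x)\<bar> < e / 4"
    using LIMSEQ_D[OF assms(3)[unfolded conv_def], of "e/4"] e by auto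
  show "\<exists>N. \<forall>m\<ge>N. \<forall>n\<ge>N. B (\<lambda>x. s m x - s n x) (\<lambda>x. s m x - s n x) < e"
  proof (intro exI allI impI)
    fix m n assume "N \<le> m" "N \<le> n"
    then show "B (\<lambda>x. s m x - s n x) (\<lambda>x. s m x - s n x) < e"
      using square_diff_le[OF diff_mem[OF s[of m] v] diff_mem[OF s[of n] v]] N[of m] N[of n] by simp
  qed
qed

end

section \<open>Orthonormal sequences, Bessel's inequality and Fourier partial sums\<close>

locale orthonormal_seq = semi_inner S B for S :: "('a \<Rightarrow> real) set" and B +
  fixes \<phi> :: "nat \<Rightarrow> 'a \<Rightarrow> real"
  assumes phi_mem: "\<And>n. \<phi> n \<in> S"
    and orthonormal: "\<And>m n. B (\<phi> m) (\<phi> n) = (if m = n then 1 else 0)"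
begin

definition proj :: "nat \<Rightarrow> ('a \<Rightarrow> real) \<Rightarrow> 'a \<Rightarrow> real" where
  "proj N v = (\<lambda>x. \<Sum>n<N. B v (\<phi> n) * \<phi> n x)"

lemma proj_mem: "proj N v \<in> S"
  unfolding proj_def by (rule lincomb_mem) (rule phi_mem)

lemma lincomb_coeff: "B (\<lambda>x. \<Sum>n<N. c n * \<phi> n x) (\<phi> k) = (if k < N then c k else 0)"
  by (subst lincomb_left) (auto simp: phi_mem orthonormal if_distrib cong: if_cong)

lemma proj_coeff: "B (proj N v) (\<phi> k) = (if k < N then B v (\<phi> k) else 0)"
  unfolding proj_def by (rule lincomb_coeff)

lemma lincomb_square: "B (\<lambda>x. \<Sum>n<N. c n * \<phi> n x) (\<lambda>x. \<Sum>n<N. c n * \<phi> n x) = (\<Sum>n<N. (c n)\<^sup>2)"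
  by (subst lincomb_right) (auto simp: phi_mem lincomb_mem lincomb_coeff power2_eq_square)

text \<open>Pythagoras; Bessel's inequality is the nonnegativity of the left-hand side.\<close>

lemma proj_residual:
  assumes v: "v \<in> S"
  shows "B (\<lambda>x. v x - proj N v x) (\<lambda>x. v x - proj N v x) = B v v - (\<Sum>n<N. (B v (\<phi> n))\<^sup>2)"
proof -
  have "B v (proj N v) = (\<Sum>n<N. (B v (\<phi> n))\<^sup>2)"
    unfolding proj_def by (subst lincomb_right) (auto simp: phi_mem v power2_eq_square)
  moreover have "B (proj N v) (proj N v) = (\<Sum>n<N. (B v (\<phi> n))\<^sup>2)"
    unfolding proj_def by (rule lincomb_square)
  ultimately show ?thesis by (simp add: diff_square v proj_mem)
qed

lemma Bessel: "v \<in> S \<Longrightarrow> (\<Sum>n<N. (B v (\<phi> n))\<^sup>2) \<le> B v v"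
  using nonneg[OF diff_mem[OF _ proj_mem], of v N v] proj_residual[of v N] by simp

lemma Bessel_summable: "v \<in> S \<Longrightarrow> summable (\<lambda>n. (B v (\<phi> n))\<^sup>2)"
  by (rule summableI_nonneg_bounded) (auto intro: Bessel)

lemma lincomb_diff_square:
  assumes "M \<le> N"
  shows "B (\<lambda>x. (\<Sum>n<N. c n * \<phi> n x) - (\<Sum>n<M. c n * \<phi> n x)) (\<lambda>x. (\<Sum>n<N. c n * \<phi> n x) - (\<Sum>n<M. c n * \<phi> n x))
    = (\<Sum>n\<in>{M..<N}. (c n)\<^sup>2)"
proof -
  have "(\<lambda>x. (\<Sum>n<N. c n * \<phi> n x) - (\<Sum>n<M. c n * \<phi> n x)) = (\<lambda>x. \<Sum>n<N. (if n < M then 0 else c n) * \<phi> n x)"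
  proof
    fix x
    have "{..<N} = {..<M} \<union> {M..<N}" "{..<M} \<inter> {M..<N} = {}" using assms by auto
    then show "(\<Sum>n<N. c n * \<phi> n x) - (\<Sum>n<M. c n * \<phi> n x) = (\<Sum>n<N. (if n < M then 0 else c n) * \<phi> n x)"
      by (simp add: sum.union_disjoint)
  qed
  moreover have "(\<Sum>n<N. (if n < M then 0 else c n)\<^sup>2) = (\<Sum>n\<in>{M..<N}. (c n)\<^sup>2)"
    by (rule sum.mono_neutral_cong_right) auto
  ultimately show ?thesis by (simp only: lincomb_square)
qed

lemma lincomb_cauchy:
  assumes "summable (\<lambda>n. (c n)\<^sup>2)"
  shows "cauchy (\<lambda>N x. \<Sum>n<N. c n * \<phi> n x)"
  unfolding cauchy_def
proof (intro allI impI)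
  fix e :: real assume e: "e > 0"
  obtain N where N: "\<And>m n. m \<ge> N \<Longrightarrow> norm (\<Sum>k=m..<n. (c k)\<^sup>2) < e"
    using assms[unfolded summable_Cauchy] e by blast
  have le: "B (\<lambda>x. (\<Sum>n<q. c n * \<phi> n x) - (\<Sum>n<p. c n * \<phi> n x)) (\<lambda>x. (\<Sum>n<q. c n * \<phi> n x) - (\<Sum>n<p. c n * \<phi> n x)) < e"
    if "p \<ge> N" "p \<le> q" for p q
    using N[OF that(1), of q] by (simp add: lincomb_diff_square[OF that(2)])
  show "\<exists>N. \<forall>m\<ge>N. \<forall>n\<ge>N. B (\<lambda>x. (\<Sum>n<m. c n * \<phi> n x) - (\<Sum>k<n. c k * \<phi> k x))
      (\<lambda>x. (\<Sum>n<m. c n * \<phi> n x) - (\<Sum>k<n. c k * \<phi> k x)) < e"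
  proof (intro exI allI impI)
    fix m n assume mn: "N \<le> m" "N \<le> n"
    show "B (\<lambda>x. (\<Sum>n<m. c n * \<phi> n x) - (\<Sum>k<n. c k * \<phi> k x))
      (\<lambda>x. (\<Sum>n<m. c n * \<phi> n x) - (\<Sum>k<n. c k * \<phi> k x)) < e"
    proof (cases "n \<le> m")
      case True then show ?thesis using le[of n m] mn by simp
    next
      case False then show ?thesis using le[of m n] mn
        by (subst diff_square_commute) (auto intro: lincomb_mem phi_mem)
    qed
  qed
qed

end

section \<open>Eigenbases of compact forms\<close>

text \<open>For small t the linear term would decide the sign. This is the first-order condition at
  a minimum, used to derive the eigenvalue equation.\<close>

lemma real_quadratic_zero:
  fixes a b :: real
  assumes "\<And>t. 0 \<le> 2 * (t * a) + t\<^sup>2 * b"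
  shows "a = 0"
proof (rule ccontr)
  assume nz: "a \<noteq> 0"
  define d where "d = \<bar>b\<bar> + 1"
  have d: "d > 0" "b < d" unfolding d_def by auto
  \<comment> \<open>With d positive and larger than b, the step -a / d makes the quadratic
    negative.\<close>
  have "0 \<le> 2 * (- a / d * a) + (- a / d)\<^sup>2 * b" by (rule assms)
  also have "\<dots> = (a\<^sup>2 / d\<^sup>2) * (b - 2 * d)"
    using d by (simp add: power2_eq_square field_simps)
  also have "\<dots> < 0"
    using nz d by (intro mult_pos_neg) auto
  finally show False by simp
qed

text \<open>The setting of the spectral theorem: \<open>S\<close> with \<open>B\<close> stands for
  L^2, \<open>V\<close> with \<open>A\<close> for the form domain with its energy,
  \<open>V_compact\<close> for the compact embedding. \<open>infinite_dim\<close> guarantees that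
  the search for further minimisers never stops.\<close>

locale compact_form = H: semi_inner S B + V: semi_inner V A
  for S :: "('a \<Rightarrow> real) set" and B and V :: "('a \<Rightarrow> real) set" and A +
  fixes K :: real
  assumes V_sub: "V \<subseteq> S"
    and K_pos: "0 < K"
    and coercive: "\<And>v. v \<in> V \<Longrightarrow> B v v \<le> K * A v v"
    and V_complete: "\<And>s. (\<And>n. s n \<in> V) \<Longrightarrow> V.cauchy s \<Longrightarrow> \<exists>v\<in>V. V.conv s v"
    and V_compact: "\<And>s C. (\<And>n::nat. s n \<in> V) \<Longrightarrow> (\<And>n. A (s n) (s n) \<le> C) \<Longrightarrow>
      \<exists>r::nat \<Rightarrow> nat. strict_mono r \<and> H.cauchy (\<lambda>n. s (r n))"
    and infinite_dim: "\<exists>e::nat \<Rightarrow> 'a \<Rightarrow> real. (\<forall>n. e n \<in> V) \<and> (\<forall>m n. B (e m) (e n) = (if m = n then 1 else 0))"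
begin

lemma V_S: "v \<in> V \<Longrightarrow> v \<in> S"
  using V_sub by auto

lemma V_conv_conv:
  assumes s: "\<And>n. s n \<in> V" and v: "v \<in> V" and "V.conv s v"
  shows "H.conv s v"
  unfolding H.conv_def
proof (rule real_tendsto_sandwich[OF _ _ tendsto_const])
  show "(\<lambda>n. K * A (\<lambda>x. s n x - v x) (\<lambda>x. s n x - v x)) \<longlonglongrightarrow> 0"
    using tendsto_mult_left[OF assms(3)[unfolded V.conv_def], of K] by simp
  show "\<forall>\<^sub>F n in sequentially. 0 \<le> B (\<lambda>x. s n x - v x) (\<lambda>x. s n x - v x)"
    by (intro always_eventually allI H.nonneg H.diff_mem V_S s v)
  show "\<forall>\<^sub>F n in sequentially. B (\<lambda>x. s n x - v x) (\<lambda>x. s n x - v x) \<le> K * A (\<lambda>x. s n x - v x) (\<lambda>x. s n x - v x)"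
    by (intro always_eventually allI coercive V.diff_mem s v)
qed

text \<open>Only the first \<open>n\<close> members of \<open>f\<close> enter, so the condition on
  the \<open>n\<close>-th eigenfunction refers to its predecessors alone, as well-founded recursion
  requires.\<close>

definition orth :: "nat \<Rightarrow> (nat \<Rightarrow> 'a \<Rightarrow> real) \<Rightarrow> ('a \<Rightarrow> real) set" where
  "orth n f = {v \<in> V. \<forall>i<n. B v (f i) = 0}"

lemma orth_add: "(\<And>i. i < n \<Longrightarrow> f i \<in> V) \<Longrightarrow> v \<in> orth n f \<Longrightarrow> w \<in> orth n f \<Longrightarrow> (\<lambda>x. v x + w x) \<in> orth n f"
  by (simp add: orth_def V.add_mem H.add_left V_S)

lemma orth_scale: "(\<And>i. i < n \<Longrightarrow> f i \<in> V) \<Longrightarrow> v \<in> orth n f \<Longrightarrow> (\<lambda>x. c * v x) \<in> orth n f"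
  by (simp add: orth_def V.scale_mem H.scale_left V_S)

text \<open>Bessel's inequality for \<open>n\<close> orthonormal functions, summed over \<open>n + 1\<close> members of an infinite
  orthonormal family, shows that some member lies outside their span.\<close>

lemma orth_nontrivial:
  assumes f: "\<And>i. i < n \<Longrightarrow> f i \<in> V" and on: "\<And>i j. i < n \<Longrightarrow> j < n \<Longrightarrow> B (f i) (f j) = (if i = j then 1 else 0)"
  shows "\<exists>v\<in>orth n f. B v v = 1"
proof -
  obtain e :: "nat \<Rightarrow> 'a \<Rightarrow> real" where e: "(\<forall>k. e k \<in> V) \<and> (\<forall>k l. B (e k) (e l) = (if k = l then 1 else 0))"
    using infinite_dim by (rule exE)
  have eV: "e k \<in> V" and eo: "B (e k) (e l) = (if k = l then 1 else 0)" for k l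
    using e by auto
  interpret E: orthonormal_seq S B e
    by unfold_locales (auto simp: V_S eV eo)
  define w where "w k = (\<lambda>x. e k x - (\<Sum>i<n. B (e k) (f i) * f i x))" for k
  have LV: "(\<lambda>x. \<Sum>i<n. B (e k) (f i) * f i x) \<in> V" for k
    by (rule V.lincomb_mem) (auto intro: f)
  have wV: "w k \<in> V" for k
    unfolding w_def by (intro V.diff_mem eV LV)
  have Lf: "B (\<lambda>x. \<Sum>i<n. B (e k) (f i) * f i x) (f j) = B (e k) (f j)" if "j < n" for k j
    using that by (subst H.lincomb_left) (auto simp: V_S f on if_distrib cong: if_cong)
  have worth: "w k \<in> orth n f" for k
    unfolding orth_def using wV
    by (auto simp: w_def H.diff_left V_S eV LV f Lf)
  have wsq: "B (w k) (w k) = 1 - (\<Sum>i<n. (B (e k) (f i))\<^sup>2)" for k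
  proof -
    have 1: "B (e k) (\<lambda>x. \<Sum>i<n. B (e k) (f i) * f i x) = (\<Sum>i<n. (B (e k) (f i))\<^sup>2)"
      by (subst H.lincomb_right) (auto simp: V_S f eV power2_eq_square)
    have 2: "B (\<lambda>x. \<Sum>i<n. B (e k) (f i) * f i x) (\<lambda>x. \<Sum>i<n. B (e k) (f i) * f i x) = (\<Sum>i<n. (B (e k) (f i))\<^sup>2)"
      by (subst H.lincomb_right) (auto simp: V_S f LV Lf power2_eq_square)
    show ?thesis
      unfolding w_def by (subst H.diff_square) (auto simp: V_S eV LV 1 2 eo)
  qed
  have "\<exists>k\<le>n. B (w k) (w k) > 0"
  proof (rule ccontr)
    assume "\<not> ?thesis"
    then have "1 \<le> (\<Sum>i<n. (B (e k) (f i))\<^sup>2)" if "k \<le> n" for k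
      using wsq[of k] that by (auto simp: not_less)
    then have "(\<Sum>k<Suc n. 1) \<le> (\<Sum>k<Suc n. \<Sum>i<n. (B (e k) (f i))\<^sup>2)"
      by (intro sum_mono) auto
    also have "\<dots> = (\<Sum>i<n. \<Sum>k<Suc n. (B (f i) (e k))\<^sup>2)"
      by (subst sum.swap) (intro sum.cong refl arg_cong[where f="\<lambda>x. x\<^sup>2"] H.sym V_S eV f, auto)
    also have "\<dots> \<le> (\<Sum>i<n. B (f i) (f i))"
      by (intro sum_mono E.Bessel V_S f) auto
    also have "\<dots> = real n" by (simp add: on)
    finally show False by simp
  qed
  then obtain k where k: "B (w k) (w k) > 0" by blast
  define c where "c = 1 / sqrt (B (w k) (w k))"
  have "B (\<lambda>x. c * w k x) (\<lambda>x. c * w k x) = c\<^sup>2 * B (w k) (w k)"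
    by (simp add: H.scale_left H.scale_right H.scale_mem V_S wV power2_eq_square)
  also have "\<dots> = 1" using k by (simp add: c_def power_divide)
  finally show ?thesis
    using orth_scale[OF f worth, of c k] by blast
qed

text \<open>The parallelogram law turns a minimising sequence that is Cauchy for \<open>B\<close> into one that is Cauchy for \<open>A\<close>.\<close>

lemma Rayleigh_minimiser:
  assumes f: "\<And>i. i < n \<Longrightarrow> f i \<in> V" and on: "\<And>i j. i < n \<Longrightarrow> j < n \<Longrightarrow> B (f i) (f j) = (if i = j then 1 else 0)"
  shows "\<exists>u\<in>orth n f. B u u = 1 \<and> (\<forall>v\<in>orth n f. A u u * B v v \<le> A v v)"
proof -
  define X where "X = {A v v | v. v \<in> orth n f \<and> B v v = 1}"
  define L where "L = Inf X"
  have orthV: "v \<in> V" if "v \<in> orth n f" for v using that by (simp add: orth_def)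
  have X0: "X \<noteq> {}" using orth_nontrivial[OF f on] unfolding X_def by blast
  have bdd: "bdd_below X"
    unfolding X_def by (rule bdd_belowI[of _ 0]) (auto intro: V.nonneg orthV)
  have L0: "L \<ge> 0" unfolding L_def using X0
    by (intro cInf_greatest) (auto simp: X_def intro: V.nonneg orthV)
  have Lle: "L * B v v \<le> A v v" if v: "v \<in> orth n f" for v
  proof (cases "B v v = 0")
    case True then show ?thesis using V.nonneg[OF orthV[OF v]] by simp
  next
    case False
    then have pos: "B v v > 0" using H.nonneg[OF V_S[OF orthV[OF v]]] by simp
    define c where "c = 1 / sqrt (B v v)"
    have c2: "c\<^sup>2 = 1 / B v v" using pos by (simp add: c_def power_divide)
    have "B (\<lambda>x. c * v x) (\<lambda>x. c * v x) = c\<^sup>2 * B v v"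
      by (simp add: H.scale_left H.scale_right H.scale_mem V_S orthV v power2_eq_square)
    moreover have "A (\<lambda>x. c * v x) (\<lambda>x. c * v x) = c\<^sup>2 * A v v"
      by (simp add: V.scale_left V.scale_right V.scale_mem orthV v power2_eq_square)
    ultimately have "c\<^sup>2 * A v v \<in> X"
      unfolding X_def using orth_scale[OF f v, of c] pos c2 by force
    then have "L \<le> c\<^sup>2 * A v v" unfolding L_def by (rule cInf_lower[OF _ bdd])
    then show ?thesis using pos by (simp add: c2 pos_le_divide_eq)
  qed
  have "\<exists>v. v \<in> orth n f \<and> B v v = 1 \<and> A v v < L + 1 / real (Suc k)" for k
  proof -
    obtain x where "x \<in> X" "x < L + 1 / real (Suc k)"
      using cInf_lessD[OF X0, of "L + 1 / real (Suc k)"] unfolding L_def by auto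
    then show ?thesis unfolding X_def by blast
  qed
  then obtain s :: "nat \<Rightarrow> 'a \<Rightarrow> real" where so: "\<And>k. s k \<in> orth n f" and s1: "\<And>k. B (s k) (s k) = 1"
    and sA: "\<And>k. A (s k) (s k) < L + 1 / real (Suc k)" by metis
  have sV: "s k \<in> V" for k by (rule orthV[OF so])
  have inv1: "1 / real (Suc k) \<le> 1" for k by simp
  have sC: "A (s k) (s k) \<le> L + 1" for k
    using sA[of k] inv1[of k] by linarith
  obtain r where r: "strict_mono r" and rc: "H.cauchy (\<lambda>n. s (r n))"
    using V_compact[of s "L + 1", OF sV sC] by blast
  define t where "t k = s (r k)" for k
  have tV: "t k \<in> V" and tS: "t k \<in> S" and torth: "t k \<in> orth n f" and t1: "B (t k) (t k) = 1" for k
    using sV V_S so s1 by (auto simp: t_def)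
  have tA: "A (t k) (t k) \<le> L + 1 / real (Suc k)" for k
  proof -
    have "1 / real (Suc (r k)) \<le> 1 / real (Suc k)"
      using seq_suble[OF r, of k] by (intro divide_left_mono) auto
    then show ?thesis using sA[of "r k"] by (simp add: t_def)
  qed
  \<comment> \<open>The lower bound \<open>L\<close> on the Rayleigh quotient is applied to the sum
    in the parallelogram law; the terms 4 L cancel, leaving the two excesses over the infimum and
    the \<open>B\<close>-distance.\<close>
  have key: "A (\<lambda>x. t m x - t k x) (\<lambda>x. t m x - t k x) \<le>
      2 / real (Suc m) + 2 / real (Suc k) + L * B (\<lambda>x. t m x - t k x) (\<lambda>x. t m x - t k x)" for m k
  proof -
    have "L * B (\<lambda>x. t m x + t k x) (\<lambda>x. t m x + t k x) \<le> A (\<lambda>x. t m x + t k x) (\<lambda>x. t m x + t k x)"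
      by (intro Lle orth_add f torth)
    moreover have "B (\<lambda>x. t m x + t k x) (\<lambda>x. t m x + t k x) = 4 - B (\<lambda>x. t m x - t k x) (\<lambda>x. t m x - t k x)"
      using H.parallelogram[OF tS[of m] tS[of k]] t1 by simp
    ultimately have "L * (4 - B (\<lambda>x. t m x - t k x) (\<lambda>x. t m x - t k x)) \<le> A (\<lambda>x. t m x + t k x) (\<lambda>x. t m x + t k x)"
      by (simp only:)
    then have 1: "4 * L - L * B (\<lambda>x. t m x - t k x) (\<lambda>x. t m x - t k x) \<le> A (\<lambda>x. t m x + t k x) (\<lambda>x. t m x + t k x)"
      by (simp only: right_diff_distrib mult.commute[of 4 L])
    have "2 / real (Suc m) = 2 * (1 / real (Suc m))" "2 / real (Suc k) = 2 * (1 / real (Suc k))" by auto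
    then show ?thesis
      using V.parallelogram[OF tV[of m] tV[of k]] tA[of m] tA[of k] 1 by linarith
  qed
  have "V.cauchy t"
    unfolding V.cauchy_def
  proof (intro allI impI)
    fix e :: real assume e: "e > 0"
    \<comment> \<open>L + 1 instead of L avoids a division by zero when the infimum is 0.\<close>
    have "e / (2 * (L + 1)) > 0" using e L0 by simp
    then obtain N1 where N1: "\<And>m k. m \<ge> N1 \<Longrightarrow> k \<ge> N1 \<Longrightarrow> B (\<lambda>x. t m x - t k x) (\<lambda>x. t m x - t k x) < e / (2 * (L + 1))"
      using rc[folded t_def, unfolded H.cauchy_def] by meson
    obtain N2 where N2: "1 / real (Suc N2) < e / 8"
      using nat_approx_posE[of "e/8"] e by auto
    show "\<exists>N. \<forall>m\<ge>N. \<forall>k\<ge>N. A (\<lambda>x. t m x - t k x) (\<lambda>x. t m x - t k x) < e"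
    proof (intro exI allI impI)
      fix m k assume mk: "max N1 N2 \<le> m" "max N1 N2 \<le> k"
      have "2 / real (Suc m) \<le> 2 / real (Suc N2)" "2 / real (Suc k) \<le> 2 / real (Suc N2)"
        using mk by (intro divide_left_mono; simp)+
      moreover have "2 / real (Suc N2) = 2 * (1 / real (Suc N2))" by simp
      moreover have "L * B (\<lambda>x. t m x - t k x) (\<lambda>x. t m x - t k x) \<le> e / 2"
      proof -
        have "L * B (\<lambda>x. t m x - t k x) (\<lambda>x. t m x - t k x) \<le> L * (e / (2 * (L + 1)))"
          using N1[of m k] mk L0 by (intro mult_left_mono) auto
        also have "\<dots> \<le> (L + 1) * (e / (2 * (L + 1)))"
          using L0 e by (intro mult_right_mono) auto
        also have "\<dots> = e / 2" using L0 by (simp add: field_simps)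
        finally show ?thesis .
      qed
      ultimately show "A (\<lambda>x. t m x - t k x) (\<lambda>x. t m x - t k x) < e"
        using key[of m k] N2 by linarith
    qed
  qed
  then obtain u where u: "u \<in> V" and tu: "V.conv t u"
    using V_complete[of t, OF tV] by blast
  have Htu: "H.conv t u" by (rule V_conv_conv[OF tV u tu])
  have "B u u = 1"
    using LIMSEQ_unique[OF H.conv_square[OF tS V_S[OF u] Htu]] t1 by simp
  moreover have "B u (f i) = 0" if "i < n" for i
    using LIMSEQ_unique[OF H.conv_inner[OF tS V_S[OF u] V_S[OF f[OF that]] Htu], of 0] torth that
    by (simp add: orth_def)
  moreover have "A u u \<le> L"
  proof (rule LIMSEQ_le[OF V.conv_square[OF tV u tu]])
    show "(\<lambda>k. L + 1 / real (Suc k)) \<longlonglongrightarrow> L"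
      using tendsto_add[OF tendsto_const LIMSEQ_inverse_real_of_nat, of L] by (simp add: inverse_eq_divide)
    show "\<exists>N. \<forall>n\<ge>N. A (t n) (t n) \<le> L + 1 / real (Suc n)" using tA by blast
  qed
  moreover have "A u u * B v v \<le> A v v" if "v \<in> orth n f" for v
    using mult_right_mono[OF \<open>A u u \<le> L\<close> H.nonneg[OF V_S[OF orthV[OF that]]]] Lle[OF that] by linarith
  ultimately show ?thesis using u by (intro bexI[of _ u]) (auto simp: orth_def)
qed

text \<open>The Euler-Lagrange equation of the constrained minimum: u + t w stays in the orthogonal
  complement, and minimality at t = 0 removes the term linear in t.\<close>

lemma minimiser_eigen:
  assumes f: "\<And>i. i < n \<Longrightarrow> f i \<in> V" and u: "u \<in> orth n f" and u1: "B u u = 1"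
    and min: "\<And>v. v \<in> orth n f \<Longrightarrow> A u u * B v v \<le> A v v" and w: "w \<in> orth n f"
  shows "A u w = A u u * B u w"
proof -
  have V: "u \<in> V" "w \<in> V" using u w by (auto simp: orth_def)
  have "0 \<le> 2 * (t * (A u w - A u u * B u w)) + t\<^sup>2 * (A w w - A u u * B w w)" for t
  proof -
    let ?v = "\<lambda>x. u x + t * w x"
    have tw: "(\<lambda>x. t * w x) \<in> V" by (rule V.scale_mem[OF V(2)])
    have "?v \<in> orth n f" by (intro orth_add orth_scale f u w)
    from min[OF this] have "A u u * (B u u + 2 * (t * B u w) + t\<^sup>2 * B w w) \<le> A u u + 2 * (t * A u w) + t\<^sup>2 * A w w"
      using V by (simp add: V.add_square V.scale_mem V.scale_left V.scale_right
          H.add_square H.scale_mem H.scale_left H.scale_right V_S power2_eq_square mult.assoc)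
    then show ?thesis by (simp add: u1 algebra_simps power2_eq_square)
  qed
  then show ?thesis using real_quadratic_zero by force
qed

text \<open>Each eigenfunction minimises the Rayleigh quotient on the orthogonal complement of its
  predecessors. The minimum property is kept in the conclusion because completeness of the basis
  will be derived from it.\<close>

theorem eigenbasis_exists:
  "\<exists>\<phi> \<Lambda>. (\<forall>n. \<phi> n \<in> V) \<and> (\<forall>m n. B (\<phi> m) (\<phi> n) = (if m = n then 1 else 0)) \<and>
     (\<forall>n. \<forall>w\<in>V. A (\<phi> n) w = \<Lambda> n * B (\<phi> n) w) \<and>
     (\<forall>n. \<forall>v\<in>V. (\<forall>i<n. B v (\<phi> i) = 0) \<longrightarrow> \<Lambda> n * B v v \<le> A v v) \<and> 0 < \<Lambda> 0 \<and> mono \<Lambda> \<and> filterlim \<Lambda> at_top sequentially"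
proof -
  define P where "P f n u \<longleftrightarrow> u \<in> orth n f \<and> B u u = 1 \<and> (\<forall>v\<in>orth n f. A u u * B v v \<le> A v v)" for f n u
  have "\<exists>\<phi>. \<forall>n. P \<phi> n (\<phi> n)"
  \<comment> \<open>The choice of each eigenfunction depends on all its predecessors.\<close>
  proof (rule dependent_wellorder_choice)
    fix r :: "'a \<Rightarrow> real" and f g :: "nat \<Rightarrow> 'a \<Rightarrow> real" and n :: nat
    assume "\<And>y. y < n \<Longrightarrow> f y = g y"
    then have "orth n f = orth n g" by (auto simp: orth_def)
    then show "P f n r = P g n r" by (simp add: P_def)
  next
    fix n f assume IH: "\<And>y. y < n \<Longrightarrow> P f y (f y)"
    have fV: "f i \<in> V" if "i < n" for i using IH[OF that] by (simp add: P_def orth_def)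
    have "B (f i) (f j) = (if i = j then 1 else 0)" if "i < n" "j < n" for i j
      using IH[OF that(1)] IH[OF that(2)] H.sym[OF V_S V_S, OF fV fV, OF that]
      by (cases i j rule: linorder_cases) (auto simp: P_def orth_def)
    from Rayleigh_minimiser[of n f, OF fV this] show "\<exists>r. P f n r" by (auto simp: P_def)
  qed
  then obtain \<phi> where P: "\<And>n. P \<phi> n (\<phi> n)" by blast
  define \<Lambda> where "\<Lambda> n = A (\<phi> n) (\<phi> n)" for n
  have pV: "\<phi> n \<in> V" and porth: "\<phi> n \<in> orth n \<phi>" and p1: "B (\<phi> n) (\<phi> n) = 1" for n using P[of n] by (auto simp: P_def orth_def)
  have pS: "\<phi> n \<in> S" for n by (rule V_S[OF pV])
  have on: "B (\<phi> m) (\<phi> n) = (if m = n then 1 else 0)" for m n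
    using porth[of m] porth[of n] p1 H.sym[OF pS[of m] pS[of n]]
    by (cases m n rule: linorder_cases) (auto simp: orth_def)
  interpret O: orthonormal_seq S B \<phi>
    by unfold_locales (auto simp: on pS)
  have mono: "mono \<Lambda>"
  proof (rule monoI)
    fix m n :: nat assume "m \<le> n"
    then have "\<phi> n \<in> orth m \<phi>" using porth[of n] by (auto simp: orth_def)
    then show "\<Lambda> m \<le> \<Lambda> n" using P[of m] p1[of n] by (fastforce simp: P_def \<Lambda>_def)
  qed
  have eig: "\<forall>w\<in>V. A (\<phi> n) w = \<Lambda> n * B (\<phi> n) w" for n
  proof (induction n rule: less_induct)
    case (less n)
    show ?case
    proof
      fix w assume w: "w \<in> V"
      \<comment> \<open>\<open>minimiser_eigen\<close> tests only with functions orthogonal to the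
        predecessors. A general w is reduced to its residual, because each earlier eigenfunction is
        \<open>A\<close>-orthogonal to the n-th by the induction hypothesis and symmetry.\<close>
      have L: "O.proj n w \<in> V" unfolding O.proj_def by (intro V.lincomb_mem pV)
      have wo: "(\<lambda>x. w x - O.proj n w x) \<in> orth n \<phi>"
        unfolding orth_def by (auto simp: V.diff_mem w L H.diff_left V_S pS O.proj_coeff)
      have "A (\<phi> n) (\<phi> i) = 0" if "i < n" for i
        using less[OF that] V.sym[OF pV[of i] pV[of n]] pV[of n] on[of i n] that by simp
      then have "A (\<phi> n) (O.proj n w) = 0"
        unfolding O.proj_def by (subst V.lincomb_right) (auto simp: pV)
      moreover have "B (\<phi> n) (O.proj n w) = 0"
        using O.proj_coeff[of n w n] H.sym[OF pS V_S[OF L], of n] by simp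
      moreover have "A (\<phi> n) (\<lambda>x. w x - O.proj n w x) = A (\<phi> n) (\<phi> n) * B (\<phi> n) (\<lambda>x. w x - O.proj n w x)"
        using P[of n] wo by (intro minimiser_eigen[of n \<phi>] pV) (auto simp: P_def)
      ultimately show "A (\<phi> n) w = \<Lambda> n * B (\<phi> n) w"
        by (simp add: V.diff_right H.diff_right w L pV pS V_S \<Lambda>_def)
    qed
  qed
  \<comment> \<open>Bounded eigenvalues would yield a Cauchy subsequence of orthonormal functions,
    whose mutual squared distances are 2.\<close>
  have unb: "\<exists>n. C < \<Lambda> n" for C
  proof (rule ccontr)
    assume "\<not> ?thesis"
    then have "A (\<phi> n) (\<phi> n) \<le> C" for n by (auto simp: \<Lambda>_def not_less)
    from V_compact[of \<phi> C, OF pV this] obtain r where r: "strict_mono r" and c: "H.cauchy (\<lambda>n. \<phi> (r n))" by blast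
    obtain N where N: "\<And>m n. m \<ge> N \<Longrightarrow> n \<ge> N \<Longrightarrow> B (\<lambda>x. \<phi> (r m) x - \<phi> (r n) x) (\<lambda>x. \<phi> (r m) x - \<phi> (r n) x) < 1"
      using c[unfolded H.cauchy_def] zero_less_one by blast
    have "r N \<noteq> r (Suc N)" using r by (metis lessI less_irrefl strict_mono_def)
    then show False using N[of N "Suc N"] by (simp add: H.diff_square pS on)
  qed
  have "filterlim \<Lambda> at_top sequentially"
    unfolding filterlim_at_top
  proof
    fix C
    obtain n where "C < \<Lambda> n" using unb by blast
    then show "\<forall>\<^sub>F x in sequentially. C \<le> \<Lambda> x"
      using monoD[OF mono] by (intro eventually_sequentiallyI[of n]) (meson less_imp_le order_trans)
  qed
  moreover have "0 < \<Lambda> 0"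
    using coercive[OF pV[of 0]] p1[of 0] K_pos unfolding \<Lambda>_def
    by (smt (verit) mult_nonneg_nonpos)
  moreover have "\<forall>v\<in>V. (\<forall>i<n. B v (\<phi> i) = 0) \<longrightarrow> \<Lambda> n * B v v \<le> A v v" for n
    using P[of n] by (simp add: P_def orth_def \<Lambda>_def)
  ultimately show ?thesis using pV on eig mono by blast
qed

end

text \<open>\<open>B\<close>-null functions play the role of functions vanishing almost everywhere.\<close>

locale form_eigenbasis = H: semi_inner S B + V: semi_inner V A + orthonormal_seq S B \<phi>
  for S :: "('a \<Rightarrow> real) set" and B and V :: "('a \<Rightarrow> real) set" and A and \<phi> +
  fixes \<Lambda> :: "nat \<Rightarrow> real" and K :: real
  assumes V_sub: "V \<subseteq> S"
    and coercive: "\<And>v. v \<in> V \<Longrightarrow> B v v \<le> K * A v v"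
    and V_complete: "\<And>s. (\<And>n. s n \<in> V) \<Longrightarrow> V.cauchy s \<Longrightarrow> \<exists>v\<in>V. V.conv s v"
    and S_complete: "\<And>s. (\<And>n. s n \<in> S) \<Longrightarrow> H.cauchy s \<Longrightarrow> \<exists>v\<in>S. H.conv s v"
    and V_null: "\<And>v w. v \<in> V \<Longrightarrow> w \<in> S \<Longrightarrow> B (\<lambda>x. w x - v x) (\<lambda>x. w x - v x) = 0 \<Longrightarrow> w \<in> V"
    and A_null: "\<And>v w. v \<in> V \<Longrightarrow> B v v = 0 \<Longrightarrow> w \<in> V \<Longrightarrow> A v w = 0"
    and phi_V: "\<And>n. \<phi> n \<in> V"
    and eigen: "\<And>n w. w \<in> V \<Longrightarrow> A (\<phi> n) w = \<Lambda> n * B (\<phi> n) w"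
    and Lambda_pos: "\<And>n. 0 < \<Lambda> n"
    and basis: "\<And>v. v \<in> S \<Longrightarrow> H.conv (\<lambda>N. proj N v) v"
begin

abbreviation coeff :: "('a \<Rightarrow> real) \<Rightarrow> nat \<Rightarrow> real" where "coeff v n \<equiv> B v (\<phi> n)"

lemma V_S': "v \<in> V \<Longrightarrow> v \<in> S"
  using V_sub by auto

lemma Parseval: "v \<in> S \<Longrightarrow> w \<in> S \<Longrightarrow> (\<lambda>n. coeff v n * coeff w n) sums B v w"
proof -
  assume v: "v \<in> S" and w: "w \<in> S"
  have "B (proj N v) w = (\<Sum>n<N. coeff v n * coeff w n)" for N
    unfolding proj_def by (subst H.lincomb_left) (auto simp: phi_mem w H.sym[OF w phi_mem])
  then show ?thesis
    using H.conv_inner[OF proj_mem v w basis[OF v]] by (simp add: sums_def)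
qed

lemma null_if_coeff_zero: "v \<in> S \<Longrightarrow> (\<And>n. coeff v n = 0) \<Longrightarrow> B v v = 0"
  using Parseval[of v v] by (simp add: sums_iff)

lemma Riesz_Fischer:
  assumes "summable (\<lambda>n. (c n)\<^sup>2)"
  shows "\<exists>v\<in>S. \<forall>n. coeff v n = c n"
proof -
  let ?s = "\<lambda>N x. \<Sum>n<N. c n * \<phi> n x"
  have s: "?s N \<in> S" for N by (intro H.lincomb_mem phi_mem)
  obtain v where v: "v \<in> S" and conv: "H.conv ?s v"
    using S_complete[of ?s, OF s, OF lincomb_cauchy[OF assms]] by blast
  have "coeff v n = c n" for n
  proof -
    have "(\<lambda>N. B (?s N) (\<phi> n)) \<longlonglongrightarrow> coeff v n"
      by (rule H.conv_inner[OF s v phi_mem conv])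
    moreover have "(\<lambda>N. B (?s N) (\<phi> n)) \<longlonglongrightarrow> c n"
      by (rule tendsto_eventually, rule eventually_sequentiallyI[of "Suc n"]) (simp add: lincomb_coeff)
    ultimately show ?thesis by (rule LIMSEQ_unique)
  qed
  then show ?thesis using v by blast
qed

lemma proj_V: "proj N v \<in> V"
  unfolding proj_def by (intro V.lincomb_mem phi_V)

lemma A_lincomb: "w \<in> V \<Longrightarrow> A (\<lambda>x. \<Sum>n<N. c n * \<phi> n x) w = (\<Sum>n<N. \<Lambda> n * c n * coeff w n)"
  by (subst V.lincomb_left) (auto simp: phi_V eigen V_S' H.sym[OF phi_mem V_S'] mult_ac)

text \<open>Scaling by the square root of the eigenvalue makes Bessel's inequality and the Cauchy
  criterion for orthonormal sums available for the energy form.\<close>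

lemma energy_basis: "orthonormal_seq V A (\<lambda>n x. 1 / sqrt (\<Lambda> n) * \<phi> n x)"
proof
  show "(\<lambda>x. 1 / sqrt (\<Lambda> n) * \<phi> n x) \<in> V" for n by (intro V.scale_mem phi_V)
  show "A (\<lambda>x. 1 / sqrt (\<Lambda> m) * \<phi> m x) (\<lambda>x. 1 / sqrt (\<Lambda> n) * \<phi> n x) = (if m = n then 1 else 0)" for m n
    using Lambda_pos[of n] by (simp only: V.scale_left V.scale_right V.scale_mem phi_V eigen orthonormal) (auto simp: field_simps)
qed

lemma V_energy_summable:
  assumes v: "v \<in> V"
  shows "summable (\<lambda>n. \<Lambda> n * (coeff v n)\<^sup>2)"
proof -
  interpret E: orthonormal_seq V A "\<lambda>n x. 1 / sqrt (\<Lambda> n) * \<phi> n x" by (rule energy_basis)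
  have "(A v (\<lambda>x. 1 / sqrt (\<Lambda> n) * \<phi> n x))\<^sup>2 = \<Lambda> n * (coeff v n)\<^sup>2" for n
  proof -
    have "A v (\<lambda>x. 1 / sqrt (\<Lambda> n) * \<phi> n x) = 1 / sqrt (\<Lambda> n) * (\<Lambda> n * coeff v n)"
      using eigen[OF v, of n] V.sym[OF v phi_V, of n] H.sym[OF V_S'[OF v] phi_mem, of n]
      by (simp only: V.scale_right[OF phi_V v])
    also have "\<dots> = sqrt (\<Lambda> n) * coeff v n"
      using Lambda_pos[of n] real_sqrt_mult_self[of "\<Lambda> n"] by (simp add: field_simps)
    finally show ?thesis using Lambda_pos[of n] by (simp add: power_mult_distrib)
  qed
  then show ?thesis using E.Bessel_summable[OF v] by simp
qed

lemma proj_V_cauchy: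
  assumes "summable (\<lambda>n. \<Lambda> n * (coeff v n)\<^sup>2)"
  shows "V.cauchy (\<lambda>N. proj N v)"
proof -
  interpret E: orthonormal_seq V A "\<lambda>n x. 1 / sqrt (\<Lambda> n) * \<phi> n x" by (rule energy_basis)
  have "V.cauchy (\<lambda>N x. \<Sum>n<N. (sqrt (\<Lambda> n) * coeff v n) * (1 / sqrt (\<Lambda> n) * \<phi> n x))"
    using assms Lambda_pos by (intro E.lincomb_cauchy) (simp add: power_mult_distrib less_imp_le)
  moreover have "sqrt (\<Lambda> n) * a * (1 / sqrt (\<Lambda> n) * b) = a * b" for n a b
    using Lambda_pos[of n] by simp
  ultimately show ?thesis unfolding proj_def by (simp only:)
qed

text \<open>If the weighted sum is finite, the projections of v converge in energy to some w. By
  coercivity they converge to w for \<open>B\<close> too, where they also converge to v; so v - w is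
  null, and \<open>V_null\<close> puts v into \<open>V\<close>.\<close>

lemma mem_V_iff: "v \<in> V \<longleftrightarrow> v \<in> S \<and> summable (\<lambda>n. \<Lambda> n * (coeff v n)\<^sup>2)"
  and V_conv_proj: "v \<in> V \<Longrightarrow> V.conv (\<lambda>N. proj N v) v"
proof -
  have *: "\<exists>w\<in>V. V.conv (\<lambda>N. proj N v) w \<and> B (\<lambda>x. v x - w x) (\<lambda>x. v x - w x) = 0"
    if v: "v \<in> S" and s: "summable (\<lambda>n. \<Lambda> n * (coeff v n)\<^sup>2)" for v
  proof -
    obtain w where w: "w \<in> V" and c: "V.conv (\<lambda>N. proj N v) w"
      using V_complete[of "\<lambda>N. proj N v", OF proj_V proj_V_cauchy[OF s]] by blast
    have le: "B (\<lambda>x. v x - w x) (\<lambda>x. v x - w x) \<le>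
      2 * B (\<lambda>x. proj N v x - v x) (\<lambda>x. proj N v x - v x) + 2 * (K * A (\<lambda>x. proj N v x - w x) (\<lambda>x. proj N v x - w x))" for N
    proof -
      have "B (\<lambda>x. (proj N v x - w x) - (proj N v x - v x)) (\<lambda>x. (proj N v x - w x) - (proj N v x - v x)) \<le>
        2 * B (\<lambda>x. proj N v x - w x) (\<lambda>x. proj N v x - w x) + 2 * B (\<lambda>x. proj N v x - v x) (\<lambda>x. proj N v x - v x)"
        by (intro H.square_diff_le H.diff_mem proj_mem v V_S' w)
      moreover have "B (\<lambda>x. proj N v x - w x) (\<lambda>x. proj N v x - w x) \<le> K * A (\<lambda>x. proj N v x - w x) (\<lambda>x. proj N v x - w x)"
        by (intro coercive V.diff_mem proj_V w)
      ultimately show ?thesis by simp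
    qed
    have "(\<lambda>N. 2 * B (\<lambda>x. proj N v x - v x) (\<lambda>x. proj N v x - v x) + 2 * (K * A (\<lambda>x. proj N v x - w x) (\<lambda>x. proj N v x - w x))) \<longlonglongrightarrow> 2 * 0 + 2 * (K * 0)"
      by (intro tendsto_add tendsto_mult tendsto_const basis[OF v, unfolded H.conv_def] c[unfolded V.conv_def])
    then have "B (\<lambda>x. v x - w x) (\<lambda>x. v x - w x) \<le> 0"
      by (intro LIMSEQ_le_const[where X="\<lambda>N. 2 * B (\<lambda>x. proj N v x - v x) (\<lambda>x. proj N v x - v x) + 2 * (K * A (\<lambda>x. proj N v x - w x) (\<lambda>x. proj N v x - w x))"])
         (use le in auto)
    then have "B (\<lambda>x. v x - w x) (\<lambda>x. v x - w x) = 0"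
      by (rule antisym[OF _ H.nonneg[OF H.diff_mem[OF v V_S'[OF w]]]])
    then show ?thesis by (intro bexI[OF _ w] conjI c)
  qed
  show "v \<in> V \<longleftrightarrow> v \<in> S \<and> summable (\<lambda>n. \<Lambda> n * (coeff v n)\<^sup>2)"
  proof
    assume "v \<in> V" then show "v \<in> S \<and> summable (\<lambda>n. \<Lambda> n * (coeff v n)\<^sup>2)"
      by (intro conjI V_energy_summable V_S')
  next
    assume a: "v \<in> S \<and> summable (\<lambda>n. \<Lambda> n * (coeff v n)\<^sup>2)"
    obtain w where w: "w \<in> V" and n: "B (\<lambda>x. v x - w x) (\<lambda>x. v x - w x) = 0"
      using *[OF conjunct1[OF a] conjunct2[OF a]] by (elim bexE conjE)
    show "v \<in> V" by (rule V_null[OF w conjunct1[OF a] n])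
  qed
  assume v: "v \<in> V"
  obtain w where w: "w \<in> V" and c: "V.conv (\<lambda>N. proj N v) w" and n: "B (\<lambda>x. v x - w x) (\<lambda>x. v x - w x) = 0"
    using *[OF V_S'[OF v] V_energy_summable[OF v]] by (elim bexE conjE)
  \<comment> \<open>The difference v - w is null, hence invisible to \<open>A\<close>, so energy
    convergence to w is energy convergence to v.\<close>
  have "A (\<lambda>x. proj N v x - v x) (\<lambda>x. proj N v x - v x) = A (\<lambda>x. proj N v x - w x) (\<lambda>x. proj N v x - w x)" for N
  proof -
    have z: "A (\<lambda>x. v x - w x) g = 0" if "g \<in> V" for g
      by (rule A_null[OF V.diff_mem[OF v w] n that])
    have pw: "(\<lambda>x. proj N v x - w x) \<in> V" by (intro V.diff_mem proj_V w)
    have "A (\<lambda>x. (proj N v x - w x) - (v x - w x)) (\<lambda>x. (proj N v x - w x) - (v x - w x)) =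
      A (\<lambda>x. proj N v x - w x) (\<lambda>x. proj N v x - w x)"
      using V.sym[OF V.diff_mem[OF v w] pw] z[OF pw] z[OF V.diff_mem[OF v w]]
      by (subst V.diff_square[OF pw V.diff_mem[OF v w]]) simp
    then show ?thesis by simp
  qed
  then show "V.conv (\<lambda>N. proj N v) v" using c by (simp add: V.conv_def)
qed

lemma A_sums:
  assumes v: "v \<in> V" and w: "w \<in> V"
  shows "(\<lambda>n. \<Lambda> n * coeff v n * coeff w n) sums A v w"
  using V.conv_inner[OF proj_V v w V_conv_proj[OF v]] A_lincomb[OF w]
  by (simp add: sums_def proj_def)

end

section \<open>Test functions\<close>

text \<open>The flat function exp (-1 / x) with its quotients by powers of x: differentiation stays
  within combinations of these, so smoothness needs no formula for higher derivatives.\<close>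

definition eta :: "nat \<Rightarrow> real \<Rightarrow> real" where
  "eta m x = (if 0 < x then exp (- 1 / x) / x ^ m else 0)"

lemma eta_pos: "0 < x \<Longrightarrow> 0 < eta m x" and eta_nonneg: "0 \<le> eta m x"
  and eta_zero: "x \<le> 0 \<Longrightarrow> eta m x = 0"
  by (auto simp: eta_def)

lemma eta_tendsto_0: "(eta m \<longlongrightarrow> 0) (at 0)"
proof (rule filterlim_split_at)
  show "(eta m \<longlongrightarrow> 0) (at_left 0)"
    by (rule tendsto_eventually) (auto simp: eta_def eventually_at_filter)
  have "((\<lambda>x. inverse x ^ m / exp (inverse x)) \<longlongrightarrow> 0) (at_right (0::real))"
    by (rule filterlim_compose[OF tendsto_power_div_exp_0 filterlim_inverse_at_top_right])
  moreover have "\<forall>\<^sub>F x in at_right 0. inverse x ^ m / exp (inverse x) = eta m x"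
    by (auto simp: eta_def eventually_at_filter exp_minus field_simps)
  ultimately show "(eta m \<longlongrightarrow> 0) (at_right 0)"
    by (rule Lim_transform_eventually)
qed

lemma eta_deriv: "(eta m has_field_derivative eta (m + 2) x - real m * eta (m + 1) x) (at x)"
proof (cases x "0::real" rule: linorder_cases)
  case less
  then have "(eta m has_field_derivative 0) (at x)"
    by (intro has_field_derivative_transform_within_open[OF DERIV_const[of 0], of "{..<0}"]) (auto simp: eta_def)
  then show ?thesis using less by (simp add: eta_def)
next
  case equal
  \<comment> \<open>The difference quotient at 0 is \<open>eta (Suc m)\<close>, which tends to
    0.\<close>
  have "((\<lambda>h. (eta m (0 + h) - eta m 0) / h) \<longlongrightarrow> 0) (at 0)"
    by (rule Lim_transform_eventually[OF eta_tendsto_0[of "Suc m"]])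
       (auto simp: eta_def eventually_at_filter mult.commute)
  then show ?thesis unfolding equal by (simp add: DERIV_def eta_def)
next
  case greater
  have "((\<lambda>x. exp (- 1 / x) / x ^ m) has_field_derivative eta (m + 2) x - real m * eta (m + 1) x) (at x)"
  proof -
    have 1: "((\<lambda>x. exp (- 1 / x)) has_field_derivative exp (- 1 / x) / x\<^sup>2) (at x)"
      using greater by (auto intro!: derivative_eq_intros simp: power2_eq_square)
    have 2: "((\<lambda>x. inverse (x ^ m)) has_field_derivative - (real m / x ^ (m + 1))) (at x)"
    proof -
      have "((\<lambda>x. inverse (x ^ m)) has_field_derivative - (inverse (x ^ m) * (real m * x ^ (m - 1)) * inverse (x ^ m))) (at x)"
        using greater by (intro DERIV_inverse' DERIV_pow[of m x, simplified]) auto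
      moreover have "inverse (x ^ m) * (real m * x ^ (m - 1)) * inverse (x ^ m) = real m / x ^ (m + 1)"
        using greater by (cases m) (auto simp: field_simps)
      ultimately show ?thesis by simp
    qed
    have 3: "eta (m + 2) x = exp (- 1 / x) / x\<^sup>2 * inverse (x ^ m)"
      using greater by (simp add: eta_def power_add divide_inverse power2_eq_square)
    have 4: "eta (m + 1) x = exp (- 1 / x) / x ^ (m + 1)"
      using greater by (simp add: eta_def)
    have "((\<lambda>x. exp (- 1 / x) / x ^ m) has_field_derivative
        exp (- 1 / x) / x\<^sup>2 * inverse (x ^ m) + - (real m / x ^ (m + 1)) * exp (- 1 / x)) (at x)"
      using DERIV_mult[OF 1 2] by (simp only: divide_inverse)
    then show ?thesis unfolding 3 4 by simp
  qed
  then show ?thesis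
    by (rule has_field_derivative_transform_within_open[where S="{0<..}"]) (use greater in \<open>auto simp: eta_def\<close>)
qed

text \<open>A linear space of functions that is closed under differentiation; membership replaces an
  induction over all derivatives. For c < d the generators are positive exactly between c and
  d.\<close>

inductive_set bumps :: "(real \<Rightarrow> real) set" where
  bump: "(\<lambda>x. eta m (x - c) * eta n (d - x)) \<in> bumps"
| sum: "f \<in> bumps \<Longrightarrow> g \<in> bumps \<Longrightarrow> (\<lambda>x. f x + g x) \<in> bumps"
| scale: "f \<in> bumps \<Longrightarrow> (\<lambda>x. k * f x) \<in> bumps"

lemma bumps_diff: "f \<in> bumps \<Longrightarrow> g \<in> bumps \<Longrightarrow> (\<lambda>x. f x - g x) \<in> bumps"
  using bumps.sum[OF _ bumps.scale[of g "-1"], of f] by simp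

lemma bumps_deriv: "f \<in> bumps \<Longrightarrow> \<exists>g\<in>bumps. \<forall>x. (f has_field_derivative g x) (at x)"
proof (induction rule: bumps.induct)
  case (bump m c n d)
  let ?E = "\<lambda>m n x. eta m (x - c) * eta n (d - x)"
  let ?g = "\<lambda>x. (?E (m + 2) n x + (- real m) * ?E (m + 1) n x) + ((-1) * ?E m (n + 2) x + real n * ?E m (n + 1) x)"
  have "?g \<in> bumps" by (rule bumps.sum[OF bumps.sum[OF bumps.bump bumps.scale[OF bumps.bump]] bumps.sum[OF bumps.scale[OF bumps.bump] bumps.scale[OF bumps.bump]]])
  moreover have "(?E m n has_field_derivative ?g x) (at x)" for x
  proof -
    have "((\<lambda>x. x - c) has_field_derivative 1) (at x)" "((\<lambda>x. d - x) has_field_derivative - 1) (at x)"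
      by (auto intro!: derivative_eq_intros)
    note 1 = DERIV_chain2[where f="eta m", OF eta_deriv this(1)]
      and 2 = DERIV_chain2[where f="eta n", OF eta_deriv this(2)]
    show ?thesis
      by (rule DERIV_cong[OF DERIV_mult[OF 1 2]]) (simp add: algebra_simps)
  qed
  ultimately show ?case by (intro bexI[of _ ?g] allI)
next
  case (sum f g)
  then obtain f' g' where "f' \<in> bumps" "g' \<in> bumps" and d: "\<And>x. (f has_field_derivative f' x) (at x)" "\<And>x. (g has_field_derivative g' x) (at x)"
    by blast
  then show ?case by (intro bexI[of _ "\<lambda>x. f' x + g' x"] allI DERIV_add[OF d] bumps.sum)
next
  case (scale f k)
  then obtain f' where "f' \<in> bumps" and d: "\<And>x. (f has_field_derivative f' x) (at x)"
    by blast
  then show ?case by (intro bexI[of _ "\<lambda>x. k * f' x"] allI DERIV_cmult[OF d] bumps.scale)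
qed

lemma bumps_continuous: "f \<in> bumps \<Longrightarrow> continuous_on A f"
  using bumps_deriv[of f] by (metis DERIV_continuous_on has_field_derivative_at_within)

lemma bumps_higher_deriv: "f \<in> bumps \<Longrightarrow> (deriv ^^ k) f \<in> bumps"
proof (induction k)
  case (Suc k)
  then obtain g where g: "g \<in> bumps" "\<And>x. ((deriv ^^ k) f has_field_derivative g x) (at x)"
    using bumps_deriv by blast
  have "(deriv ^^ Suc k) f = g" using g(2) by (auto simp: DERIV_imp_deriv)
  then show ?case using g(1) by simp
qed simp

lemma bumps_differentiable: "f \<in> bumps \<Longrightarrow> f field_differentiable at x"
  using bumps_deriv[of f] by (auto simp: field_differentiable_def)

text \<open>Asking only the derivative to be in \<open>bumps\<close> admits primitives, for instance
  differences of two smooth steps.\<close>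

lemma test_function_if_deriv_bump:
  assumes "g \<in> bumps" and d: "\<And>x. (f has_field_derivative g x) (at x)"
    and "a < c" "c < d" "d < b" and "\<And>x. x \<notin> {c..d} \<Longrightarrow> f x = 0"
  shows "f \<in> test_functions a b"
proof -
  have "deriv f = g" using d by (auto simp: DERIV_imp_deriv)
  then have 1: "(deriv ^^ Suc k) f = (deriv ^^ k) g" for k
    by (simp only: funpow_Suc_right o_apply)
  have "(deriv ^^ k) f field_differentiable at x" for k x
  proof (cases k)
    case 0
    then show ?thesis using d by (auto simp: field_differentiable_def)
  next
    case (Suc j)
    then show ?thesis unfolding Suc 1 by (intro bumps_differentiable bumps_higher_deriv assms(1))
  qed
  then show ?thesis using assms by (auto simp: test_functions_def)
qed

lemma test_function_continuous:
  assumes "\<psi> \<in> test_functions a b"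
  shows "continuous_on A \<psi>" "continuous_on A (deriv \<psi>)" "(\<psi> has_field_derivative deriv \<psi> x) (at x)"
proof -
  have *: "(deriv ^^ k) \<psi> field_differentiable at x" for k x
    using assms by (auto simp: test_functions_def)
  have "(deriv ^^ 0) \<psi> field_differentiable at x" "(deriv ^^ 1) \<psi> field_differentiable at x" for x
    using *[of _ x] by blast+
  then have d: "\<psi> field_differentiable at x" "deriv \<psi> field_differentiable at x" for x by simp_all
  then show "continuous_on A \<psi>" "continuous_on A (deriv \<psi>)"
    by (meson continuous_at_imp_continuous_on field_differentiable_imp_continuous_at)+
  show "(\<psi> has_field_derivative deriv \<psi> x) (at x)"
    using d by (simp add: field_differentiable_derivI)
qed

text \<open>The normalised primitive of a bump. Its derivative \<open>h\<close> serves as a unit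
  mass in averages, \<open>H\<close> itself as a building block of cutoffs.\<close>

lemma smooth_step:
  assumes cd: "c < d"
  obtains H h :: "real \<Rightarrow> real" where "h \<in> bumps" "\<And>x. (H has_field_derivative h x) (at x)"
    "\<And>x. 0 \<le> h x" "\<And>x. x \<le> c \<Longrightarrow> H x = 0" "\<And>x. d \<le> x \<Longrightarrow> H x = 1" "\<And>x. x \<notin> {c<..<d} \<Longrightarrow> h x = 0"
    "\<And>x. 0 \<le> H x" "\<And>x. H x \<le> 1"
proof -
  define r where "r x = eta 0 (x - c) * eta 0 (d - x)" for x
  have r: "r \<in> bumps" unfolding r_def by (rule bumps.bump)
  have rpos: "r x > 0" if "c < x" "x < d" for x using that by (simp add: r_def eta_pos)
  have r0: "0 \<le> r x" for x by (simp add: r_def eta_nonneg)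
  have rz: "r x = 0" if "x \<notin> {c<..<d}" for x using that by (auto simp: r_def eta_def)
  \<comment> \<open>Starting at c - 1 puts every x >= c in the interior of an interval of
    integration, so that the derivative within the interval is the full derivative.\<close>
  define F where "F x = integral {c - 1..x} r" for x
  have Fz: "F x = 0" if "x \<le> c" for x
  proof -
    have "integral {c - 1..x} r = integral {c - 1..x} (\<lambda>x. 0)"
      using that by (intro integral_cong) (auto intro: rz)
    then show ?thesis by (simp add: F_def)
  qed
  have F': "(F has_field_derivative r x) (at x)" for x
  proof (cases "x < c")
    case True
    have "(F has_field_derivative 0) (at x)"
      using True by (intro has_field_derivative_transform_within_open[OF DERIV_const[of 0], of "{..<c}"]) (auto simp: Fz)
    then show ?thesis using rz[of x] True by simp
  next
    case False
    have "(F has_field_derivative r x) (at x within {c - 1..x + 1})"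
      unfolding F_def using False by (intro integral_has_real_derivative bumps_continuous r) auto
    then show ?thesis using False by (simp add: at_within_Icc_at)
  qed
  have Fmono: "F x \<le> F y" if "x \<le> y" for x y
    by (rule DERIV_nonneg_imp_nondecreasing[OF that]) (use F' r0 in blast)
  obtain e where e: "c < e" "e < d" using dense[OF cd] by blast
  have FI: "0 < F d"
  proof -
    have "\<exists>z>c. z < d \<and> F d - F c = (d - c) * r z"
      by (rule MVT2[OF cd]) (use F' in blast)
    then show ?thesis using rpos Fz[of c] cd by auto
  qed
  have Fd: "F x = F d" if "d \<le> x" for x
  proof (cases "d = x")
    case False
    then have "d < x" using that by simp
    then have "\<exists>z>d. z < x \<and> F x - F d = (x - d) * r z"
      by (rule MVT2) (use F' in blast)
    then show ?thesis using rz by auto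
  qed simp
  show ?thesis
  proof
    show "(\<lambda>x. 1 / F d * r x) \<in> bumps" by (rule bumps.scale[OF r])
    show "((\<lambda>x. 1 / F d * F x) has_field_derivative 1 / F d * r x) (at x)" for x
      by (intro DERIV_cmult F')
    show "0 \<le> 1 / F d * r x" for x using r0 FI by simp
    show "1 / F d * F x = 0" if "x \<le> c" for x using Fz[OF that] by simp
    show "1 / F d * F x = 1" if "d \<le> x" for x using Fd[OF that] FI by simp
    show "1 / F d * r x = 0" if "x \<notin> {c<..<d}" for x using rz[OF that] by simp
    have "0 \<le> F x" for x using Fmono[of "min x c" x] Fz[of "min x c"] by simp
    then show "0 \<le> 1 / F d * F x" for x using FI by simp
    have "F x \<le> F d" for x using Fmono[of x "max x d"] Fd[of "max x d"] by simp
    then show "1 / F d * F x \<le> 1" for x using FI by simp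
  qed
qed

section \<open>Du Bois-Reymond's lemma and the fundamental lemma of the calculus of
  variations\<close>

lemma integrable_bounded_interval:
  fixes f :: "real \<Rightarrow> real"
  assumes "f \<in> borel_measurable (lebesgue_on {a<..<b})" and "\<And>x. x \<in> {a<..<b} \<Longrightarrow> \<bar>f x\<bar> \<le> C"
  shows "integrable (lebesgue_on {a<..<b}) f"
proof -
  interpret finite_measure "lebesgue_on {a<..<b}" by (rule finite_measure_lebesgue_on) simp
  show ?thesis
    using assms by (intro integrable_const_bound[where B=C]) auto
qed

lemma integrable_lebesgue_on_subset:
  fixes f :: "real \<Rightarrow> real"
  assumes "integrable (lebesgue_on A) f" "A \<in> sets lebesgue" "C \<in> sets lebesgue" "C \<subseteq> A"
  shows "integrable (lebesgue_on C) f"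
proof -
  have "integrable lebesgue (\<lambda>x. indicator A x *\<^sub>R f x)"
    using assms(1,2) by (simp add: integrable_restrict_space)
  then have "integrable lebesgue (\<lambda>x. indicator C x *\<^sub>R (indicator A x *\<^sub>R f x))"
    using assms(3) by (rule integrable_mult_indicator[rotated])
  moreover have "(\<lambda>x. indicator C x *\<^sub>R (indicator A x *\<^sub>R f x)) = (\<lambda>x. indicator C x *\<^sub>R f x)"
    using assms(4) by (intro ext) (auto simp: indicator_def)
  ultimately have "integrable lebesgue (\<lambda>x. indicator C x *\<^sub>R f x)" by (simp only:)
  then show ?thesis using assms(3) by (subst integrable_restrict_space) auto
qed

text \<open>Testing with the difference of two smooth steps compares the averages of \<open>G\<close> near two points.\<close>

lemma du_Bois_Reymond:
  fixes G :: "real \<Rightarrow> real"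
  assumes cont: "continuous_on {a<..<b} G"
    and orth: "\<And>\<psi>. \<psi> \<in> test_functions a b \<Longrightarrow> (\<integral>x. deriv \<psi> x * G x \<partial>lebesgue_on {a<..<b}) = 0"
    and p: "p \<in> {a<..<b}" and q: "q \<in> {a<..<b}"
  shows "G p = G q"
proof (rule ccontr)
  assume "G p \<noteq> G q"
  \<comment> \<open>The two averages will coincide and lie within e of G p and G q, so the distance
    of these values is at most 2 e, which is less than 3 e.\<close>
  define e where "e = \<bar>G p - G q\<bar> / 3"
  have e: "e > 0" using \<open>G p \<noteq> G q\<close> by (simp add: e_def)
  have near: "\<exists>d>0. {c - d..c + d} \<subseteq> {a<..<b} \<and> (\<forall>x\<in>{c - d..c + d}. \<bar>G x - G c\<bar> \<le> e)" if c: "c \<in> {a<..<b}" for c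
  proof -
    obtain d where d: "d > 0" "\<And>x. x \<in> {a<..<b} \<Longrightarrow> dist x c < d \<Longrightarrow> dist (G x) (G c) < e"
      using cont[unfolded continuous_on_iff] c e by blast
    define d' where "d' = min (d / 2) (min ((c - a) / 2) ((b - c) / 2))"
    have d'0: "d' > 0" using d(1) c by (auto simp: d'_def)
    have d'1: "d' \<le> d / 2" "d' \<le> (c - a) / 2" "d' \<le> (b - c) / 2" unfolding d'_def by (simp_all only: min_le_iff_disj order_refl simp_thms)
    have sub: "{c - d'..c + d'} \<subseteq> {a<..<b}"
    proof
      fix x assume "x \<in> {c - d'..c + d'}"
      then have "c - d' \<le> x" "x \<le> c + d'" "a < c" "c < b" using c by auto
      then have "a < x" "x < b" using d'1 by (auto simp: field_simps)
      then show "x \<in> {a<..<b}" by simp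
    qed
    have "\<bar>G x - G c\<bar> \<le> e" if "x \<in> {c - d'..c + d'}" for x
    proof -
      have "dist x c < d" using that d(1) d'1(1) unfolding dist_real_def atLeastAtMost_iff by linarith
      then show ?thesis using d(2)[of x] that sub by (fastforce simp: dist_real_def)
    qed
    then show ?thesis using d'0 sub by blast
  qed
  obtain dp where dp: "dp > 0" "{p - dp..p + dp} \<subseteq> {a<..<b}" "\<And>x. x \<in> {p - dp..p + dp} \<Longrightarrow> \<bar>G x - G p\<bar> \<le> e"
    using near[OF p] by blast
  obtain dq where dq: "dq > 0" "{q - dq..q + dq} \<subseteq> {a<..<b}" "\<And>x. x \<in> {q - dq..q + dq} \<Longrightarrow> \<bar>G x - G q\<bar> \<le> e"
    using near[OF q] by blast
  \<comment> \<open>\<open>h\<close> has mass one and lives where G is within e of G c, so its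
    average of G is within e of G c.\<close>
  have avg: "integrable (lebesgue_on {a<..<b}) (\<lambda>x. h x * G x) \<and>
      \<bar>(\<integral>x. h x * G x \<partial>lebesgue_on {a<..<b}) - G c\<bar> \<le> e"
    if h: "h \<in> bumps" "\<And>x. (H has_field_derivative h x) (at x)" "\<And>x. 0 \<le> h x" "\<And>x. x \<notin> {c - d<..<c + d} \<Longrightarrow> h x = 0"
      and H: "\<And>x. x \<le> c - d \<Longrightarrow> H x = 0" "\<And>x. c + d \<le> x \<Longrightarrow> H x = 1"
      and d: "d > 0" "{c - d..c + d} \<subseteq> {a<..<b}" "\<And>x. x \<in> {c - d..c + d} \<Longrightarrow> \<bar>G x - G c\<bar> \<le> e" for h H c d
  proof -
    have cb: "a < c - d" "c + d < b" using d(1) subsetD[OF d(2), of "c - d"] subsetD[OF d(2), of "c + d"] by auto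
    have hi: "(h has_integral (H b - H a)) {a..b}"
      using cb d(1) h(2) by (intro fundamental_theorem_of_calculus)
        (auto simp: has_real_derivative_iff_has_vector_derivative[symmetric] intro: has_field_derivative_at_within)
    have hint: "integrable (lebesgue_on {a..b}) h"
      by (intro continuous_imp_integrable_real bumps_continuous h)
    have hint': "integrable (lebesgue_on {a<..<b}) h"
      by (rule integrable_lebesgue_on_subset[OF hint]) auto
    have h1: "(\<integral>x. h x \<partial>lebesgue_on {a<..<b}) = 1"
    proof -
      have "(h has_integral 1) {a<..<b}"
        using hi H(1)[of a] H(2)[of b] cb has_integral_open_interval[of h "1::real" a b] by (simp add: box_real)
      then show ?thesis
        using lebesgue_integral_eq_integral[OF hint'] by (simp add: integral_unique)
    qed
    have hm: "h \<in> borel_measurable (lebesgue_on {a<..<b})"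
      and Gm: "G \<in> borel_measurable (lebesgue_on {a<..<b})"
      by (intro continuous_imp_measurable_on_sets_lebesgue bumps_continuous h cont; simp)+
    have le: "\<bar>h x * (G x - G c)\<bar> \<le> e * h x" for x
    proof (cases "x \<in> {c - d<..<c + d}")
      case True
      then show ?thesis using d(3)[of x] h(3)[of x] by (auto simp: abs_mult mult.commute[of e] intro: mult_left_mono)
    qed (simp add: h(4))
    have int: "integrable (lebesgue_on {a<..<b}) (\<lambda>x. h x * (G x - G c))"
      by (rule Bochner_Integration.integrable_bound[where f="\<lambda>x. e * h x"])
         (use le hint' hm Gm order_trans[OF le abs_ge_self] in auto)
    have "\<bar>\<integral>x. h x * (G x - G c) \<partial>lebesgue_on {a<..<b}\<bar> \<le> (\<integral>x. e * h x \<partial>lebesgue_on {a<..<b})"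
      using Bochner_Integration.integral_norm_bound_integral[OF int, of "\<lambda>x. e * h x"] hint' le by simp
    then have b: "\<bar>\<integral>x. h x * (G x - G c) \<partial>lebesgue_on {a<..<b}\<bar> \<le> e" using h1 by simp
    have eq: "(\<lambda>x. h x * G x) = (\<lambda>x. h x * (G x - G c) + G c * h x)" by (auto simp: algebra_simps)
    show ?thesis
      unfolding eq using b h1 int hint' by (subst Bochner_Integration.integral_add) auto
  qed
  obtain Hp hp where P: "hp \<in> bumps" "\<And>x. (Hp has_field_derivative hp x) (at x)"
    "\<And>x. 0 \<le> hp x" "\<And>x. x \<le> p - dp \<Longrightarrow> Hp x = 0" "\<And>x. p + dp \<le> x \<Longrightarrow> Hp x = 1" "\<And>x. x \<notin> {p - dp<..<p + dp} \<Longrightarrow> hp x = 0"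
    by (rule smooth_step[of "p - dp" "p + dp"]) (use dp(1) in auto)
  obtain Hq hq where Q: "hq \<in> bumps" "\<And>x. (Hq has_field_derivative hq x) (at x)"
    "\<And>x. 0 \<le> hq x" "\<And>x. x \<le> q - dq \<Longrightarrow> Hq x = 0" "\<And>x. q + dq \<le> x \<Longrightarrow> Hq x = 1" "\<And>x. x \<notin> {q - dq<..<q + dq} \<Longrightarrow> hq x = 0"
    by (rule smooth_step[of "q - dq" "q + dq"]) (use dq(1) in auto)
  \<comment> \<open>Both steps equal 1 far to the right, so their difference has compact
    support.\<close>
  define \<psi> where "\<psi> = (\<lambda>x. Hp x - Hq x)"
  have \<psi>': "(\<psi> has_field_derivative hp x - hq x) (at x)" for x
    unfolding \<psi>_def by (intro DERIV_diff P Q)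
  have "\<psi> \<in> test_functions a b"
  proof (rule test_function_if_deriv_bump[OF bumps_diff[OF P(1) Q(1)] \<psi>'])
    show "a < min (p - dp) (q - dq)" "max (p + dp) (q + dq) < b" "min (p - dp) (q - dq) < max (p + dp) (q + dq)"
      using dp(1) dq(1) subsetD[OF dp(2), of "p - dp"] subsetD[OF dp(2), of "p + dp"]
        subsetD[OF dq(2), of "q - dq"] subsetD[OF dq(2), of "q + dq"] by auto
    show "\<psi> x = 0" if "x \<notin> {min (p - dp) (q - dq)..max (p + dp) (q + dq)}" for x
      using that P(4,5)[of x] Q(4,5)[of x] by (auto simp: \<psi>_def)
  qed
  then have "(\<integral>x. (hp x - hq x) * G x \<partial>lebesgue_on {a<..<b}) = 0"
    using orth \<psi>' by (metis (no_types, lifting) DERIV_imp_deriv Bochner_Integration.integral_cong)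
  moreover note avg[OF P(1,2,3,6,4,5) dp] avg[OF Q(1,2,3,6,4,5) dq]
  ultimately have "\<bar>G p - G q\<bar> \<le> 2 * e"
    by (auto simp: left_diff_distrib)
  then show False using e by (simp add: e_def)
qed

text \<open>Open intervals are an intersection-stable generator of the Borel sets, so the integral
  vanishes over every Borel set, and densities are unique almost everywhere.\<close>

lemma AE_zero_if_interval_integrals_zero:
  fixes f :: "real \<Rightarrow> real"
  assumes f: "integrable lborel f"
    and z: "\<And>p q. p < q \<Longrightarrow> (LINT x:{p<..<q}|lborel. f x) = 0"
  shows "AE x in lborel. f x = 0"
proof -
  have si: "set_integrable lborel A f" if "A \<in> sets borel" for A
    using integrable_mult_indicator[OF _ f, of A] that by (simp add: set_integrable_def)
  have UN: "(LINT x|lborel. f x) = 0"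
  proof -
    have "(\<lambda>n. LINT x|lborel. indicator {- real (Suc n)<..<real (Suc n)} x *\<^sub>R f x) \<longlonglongrightarrow> (LINT x|lborel. f x)"
    proof (rule integral_dominated_convergence[where w="\<lambda>x. \<bar>f x\<bar>"])
      show "AE x in lborel. (\<lambda>n. indicator {- real (Suc n)<..<real (Suc n)} x *\<^sub>R f x) \<longlonglongrightarrow> f x"
      proof (rule AE_I2)
        fix x :: real
        obtain N where N: "\<bar>x\<bar> < real N" using reals_Archimedean2 by blast
        show "(\<lambda>n. indicator {- real (Suc n)<..<real (Suc n)} x *\<^sub>R f x) \<longlonglongrightarrow> f x"
          by (rule tendsto_eventually, rule eventually_sequentiallyI[of N]) (use N in \<open>auto simp: indicator_def\<close>)
      qed
      show "AE x in lborel. norm (indicator {- real (Suc n)<..<real (Suc n)} x *\<^sub>R f x) \<le> \<bar>f x\<bar>" for n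
        by (auto simp: indicator_def)
    qed (use f in auto)
    moreover have "(LINT x|lborel. indicator {- real (Suc n)<..<real (Suc n)} x *\<^sub>R f x) = 0" for n
      using z[of "- real (Suc n)" "real (Suc n)"] by (simp add: set_lebesgue_integral_def)
    ultimately have "(\<lambda>n. 0) \<longlonglongrightarrow> (LINT x|lborel. f x)" by (simp only:)
    then show ?thesis by (simp only: LIMSEQ_const_iff)
  qed
  have "(LINT x:A|lborel. f x) = 0" if "A \<in> sets borel" for A
  proof -
    let ?G = "range (\<lambda>(a, b). {a<..<b} :: real set)"
    have bg: "borel = sigma UNIV ?G" using borel_eq_box[where 'a=real] by (simp only: box_real)
    have sg: "sets borel = sigma_sets UNIV ?G" by (subst bg) (rule sets_measure_of, simp)
    have Asg: "A \<in> sigma_sets UNIV ?G" using that sg by simp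
    have GP: "?G \<subseteq> Pow UNIV" by simp
    have Ist: "Int_stable ?G"
    proof (rule Int_stableI)
      fix x y assume "x \<in> ?G" "y \<in> ?G"
      then obtain p q r s where "x = {p<..<q}" "y = {r<..<s}" by (auto simp: box_real)
      then have "x \<inter> y = {max p r<..<min q s}" by auto
      then show "x \<inter> y \<in> ?G" by (force simp: box_real image_iff)
    qed
    show ?thesis
      using Ist GP Asg
    proof (induction rule: sigma_sets_induct_disjoint)
      case (basic A)
      then obtain p q where "A = {p<..<q}" by (auto simp: box_real)
      then show ?case using z[of p q] by (cases "p < q") (auto simp: set_lebesgue_integral_def)
    next
      case (compl A)
      have A: "A \<in> sets borel" using compl(1) sg by simp
      have "(LINT x:(UNIV - A)|lborel. f x) + (LINT x:A|lborel. f x) = (LINT x:(UNIV - A) \<union> A|lborel. f x)"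
        using A by (intro set_integral_Un[symmetric] si) auto
      then show ?case using compl UN by (simp add: set_lebesgue_integral_def)
    next
      case (union A)
      have A: "A i \<in> sets borel" for i using union(2) sg by auto
      have "(LINT x:(\<Union>i. A i)|lborel. f x) = (\<Sum>i. LINT x:A i|lborel. f x)"
        using A union(1) by (intro lebesgue_integral_countable_add si) (auto simp: disjoint_family_on_def)
      then show ?case using union by simp
    qed (auto simp: set_lebesgue_integral_def)
  qed
  then show ?thesis
    using density_unique_real[of lborel f "\<lambda>x. 0"] f by (auto simp: set_lebesgue_integral_def)
qed

text \<open>Smooth cutoffs between 0 and 1 converge pointwise to the indicator of a subinterval;
  dominated convergence, with majorant the absolute value of r, makes the integral of r over every
  subinterval vanish.\<close>

lemma fundamental_lemma:
  fixes r :: "real \<Rightarrow> real"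
  assumes r: "integrable (lebesgue_on {a<..<b}) r"
    and orth: "\<And>\<psi>. \<psi> \<in> test_functions a b \<Longrightarrow> (\<integral>x. r x * \<psi> x \<partial>lebesgue_on {a<..<b}) = 0"
  shows "AE x in lebesgue_on {a<..<b}. r x = 0"
proof -
  have zero: "(\<integral>x. r x * indicator {p<..<q} x \<partial>lebesgue_on {a<..<b}) = 0" if pq: "a < p" "p < q" "q < b" for p q
  proof -
    \<comment> \<open>A quarter of the length at most: the rising layer from p + d to p + 2 d and
      the falling layer from q - 2 d to q - d do not overlap.\<close>
    define d where "d n = (q - p) / (4 * real (Suc n))" for n
    have d0: "d n > 0" for n using pq by (simp add: d_def)
    have d1: "d n \<le> (q - p) / 4" for n using pq unfolding d_def by (intro divide_left_mono) auto
    have dlim: "d \<longlonglongrightarrow> 0"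
      unfolding d_def by real_asymp
    define P where "P n \<psi> \<longleftrightarrow> (\<forall>x. 0 \<le> \<psi> x \<and> \<psi> x \<le> 1) \<and> (\<forall>x. x \<notin> {p<..<q} \<longrightarrow> \<psi> x = 0) \<and>
       (\<forall>x\<in>{p + 2 * d n..q - 2 * d n}. \<psi> x = 1)" for n and \<psi> :: "real \<Rightarrow> real"
    have "\<exists>\<psi>. \<psi> \<in> test_functions a b \<and> P n \<psi>" for n
    proof -
      obtain H1 h1 where 1: "h1 \<in> bumps" "\<And>x. (H1 has_field_derivative h1 x) (at x)" "\<And>x. x \<le> p + d n \<Longrightarrow> H1 x = 0"
          "\<And>x. p + 2 * d n \<le> x \<Longrightarrow> H1 x = 1" "\<And>x. 0 \<le> H1 x" "\<And>x. H1 x \<le> 1"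
        by (rule smooth_step[of "p + d n" "p + 2 * d n"]) (use d0[of n] in auto)
      obtain H2 h2 where 2: "h2 \<in> bumps" "\<And>x. (H2 has_field_derivative h2 x) (at x)" "\<And>x. x \<le> q - 2 * d n \<Longrightarrow> H2 x = 0"
          "\<And>x. q - d n \<le> x \<Longrightarrow> H2 x = 1" "\<And>x. 0 \<le> H2 x" "\<And>x. H2 x \<le> 1"
        by (rule smooth_step[of "q - 2 * d n" "q - d n"]) (use d0[of n] in auto)
      have dd: "p + 2 * d n \<le> q - 2 * d n" "p + d n < q - d n" using d1[of n] d0[of n] pq by - (simp_all add: field_simps)
      let ?\<psi> = "\<lambda>x. H1 x - H2 x"
      have t1: "?\<psi> \<in> test_functions a b"
        by (rule test_function_if_deriv_bump[OF bumps_diff[OF 1(1) 2(1)] DERIV_diff[OF 1(2) 2(2)], of a "p + d n" "q - d n"])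
           (use pq d0[of n] dd 1(3,4) 2(3,4) in auto)
      have t2: "0 \<le> ?\<psi> x \<and> ?\<psi> x \<le> 1" for x
        using 1(3-6)[of x] 2(3-6)[of x] dd by (cases "x \<le> q - 2 * d n") auto
      have t3: "?\<psi> x = 0" if "x \<notin> {p<..<q}" for x
        using that 1(3,4)[of x] 2(3,4)[of x] dd d0[of n] by auto
      have t4: "?\<psi> x = 1" if "x \<in> {p + 2 * d n..q - 2 * d n}" for x
        using that 1(4)[of x] 2(3)[of x] by auto
      show ?thesis unfolding P_def by (intro exI[of _ ?\<psi>] t1 conjI allI ballI impI t2[THEN conjunct1] t2[THEN conjunct2] t3 t4)
    qed
    then obtain \<psi> where P: "\<And>n. \<psi> n \<in> test_functions a b \<and> P n (\<psi> n)" by metis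
    have \<psi>: "\<psi> n \<in> test_functions a b" "0 \<le> \<psi> n x" "\<psi> n x \<le> 1" "x \<notin> {p<..<q} \<Longrightarrow> \<psi> n x = 0"
      "x \<in> {p + 2 * d n..q - 2 * d n} \<Longrightarrow> \<psi> n x = 1" for n x
      using P[of n] unfolding P_def by blast+
    have "(\<lambda>n. \<integral>x. r x * \<psi> n x \<partial>lebesgue_on {a<..<b}) \<longlonglongrightarrow> (\<integral>x. r x * indicator {p<..<q} x \<partial>lebesgue_on {a<..<b})"
    proof (rule integral_dominated_convergence[where w="\<lambda>x. \<bar>r x\<bar>"])
      show "AE x in lebesgue_on {a<..<b}. (\<lambda>n. r x * \<psi> n x) \<longlonglongrightarrow> r x * indicator {p<..<q} x"
      proof (rule AE_I2)
        fix x
        show "(\<lambda>n. r x * \<psi> n x) \<longlonglongrightarrow> r x * indicator {p<..<q} x"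
        proof (cases "x \<in> {p<..<q}")
          case True
          then have "min (x - p) (q - x) / 2 > 0" by auto
          then have "\<forall>\<^sub>F n in sequentially. d n < min (x - p) (q - x) / 2"
            using order_tendstoD(2)[OF dlim] by blast
          then have "\<forall>\<^sub>F n in sequentially. \<psi> n x = 1"
            by eventually_elim (auto intro!: \<psi>(5))
          then have "\<forall>\<^sub>F n in sequentially. r x * \<psi> n x = r x * indicator {p<..<q} x"
            by eventually_elim (use True in auto)
          then show ?thesis by (rule tendsto_eventually)
        qed (simp add: \<psi>(4))
      qed
      show "AE x in lebesgue_on {a<..<b}. norm (r x * \<psi> n x) \<le> \<bar>r x\<bar>" for n
        using \<psi>(2,3)[of n] by (auto simp: abs_mult intro!: mult_left_le)
      show "(\<lambda>x. r x * indicator {p<..<q} x) \<in> borel_measurable (lebesgue_on {a<..<b})"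
        by (rule borel_measurable_times[OF borel_measurable_integrable[OF r] borel_measurable_indicator])
           (use pq in \<open>auto simp: sets_restrict_space_iff\<close>)
      show "(\<lambda>x. r x * \<psi> n x) \<in> borel_measurable (lebesgue_on {a<..<b})" for n
        by (intro borel_measurable_times[OF borel_measurable_integrable[OF r]] continuous_imp_measurable_on_sets_lebesgue
            test_function_continuous(1)[OF \<psi>(1)]) auto
    qed (use r in auto)
    then show ?thesis by (simp only: orth[OF \<psi>(1)] LIMSEQ_const_iff)
  qed
  define R where "R x = indicator {a<..<b} x * r x" for x
  have RI: "integrable lebesgue R"
    using r unfolding R_def by (subst (asm) integrable_restrict_space) auto
  \<comment> \<open>The lemma on interval integrals is about \<open>lborel\<close>, so r is replaced
    by a Borel function that agrees with it almost everywhere.\<close>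
  then obtain r' where r'm: "r' \<in> borel_measurable lborel" and r'ae: "AE x in lborel. R x = r' x"
    using completion_ex_borel_measurable_real[OF borel_measurable_integrable[OF RI]] by blast
  have r'ae': "AE x in lebesgue. R x = r' x" by (rule AE_completion[OF r'ae])
  have r'm': "r' \<in> borel_measurable lebesgue" using r'm by (rule measurable_completion)
  have r'I: "integrable lebesgue r'"
    using RI r'ae' r'm' by (subst integrable_cong_AE[of _ _ R]) (auto intro: borel_measurable_integrable)
  then have r'i: "integrable lborel r'" using r'm by (simp add: integrable_completion)
  define g where "g x = indicator {a<..<b} x * r' x" for x
  have gi: "integrable lborel g"
    using integrable_mult_indicator[OF _ r'i, of "{a<..<b}"] by (simp add: g_def[abs_def])
  have gz: "(LINT x:{p<..<q}|lborel. g x) = 0" if "a < p" "p < q" "q < b" for p q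
  proof -
    have "(LINT x:{p<..<q}|lborel. g x) = (\<integral>x. indicator {p<..<q} x * r' x \<partial>lborel)"
      unfolding set_lebesgue_integral_def g_def using that by (intro Bochner_Integration.integral_cong) (auto simp: indicator_def)
    also have "\<dots> = (\<integral>x. indicator {p<..<q} x * r' x \<partial>lebesgue)"
      using r'm by (intro integral_completion[symmetric]) auto
    also have "\<dots> = (\<integral>x. indicator {a<..<b} x *\<^sub>R (r x * indicator {p<..<q} x) \<partial>lebesgue)"
    proof (rule integral_cong_AE)
      show "AE x in lebesgue. indicator {p<..<q} x * r' x = indicator {a<..<b} x *\<^sub>R (r x * indicator {p<..<q} x)"
        using r'ae' by eventually_elim (use that in \<open>auto simp: R_def indicator_def\<close>)
      have "(\<lambda>x. indicator {p<..<q} x * R x) \<in> borel_measurable lebesgue"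
        by (rule borel_measurable_times[OF borel_measurable_indicator borel_measurable_integrable[OF RI]]) auto
      then show "(\<lambda>x. indicator {a<..<b} x *\<^sub>R (r x * indicator {p<..<q} x)) \<in> borel_measurable lebesgue"
        by (simp add: R_def mult_ac)
      show "(\<lambda>x. indicator {p<..<q} x * r' x) \<in> borel_measurable lebesgue"
        by (rule borel_measurable_times[OF borel_measurable_indicator r'm']) auto
    qed
    also have "\<dots> = (\<integral>x. r x * indicator {p<..<q} x \<partial>lebesgue_on {a<..<b})"
      by (subst integral_restrict_space) auto
    finally show ?thesis using zero[OF that] by simp
  qed
  have "AE x in lborel. g x = 0"
  proof (rule AE_zero_if_interval_integrals_zero[OF gi])
    fix p q :: real assume "p < q"
    \<comment> \<open>Intervals strictly inside (a, b), where compactly supported cutoffs exist,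
      exhaust the part of (p, q) on which g can be nonzero.\<close>
    define p' q' where "p' n = max p a + 1 / real (Suc n)" and "q' n = min q b - 1 / real (Suc n)" for n
    have "(\<lambda>n. LINT x:{p' n<..<q' n}|lborel. g x) \<longlonglongrightarrow> (LINT x:{p<..<q}|lborel. g x)"
      unfolding set_lebesgue_integral_def
    proof (rule integral_dominated_convergence[where w="\<lambda>x. \<bar>g x\<bar>"])
      have lim: "(\<lambda>n. 1 / real (Suc n)) \<longlonglongrightarrow> 0" by real_asymp
      show "AE x in lborel. (\<lambda>n. indicator {p' n<..<q' n} x *\<^sub>R g x) \<longlonglongrightarrow> indicator {p<..<q} x *\<^sub>R g x"
      proof (rule AE_I2)
        fix x :: real
        show "(\<lambda>n. indicator {p' n<..<q' n} x *\<^sub>R g x) \<longlonglongrightarrow> indicator {p<..<q} x *\<^sub>R g x"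
        proof (cases "max p a < x \<and> x < min q b")
          case True
          then have "min (x - max p a) (min q b - x) > 0" by auto
          then have "\<forall>\<^sub>F n in sequentially. 1 / real (Suc n) < min (x - max p a) (min q b - x)"
            using order_tendstoD(2)[OF lim] by blast
          then have "\<forall>\<^sub>F n in sequentially. indicator {p' n<..<q' n} x *\<^sub>R g x = indicator {p<..<q} x *\<^sub>R g x"
            by eventually_elim (use True in \<open>auto simp: p'_def q'_def\<close>)
          then show ?thesis by (rule tendsto_eventually)
        next
          case False
          have "x \<notin> {p' n<..<q' n}" for n
          proof
            assume "x \<in> {p' n<..<q' n}"
            then have "max p a + 1 / real (Suc n) < x" "x < min q b - 1 / real (Suc n)"
              by (simp_all only: greaterThanLessThan_iff p'_def q'_def)
            moreover have "1 / real (Suc n) > 0" by simp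
            ultimately have "max p a < x" "x < min q b" by linarith+
            then show False using False by blast
          qed
          then have eq: "indicator {p' n<..<q' n} x *\<^sub>R g x = 0" for n by simp
          have "indicator {p<..<q} x *\<^sub>R g x = 0"
            using False by (auto simp: g_def indicator_def)
          then show ?thesis by (simp only: eq tendsto_const)
        qed
      qed
    qed (use gi in \<open>auto simp: indicator_def intro!: AE_I2\<close>)
    moreover have "(LINT x:{p' n<..<q' n}|lborel. g x) = 0" for n
    proof (cases "p' n < q' n")
      case True
      have "1 / real (Suc n) > 0" by simp
      moreover have "a \<le> max p a" "min q b \<le> b" by auto
      ultimately have "a < p' n" "q' n < b" unfolding p'_def q'_def by linarith+
      then show ?thesis by (rule gz[OF _ True])
    qed (simp add: set_lebesgue_integral_def)
    ultimately show "(LINT x:{p<..<q}|lborel. g x) = 0" by (simp only: LIMSEQ_const_iff)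
  qed
  from AE_completion[OF this] r'ae' have "AE x in lebesgue. x \<in> {a<..<b} \<longrightarrow> r x = 0"
    by eventually_elim (auto simp: g_def R_def)
  then show ?thesis by (subst AE_restrict_space_iff) auto
qed

section \<open>The space \<open>L\<^sup>2\<close>\<close>

lemma Ltwo_mult_integrable:
  assumes f: "f \<in> Ltwo M" and g: "g \<in> Ltwo M"
  shows "integrable M (\<lambda>x. f x * g x)"
proof -
  have m [measurable]: "f \<in> borel_measurable M" "g \<in> borel_measurable M" and i: "integrable M (\<lambda>x. (f x)\<^sup>2)" "integrable M (\<lambda>x. (g x)\<^sup>2)"
    using f g by (auto simp: Ltwo_def)
  have le: "\<bar>f x * g x\<bar> \<le> (f x)\<^sup>2 + (g x)\<^sup>2" for x
  proof -
    have "2 * \<bar>f x\<bar> * \<bar>g x\<bar> \<le> \<bar>f x\<bar>\<^sup>2 + \<bar>g x\<bar>\<^sup>2" by (rule sum_squares_bound)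
    moreover have "0 \<le> \<bar>f x\<bar> * \<bar>g x\<bar>" by simp
    ultimately show ?thesis unfolding abs_mult power2_abs by linarith
  qed
  show ?thesis
    by (rule Bochner_Integration.integrable_bound[OF Bochner_Integration.integrable_add[OF i]])
       (use le order_trans[OF le abs_ge_self] in auto)
qed

lemma Ltwo_add: "f \<in> Ltwo M \<Longrightarrow> g \<in> Ltwo M \<Longrightarrow> (\<lambda>x. f x + g x) \<in> Ltwo M"
proof -
  assume f: "f \<in> Ltwo M" and g: "g \<in> Ltwo M"
  have "integrable M (\<lambda>x. (f x)\<^sup>2 + 2 * (f x * g x) + (g x)\<^sup>2)"
    using f g Ltwo_mult_integrable[OF f g] unfolding Ltwo_def by auto
  moreover have "(\<lambda>x. (f x)\<^sup>2 + 2 * (f x * g x) + (g x)\<^sup>2) = (\<lambda>x. (f x + g x)\<^sup>2)"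
    by (auto simp: power2_sum algebra_simps)
  ultimately show ?thesis using f g by (auto simp: Ltwo_def)
qed

interpretation Ltwo: semi_inner "Ltwo M" "Ltwo_inner M" for M :: "'a measure"
proof
  show "(\<lambda>x. 0) \<in> Ltwo M" by (simp add: Ltwo_def)
  show "(\<lambda>x. f x + g x) \<in> Ltwo M" if "f \<in> Ltwo M" "g \<in> Ltwo M" for f g by (rule Ltwo_add[OF that])
  show "(\<lambda>x. c * f x) \<in> Ltwo M" if "f \<in> Ltwo M" for f c using that by (auto simp: Ltwo_def power_mult_distrib)
  show "Ltwo_inner M (\<lambda>x. f x + g x) h = Ltwo_inner M f h + Ltwo_inner M g h"
    if "f \<in> Ltwo M" "g \<in> Ltwo M" "h \<in> Ltwo M" for f g h
    unfolding Ltwo_inner_def distrib_right by (intro Bochner_Integration.integral_add Ltwo_mult_integrable that)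
  show "Ltwo_inner M (\<lambda>x. c * f x) h = c * Ltwo_inner M f h" for f h c
    unfolding Ltwo_inner_def by (simp only: mult.assoc integral_mult_right_zero)
  show "Ltwo_inner M f g = Ltwo_inner M g f" for f g
    unfolding Ltwo_inner_def by (simp only: mult.commute)
  show "0 \<le> Ltwo_inner M f f" for f
    unfolding Ltwo_inner_def by (rule Bochner_Integration.integral_nonneg) simp
qed

lemma Ltwo_measurable: "f \<in> Ltwo M \<Longrightarrow> f \<in> borel_measurable M"
  and Ltwo_square_integrable: "f \<in> Ltwo M \<Longrightarrow> integrable M (\<lambda>x. (f x)\<^sup>2)"
  by (auto simp: Ltwo_def)

lemma Ltwo_inner_self: "Ltwo_inner M f f = (\<integral>x. (f x)\<^sup>2 \<partial>M)"
  by (simp add: Ltwo_inner_def power2_eq_square)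

lemma Ltwo_norm_power2: "(Ltwo_norm M f)\<^sup>2 = Ltwo_inner M f f"
  unfolding Ltwo_norm_def Ltwo_inner_self by (rule real_sqrt_pow2) (rule Bochner_Integration.integral_nonneg, simp)

lemma Ltwo_null: "f \<in> Ltwo M \<Longrightarrow> Ltwo_inner M f f = 0 \<longleftrightarrow> (AE x in M. f x = 0)"
  unfolding Ltwo_inner_self
  by (subst integral_nonneg_eq_0_iff_AE[OF Ltwo_square_integrable]) auto

lemma Ltwo_inner_cong_AE:
  assumes "f \<in> Ltwo M" "f' \<in> Ltwo M" "g \<in> Ltwo M" "g' \<in> Ltwo M" "AE x in M. f x = f' x" "AE x in M. g x = g' x"
  shows "Ltwo_inner M f g = Ltwo_inner M f' g'"
  unfolding Ltwo_inner_def
proof (rule integral_cong_AE)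
  show "AE x in M. f x * g x = f' x * g' x" using assms(5,6) by eventually_elim simp
qed (use assms(1-4) in \<open>auto simp: Ltwo_def\<close>)

section \<open>Completeness of L^2 over a finite measure\<close>

lemma (in finite_measure) Ltwo_integrable: "f \<in> Ltwo M \<Longrightarrow> integrable M f"
proof -
  assume f: "f \<in> Ltwo M"
  have "(\<lambda>x. 1) \<in> Ltwo M" by (simp add: Ltwo_def)
  from Ltwo_mult_integrable[OF f this] show ?thesis by simp
qed

text \<open>The integral of the series of absolute values is finite by monotone convergence, so the
  series is finite almost everywhere.\<close>

lemma summable_integral_norm_AE:
  fixes d :: "nat \<Rightarrow> 'a \<Rightarrow> real"
  assumes i: "\<And>n. integrable M (d n)" and s: "summable (\<lambda>n. \<integral>x. \<bar>d n x\<bar> \<partial>M)"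
  shows "AE x in M. summable (\<lambda>n. \<bar>d n x\<bar>)"
proof -
  have m [measurable]: "d n \<in> borel_measurable M" for n by (rule borel_measurable_integrable[OF i])
  have eq: "(\<integral>\<^sup>+x. ennreal \<bar>d n x\<bar> \<partial>M) = ennreal (\<integral>x. \<bar>d n x\<bar> \<partial>M)" for n
    by (rule nn_integral_eq_integral) (use i in auto)
  have "(\<integral>\<^sup>+x. (\<Sum>n. ennreal \<bar>d n x\<bar>) \<partial>M) = (\<Sum>n. \<integral>\<^sup>+x. ennreal \<bar>d n x\<bar> \<partial>M)"
    by (rule nn_integral_suminf) measurable
  also have "\<dots> = ennreal (\<Sum>n. \<integral>x. \<bar>d n x\<bar> \<partial>M)"
    unfolding eq by (rule suminf_ennreal2[OF _ s]) simp
  finally have fin: "(\<integral>\<^sup>+x. (\<Sum>n. ennreal \<bar>d n x\<bar>) \<partial>M) \<noteq> \<infinity>" by simp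
  have "AE x in M. (\<Sum>n. ennreal \<bar>d n x\<bar>) \<noteq> \<infinity>"
    by (rule nn_integral_PInf_AE[OF _ fin]) measurable
  then show ?thesis
    by eventually_elim (rule summable_suminf_not_top, auto)
qed

text \<open>A subsequence whose increments have squared norm at most (1/4)^n has summable L^1
  increments, the measure being finite; its telescoping series converges almost everywhere.\<close>

lemma (in finite_measure) Ltwo_cauchy_subseq_AE:
  assumes s: "\<And>n. s n \<in> Ltwo M" and c: "Ltwo.cauchy M s"
  shows "\<exists>r f. strict_mono (r::nat \<Rightarrow> nat) \<and> f \<in> borel_measurable M \<and> (AE x in M. (\<lambda>n. s (r n) x) \<longlonglongrightarrow> f x)"
proof -
  have "\<exists>N. \<forall>m\<ge>N. \<forall>n\<ge>N. Ltwo_inner M (\<lambda>x. s m x - s n x) (\<lambda>x. s m x - s n x) < (1 / 4) ^ k" for k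
    using c[unfolded Ltwo.cauchy_def] by simp
  then obtain N where N: "\<And>k m n. m \<ge> N k \<Longrightarrow> n \<ge> N k \<Longrightarrow> Ltwo_inner M (\<lambda>x. s m x - s n x) (\<lambda>x. s m x - s n x) < (1 / 4) ^ k"
    by metis
  \<comment> \<open>Each index lies beyond its predecessor and beyond the threshold for its own
    accuracy.\<close>
  define r where "r = rec_nat (N 0) (\<lambda>k p. max (Suc p) (N (Suc k)))"
  have rS: "r (Suc k) = max (Suc (r k)) (N (Suc k))" and r0: "r 0 = N 0" for k by (simp_all add: r_def)
  have rN: "N k \<le> r k" for k by (cases k) (auto simp: rS r0)
  have mono: "strict_mono r" by (rule strict_monoI_Suc) (simp add: rS)
  define d where "d n x = s (r (Suc n)) x - s (r n) x" for n x
  have dL: "d n \<in> Ltwo M" for n unfolding d_def[abs_def] by (intro Ltwo.diff_mem s)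
  have dsq: "(\<integral>x. (d n x)\<^sup>2 \<partial>M) \<le> (1 / 4) ^ n" for n
  proof -
    have "N n \<le> r (Suc n)" using rN[of n] rS[of n] by simp
    from less_imp_le[OF N[OF this rN]] show ?thesis unfolding d_def Ltwo_inner_self .
  qed
  have di: "integrable M (d n)" for n by (rule Ltwo_integrable[OF dL])
  have "(\<integral>x. \<bar>d n x\<bar> \<partial>M) \<le> (1 + measure M (space M)) * (1 / 2) ^ n" for n
  proof -
    \<comment> \<open>The weights are balanced so that the bound (1/4)^n on the integral of the
      square becomes (1/2)^n.\<close>
    have le: "\<bar>d n x\<bar> \<le> 2 ^ n * (d n x)\<^sup>2 + (1 / 2) ^ n" for x
    proof -
      have "2 * (2 ^ n * \<bar>d n x\<bar>) * 1 \<le> (2 ^ n * \<bar>d n x\<bar>)\<^sup>2 + 1\<^sup>2" by (rule sum_squares_bound)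
      moreover have "0 \<le> 2 ^ n * \<bar>d n x\<bar>" by simp
      ultimately have "2 ^ n * \<bar>d n x\<bar> \<le> (2 ^ n * \<bar>d n x\<bar>)\<^sup>2 + 1" unfolding power_one mult_1_right by linarith
      also have "(2 ^ n * \<bar>d n x\<bar>)\<^sup>2 = 2 ^ n * (2 ^ n * (d n x)\<^sup>2)"
        by (simp only: power_mult_distrib power2_abs power2_eq_square[of "2 ^ n"] mult.assoc)
      also have "(1::real) = 2 ^ n * (1 / 2) ^ n" by (simp add: power_mult_distrib[symmetric])
      finally have "2 ^ n * \<bar>d n x\<bar> \<le> 2 ^ n * (2 ^ n * (d n x)\<^sup>2 + (1 / 2) ^ n)" by (simp only: distrib_left)
      then show ?thesis by simp
    qed
    have "(\<integral>x. \<bar>d n x\<bar> \<partial>M) \<le> (\<integral>x. 2 ^ n * (d n x)\<^sup>2 + (1 / 2) ^ n \<partial>M)"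
      using di Ltwo_square_integrable[OF dL] le by (intro integral_mono) auto
    also have "\<dots> = 2 ^ n * (\<integral>x. (d n x)\<^sup>2 \<partial>M) + measure M (space M) * (1 / 2) ^ n"
      using Ltwo_square_integrable[OF dL] by simp
    also have "2 ^ n * (\<integral>x. (d n x)\<^sup>2 \<partial>M) \<le> 2 ^ n * (1 / 4) ^ n"
      by (intro mult_left_mono dsq) simp
    also have "2 ^ n * (1 / 4) ^ n = (1 / 2 :: real) ^ n" by (simp add: power_mult_distrib[symmetric])
    finally show ?thesis by (simp add: distrib_right)
  qed
  then have sm: "summable (\<lambda>n. \<integral>x. \<bar>d n x\<bar> \<partial>M)"
    by (intro summable_comparison_test'[OF summable_mult[OF summable_geometric[of "1 / 2 :: real"]], of 0]) auto
  define f where "f x = s (r 0) x + (\<Sum>n. d n x)" for x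
  have [measurable]: "d n \<in> borel_measurable M" "s n \<in> borel_measurable M" for n
    using dL s by (auto simp: Ltwo_def)
  have fm: "f \<in> borel_measurable M" unfolding f_def[abs_def] by measurable
  have "AE x in M. (\<lambda>n. s (r n) x) \<longlonglongrightarrow> f x"
    using summable_integral_norm_AE[OF di sm]
  proof eventually_elim
    case (elim x)
    have "summable (\<lambda>n. d n x)" using elim by (rule summable_rabs_cancel)
    then have "(\<lambda>n. \<Sum>i<n. d i x) \<longlonglongrightarrow> (\<Sum>n. d n x)" by (rule summable_LIMSEQ)
    moreover have "(\<Sum>i<n. d i x) = s (r n) x - s (r 0) x" for n
      unfolding d_def by (rule sum_lessThan_telescope)
    ultimately have "(\<lambda>n. s (r 0) x + (s (r n) x - s (r 0) x)) \<longlonglongrightarrow> f x"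
      unfolding f_def by (intro tendsto_add tendsto_const) simp
    then show ?case by simp
  qed
  then show ?thesis using mono fm by blast
qed

text \<open>Fatou's lemma for squares, with the bound required only from some index on, as Cauchy
  estimates provide it.\<close>

lemma Ltwo_Fatou:
  fixes s :: "nat \<Rightarrow> 'a \<Rightarrow> real" and f :: "'a \<Rightarrow> real"
  assumes s: "\<And>n. s n \<in> borel_measurable M" and f: "f \<in> borel_measurable M"
    and lim: "AE x in M. (\<lambda>n. s n x) \<longlonglongrightarrow> f x"
    and i: "\<And>n. n \<ge> N \<Longrightarrow> integrable M (\<lambda>x. (s n x)\<^sup>2)" and b: "\<And>n. n \<ge> N \<Longrightarrow> (\<integral>x. (s n x)\<^sup>2 \<partial>M) \<le> C"
  shows "integrable M (\<lambda>x. (f x)\<^sup>2)" "(\<integral>x. (f x)\<^sup>2 \<partial>M) \<le> C"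
proof -
  note [measurable] = s f
  have "0 \<le> (\<integral>x. (s N x)\<^sup>2 \<partial>M)" by (rule Bochner_Integration.integral_nonneg) simp
  from order_trans[OF this b[OF order_refl]] have C: "0 \<le> C" .
  have "(\<integral>\<^sup>+x. ennreal ((f x)\<^sup>2) \<partial>M) = (\<integral>\<^sup>+x. liminf (\<lambda>n. ennreal ((s n x)\<^sup>2)) \<partial>M)"
  proof (rule nn_integral_cong_AE)
    show "AE x in M. ennreal ((f x)\<^sup>2) = liminf (\<lambda>n. ennreal ((s n x)\<^sup>2))"
      using lim
    proof eventually_elim
      case (elim x)
      have "(\<lambda>n. ennreal ((s n x)\<^sup>2)) \<longlonglongrightarrow> ennreal ((f x)\<^sup>2)"
        by (intro tendsto_ennrealI tendsto_power elim)
      from lim_imp_Liminf[OF _ this] show ?case by simp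
    qed
  qed
  also have "\<dots> \<le> liminf (\<lambda>n. \<integral>\<^sup>+x. ennreal ((s n x)\<^sup>2) \<partial>M)"
    by (rule nn_integral_liminf) measurable
  also have "\<dots> \<le> ennreal C"
  proof (rule Liminf_le)
    have "(\<integral>\<^sup>+x. ennreal ((s n x)\<^sup>2) \<partial>M) \<le> ennreal C" if "n \<ge> N" for n
    proof -
      have "(\<integral>\<^sup>+x. ennreal ((s n x)\<^sup>2) \<partial>M) = ennreal (\<integral>x. (s n x)\<^sup>2 \<partial>M)"
        by (rule nn_integral_eq_integral[OF i[OF that]]) simp
      then show ?thesis using ennreal_leI[OF b[OF that]] by (simp only:)
    qed
    then show "\<forall>\<^sub>F n in sequentially. (\<integral>\<^sup>+x. ennreal ((s n x)\<^sup>2) \<partial>M) \<le> ennreal C"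
      by (rule eventually_sequentiallyI)
  qed simp
  finally have le: "(\<integral>\<^sup>+x. ennreal ((f x)\<^sup>2) \<partial>M) \<le> ennreal C" .
  have fin: "(\<integral>\<^sup>+x. ennreal ((f x)\<^sup>2) \<partial>M) < \<infinity>" by (rule le_less_trans[OF le]) simp
  show int: "integrable M (\<lambda>x. (f x)\<^sup>2)"
    by (rule integrableI_nonneg) (use fin in auto)
  show "(\<integral>x. (f x)\<^sup>2 \<partial>M) \<le> C"
    proof -
    have "ennreal (\<integral>x. (f x)\<^sup>2 \<partial>M) \<le> ennreal C"
      using le nn_integral_eq_integral[OF int] by simp
    then show ?thesis using C by (simp only: ennreal_le_iff)
  qed
qed

text \<open>Fatou, applied for fixed m to the differences from the almost everywhere convergent
  subsequence, turns the Cauchy estimate into an estimate of the distance to its limit f, and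
  thereby shows that f is square integrable.\<close>

lemma (in finite_measure) Ltwo_complete:
  assumes s: "\<And>n. s n \<in> Ltwo M" and c: "Ltwo.cauchy M s"
  shows "\<exists>f\<in>Ltwo M. Ltwo.conv M s f"
proof -
  obtain r f where r: "strict_mono r" and fm: "f \<in> borel_measurable M" and lim: "AE x in M. (\<lambda>n. s (r n) x) \<longlonglongrightarrow> f x"
    using Ltwo_cauchy_subseq_AE[OF s c] by blast
  have key: "\<exists>N. \<forall>m\<ge>N. integrable M (\<lambda>x. (s m x - f x)\<^sup>2) \<and> (\<integral>x. (s m x - f x)\<^sup>2 \<partial>M) \<le> e" if e: "0 < e" for e
  proof -
    obtain N where N: "\<And>m n. m \<ge> N \<Longrightarrow> n \<ge> N \<Longrightarrow> Ltwo_inner M (\<lambda>x. s m x - s n x) (\<lambda>x. s m x - s n x) < e"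
      using c[unfolded Ltwo.cauchy_def] e by blast
    have "integrable M (\<lambda>x. (s m x - f x)\<^sup>2) \<and> (\<integral>x. (s m x - f x)\<^sup>2 \<partial>M) \<le> e" if m: "m \<ge> N" for m
    proof -
      have 1: "(\<lambda>x. s m x - s (r n) x) \<in> Ltwo M" for n by (intro Ltwo.diff_mem s)
      have 2: "(\<lambda>x. s m x - f x) \<in> borel_measurable M" by (intro borel_measurable_diff Ltwo_measurable s fm)
      have 3: "AE x in M. (\<lambda>n. s m x - s (r n) x) \<longlonglongrightarrow> s m x - f x"
        using lim by eventually_elim (intro tendsto_diff tendsto_const)
      have 4: "(\<integral>x. (s m x - s (r n) x)\<^sup>2 \<partial>M) \<le> e" if "n \<ge> N" for n
        using N[OF m, of "r n"] order_trans[OF that seq_suble[OF r, of n]] by (simp add: Ltwo_inner_self)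
      show ?thesis
        using Ltwo_Fatou[OF Ltwo_measurable[OF 1] 2 3 Ltwo_square_integrable[OF 1] 4] by blast
    qed
    then show ?thesis by blast
  qed
  have fL: "f \<in> Ltwo M"
  proof -
    obtain N where "integrable M (\<lambda>x. (s N x - f x)\<^sup>2)" using key[of 1] by auto
    moreover have "(\<lambda>x. s N x - f x) \<in> borel_measurable M" by (intro borel_measurable_diff Ltwo_measurable s fm)
    ultimately have "(\<lambda>x. s N x - f x) \<in> Ltwo M" by (simp add: Ltwo_def)
    from Ltwo.diff_mem[OF s this, of N] show ?thesis by simp
  qed
  have "Ltwo.conv M s f"
    unfolding Ltwo.conv_def Ltwo_inner_self
  proof (rule LIMSEQ_I)
    fix e :: real assume e: "0 < e"
    obtain N where N: "\<And>m. m \<ge> N \<Longrightarrow> (\<integral>x. (s m x - f x)\<^sup>2 \<partial>M) \<le> e / 2" using key[of "e / 2"] e by auto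
    have "norm ((\<integral>x. (s m x - f x)\<^sup>2 \<partial>M) - 0) < e" if "m \<ge> N" for m
    proof -
      have "0 \<le> (\<integral>x. (s m x - f x)\<^sup>2 \<partial>M)" by (rule Bochner_Integration.integral_nonneg) simp
      then show ?thesis using N[OF that] e by simp
    qed
    then show "\<exists>N. \<forall>m\<ge>N. norm ((\<integral>x. (s m x - f x)\<^sup>2 \<partial>M) - 0) < e" by blast
  qed
  then show ?thesis using fL by blast
qed

section \<open>Weak derivatives\<close>

interpretation Omega: finite_measure Omega
  by (rule finite_measure_lebesgue_on) simp

lemma Ltwo_bounded_continuous:
  assumes "continuous_on {0..1} f"
  shows "f \<in> Ltwo Omega"
proof -
  have "integrable (lebesgue_on {0..1}) (\<lambda>x. (f x)\<^sup>2)"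
    by (intro continuous_imp_integrable_real continuous_intros assms)
  then have "integrable Omega (\<lambda>x. (f x)\<^sup>2)"
    by (rule integrable_lebesgue_on_subset) auto
  moreover have "f \<in> borel_measurable Omega"
    by (rule continuous_imp_measurable_on_sets_lebesgue[OF continuous_on_subset[OF assms]]) auto
  ultimately show ?thesis by (simp add: Ltwo_def)
qed

lemma test_Ltwo: "\<psi> \<in> test_functions 0 1 \<Longrightarrow> \<psi> \<in> Ltwo Omega" "\<psi> \<in> test_functions 0 1 \<Longrightarrow> deriv \<psi> \<in> Ltwo Omega"
  by (intro Ltwo_bounded_continuous test_function_continuous; assumption)+

lemma has_weak_deriv_iff:
  "has_weak_deriv v g \<longleftrightarrow> g \<in> Ltwo Omega \<and>
    (\<forall>\<psi>\<in>test_functions 0 1. Ltwo_inner Omega v (deriv \<psi>) = - Ltwo_inner Omega g \<psi>)"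
  by (simp add: has_weak_deriv_def Ltwo_inner_def)

lemma has_weak_deriv_Ltwo: "has_weak_deriv v g \<Longrightarrow> g \<in> Ltwo Omega"
  by (simp add: has_weak_deriv_iff)

lemma has_weak_deriv_unique:
  assumes g: "has_weak_deriv v g" and h: "has_weak_deriv v h"
  shows "AE x in Omega. g x = h x"
proof -
  have L: "g \<in> Ltwo Omega" "h \<in> Ltwo Omega" using g h by (auto simp: has_weak_deriv_iff)
  have "AE x in Omega. g x - h x = 0"
  proof (rule fundamental_lemma)
    show "integrable Omega (\<lambda>x. g x - h x)" by (rule Omega.Ltwo_integrable[OF Ltwo.diff_mem[OF L]])
    show "(\<integral>x. (g x - h x) * \<psi> x \<partial>Omega) = 0" if "\<psi> \<in> test_functions 0 1" for \<psi>
      using Ltwo.diff_left[OF L test_Ltwo(1)[OF that]] g h that by (simp add: has_weak_deriv_iff Ltwo_inner_def)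
  qed
  then show ?thesis by eventually_elim simp
qed

lemma weak_deriv: "has_weak_deriv v g \<Longrightarrow> has_weak_deriv v (weak_deriv v)"
  using someI[of "has_weak_deriv v" g] by (simp add: weak_deriv_def)

lemma weak_deriv_AE: "has_weak_deriv v g \<Longrightarrow> AE x in Omega. weak_deriv v x = g x"
  by (rule has_weak_deriv_unique[OF weak_deriv])

lemma H1_Ltwo: "v \<in> sobolev_H1 \<Longrightarrow> v \<in> Ltwo Omega"
  by (simp add: sobolev_H1_def)

lemma H1_weak_deriv: "v \<in> sobolev_H1 \<Longrightarrow> has_weak_deriv v (weak_deriv v)"
  unfolding sobolev_H1_def by (elim CollectE conjE exE) (rule weak_deriv)

lemma weak_deriv_Ltwo: "v \<in> sobolev_H1 \<Longrightarrow> weak_deriv v \<in> Ltwo Omega"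
  by (drule H1_weak_deriv) (simp add: has_weak_deriv_iff)

lemma has_weak_deriv_add:
  "v \<in> Ltwo Omega \<Longrightarrow> w \<in> Ltwo Omega \<Longrightarrow> has_weak_deriv v g \<Longrightarrow> has_weak_deriv w h \<Longrightarrow>
    has_weak_deriv (\<lambda>x. v x + w x) (\<lambda>x. g x + h x)"
  unfolding has_weak_deriv_iff by (auto simp: Ltwo.add_left test_Ltwo Ltwo.add_mem)

lemma has_weak_deriv_scale:
  "v \<in> Ltwo Omega \<Longrightarrow> has_weak_deriv v g \<Longrightarrow> has_weak_deriv (\<lambda>x. c * v x) (\<lambda>x. c * g x)"
  unfolding has_weak_deriv_iff by (auto simp: Ltwo.scale_left test_Ltwo Ltwo.scale_mem)

lemma has_weak_deriv_cong_AE: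
  assumes "has_weak_deriv v g" "v \<in> Ltwo Omega" "w \<in> Ltwo Omega" "AE x in Omega. w x = v x"
  shows "has_weak_deriv w g"
proof -
  have "Ltwo_inner Omega w (deriv \<psi>) = Ltwo_inner Omega v (deriv \<psi>)" if "\<psi> \<in> test_functions 0 1" for \<psi>
    by (rule Ltwo_inner_cong_AE[OF assms(3,2) test_Ltwo(2)[OF that] test_Ltwo(2)[OF that] assms(4)]) simp
  then show ?thesis using assms(1) by (simp add: has_weak_deriv_iff)
qed

lemma H1_I: "v \<in> Ltwo Omega \<Longrightarrow> has_weak_deriv v g \<Longrightarrow> v \<in> sobolev_H1"
  by (auto simp: sobolev_H1_def)

lemma H1_add: "v \<in> sobolev_H1 \<Longrightarrow> w \<in> sobolev_H1 \<Longrightarrow> (\<lambda>x. v x + w x) \<in> sobolev_H1"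
  by (rule H1_I[OF Ltwo.add_mem has_weak_deriv_add[OF _ _ H1_weak_deriv H1_weak_deriv]]) (simp_all add: H1_Ltwo)

lemma H1_scale: "v \<in> sobolev_H1 \<Longrightarrow> (\<lambda>x. c * v x) \<in> sobolev_H1"
  by (rule H1_I[OF Ltwo.scale_mem has_weak_deriv_scale[OF _ H1_weak_deriv]]) (simp_all add: H1_Ltwo)

text \<open>The choice operator picks the weak derivative of a sum independently of those of the
  summands, so additivity can only hold almost everywhere; inner products do not see the
  difference.\<close>

lemma weak_deriv_add_AE: "v \<in> sobolev_H1 \<Longrightarrow> w \<in> sobolev_H1 \<Longrightarrow>
    AE x in Omega. weak_deriv (\<lambda>x. v x + w x) x = weak_deriv v x + weak_deriv w x"
  by (rule weak_deriv_AE[OF has_weak_deriv_add[OF H1_Ltwo H1_Ltwo H1_weak_deriv H1_weak_deriv]])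

lemma weak_deriv_scale_AE: "v \<in> sobolev_H1 \<Longrightarrow>
    AE x in Omega. weak_deriv (\<lambda>x. c * v x) x = c * weak_deriv v x"
  by (rule weak_deriv_AE[OF has_weak_deriv_scale[OF H1_Ltwo H1_weak_deriv]])

section \<open>The Dirichlet form and the complete space H^1\<close>

definition dirichlet :: "(real \<Rightarrow> real) \<Rightarrow> (real \<Rightarrow> real) \<Rightarrow> real" where
  "dirichlet v w = Ltwo_inner Omega (weak_deriv v) (weak_deriv w)"

interpretation Dirichlet: semi_inner sobolev_H1 dirichlet
proof
  show "(\<lambda>x. 0) \<in> sobolev_H1"
    by (auto simp: sobolev_H1_def Ltwo.zero_mem has_weak_deriv_iff intro!: exI[of _ "\<lambda>x. 0"] simp: Ltwo_inner_def)
  show "dirichlet (\<lambda>x. f x + g x) h = dirichlet f h + dirichlet g h"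
    if a: "f \<in> sobolev_H1" "g \<in> sobolev_H1" "h \<in> sobolev_H1" for f g h
    unfolding dirichlet_def using Ltwo.add_left[OF a[THEN weak_deriv_Ltwo]]
      Ltwo_inner_cong_AE[OF weak_deriv_Ltwo[OF H1_add[OF a(1,2)]] Ltwo.add_mem[OF a(1,2)[THEN weak_deriv_Ltwo]]
        weak_deriv_Ltwo[OF a(3)] weak_deriv_Ltwo[OF a(3)] weak_deriv_add_AE[OF a(1,2)]] by simp
  show "dirichlet (\<lambda>x. c * f x) h = c * dirichlet f h"
    if a: "f \<in> sobolev_H1" "h \<in> sobolev_H1" for f h c
    unfolding dirichlet_def using Ltwo.scale_left[OF a[THEN weak_deriv_Ltwo]]
      Ltwo_inner_cong_AE[OF weak_deriv_Ltwo[OF H1_scale[OF a(1)]] Ltwo.scale_mem[OF weak_deriv_Ltwo[OF a(1)]]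
        weak_deriv_Ltwo[OF a(2)] weak_deriv_Ltwo[OF a(2)] weak_deriv_scale_AE[OF a(1)]] by simp
  show "dirichlet f g = dirichlet g f" for f g by (simp add: dirichlet_def Ltwo_inner_def mult.commute)
  show "0 \<le> dirichlet f f" if "f \<in> sobolev_H1" for f unfolding dirichlet_def by (rule Ltwo.nonneg[OF weak_deriv_Ltwo[OF that]])
qed (auto intro: H1_add H1_scale)

lemma dirichlet_eq:
  assumes "has_weak_deriv v g" "has_weak_deriv w h"
  shows "dirichlet v w = Ltwo_inner Omega g h"
  unfolding dirichlet_def
  by (rule Ltwo_inner_cong_AE[OF has_weak_deriv_Ltwo[OF weak_deriv[OF assms(1)]] has_weak_deriv_Ltwo[OF assms(1)]
        has_weak_deriv_Ltwo[OF weak_deriv[OF assms(2)]] has_weak_deriv_Ltwo[OF assms(2)]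
        weak_deriv_AE[OF assms(1)] weak_deriv_AE[OF assms(2)]])

definition H1_inner :: "(real \<Rightarrow> real) \<Rightarrow> (real \<Rightarrow> real) \<Rightarrow> real" where
  "H1_inner v w = Ltwo_inner Omega v w + dirichlet v w"

interpretation H1: semi_inner sobolev_H1 H1_inner
proof
  show "H1_inner (\<lambda>x. f x + g x) h = H1_inner f h + H1_inner g h"
    if "f \<in> sobolev_H1" "g \<in> sobolev_H1" "h \<in> sobolev_H1" for f g h
    using Dirichlet.add_left[OF that] Ltwo.add_left[OF that[THEN H1_Ltwo]] by (simp add: H1_inner_def)
  show "H1_inner (\<lambda>x. c * f x) h = c * H1_inner f h" if "f \<in> sobolev_H1" "h \<in> sobolev_H1" for f h c
    using Dirichlet.scale_left[OF that] Ltwo.scale_left[OF that[THEN H1_Ltwo]] by (simp add: H1_inner_def distrib_left)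
  show "H1_inner f g = H1_inner g f" if "f \<in> sobolev_H1" "g \<in> sobolev_H1" for f g
    using Dirichlet.sym[OF that] Ltwo.sym[OF that[THEN H1_Ltwo]] by (simp add: H1_inner_def)
  show "0 \<le> H1_inner f f" if "f \<in> sobolev_H1" for f
    unfolding H1_inner_def by (intro add_nonneg_nonneg Dirichlet.nonneg Ltwo.nonneg H1_Ltwo that)
qed (intro Dirichlet.zero_mem H1_add H1_scale; assumption)+

lemma sobolev_H1_norm_eq: "sobolev_H1_norm v = sqrt (H1_inner v v)"
  by (simp add: sobolev_H1_norm_def H1_inner_def dirichlet_def Ltwo_norm_power2)

text \<open>The weak derivative is a closed operator: functions and derivatives converge separately
  in L^2, and the defining identity passes to the limit for each test function.\<close>

lemma H1_complete:
  assumes s: "\<And>n. s n \<in> sobolev_H1" and c: "H1.cauchy s"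
  shows "\<exists>v\<in>sobolev_H1. H1.conv s v"
proof -
  have L: "s n \<in> Ltwo Omega" and W: "weak_deriv (s n) \<in> Ltwo Omega" for n by (intro H1_Ltwo weak_deriv_Ltwo s)+
  have hd: "has_weak_deriv (\<lambda>x. s m x - s n x) (\<lambda>x. weak_deriv (s m) x - weak_deriv (s n) x)" for m n
    using has_weak_deriv_add[OF L Ltwo.scale_mem[OF L] H1_weak_deriv[OF s] has_weak_deriv_scale[OF L H1_weak_deriv[OF s]], of m "-1" n] by simp
  have split: "H1_inner (\<lambda>x. s m x - s n x) (\<lambda>x. s m x - s n x) =
     Ltwo_inner Omega (\<lambda>x. s m x - s n x) (\<lambda>x. s m x - s n x) +
     Ltwo_inner Omega (\<lambda>x. weak_deriv (s m) x - weak_deriv (s n) x) (\<lambda>x. weak_deriv (s m) x - weak_deriv (s n) x)" for m n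
    unfolding H1_inner_def dirichlet_eq[OF hd hd] ..
  have nn: "0 \<le> Ltwo_inner Omega (\<lambda>x. s m x - s n x) (\<lambda>x. s m x - s n x)"
    "0 \<le> Ltwo_inner Omega (\<lambda>x. weak_deriv (s m) x - weak_deriv (s n) x) (\<lambda>x. weak_deriv (s m) x - weak_deriv (s n) x)" for m n
    by (intro Ltwo.nonneg Ltwo.diff_mem L W)+
  have "\<exists>N. \<forall>m\<ge>N. \<forall>n\<ge>N. Ltwo_inner Omega (\<lambda>x. s m x - s n x) (\<lambda>x. s m x - s n x) < e \<and>
      Ltwo_inner Omega (\<lambda>x. weak_deriv (s m) x - weak_deriv (s n) x) (\<lambda>x. weak_deriv (s m) x - weak_deriv (s n) x) < e"
    if "0 < e" for e
  proof -
    obtain N where N: "\<And>m n. m \<ge> N \<Longrightarrow> n \<ge> N \<Longrightarrow> H1_inner (\<lambda>x. s m x - s n x) (\<lambda>x. s m x - s n x) < e"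
      using c[unfolded H1.cauchy_def] \<open>0 < e\<close> by blast
    show ?thesis
    proof (rule exI[of _ N], intro allI impI)
      fix m n assume "N \<le> m" "N \<le> n"
      from N[OF this] nn[of m n] show "Ltwo_inner Omega (\<lambda>x. s m x - s n x) (\<lambda>x. s m x - s n x) < e \<and>
        Ltwo_inner Omega (\<lambda>x. weak_deriv (s m) x - weak_deriv (s n) x) (\<lambda>x. weak_deriv (s m) x - weak_deriv (s n) x) < e"
        unfolding split by linarith
    qed
  qed
  then have "Ltwo.cauchy Omega s" "Ltwo.cauchy Omega (\<lambda>n. weak_deriv (s n))"
    unfolding Ltwo.cauchy_def by blast+
  then obtain v g where v: "v \<in> Ltwo Omega" "Ltwo.conv Omega s v" and g: "g \<in> Ltwo Omega" "Ltwo.conv Omega (\<lambda>n. weak_deriv (s n)) g"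
    using Omega.Ltwo_complete[of s, OF L] Omega.Ltwo_complete[of "\<lambda>n. weak_deriv (s n)", OF W] by blast
  have vg: "has_weak_deriv v g"
    unfolding has_weak_deriv_iff
  proof (intro conjI ballI g)
    fix \<psi> assume \<psi>: "\<psi> \<in> test_functions 0 1"
    have 1: "(\<lambda>n. Ltwo_inner Omega (s n) (deriv \<psi>)) \<longlonglongrightarrow> Ltwo_inner Omega v (deriv \<psi>)"
      by (rule Ltwo.conv_inner[OF L v(1) test_Ltwo(2)[OF \<psi>] v(2)])
    have 2: "(\<lambda>n. - Ltwo_inner Omega (weak_deriv (s n)) \<psi>) \<longlonglongrightarrow> - Ltwo_inner Omega g \<psi>"
      by (rule tendsto_minus[OF Ltwo.conv_inner[OF W g(1) test_Ltwo(1)[OF \<psi>] g(2)]])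
    have eq: "Ltwo_inner Omega (s n) (deriv \<psi>) = - Ltwo_inner Omega (weak_deriv (s n)) \<psi>" for n
      using H1_weak_deriv[OF s] \<psi> by (simp add: has_weak_deriv_iff)
    show "Ltwo_inner Omega v (deriv \<psi>) = - Ltwo_inner Omega g \<psi>"
      by (rule LIMSEQ_unique[OF 1[unfolded eq] 2])
  qed
  have hv: "has_weak_deriv (\<lambda>x. s n x - v x) (\<lambda>x. weak_deriv (s n) x - g x)" for n
    using has_weak_deriv_add[OF L Ltwo.scale_mem[OF v(1)] H1_weak_deriv[OF s] has_weak_deriv_scale[OF v(1) vg], of n "-1"] by simp
  have "H1.conv s v"
    unfolding H1.conv_def H1_inner_def dirichlet_eq[OF hv hv]
    using tendsto_add[OF v(2)[unfolded Ltwo.conv_def] g(2)[unfolded Ltwo.conv_def]] by simp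
  then show ?thesis using v vg by (auto simp: sobolev_H1_def)
qed

section \<open>Test functions in H^1 and their closure H_0^1\<close>

lemma interval_FTC:
  fixes f F :: "real \<Rightarrow> real"
  assumes ab: "a \<le> b" and d: "\<And>x. (F has_field_derivative f x) (at x)" and c: "continuous_on {a..b} f"
  shows "integrable (lebesgue_on {a<..<b}) f" "(\<integral>x. f x \<partial>lebesgue_on {a<..<b}) = F b - F a"
proof -
  have "integrable (lebesgue_on {a..b}) f" by (rule continuous_imp_integrable_real[OF c])
  then show i: "integrable (lebesgue_on {a<..<b}) f"
    by (rule integrable_lebesgue_on_subset) auto
  have "(f has_integral (F b - F a)) {a..b}"
    using ab d by (intro fundamental_theorem_of_calculus)
      (auto simp: has_real_derivative_iff_has_vector_derivative[symmetric] intro: has_field_derivative_at_within)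
  then have "(f has_integral (F b - F a)) {a<..<b}"
    using has_integral_open_interval[of f "F b - F a" a b] by (simp add: box_real)
  then show "(\<integral>x. f x \<partial>lebesgue_on {a<..<b}) = F b - F a"
    using lebesgue_integral_eq_integral[OF i] by (simp add: integral_unique)
qed

lemma test_function_support:
  assumes "\<psi> \<in> test_functions a b"
  obtains c d where "a < c" "c < d" "d < b" "\<And>x. x \<notin> {c..d} \<Longrightarrow> \<psi> x = 0"
  using assms unfolding test_functions_def by blast

lemma test_function_outside: "\<psi> \<in> test_functions a b \<Longrightarrow> x \<le> a \<or> b \<le> x \<Longrightarrow> \<psi> x = 0"
  by (erule test_function_support) (auto simp: not_le)

text \<open>Integration by parts: the product of two test functions vanishes at both end
  points.\<close>

lemma test_has_weak_deriv:
  assumes \<psi>: "\<psi> \<in> test_functions 0 1"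
  shows "has_weak_deriv \<psi> (deriv \<psi>)"
  unfolding has_weak_deriv_iff
proof (intro conjI ballI)
  show "deriv \<psi> \<in> Ltwo Omega" by (rule test_Ltwo(2)[OF \<psi>])
  fix \<phi> assume \<phi>: "\<phi> \<in> test_functions 0 1"
  let ?f = "\<lambda>x. deriv \<psi> x * \<phi> x + deriv \<phi> x * \<psi> x"
  have "((\<lambda>x. \<psi> x * \<phi> x) has_field_derivative ?f x) (at x)" for x
    by (intro DERIV_mult test_function_continuous(3)[OF \<psi>] test_function_continuous(3)[OF \<phi>])
  moreover have "continuous_on {0..1} ?f"
    by (intro continuous_on_add continuous_on_mult test_function_continuous[OF \<psi>] test_function_continuous[OF \<phi>])
  ultimately have "(\<integral>x. ?f x \<partial>Omega) = \<psi> 1 * \<phi> 1 - \<psi> 0 * \<phi> 0"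
    by (intro interval_FTC(2)) auto
  then have 0: "(\<integral>x. ?f x \<partial>Omega) = 0" using test_function_outside[OF \<psi>, of 0] test_function_outside[OF \<psi>, of 1] by simp
  have "(\<integral>x. ?f x \<partial>Omega) = Ltwo_inner Omega (deriv \<psi>) \<phi> + Ltwo_inner Omega (deriv \<phi>) \<psi>"
    unfolding Ltwo_inner_def by (intro Bochner_Integration.integral_add Ltwo_mult_integrable test_Ltwo \<psi> \<phi>)
  moreover have "Ltwo_inner Omega (deriv \<phi>) \<psi> = Ltwo_inner Omega \<psi> (deriv \<phi>)"
    by (rule Ltwo.sym[OF test_Ltwo(2)[OF \<phi>] test_Ltwo(1)[OF \<psi>]])
  ultimately show "Ltwo_inner Omega \<psi> (deriv \<phi>) = - Ltwo_inner Omega (deriv \<psi>) \<phi>"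
    using 0 by simp
qed

lemma test_H1: "\<psi> \<in> test_functions 0 1 \<Longrightarrow> \<psi> \<in> sobolev_H1"
  by (rule H1_I[OF test_Ltwo(1) test_has_weak_deriv])

lemma test_function_add:
  assumes f: "f \<in> test_functions a b" and g: "g \<in> test_functions a b"
  shows "(\<lambda>x. f x + g x) \<in> test_functions a b"
proof -
  have F: "(deriv ^^ k) f field_differentiable at x" and G: "(deriv ^^ k) g field_differentiable at x" for k x
    using f g by (auto simp: test_functions_def)
  have eq: "(deriv ^^ k) (\<lambda>x. f x + g x) = (\<lambda>x. (deriv ^^ k) f x + (deriv ^^ k) g x)" for k
  proof (induction k)
    case (Suc k)
    have "deriv (\<lambda>x. (deriv ^^ k) f x + (deriv ^^ k) g x) x = (deriv ^^ Suc k) f x + (deriv ^^ Suc k) g x" for x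
      by (simp add: deriv_add[OF F G])
    then show ?case by (simp add: Suc fun_eq_iff)
  qed simp
  obtain c d where cd: "a < c" "c < d" "d < b" "\<And>x. x \<notin> {c..d} \<Longrightarrow> f x = 0" using test_function_support[OF f] by blast
  obtain c' d' where cd': "a < c'" "c' < d'" "d' < b" "\<And>x. x \<notin> {c'..d'} \<Longrightarrow> g x = 0" using test_function_support[OF g] by blast
  have "f x + g x = 0" if "x \<notin> {min c c'..max d d'}" for x
  proof -
    have "x \<notin> {c..d}" "x \<notin> {c'..d'}" using that by (auto simp: min_le_iff_disj le_max_iff_disj)
    then have "f x = 0" "g x = 0" by (simp_all add: cd(4) cd'(4))
    then show ?thesis by simp
  qed
  moreover have "a < min c c'" "min c c' < max d d'" "max d d' < b" using cd(1-3) cd'(1-3) by auto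
  ultimately have "\<exists>c d. a < c \<and> c < d \<and> d < b \<and> (\<forall>x. x \<notin> {c..d} \<longrightarrow> f x + g x = 0)" by blast
  moreover have "(deriv ^^ k) (\<lambda>x. f x + g x) field_differentiable at x" for k x
    unfolding eq by (rule field_differentiable_add[OF F G])
  ultimately show ?thesis unfolding test_functions_def by blast
qed

lemma test_function_scale:
  assumes f: "f \<in> test_functions a b"
  shows "(\<lambda>x. c * f x) \<in> test_functions a b"
proof -
  have F: "(deriv ^^ k) f field_differentiable at x" for k x
    using f by (auto simp: test_functions_def)
  have eq: "(deriv ^^ k) (\<lambda>x. c * f x) = (\<lambda>x. c * (deriv ^^ k) f x)" for k
  proof (induction k)
    case (Suc k)
    have "deriv (\<lambda>x. c * (deriv ^^ k) f x) x = c * (deriv ^^ Suc k) f x" for x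
      by (simp add: deriv_cmult[OF F])
    then show ?case by (simp add: Suc fun_eq_iff)
  qed simp
  obtain p q where pq: "a < p" "p < q" "q < b" "\<And>x. x \<notin> {p..q} \<Longrightarrow> f x = 0" using test_function_support[OF f] by blast
  then have "\<exists>p q. a < p \<and> p < q \<and> q < b \<and> (\<forall>x. x \<notin> {p..q} \<longrightarrow> c * f x = 0)" by (metis mult_zero_right)
  moreover have "(deriv ^^ k) (\<lambda>x. c * f x) field_differentiable at x" for k x
    unfolding eq by (rule field_differentiable_mult[OF field_differentiable_const F])
  ultimately show ?thesis unfolding test_functions_def by blast
qed

lemma H10_iff: "v \<in> sobolev_H10 \<longleftrightarrow> v \<in> sobolev_H1 \<and> (\<exists>\<psi>. (\<forall>n. \<psi> n \<in> test_functions 0 1) \<and> H1.conv \<psi> v)"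
proof -
  have "(\<lambda>n. sobolev_H1_norm (\<lambda>x. \<psi> n x - v x)) \<longlonglongrightarrow> 0 \<longleftrightarrow> H1.conv \<psi> v"
    if v: "v \<in> sobolev_H1" and \<psi>: "\<forall>n. \<psi> n \<in> test_functions 0 1" for \<psi> :: "nat \<Rightarrow> real \<Rightarrow> real"
  proof -
    have nn: "0 \<le> H1_inner (\<lambda>x. \<psi> n x - v x) (\<lambda>x. \<psi> n x - v x)" for n
      by (rule H1.nonneg[OF H1.diff_mem[OF test_H1 v]]) (use \<psi> in blast)
    show ?thesis unfolding H1.conv_def sobolev_H1_norm_eq
    proof
      assume "(\<lambda>n. sqrt (H1_inner (\<lambda>x. \<psi> n x - v x) (\<lambda>x. \<psi> n x - v x))) \<longlonglongrightarrow> 0"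
      from tendsto_power[OF this, of 2] show "(\<lambda>n. H1_inner (\<lambda>x. \<psi> n x - v x) (\<lambda>x. \<psi> n x - v x)) \<longlonglongrightarrow> 0"
        using nn by simp
    next
      assume "(\<lambda>n. H1_inner (\<lambda>x. \<psi> n x - v x) (\<lambda>x. \<psi> n x - v x)) \<longlonglongrightarrow> 0"
      from tendsto_real_sqrt[OF this] show "(\<lambda>n. sqrt (H1_inner (\<lambda>x. \<psi> n x - v x) (\<lambda>x. \<psi> n x - v x))) \<longlonglongrightarrow> 0"
        by simp
    qed
  qed
  then show ?thesis unfolding sobolev_H10_def by blast
qed

lemma H10_H1: "v \<in> sobolev_H10 \<Longrightarrow> v \<in> sobolev_H1"
  by (simp add: sobolev_H10_def)

lemma H10_Ltwo: "v \<in> sobolev_H10 \<Longrightarrow> v \<in> Ltwo Omega"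
  by (rule H1_Ltwo[OF H10_H1])

lemma H10_approx:
  assumes "v \<in> sobolev_H10"
  obtains \<psi> where "\<And>n. \<psi> n \<in> test_functions 0 1" "H1.conv \<psi> v"
  using assms unfolding H10_iff by blast

lemma H10_I: "v \<in> sobolev_H1 \<Longrightarrow> (\<And>n. \<psi> n \<in> test_functions 0 1) \<Longrightarrow> H1.conv \<psi> v \<Longrightarrow> v \<in> sobolev_H10"
  unfolding H10_iff by blast

lemma test_H10:
  assumes \<psi>: "\<psi> \<in> test_functions 0 1"
  shows "\<psi> \<in> sobolev_H10"
proof (rule H10_I[of _ "\<lambda>n. \<psi>", OF test_H1[OF \<psi>] \<psi>])
  have "(\<lambda>x. \<psi> x - \<psi> x) = (\<lambda>x. 0)" by simp
  then show "H1.conv (\<lambda>n. \<psi>) \<psi>"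
    unfolding H1.conv_def using H1.zero_left[OF H1.zero_mem] by simp
qed

lemma H1_square_add_le: "f \<in> sobolev_H1 \<Longrightarrow> g \<in> sobolev_H1 \<Longrightarrow>
    H1_inner (\<lambda>x. f x + g x) (\<lambda>x. f x + g x) \<le> 2 * H1_inner f f + 2 * H1_inner g g"
  using H1.parallelogram[of f g] H1.nonneg[OF H1.diff_mem[of f g]] by simp

lemma H1_conv_sum_bound:
  assumes "\<And>n. 0 \<le> X n" "\<And>n. X n \<le> 2 * Y n + 2 * Z n" "Y \<longlonglongrightarrow> 0" "Z \<longlonglongrightarrow> (0::real)"
  shows "X \<longlonglongrightarrow> 0"
proof (rule tendsto_sandwich[OF _ _ tendsto_const])
  show "(\<lambda>n. 2 * Y n + 2 * Z n) \<longlonglongrightarrow> 0"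
    using tendsto_add[OF tendsto_mult_left[OF assms(3), of 2] tendsto_mult_left[OF assms(4), of 2]] by simp
qed (use assms(1,2) in auto)

lemma H10_add:
  assumes v: "v \<in> sobolev_H10" and w: "w \<in> sobolev_H10"
  shows "(\<lambda>x. v x + w x) \<in> sobolev_H10"
proof -
  obtain \<psi> where \<psi>: "\<And>n. \<psi> n \<in> test_functions 0 1" "H1.conv \<psi> v" using H10_approx[OF v] by blast
  obtain \<xi> where \<xi>: "\<And>n. \<xi> n \<in> test_functions 0 1" "H1.conv \<xi> w" using H10_approx[OF w] by blast
  note h = test_H1[OF \<psi>(1)] test_H1[OF \<xi>(1)] H10_H1[OF v] H10_H1[OF w]
  show ?thesis
  proof (rule H10_I[of _ "\<lambda>n x. \<psi> n x + \<xi> n x"])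
    show "(\<lambda>x. v x + w x) \<in> sobolev_H1" by (rule H1_add[OF h(3,4)])
    show "(\<lambda>x. \<psi> n x + \<xi> n x) \<in> test_functions 0 1" for n by (rule test_function_add[OF \<psi>(1) \<xi>(1)])
    have eq: "(\<lambda>x. (\<psi> n x + \<xi> n x) - (v x + w x)) = (\<lambda>x. (\<psi> n x - v x) + (\<xi> n x - w x))" for n by auto
    show "H1.conv (\<lambda>n x. \<psi> n x + \<xi> n x) (\<lambda>x. v x + w x)"
      unfolding H1.conv_def eq
      by (rule H1_conv_sum_bound[OF H1.nonneg[OF H1_add[OF H1.diff_mem[OF h(1,3)] H1.diff_mem[OF h(2,4)]]]
            H1_square_add_le[OF H1.diff_mem[OF h(1,3)] H1.diff_mem[OF h(2,4)]]
            \<psi>(2)[unfolded H1.conv_def] \<xi>(2)[unfolded H1.conv_def]])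
  qed
qed

lemma H10_scale:
  assumes v: "v \<in> sobolev_H10"
  shows "(\<lambda>x. c * v x) \<in> sobolev_H10"
proof -
  obtain \<psi> where \<psi>: "\<And>n. \<psi> n \<in> test_functions 0 1" "H1.conv \<psi> v" using H10_approx[OF v] by blast
  note d = H1.diff_mem[OF test_H1[OF \<psi>(1)] H10_H1[OF v]]
  show ?thesis
  proof (rule H10_I[of _ "\<lambda>n x. c * \<psi> n x"])
    show "(\<lambda>x. c * v x) \<in> sobolev_H1" by (rule H1_scale[OF H10_H1[OF v]])
    show "(\<lambda>x. c * \<psi> n x) \<in> test_functions 0 1" for n by (rule test_function_scale[OF \<psi>(1)])
    have eq: "(\<lambda>x. c * \<psi> n x - c * v x) = (\<lambda>x. c * (\<psi> n x - v x))" for n by (simp add: right_diff_distrib)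
    have "H1_inner (\<lambda>x. c * (\<psi> n x - v x)) (\<lambda>x. c * (\<psi> n x - v x)) = c * (c * H1_inner (\<lambda>x. \<psi> n x - v x) (\<lambda>x. \<psi> n x - v x))" for n
      by (simp only: H1.scale_left[OF d H1_scale[OF d]] H1.scale_right[OF d d])
    then show "H1.conv (\<lambda>n x. c * \<psi> n x) (\<lambda>x. c * v x)"
      unfolding H1.conv_def eq using tendsto_mult_left[OF tendsto_mult_left[OF \<psi>(2)[unfolded H1.conv_def], of c], of c] by simp
  qed
qed

text \<open>A diagonal choice: each member is replaced by a test function within 1 / (n + 1) of it,
  and these approximate the H^1 limit.\<close>

lemma H10_complete:
  assumes s: "\<And>n. s n \<in> sobolev_H10" and c: "H1.cauchy s"
  shows "\<exists>v\<in>sobolev_H10. H1.conv s v"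
proof -
  have h: "s n \<in> sobolev_H1" for n by (rule H10_H1[OF s])
  obtain v where v: "v \<in> sobolev_H1" "H1.conv s v" using H1_complete[of s, OF h c] by blast
  have "\<exists>\<psi>. \<psi> \<in> test_functions 0 1 \<and> H1_inner (\<lambda>x. \<psi> x - s n x) (\<lambda>x. \<psi> x - s n x) < 1 / real (Suc n)" for n
  proof -
    obtain \<psi> where \<psi>: "\<And>n. \<psi> n \<in> test_functions 0 1" "H1.conv \<psi> (s n)" using H10_approx[OF s[of n]] by blast
    have "\<forall>\<^sub>F k in sequentially. H1_inner (\<lambda>x. \<psi> k x - s n x) (\<lambda>x. \<psi> k x - s n x) < 1 / real (Suc n)"
      by (rule order_tendstoD(2)[OF \<psi>(2)[unfolded H1.conv_def]]) simp
    then obtain k where "H1_inner (\<lambda>x. \<psi> k x - s n x) (\<lambda>x. \<psi> k x - s n x) < 1 / real (Suc n)"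
      unfolding eventually_sequentially by blast
    then show ?thesis using \<psi>(1) by blast
  qed
  then obtain \<psi> where "\<forall>n. \<psi> n \<in> test_functions 0 1 \<and> H1_inner (\<lambda>x. \<psi> n x - s n x) (\<lambda>x. \<psi> n x - s n x) < 1 / real (Suc n)"
    using choice[of "\<lambda>n \<psi>. \<psi> \<in> test_functions 0 1 \<and> H1_inner (\<lambda>x. \<psi> x - s n x) (\<lambda>x. \<psi> x - s n x) < 1 / real (Suc n)"] by blast
  then have \<psi>: "\<psi> n \<in> test_functions 0 1" "H1_inner (\<lambda>x. \<psi> n x - s n x) (\<lambda>x. \<psi> n x - s n x) < 1 / real (Suc n)" for n by auto
  have lim: "(\<lambda>n. H1_inner (\<lambda>x. \<psi> n x - s n x) (\<lambda>x. \<psi> n x - s n x)) \<longlonglongrightarrow> 0"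
  proof (rule tendsto_sandwich[OF _ _ tendsto_const])
    show "(\<lambda>n. 1 / real (Suc n)) \<longlonglongrightarrow> 0" by real_asymp
    show "\<forall>\<^sub>F n in sequentially. 0 \<le> H1_inner (\<lambda>x. \<psi> n x - s n x) (\<lambda>x. \<psi> n x - s n x)"
      by (intro always_eventually allI H1.nonneg H1.diff_mem test_H1 \<psi>(1) h)
    show "\<forall>\<^sub>F n in sequentially. H1_inner (\<lambda>x. \<psi> n x - s n x) (\<lambda>x. \<psi> n x - s n x) \<le> 1 / real (Suc n)"
      by (intro always_eventually allI less_imp_le \<psi>(2))
  qed
  note d1 = H1.diff_mem[OF test_H1[OF \<psi>(1)] h] and d2 = H1.diff_mem[OF h v(1)]
  have eq: "(\<lambda>x. \<psi> n x - v x) = (\<lambda>x. (\<psi> n x - s n x) + (s n x - v x))" for n by auto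
  have "H1.conv \<psi> v"
    unfolding H1.conv_def eq
    by (rule H1_conv_sum_bound[OF H1.nonneg[OF H1_add[OF d1 d2]] H1_square_add_le[OF d1 d2] lim v(2)[unfolded H1.conv_def]])
  then have "v \<in> sobolev_H10" by (rule H10_I[OF v(1) \<psi>(1)])
  then show ?thesis using v(2) by blast
qed

section \<open>Hardy's inequality and compactness\<close>

text \<open>Division by zero yields 0, which is the right value here because h vanishes near the
  origin.\<close>

lemma continuous_div_self:
  fixes h :: "real \<Rightarrow> real"
  assumes h: "continuous_on UNIV h" and z: "\<And>x. x < c \<Longrightarrow> h x = 0" and c: "0 < c"
  shows "continuous_on UNIV (\<lambda>x. h x / x)"
proof -
  have "continuous_on {0<..} (\<lambda>x. h x / x)"
    by (intro continuous_intros continuous_on_subset[OF h]) auto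
  moreover have "continuous_on {..<c} (\<lambda>x. h x / x)"
    using z by (subst continuous_on_cong[OF refl, of _ _ "\<lambda>x. 0"]) auto
  ultimately have "continuous_on ({0<..} \<union> {..<c}) (\<lambda>x. h x / x)"
    by (intro continuous_on_open_Un) auto
  moreover have "{0<..} \<union> {..<c} = (UNIV :: real set)" using c by auto
  ultimately show ?thesis by simp
qed

text \<open>\<open>?f\<close> is the derivative of \<psi>^2 / x and so has integral zero.
  Subtracting twice \<open>?f\<close> from 4 (\<psi>')^2 completes the square of 2 \<psi>' - \<psi>
  / x. The constant 4 obtained here is what sets the threshold 1/4 for \<mu>.\<close>

lemma Hardy_test:
  assumes \<psi>: "\<psi> \<in> test_functions 0 1"
  shows "(\<lambda>x. \<psi> x / x) \<in> Ltwo Omega" "Ltwo_inner Omega (\<lambda>x. \<psi> x / x) (\<lambda>x. \<psi> x / x) \<le> 4 * dirichlet \<psi> \<psi>"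
proof -
  obtain c d where cd: "0 < c" "c < d" "d < 1" "\<And>x. x \<notin> {c..d} \<Longrightarrow> \<psi> x = 0" using test_function_support[OF \<psi>] by blast
  note cont = test_function_continuous[OF \<psi>]
  have z: "\<psi> x = 0" if "x < c" for x using cd(4)[of x] that by simp
  have c1: "continuous_on UNIV (\<lambda>x. \<psi> x / x)" by (rule continuous_div_self[OF cont(1) z cd(1)])
  then show L: "(\<lambda>x. \<psi> x / x) \<in> Ltwo Omega"
    by (intro Ltwo_bounded_continuous continuous_on_subset[OF c1]) auto
  let ?f = "\<lambda>x. (2 * \<psi> x * deriv \<psi> x) / x - (\<psi> x / x)\<^sup>2"
  have c2: "continuous_on UNIV (\<lambda>x. (2 * \<psi> x * deriv \<psi> x) / x)"
    by (rule continuous_div_self[OF _ _ cd(1)]) (auto intro!: continuous_intros cont simp: z)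
  have fc: "continuous_on {0..1} ?f"
    by (intro continuous_on_diff continuous_on_power continuous_on_subset[OF c1] continuous_on_subset[OF c2]) auto
  have "((\<lambda>x. (\<psi> x)\<^sup>2 / x) has_field_derivative ?f x) (at x)" for x
  proof (cases "x < c")
    case True
    have "((\<lambda>x. (\<psi> x)\<^sup>2 / x) has_field_derivative 0) (at x)"
      by (rule has_field_derivative_transform_within_open[OF DERIV_const[of 0], of "{..<c}"]) (use True in \<open>auto simp: z\<close>)
    then show ?thesis by (simp add: z[OF True])
  next
    case False
    then have x: "x \<noteq> 0" using cd(1) by simp
    have "((\<lambda>x. (\<psi> x)\<^sup>2 / x) has_field_derivative (2 * \<psi> x * deriv \<psi> x * x - (\<psi> x)\<^sup>2 * 1) / (x * x)) (at x)"
      by (rule DERIV_divide[OF _ DERIV_ident x]) (auto intro!: derivative_eq_intros cont(3))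
    moreover have "(2 * \<psi> x * deriv \<psi> x * x - (\<psi> x)\<^sup>2 * 1) / (x * x) = ?f x"
      using x by (simp add: diff_divide_distrib power2_eq_square)
    ultimately show ?thesis by simp
  qed
  note F = interval_FTC[of 0 1 "\<lambda>x. (\<psi> x)\<^sup>2 / x", OF _ this fc]
  have F0: "(\<integral>x. ?f x \<partial>Omega) = 0" using F(2) test_function_outside[OF \<psi>, of 1] by simp
  have i1: "integrable Omega (\<lambda>x. (\<psi> x / x)\<^sup>2)" and i2: "integrable Omega (\<lambda>x. (deriv \<psi> x)\<^sup>2)"
    by (intro Ltwo_square_integrable L test_Ltwo \<psi>)+
  have i3: "integrable Omega ?f" by (rule F(1)) simp
  have "(\<integral>x. (\<psi> x / x)\<^sup>2 \<partial>Omega) \<le> (\<integral>x. 4 * (deriv \<psi> x)\<^sup>2 - 2 * ?f x \<partial>Omega)"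
  proof (rule integral_mono[OF i1 Bochner_Integration.integrable_diff[OF integrable_mult_right[OF i2] integrable_mult_right[OF i3]]])
    fix x
    have "0 \<le> (2 * deriv \<psi> x - \<psi> x / x)\<^sup>2" by simp
    then show "(\<psi> x / x)\<^sup>2 \<le> 4 * (deriv \<psi> x)\<^sup>2 - 2 * ?f x"
      by (simp add: power2_diff power_mult_distrib algebra_simps)
  qed
  also have "\<dots> = (\<integral>x. 4 * (deriv \<psi> x)\<^sup>2 \<partial>Omega) - (\<integral>x. 2 * ?f x \<partial>Omega)"
    by (rule Bochner_Integration.integral_diff[OF integrable_mult_right[OF i2] integrable_mult_right[OF i3]])
  also have "\<dots> = 4 * (\<integral>x. (deriv \<psi> x)\<^sup>2 \<partial>Omega)" by (simp only: integral_mult_right_zero F0 mult_zero_right diff_zero)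
  finally show "Ltwo_inner Omega (\<lambda>x. \<psi> x / x) (\<lambda>x. \<psi> x / x) \<le> 4 * dirichlet \<psi> \<psi>"
    unfolding dirichlet_eq[OF test_has_weak_deriv[OF \<psi>] test_has_weak_deriv[OF \<psi>]] Ltwo_inner_self .
qed

text \<open>Some subsequence has an almost everywhere limit; Fatou bounds its distance to v by every
  positive number, so it equals v almost everywhere.\<close>

lemma (in finite_measure) Ltwo_conv_subseq_AE:
  assumes s: "\<And>n. s n \<in> Ltwo M" and v: "v \<in> Ltwo M" and c: "Ltwo.conv M s v"
  shows "\<exists>r. strict_mono (r::nat \<Rightarrow> nat) \<and> (AE x in M. (\<lambda>n. s (r n) x) \<longlonglongrightarrow> v x)"
proof -
  obtain r f where r: "strict_mono r" and fm: "f \<in> borel_measurable M" and lim: "AE x in M. (\<lambda>n. s (r n) x) \<longlonglongrightarrow> f x"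
    using Ltwo_cauchy_subseq_AE[of s, OF s Ltwo.conv_cauchy[OF s v c]] by blast
  have 1: "(\<lambda>x. s (r n) x - v x) \<in> Ltwo M" for n by (rule Ltwo.diff_mem[OF s v])
  have 2: "(\<lambda>x. f x - v x) \<in> borel_measurable M" by (rule borel_measurable_diff[OF fm Ltwo_measurable[OF v]])
  have 3: "AE x in M. (\<lambda>n. s (r n) x - v x) \<longlonglongrightarrow> f x - v x"
    using lim by eventually_elim (intro tendsto_diff tendsto_const)
  have clim: "(\<lambda>n. \<integral>x. (s (r n) x - v x)\<^sup>2 \<partial>M) \<longlonglongrightarrow> 0"
    using Ltwo.conv_subseq[OF c r] unfolding Ltwo.conv_def Ltwo_inner_self .
  have 4: "integrable M (\<lambda>x. (f x - v x)\<^sup>2) \<and> (\<integral>x. (f x - v x)\<^sup>2 \<partial>M) \<le> e" if e: "0 < e" for e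
  proof -
    obtain N where N: "\<And>n. n \<ge> N \<Longrightarrow> (\<integral>x. (s (r n) x - v x)\<^sup>2 \<partial>M) < e"
      using order_tendstoD(2)[OF clim e] unfolding eventually_sequentially by blast
    show ?thesis
      using Ltwo_Fatou[OF Ltwo_measurable[OF 1] 2 3 Ltwo_square_integrable[OF 1] less_imp_le[OF N]] by blast
  qed
  have "(\<integral>x. (f x - v x)\<^sup>2 \<partial>M) \<le> 0" by (rule field_le_epsilon) (use 4 in simp)
  moreover have "0 \<le> (\<integral>x. (f x - v x)\<^sup>2 \<partial>M)" by (rule Bochner_Integration.integral_nonneg) simp
  ultimately have "(\<integral>x. (f x - v x)\<^sup>2 \<partial>M) = 0" by (rule antisym)
  moreover have "integrable M (\<lambda>x. (f x - v x)\<^sup>2)" using 4[OF zero_less_one] by blast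
  ultimately have "AE x in M. (f x - v x)\<^sup>2 = 0" using integral_nonneg_eq_0_iff_AE[of M "\<lambda>x. (f x - v x)\<^sup>2"] by simp
  with lim have "AE x in M. (\<lambda>n. s (r n) x) \<longlonglongrightarrow> v x" by eventually_elim simp
  then show ?thesis using r by blast
qed

lemma H1_conv_parts:
  assumes s: "\<And>n. s n \<in> sobolev_H1" and v: "v \<in> sobolev_H1" and c: "H1.conv s v"
  shows "Ltwo.conv Omega s v" "Dirichlet.conv s v"
proof -
  have nn: "0 \<le> Ltwo_inner Omega (\<lambda>x. s n x - v x) (\<lambda>x. s n x - v x)" "0 \<le> dirichlet (\<lambda>x. s n x - v x) (\<lambda>x. s n x - v x)" for n
    using Ltwo.nonneg[OF H1_Ltwo[OF H1.diff_mem[OF s v]]] Dirichlet.nonneg[OF H1.diff_mem[OF s v]] by auto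
  show "Ltwo.conv Omega s v" unfolding Ltwo.conv_def
    by (rule tendsto_sandwich[OF _ _ tendsto_const c[unfolded H1.conv_def]]) (use nn in \<open>auto simp: H1_inner_def\<close>)
  show "Dirichlet.conv s v" unfolding Dirichlet.conv_def
    by (rule tendsto_sandwich[OF _ _ tendsto_const c[unfolded H1.conv_def]]) (use nn in \<open>auto simp: H1_inner_def\<close>)
qed

text \<open>By density: along an almost everywhere convergent sequence of test functions the
  left-hand side is lower semicontinuous by Fatou, and the Dirichlet integrals converge.\<close>

lemma Hardy:
  assumes v: "v \<in> sobolev_H10"
  shows "(\<lambda>x. v x / x) \<in> Ltwo Omega" "Ltwo_inner Omega (\<lambda>x. v x / x) (\<lambda>x. v x / x) \<le> 4 * dirichlet v v"
proof -
  obtain \<psi> where \<psi>: "\<And>n. \<psi> n \<in> test_functions 0 1" and c: "H1.conv \<psi> v" using H10_approx[OF v] by blast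
  note h = test_H1[OF \<psi>] H10_H1[OF v]
  obtain r where r: "strict_mono r" and lim: "AE x in Omega. (\<lambda>n. \<psi> (r n) x) \<longlonglongrightarrow> v x"
    using Omega.Ltwo_conv_subseq_AE[of \<psi>, OF test_Ltwo(1)[OF \<psi>] H10_Ltwo[OF v] H1_conv_parts(1)[OF h c]] by blast
  have D: "(\<lambda>n. dirichlet (\<psi> (r n)) (\<psi> (r n))) \<longlonglongrightarrow> dirichlet v v"
    by (rule Dirichlet.conv_square[OF test_H1[OF \<psi>] h(2) Dirichlet.conv_subseq[OF H1_conv_parts(2)[OF h c] r]])
  have idm: "(\<lambda>x. x) \<in> borel_measurable Omega" using id_borel_measurable_lebesgue_on by (simp add: id_def)
  have m: "(\<lambda>x. v x / x) \<in> borel_measurable Omega"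
    by (rule borel_measurable_divide[OF Ltwo_measurable[OF H10_Ltwo[OF v]] idm])
  have lim': "AE x in Omega. (\<lambda>n. \<psi> (r n) x / x) \<longlonglongrightarrow> v x / x"
  proof -
    have "AE x in Omega. x \<noteq> 0" by (rule AE_I2) (simp add: space_restrict_space)
    then show ?thesis using lim by eventually_elim (rule tendsto_divide[OF _ tendsto_const])
  qed
  have e: "integrable Omega (\<lambda>x. (v x / x)\<^sup>2) \<and> (\<integral>x. (v x / x)\<^sup>2 \<partial>Omega) \<le> 4 * dirichlet v v + e" if e: "0 < e" for e
  proof -
    have "\<forall>\<^sub>F n in sequentially. dirichlet (\<psi> (r n)) (\<psi> (r n)) < dirichlet v v + e / 4"
      by (rule order_tendstoD(2)[OF D]) (use e in simp)
    then obtain N where N: "\<And>n. n \<ge> N \<Longrightarrow> dirichlet (\<psi> (r n)) (\<psi> (r n)) < dirichlet v v + e / 4"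
      unfolding eventually_sequentially by blast
    have b: "(\<integral>x. (\<psi> (r n) x / x)\<^sup>2 \<partial>Omega) \<le> 4 * dirichlet v v + e" if "n \<ge> N" for n
      using Hardy_test(2)[OF \<psi>[of "r n"]] N[OF that] unfolding Ltwo_inner_self by simp
    show ?thesis
      using Ltwo_Fatou[OF Ltwo_measurable[OF Hardy_test(1)[OF \<psi>]] m lim' Ltwo_square_integrable[OF Hardy_test(1)[OF \<psi>]] b] by blast
  qed
  show "(\<lambda>x. v x / x) \<in> Ltwo Omega" using e[OF zero_less_one] m by (simp add: Ltwo_def)
  show "Ltwo_inner Omega (\<lambda>x. v x / x) (\<lambda>x. v x / x) \<le> 4 * dirichlet v v"
    unfolding Ltwo_inner_self by (rule field_le_epsilon) (use e in blast)
qed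

text \<open>On (0,1) the weight 1 / x^2 exceeds 1, so Hardy's inequality contains this one.\<close>

lemma Poincare:
  assumes v: "v \<in> sobolev_H10"
  shows "Ltwo_inner Omega v v \<le> 4 * dirichlet v v"
proof -
  have "(\<integral>x. (v x)\<^sup>2 \<partial>Omega) \<le> (\<integral>x. (v x / x)\<^sup>2 \<partial>Omega)"
  proof (rule integral_mono[OF Ltwo_square_integrable[OF H10_Ltwo[OF v]] Ltwo_square_integrable[OF Hardy(1)[OF v]]])
    fix x :: real assume "x \<in> space Omega"
    then have x: "0 < x" "x < 1" by (auto simp: space_restrict_space)
    have "x\<^sup>2 \<le> 1" using x by (simp add: power_le_one)
    then have "(v x)\<^sup>2 * x\<^sup>2 \<le> (v x)\<^sup>2" by (simp add: mult_left_le)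
    then show "(v x)\<^sup>2 \<le> (v x / x)\<^sup>2" using x by (simp add: power_divide pos_le_divide_eq)
  qed
  then show ?thesis using Hardy(2)[OF v] unfolding Ltwo_inner_self by simp
qed

text \<open>Cauchy-Schwarz for the derivative against the indicator of the interval from x to
  y.\<close>

lemma test_Hoelder:
  assumes \<psi>: "\<psi> \<in> test_functions 0 1" and xy: "0 \<le> x" "x \<le> y" "y \<le> 1"
  shows "(\<psi> y - \<psi> x)\<^sup>2 \<le> dirichlet \<psi> \<psi> * (y - x)"
proof -
  let ?I = "indicator {x<..<y} :: real \<Rightarrow> real"
  have Ig: "integrable Omega ?I"
    by (rule integrable_bounded_interval[where C=1], rule borel_measurable_indicator) (use xy in \<open>auto simp: sets_restrict_space_iff indicator_def\<close>)
  have IL: "?I \<in> Ltwo Omega"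
  proof -
    have "(\<lambda>z. (?I z)\<^sup>2) = ?I" by (auto simp: indicator_def)
    then show ?thesis using Ig by (simp add: Ltwo_def borel_measurable_integrable)
  qed
  have sub: "(\<integral>z. f z * ?I z \<partial>Omega) = (\<integral>z. f z \<partial>lebesgue_on {x<..<y})" for f :: "real \<Rightarrow> real"
  proof -
    have "(\<integral>z. f z * ?I z \<partial>Omega) = (\<integral>z. indicator {0<..<1} z *\<^sub>R (f z * ?I z) \<partial>lebesgue)"
      by (rule integral_restrict_space) simp
    also have "\<dots> = (\<integral>z. ?I z *\<^sub>R f z \<partial>lebesgue)"
      using xy by (intro Bochner_Integration.integral_cong refl) (auto simp: indicator_def)
    also have "\<dots> = (\<integral>z. f z \<partial>lebesgue_on {x<..<y})"
      by (rule integral_restrict_space[symmetric]) simp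
    finally show ?thesis .
  qed
  have "Ltwo_inner Omega (deriv \<psi>) ?I = \<psi> y - \<psi> x"
    unfolding Ltwo_inner_def sub by (rule interval_FTC(2)[OF xy(2) test_function_continuous(3)[OF \<psi>] test_function_continuous(2)[OF \<psi>]])
  moreover have "Ltwo_inner Omega ?I ?I = y - x"
  proof -
    have "Ltwo_inner Omega ?I ?I = (\<integral>z. 1 * ?I z \<partial>Omega)"
      unfolding Ltwo_inner_def by (intro Bochner_Integration.integral_cong refl) (auto simp: indicator_def)
    also have "\<dots> = y - x" unfolding sub by (rule interval_FTC(2)[of _ _ "\<lambda>x. x"]) (use xy in auto)
    finally show ?thesis .
  qed
  ultimately show ?thesis
    using Ltwo.Cauchy_Schwarz[OF test_Ltwo(2)[OF \<psi>] IL]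
    unfolding dirichlet_eq[OF test_has_weak_deriv[OF \<psi>] test_has_weak_deriv[OF \<psi>]] by simp
qed

text \<open>A bounded Dirichlet integral gives a common Hoelder bound with exponent 1/2 and, as the
  functions vanish at 0, a common bound. Arzela-Ascoli yields a uniformly convergent subsequence,
  which is Cauchy in L^2 on a bounded interval.\<close>

lemma test_bounded_uniform_limit:
  assumes \<psi>: "\<And>n. \<psi> n \<in> test_functions 0 1" and D: "\<And>n. dirichlet (\<psi> n) (\<psi> n) \<le> C"
  shows "\<exists>r. strict_mono (r::nat \<Rightarrow> nat) \<and> Ltwo.cauchy Omega (\<lambda>n. \<psi> (r n))"
proof -
  have C: "0 \<le> C" using order_trans[OF Dirichlet.nonneg[OF test_H1[OF \<psi>]] D[of 0]] .
  have H: "\<bar>\<psi> n y - \<psi> n x\<bar> \<le> sqrt (C * \<bar>y - x\<bar>)" if xy: "x \<in> {0..1}" "y \<in> {0..1}" for n x y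
  proof -
    have *: "\<bar>\<psi> n y - \<psi> n x\<bar> \<le> sqrt (C * \<bar>y - x\<bar>)" if "0 \<le> x" "x \<le> y" "y \<le> 1" for x y
    proof (rule real_le_rsqrt)
      have "(\<psi> n y - \<psi> n x)\<^sup>2 \<le> dirichlet (\<psi> n) (\<psi> n) * (y - x)" by (rule test_Hoelder[OF \<psi> that])
      also have "\<dots> \<le> C * \<bar>y - x\<bar>" using D[of n] that by (intro mult_mono C) auto
      finally show "\<bar>\<psi> n y - \<psi> n x\<bar>\<^sup>2 \<le> C * \<bar>y - x\<bar>" by simp
    qed
    show ?thesis
    proof (cases "x \<le> y")
      case True
      then show ?thesis using *[of x y] xy by simp
    next
      case False
      then show ?thesis using *[of y x] xy by (simp add: abs_minus_commute)
    qed
  qed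
  have bound: "norm (\<psi> n x) \<le> sqrt C" if "x \<in> {0..1}" for n x
  proof -
    have "\<bar>\<psi> n x\<bar> \<le> sqrt (C * x)" using H[of 0 x n] that test_function_outside[OF \<psi>, of 0 n] by simp
    also have "\<dots> \<le> sqrt C" using that C by (intro real_sqrt_le_mono) (simp add: mult_left_le)
    finally show ?thesis by simp
  qed
  \<comment> \<open>A modulus for exponent 1/2; C + 1 in the denominator covers C = 0.\<close>
  have equi: "\<exists>d. 0 < d \<and> (\<forall>n y. y \<in> {0..1} \<and> norm (x - y) < d \<longrightarrow> norm (\<psi> n x - \<psi> n y) < e)"
    if x: "x \<in> {0..1}" and e: "0 < e" for x e :: real
  proof (intro exI[of _ "e\<^sup>2 / (C + 1)"] conjI allI impI)
    show "0 < e\<^sup>2 / (C + 1)" using e C by simp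
    fix n y assume y: "y \<in> {0..1} \<and> norm (x - y) < e\<^sup>2 / (C + 1)"
    have "\<bar>\<psi> n x - \<psi> n y\<bar> \<le> sqrt (C * \<bar>x - y\<bar>)" using H[of y x n] x y by simp
    also have "\<dots> < sqrt (e\<^sup>2)"
    proof (rule real_sqrt_less_mono)
      have "\<bar>x - y\<bar> * (C + 1) < e\<^sup>2" using y C by (simp add: pos_less_divide_eq)
      moreover have "C * \<bar>x - y\<bar> \<le> \<bar>x - y\<bar> * (C + 1)" by (simp add: algebra_simps)
      ultimately show "C * \<bar>x - y\<bar> < e\<^sup>2" by linarith
    qed
    finally show "norm (\<psi> n x - \<psi> n y) < e" using e by simp
  qed
  obtain g r where r: "strict_mono (r :: nat \<Rightarrow> nat)"
    and unif: "\<And>e. 0 < e \<Longrightarrow> \<exists>N. \<forall>n x. n \<ge> N \<and> x \<in> {0..1} \<longrightarrow> norm (\<psi> (r n) x - g x) < e"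
    by (rule Arzela_Ascoli[of "{0..1::real}" \<psi> "sqrt C", OF compact_Icc bound equi]) auto
  have "Ltwo.cauchy Omega (\<lambda>n. \<psi> (r n))"
    unfolding Ltwo.cauchy_def
  proof (intro allI impI)
    fix e :: real assume e: "0 < e"
    obtain N where N: "\<And>n x. n \<ge> N \<Longrightarrow> x \<in> {0..1} \<Longrightarrow> norm (\<psi> (r n) x - g x) < sqrt (e / 2) / 2"
      using unif[of "sqrt (e / 2) / 2"] e by auto
    have "Ltwo_inner Omega (\<lambda>x. \<psi> (r m) x - \<psi> (r n) x) (\<lambda>x. \<psi> (r m) x - \<psi> (r n) x) < e" if mn: "m \<ge> N" "n \<ge> N" for m n
    proof -
      have "(\<integral>x. (\<psi> (r m) x - \<psi> (r n) x)\<^sup>2 \<partial>Omega) \<le> (\<integral>x. e / 2 \<partial>Omega)"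
      proof (rule integral_mono[OF Ltwo_square_integrable[OF Ltwo.diff_mem[OF test_Ltwo(1)[OF \<psi>] test_Ltwo(1)[OF \<psi>]]]])
        fix x assume "x \<in> space Omega"
        then have x: "x \<in> {0..1}" by (auto simp: space_restrict_space)
        have "\<bar>\<psi> (r m) x - \<psi> (r n) x\<bar> \<le> \<bar>\<psi> (r m) x - g x\<bar> + \<bar>\<psi> (r n) x - g x\<bar>" by linarith
        then have "\<bar>\<psi> (r m) x - \<psi> (r n) x\<bar> \<le> sqrt (e / 2)" using N[OF mn(1) x] N[OF mn(2) x] by simp
        then have "\<bar>\<psi> (r m) x - \<psi> (r n) x\<bar>\<^sup>2 \<le> (sqrt (e / 2))\<^sup>2" by (intro power_mono) auto
        then show "(\<psi> (r m) x - \<psi> (r n) x)\<^sup>2 \<le> e / 2" using e by simp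
      qed simp
      also have "(\<integral>x. e / 2 \<partial>Omega) = e / 2"
        by (simp add: measure_restrict_space space_restrict_space)
      finally show ?thesis using e unfolding Ltwo_inner_self by simp
    qed
    then show "\<exists>N. \<forall>m\<ge>N. \<forall>n\<ge>N. Ltwo_inner Omega (\<lambda>x. \<psi> (r m) x - \<psi> (r n) x) (\<lambda>x. \<psi> (r m) x - \<psi> (r n) x) < e" by blast
  qed
  then show ?thesis using r by blast
qed

text \<open>The pointwise Hoelder bound is available for test functions, so each member is first
  replaced by a test function within 1 / (n + 1) of it in H^1; the error vanishes along any
  subsequence.\<close>

lemma Rellich:
  assumes s: "\<And>n. s n \<in> sobolev_H10" and D: "\<And>n. dirichlet (s n) (s n) \<le> C"
  shows "\<exists>r. strict_mono (r::nat \<Rightarrow> nat) \<and> Ltwo.cauchy Omega (\<lambda>n. s (r n))"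
proof -
  have h: "s n \<in> sobolev_H1" for n by (rule H10_H1[OF s])
  have "\<exists>\<psi>. \<psi> \<in> test_functions 0 1 \<and> H1_inner (\<lambda>x. \<psi> x - s n x) (\<lambda>x. \<psi> x - s n x) < 1 / real (Suc n)" for n
  proof -
    obtain \<psi> where \<psi>: "\<And>n. \<psi> n \<in> test_functions 0 1" "H1.conv \<psi> (s n)" using H10_approx[OF s[of n]] by blast
    have "\<forall>\<^sub>F k in sequentially. H1_inner (\<lambda>x. \<psi> k x - s n x) (\<lambda>x. \<psi> k x - s n x) < 1 / real (Suc n)"
      by (rule order_tendstoD(2)[OF \<psi>(2)[unfolded H1.conv_def]]) simp
    then obtain k where "H1_inner (\<lambda>x. \<psi> k x - s n x) (\<lambda>x. \<psi> k x - s n x) < 1 / real (Suc n)"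
      unfolding eventually_sequentially by blast
    then show ?thesis using \<psi>(1) by blast
  qed
  then obtain \<psi> where "\<forall>n. \<psi> n \<in> test_functions 0 1 \<and> H1_inner (\<lambda>x. \<psi> n x - s n x) (\<lambda>x. \<psi> n x - s n x) < 1 / real (Suc n)"
    using choice[of "\<lambda>n \<psi>. \<psi> \<in> test_functions 0 1 \<and> H1_inner (\<lambda>x. \<psi> x - s n x) (\<lambda>x. \<psi> x - s n x) < 1 / real (Suc n)"] by blast
  then have \<psi>: "\<psi> n \<in> test_functions 0 1" "H1_inner (\<lambda>x. \<psi> n x - s n x) (\<lambda>x. \<psi> n x - s n x) < 1 / real (Suc n)" for n by auto
  note t = test_H1[OF \<psi>(1)]
  note d = H1.diff_mem[OF t h]
  have L: "Ltwo_inner Omega (\<lambda>x. \<psi> n x - s n x) (\<lambda>x. \<psi> n x - s n x) < 1 / real (Suc n)"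
    and Dd: "dirichlet (\<lambda>x. \<psi> n x - s n x) (\<lambda>x. \<psi> n x - s n x) < 1 / real (Suc n)" for n
    using \<psi>(2)[of n] Ltwo.nonneg[OF H1_Ltwo[OF d[of n n]]] Dirichlet.nonneg[OF d[of n n]] unfolding H1_inner_def by linarith+
  have "dirichlet (\<psi> n) (\<psi> n) \<le> 2 + 2 * C" for n
  proof -
    have "dirichlet (\<lambda>x. (\<psi> n x - s n x) + s n x) (\<lambda>x. (\<psi> n x - s n x) + s n x) \<le>
        2 * dirichlet (\<lambda>x. \<psi> n x - s n x) (\<lambda>x. \<psi> n x - s n x) + 2 * dirichlet (s n) (s n)"
      using Dirichlet.parallelogram[OF d[of n n] h[of n]] Dirichlet.nonneg[OF Dirichlet.diff_mem[OF d[of n n] h[of n]]] by linarith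
    then have "dirichlet (\<psi> n) (\<psi> n) \<le> 2 * dirichlet (\<lambda>x. \<psi> n x - s n x) (\<lambda>x. \<psi> n x - s n x) + 2 * dirichlet (s n) (s n)" by simp
    moreover have "1 / real (Suc n) \<le> 1" by simp
    ultimately show ?thesis using Dd[of n] D[of n] by linarith
  qed
  from test_bounded_uniform_limit[of \<psi>, OF \<psi>(1) this] obtain r where r: "strict_mono (r :: nat \<Rightarrow> nat)"
    and c: "Ltwo.cauchy Omega (\<lambda>n. \<psi> (r n))" by blast
  note \<psi>L = test_Ltwo(1)[OF \<psi>(1)] and sL = H10_Ltwo[OF s]
  have "Ltwo.cauchy Omega (\<lambda>n. s (r n))"
    unfolding Ltwo.cauchy_def
  proof (intro allI impI)
    fix e :: real assume e: "0 < e"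
    obtain N1 where N1: "\<And>m n. m \<ge> N1 \<Longrightarrow> n \<ge> N1 \<Longrightarrow> Ltwo_inner Omega (\<lambda>x. \<psi> (r m) x - \<psi> (r n) x) (\<lambda>x. \<psi> (r m) x - \<psi> (r n) x) < e / 8"
      using c[unfolded Ltwo.cauchy_def, rule_format, of "e / 8"] e by auto
    obtain N2 where N2: "1 / real (Suc N2) < e / 16" using nat_approx_posE[of "e / 16"] e by auto
    have small: "Ltwo_inner Omega (\<lambda>x. \<psi> (r n) x - s (r n) x) (\<lambda>x. \<psi> (r n) x - s (r n) x) < e / 16" if "n \<ge> N2" for n
    proof -
      have "1 / real (Suc (r n)) \<le> 1 / real (Suc N2)"
        using order_trans[OF that seq_suble[OF r, of n]] by (intro divide_left_mono) auto
      then show ?thesis using L[of "r n"] N2 by linarith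
    qed
    have "Ltwo_inner Omega (\<lambda>x. s (r m) x - s (r n) x) (\<lambda>x. s (r m) x - s (r n) x) < e" if mn: "m \<ge> max N1 N2" "n \<ge> max N1 N2" for m n
    proof -
      let ?a = "\<lambda>x. \<psi> (r m) x - \<psi> (r n) x" and ?b = "\<lambda>x. \<psi> (r m) x - s (r m) x" and ?c = "\<lambda>x. \<psi> (r n) x - s (r n) x"
      have mem: "?a \<in> Ltwo Omega" "?b \<in> Ltwo Omega" "?c \<in> Ltwo Omega" "(\<lambda>x. ?b x - ?c x) \<in> Ltwo Omega"
        by (intro Ltwo.diff_mem \<psi>L sL)+
      have "Ltwo_inner Omega (\<lambda>x. ?a x - (?b x - ?c x)) (\<lambda>x. ?a x - (?b x - ?c x)) \<le>
         2 * Ltwo_inner Omega ?a ?a + 2 * Ltwo_inner Omega (\<lambda>x. ?b x - ?c x) (\<lambda>x. ?b x - ?c x)"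
        by (rule Ltwo.square_diff_le[OF mem(1,4)])
      also have "Ltwo_inner Omega (\<lambda>x. ?b x - ?c x) (\<lambda>x. ?b x - ?c x) \<le> 2 * Ltwo_inner Omega ?b ?b + 2 * Ltwo_inner Omega ?c ?c"
        by (rule Ltwo.square_diff_le[OF mem(2,3)])
      finally have "Ltwo_inner Omega (\<lambda>x. s (r m) x - s (r n) x) (\<lambda>x. s (r m) x - s (r n) x) \<le>
         2 * Ltwo_inner Omega ?a ?a + 2 * (2 * Ltwo_inner Omega ?b ?b + 2 * Ltwo_inner Omega ?c ?c)" by simp
      moreover have "Ltwo_inner Omega ?a ?a < e / 8" "Ltwo_inner Omega ?b ?b < e / 16" "Ltwo_inner Omega ?c ?c < e / 16"
        using N1[of m n] small[of m] small[of n] mn by auto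
      moreover have "x < e" if "x \<le> 2 * a + 2 * (2 * b + 2 * c)" "a < e / 8" "b < e / 16" "c < e / 16" for x a b c :: real
        using that e by (simp add: field_simps)
      ultimately show ?thesis by blast
    qed
    then show "\<exists>N. \<forall>m\<ge>N. \<forall>n\<ge>N. Ltwo_inner Omega (\<lambda>x. s (r m) x - s (r n) x) (\<lambda>x. s (r m) x - s (r n) x) < e" by blast
  qed
  then show ?thesis using r by blast
qed

section \<open>The form with inverse-square potential\<close>

definition hardy :: "(real \<Rightarrow> real) \<Rightarrow> (real \<Rightarrow> real) \<Rightarrow> real" where
  "hardy v w = Ltwo_inner Omega (\<lambda>x. v x / x) (\<lambda>x. w x / x)"

lemma a_form_eq: "a_form \<mu> v w = dirichlet v w - \<mu> * hardy v w"
  unfolding a_form_def dirichlet_def hardy_def Ltwo_inner_def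
  by (simp add: power2_eq_square)

interpretation Hardy: semi_inner sobolev_H10 hardy
proof
  show "hardy (\<lambda>x. f x + g x) h = hardy f h + hardy g h"
    if "f \<in> sobolev_H10" "g \<in> sobolev_H10" "h \<in> sobolev_H10" for f g h
    unfolding hardy_def add_divide_distrib by (rule Ltwo.add_left[OF that[THEN Hardy(1)]])
  show "hardy (\<lambda>x. c * f x) h = c * hardy f h" if "f \<in> sobolev_H10" "h \<in> sobolev_H10" for f h c
    unfolding hardy_def times_divide_eq_right[symmetric] by (rule Ltwo.scale_left[OF that[THEN Hardy(1)]])
  show "hardy f g = hardy g f" if "f \<in> sobolev_H10" "g \<in> sobolev_H10" for f g
    unfolding hardy_def by (rule Ltwo.sym[OF that[THEN Hardy(1)]])
  show "0 \<le> hardy f f" if "f \<in> sobolev_H10" for f unfolding hardy_def by (rule Ltwo.nonneg[OF Hardy(1)[OF that]])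
  show "(\<lambda>x. 0) \<in> sobolev_H10"
  proof -
    \<comment> \<open>Any member of \<open>bumps\<close> will do: multiplied by 0 it exhibits the
      zero function as having its derivative in \<open>bumps\<close>.\<close>
    obtain H h :: "real \<Rightarrow> real" where "h \<in> bumps" "\<And>x. (H has_field_derivative h x) (at x)" by (rule smooth_step[of 0 1]) auto
    have "(\<lambda>x. 0 * eta 0 x) \<in> sobolev_H10"
    proof (rule test_H10, rule test_function_if_deriv_bump[of "\<lambda>x. 0 * h x" _ _ "1/4" "1/2"])
      show "(\<lambda>x. 0 * h x) \<in> bumps" by (rule bumps.scale) fact
    qed auto
    then show ?thesis by simp
  qed
qed (intro H10_add H10_scale; assumption)+

text \<open>For nonnegative \<mu> Hardy's inequality leaves the fraction 1 - 4 \<mu> of the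
  Dirichlet integral; for negative \<mu> the potential only adds energy and the constant 1 is
  kept.\<close>

lemma a_form_semi_inner:
  assumes "\<mu> < 1 / 4"
  shows "semi_inner sobolev_H10 (a_form \<mu>)"
    and "\<exists>m>0. \<forall>v\<in>sobolev_H10. m * dirichlet v v \<le> a_form \<mu> v v"
proof -
  have coer: "min 1 (1 - 4 * \<mu>) * dirichlet v v \<le> a_form \<mu> v v" if v: "v \<in> sobolev_H10" for v
  proof -
    have D: "0 \<le> dirichlet v v" by (rule Dirichlet.nonneg[OF H10_H1[OF v]])
    have H: "0 \<le> hardy v v" "hardy v v \<le> 4 * dirichlet v v"
      using Hardy.nonneg[OF v] Hardy(2)[OF v] unfolding hardy_def by auto
    show ?thesis
    proof (cases "0 \<le> \<mu>")
      case True
      have "min 1 (1 - 4 * \<mu>) * dirichlet v v \<le> (1 - 4 * \<mu>) * dirichlet v v"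
        by (rule mult_right_mono[OF min.cobounded2 D])
      also have "\<dots> = dirichlet v v - \<mu> * (4 * dirichlet v v)" by (simp add: algebra_simps)
      also have "\<dots> \<le> dirichlet v v - \<mu> * hardy v v" using mult_left_mono[OF H(2) True] by simp
      finally show ?thesis by (simp only: a_form_eq)
    next
      case False
      have "min 1 (1 - 4 * \<mu>) * dirichlet v v \<le> 1 * dirichlet v v"
        by (rule mult_right_mono[OF min.cobounded1 D])
      moreover have "\<mu> * hardy v v \<le> 0" using False H(1) by (simp add: mult_nonpos_nonneg)
      ultimately show ?thesis by (simp only: a_form_eq mult_1_left)
    qed
  qed
  have m: "0 < min 1 (1 - 4 * \<mu>)" using assms by simp
  then show "\<exists>m>0. \<forall>v\<in>sobolev_H10. m * dirichlet v v \<le> a_form \<mu> v v" using coer by blast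
  show "semi_inner sobolev_H10 (a_form \<mu>)"
  proof
    show "a_form \<mu> (\<lambda>x. f x + g x) h = a_form \<mu> f h + a_form \<mu> g h"
      if "f \<in> sobolev_H10" "g \<in> sobolev_H10" "h \<in> sobolev_H10" for f g h
      using Hardy.add_left[OF that] Dirichlet.add_left[OF that[THEN H10_H1]] by (simp add: a_form_eq algebra_simps)
    show "a_form \<mu> (\<lambda>x. c * f x) h = c * a_form \<mu> f h" if "f \<in> sobolev_H10" "h \<in> sobolev_H10" for f h c
      using Hardy.scale_left[OF that] Dirichlet.scale_left[OF that[THEN H10_H1]] by (simp add: a_form_eq algebra_simps)
    show "a_form \<mu> f g = a_form \<mu> g f" if "f \<in> sobolev_H10" "g \<in> sobolev_H10" for f g
      using Hardy.sym[OF that] Dirichlet.sym[OF that[THEN H10_H1]] by (simp add: a_form_eq)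
    show "0 \<le> a_form \<mu> f f" if "f \<in> sobolev_H10" for f
      by (rule order_trans[OF mult_nonneg_nonneg[OF less_imp_le[OF m] Dirichlet.nonneg[OF H10_H1[OF that]]] coer[OF that]])
  qed (intro Hardy.zero_mem H10_add H10_scale; assumption)+
qed

text \<open>Bumps with disjoint supports between 1 / (n + 3) and 1 / (n + 2), normalised; these
  intervals stay inside (0,1). They show that the form domain has infinite dimension.\<close>

lemma orthonormal_test_functions:
  "\<exists>e::nat \<Rightarrow> real \<Rightarrow> real. (\<forall>n. e n \<in> sobolev_H10) \<and> (\<forall>m n. Ltwo_inner Omega (e m) (e n) = (if m = n then 1 else 0))"
proof -
  define c where "c n = 1 / real (n + 3)" for n
  define d where "d n = 1 / real (n + 2)" for n
  define \<psi> where "\<psi> n x = eta 0 (x - c n) * eta 0 (d n - x)" for n x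
  have cd: "0 < c n" "c n < d n" "d n < 1" for n by (auto simp: c_def d_def field_simps)
  have b: "\<psi> n \<in> bumps" for n unfolding \<psi>_def[abs_def] by (rule bumps.bump)
  have z: "\<psi> n x = 0" if "x \<notin> {c n<..<d n}" for n x using that by (auto simp: \<psi>_def eta_def)
  have T: "\<psi> n \<in> test_functions 0 1" for n
  proof -
    obtain g where g: "g \<in> bumps" "\<forall>x. (\<psi> n has_field_derivative g x) (at x)" using bumps_deriv[OF b[of n]] by blast
    show ?thesis
      by (rule test_function_if_deriv_bump[of g _ _ "c n" "d n"]) (use g cd[of n] z[of _ n] in auto)
  qed
  have pos: "0 < Ltwo_inner Omega (\<psi> n) (\<psi> n)" for n
  proof (rule ccontr)
    assume "\<not> ?thesis"
    then have "Ltwo_inner Omega (\<psi> n) (\<psi> n) = 0" using Ltwo.nonneg[OF test_Ltwo(1)[OF T[of n]]] by simp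
    then have ae: "AE x in Omega. \<psi> n x = 0" using Ltwo_null[OF test_Ltwo(1)[OF T[of n]]] by blast
    have "(\<integral>x. indicator {c n<..<d n} x * 1 \<partial>Omega) = (\<integral>x. 0 \<partial>Omega :: real)"
    proof (rule integral_cong_AE)
      show "AE x in Omega. indicator {c n<..<d n} x * 1 = (0::real)"
        using ae
      proof eventually_elim
        case (elim x)
        then show ?case using eta_pos[of "x - c n" 0] eta_pos[of "d n - x" 0] by (auto simp: \<psi>_def indicator_def)
      qed
      show "(\<lambda>x. indicator {c n<..<d n} x * 1 :: real) \<in> borel_measurable Omega"
        using cd[of n] by (intro borel_measurable_times borel_measurable_indicator) (auto simp: sets_restrict_space_iff)
    qed simp
    moreover have "(\<integral>x. indicator {c n<..<d n} x * 1 \<partial>Omega) = (\<integral>x. indicator {0<..<1} x *\<^sub>R (indicator {c n<..<d n} x * 1 :: real) \<partial>lebesgue)"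
      by (rule integral_restrict_space) simp
    moreover have "\<dots> = (\<integral>x. indicator {c n<..<d n} x *\<^sub>R (1::real) \<partial>lebesgue)"
      using cd[of n] by (intro Bochner_Integration.integral_cong refl) (auto simp: indicator_def)
    moreover have "\<dots> = (\<integral>x. 1 \<partial>lebesgue_on {c n<..<d n})" by (rule integral_restrict_space[symmetric]) simp
    moreover have "\<dots> = d n - c n"
      by (rule interval_FTC(2)[of _ _ "\<lambda>x. x"]) (use cd[of n] in auto)
    ultimately show False using cd(2)[of n] by simp
  qed
  have orth: "Ltwo_inner Omega (\<psi> m) (\<psi> n) = 0" if "m \<noteq> n" for m n
  proof -
    have *: "\<psi> m x * \<psi> n x = 0" if "m < n" for m n x
    proof -
      have "d n \<le> c m" using that unfolding c_def d_def by (intro divide_left_mono) auto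
      then have "x \<notin> {c m<..<d m} \<or> x \<notin> {c n<..<d n}" by auto
      then show ?thesis using z by auto
    qed
    have "\<psi> m x * \<psi> n x = 0" for x
      using *[of m n x] *[of n m x] \<open>m \<noteq> n\<close> by (cases "m < n") (auto simp: mult.commute)
    then show ?thesis unfolding Ltwo_inner_def by (simp only: Bochner_Integration.integral_zero)
  qed
  define e where "e n x = 1 / sqrt (Ltwo_inner Omega (\<psi> n) (\<psi> n)) * \<psi> n x" for n x
  note L = test_Ltwo(1)[OF T]
  have "e n \<in> sobolev_H10" for n unfolding e_def[abs_def] by (rule H10_scale[OF test_H10[OF T]])
  moreover have "Ltwo_inner Omega (e m) (e n) = (if m = n then 1 else 0)" for m n
  proof -
    have "Ltwo_inner Omega (e m) (e n) = 1 / sqrt (Ltwo_inner Omega (\<psi> m) (\<psi> m)) * (1 / sqrt (Ltwo_inner Omega (\<psi> n) (\<psi> n)) * Ltwo_inner Omega (\<psi> m) (\<psi> n))"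
      unfolding e_def[abs_def] by (simp only: Ltwo.scale_left[OF L Ltwo.scale_mem[OF L]] Ltwo.scale_right[OF L L])
    then show ?thesis using orth[of m n] pos[of n] by auto
  qed
  ultimately show ?thesis by blast
qed

section \<open>The spectral basis\<close>

lemma H1_inner_le:
  assumes v: "v \<in> sobolev_H10"
  shows "H1_inner v v \<le> 5 * dirichlet v v"
  using Poincare[OF v] by (simp add: H1_inner_def)

lemma a_form_le:
  assumes v: "v \<in> sobolev_H10"
  shows "a_form \<mu> v v \<le> (1 + 4 * \<bar>\<mu>\<bar>) * H1_inner v v"
proof -
  have H: "0 \<le> hardy v v" "hardy v v \<le> 4 * dirichlet v v"
    using Hardy.nonneg[OF v] Hardy(2)[OF v] unfolding hardy_def by auto
  have "- (\<mu> * hardy v v) \<le> \<bar>\<mu>\<bar> * hardy v v"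
    using H(1) by (metis abs_ge_minus_self mult_minus_left mult_right_mono)
  also have "\<dots> \<le> \<bar>\<mu>\<bar> * (4 * dirichlet v v)" by (rule mult_left_mono[OF H(2)]) simp
  finally have "a_form \<mu> v v \<le> (1 + 4 * \<bar>\<mu>\<bar>) * dirichlet v v"
    unfolding a_form_eq by (simp add: algebra_simps)
  also have "\<dots> \<le> (1 + 4 * \<bar>\<mu>\<bar>) * H1_inner v v"
    using Ltwo.nonneg[OF H10_Ltwo[OF v]] unfolding H1_inner_def by (intro mult_left_mono) auto
  finally show ?thesis .
qed

text \<open>The energy norm and the H^1 norm are equivalent on H_0^1: coercivity with the Poincare
  inequality in one direction, Hardy's inequality in the other.\<close>

lemma a_form_complete:
  assumes \<mu>: "\<mu> < 1 / 4" and s: "\<And>n. s n \<in> sobolev_H10" and c: "semi_inner.cauchy (a_form \<mu>) s"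
  shows "\<exists>v\<in>sobolev_H10. semi_inner.conv (a_form \<mu>) s v"
proof -
  interpret A: semi_inner sobolev_H10 "a_form \<mu>" by (rule a_form_semi_inner(1)[OF \<mu>])
  obtain m where m: "0 < m" "\<And>v. v \<in> sobolev_H10 \<Longrightarrow> m * dirichlet v v \<le> a_form \<mu> v v"
    using a_form_semi_inner(2)[OF \<mu>] by blast
  have le: "H1_inner v v \<le> 5 / m * a_form \<mu> v v" if v: "v \<in> sobolev_H10" for v
  proof -
    have "dirichlet v v \<le> a_form \<mu> v v / m" using m(2)[OF v] m(1) by (simp add: pos_le_divide_eq mult.commute)
    then show ?thesis using H1_inner_le[OF v] by simp
  qed
  have "H1.cauchy s"
    unfolding H1.cauchy_def
  proof (intro allI impI)
    fix e :: real assume e: "0 < e"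
    have "0 < e * m / 5" using e m(1) by simp
    then obtain N where N: "\<And>i j. i \<ge> N \<Longrightarrow> j \<ge> N \<Longrightarrow> a_form \<mu> (\<lambda>x. s i x - s j x) (\<lambda>x. s i x - s j x) < e * m / 5"
      using c[unfolded A.cauchy_def] by blast
    have "H1_inner (\<lambda>x. s i x - s j x) (\<lambda>x. s i x - s j x) < e" if "i \<ge> N" "j \<ge> N" for i j
    proof -
      have "H1_inner (\<lambda>x. s i x - s j x) (\<lambda>x. s i x - s j x) \<le> 5 / m * a_form \<mu> (\<lambda>x. s i x - s j x) (\<lambda>x. s i x - s j x)"
        by (rule le[OF A.diff_mem[OF s s]])
      also have "\<dots> < 5 / m * (e * m / 5)" using m(1) by (intro mult_strict_left_mono N that) simp
      also have "\<dots> = e" using m(1) by simp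
      finally show ?thesis .
    qed
    then show "\<exists>N. \<forall>i\<ge>N. \<forall>j\<ge>N. H1_inner (\<lambda>x. s i x - s j x) (\<lambda>x. s i x - s j x) < e" by blast
  qed
  then obtain v where v: "v \<in> sobolev_H10" and conv: "H1.conv s v" using H10_complete[of s, OF s] by blast
  have "A.conv s v"
    unfolding A.conv_def
  proof (rule tendsto_sandwich[OF _ _ tendsto_const])
    show "(\<lambda>n. (1 + 4 * \<bar>\<mu>\<bar>) * H1_inner (\<lambda>x. s n x - v x) (\<lambda>x. s n x - v x)) \<longlonglongrightarrow> 0"
      using tendsto_mult_left[OF conv[unfolded H1.conv_def], of "1 + 4 * \<bar>\<mu>\<bar>"] by simp
    show "\<forall>\<^sub>F n in sequentially. 0 \<le> a_form \<mu> (\<lambda>x. s n x - v x) (\<lambda>x. s n x - v x)"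
      by (rule always_eventually, rule allI, rule A.nonneg[OF A.diff_mem[OF s v]])
    show "\<forall>\<^sub>F n in sequentially. a_form \<mu> (\<lambda>x. s n x - v x) (\<lambda>x. s n x - v x) \<le> (1 + 4 * \<bar>\<mu>\<bar>) * H1_inner (\<lambda>x. s n x - v x) (\<lambda>x. s n x - v x)"
      by (rule always_eventually, rule allI, rule a_form_le[OF A.diff_mem[OF s v]])
  qed
  then show ?thesis using v by blast
qed

lemma a_form_coercive:
  assumes "\<mu> < 1 / 4"
  obtains K where "0 < K" "\<And>v. v \<in> sobolev_H10 \<Longrightarrow> Ltwo_inner Omega v v \<le> K * a_form \<mu> v v"
    "\<And>v. v \<in> sobolev_H10 \<Longrightarrow> dirichlet v v \<le> K * a_form \<mu> v v"
proof -
  obtain m where m: "0 < m" "\<And>v. v \<in> sobolev_H10 \<Longrightarrow> m * dirichlet v v \<le> a_form \<mu> v v"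
    using a_form_semi_inner(2)[OF assms] by blast
  have le: "4 * dirichlet v v \<le> 4 / m * a_form \<mu> v v" if v: "v \<in> sobolev_H10" for v
  proof -
    have "dirichlet v v \<le> a_form \<mu> v v / m" using m(2)[OF v] m(1) by (simp add: pos_le_divide_eq mult.commute)
    then show ?thesis by simp
  qed
  show ?thesis
  proof
    show "0 < 4 / m" using m(1) by simp
    show "Ltwo_inner Omega v v \<le> 4 / m * a_form \<mu> v v" if v: "v \<in> sobolev_H10" for v
      by (rule order_trans[OF Poincare[OF v] le[OF v]])
    show "dirichlet v v \<le> 4 / m * a_form \<mu> v v" if v: "v \<in> sobolev_H10" for v
      using le[OF v] Dirichlet.nonneg[OF H10_H1[OF v]] by linarith
  qed
qed

lemma a_form_compact_form:
  assumes \<mu>: "\<mu> < 1 / 4"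
  shows "\<exists>K. compact_form (Ltwo Omega) (Ltwo_inner Omega) sobolev_H10 (a_form \<mu>) K"
proof -
  interpret A: semi_inner sobolev_H10 "a_form \<mu>" by (rule a_form_semi_inner(1)[OF \<mu>])
  obtain K where K: "0 < K" "\<And>v. v \<in> sobolev_H10 \<Longrightarrow> Ltwo_inner Omega v v \<le> K * a_form \<mu> v v"
    "\<And>v. v \<in> sobolev_H10 \<Longrightarrow> dirichlet v v \<le> K * a_form \<mu> v v" using a_form_coercive[OF \<mu>] by blast
  have "compact_form (Ltwo Omega) (Ltwo_inner Omega) sobolev_H10 (a_form \<mu>) K"
  proof
    show "sobolev_H10 \<subseteq> Ltwo Omega" using H10_Ltwo by blast
    show "\<exists>v\<in>sobolev_H10. semi_inner.conv (a_form \<mu>) s v"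
      if "\<And>n. s n \<in> sobolev_H10" "semi_inner.cauchy (a_form \<mu>) s" for s by (rule a_form_complete[OF \<mu> that])
    show "\<exists>r. strict_mono r \<and> Ltwo.cauchy Omega (\<lambda>n. s (r n))"
      if s: "\<And>n::nat. s n \<in> sobolev_H10" and C: "\<And>n. a_form \<mu> (s n) (s n) \<le> C" for s C
    proof (rule Rellich[of s "K * C", OF s])
      show "dirichlet (s n) (s n) \<le> K * C" for n
        by (rule order_trans[OF K(3)[OF s] mult_left_mono[OF C]]) (use K(1) in simp)
    qed
  qed (use K orthonormal_test_functions in auto)
  then show ?thesis by blast
qed

text \<open>Completeness provides only some limit \<open>f\<close> of the projections; the triangle
  inequality passes convergence on to any \<open>v\<close> that differs from it by a null
  function.\<close>

lemma (in orthonormal_seq) conv_proj_of_limit: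
  assumes v: "v \<in> S" and f: "f \<in> S" and c: "conv (\<lambda>N. proj N v) f" and z: "B (\<lambda>x. f x - v x) (\<lambda>x. f x - v x) = 0"
  shows "conv (\<lambda>N. proj N v) v"
  unfolding conv_def
proof (rule tendsto_sandwich[OF _ _ tendsto_const])
  show "(\<lambda>N. 2 * B (\<lambda>x. proj N v x - f x) (\<lambda>x. proj N v x - f x)) \<longlonglongrightarrow> 0"
    using tendsto_mult_left[OF c[unfolded conv_def], of 2] by simp
  show "\<forall>\<^sub>F N in sequentially. 0 \<le> B (\<lambda>x. proj N v x - v x) (\<lambda>x. proj N v x - v x)"
    by (rule always_eventually, rule allI, rule nonneg[OF diff_mem[OF proj_mem v]])
  have "B (\<lambda>x. proj N v x - v x) (\<lambda>x. proj N v x - v x) \<le> 2 * B (\<lambda>x. proj N v x - f x) (\<lambda>x. proj N v x - f x)" for N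
  proof -
    have vf: "B (\<lambda>x. v x - f x) (\<lambda>x. v x - f x) = 0" using z diff_square_commute[OF v f] by simp
    have "B (\<lambda>x. (proj N v x - f x) - (v x - f x)) (\<lambda>x. (proj N v x - f x) - (v x - f x)) \<le>
      2 * B (\<lambda>x. proj N v x - f x) (\<lambda>x. proj N v x - f x) + 2 * B (\<lambda>x. v x - f x) (\<lambda>x. v x - f x)"
      by (rule square_diff_le[OF diff_mem[OF proj_mem f] diff_mem[OF v f]])
    then show ?thesis unfolding vf by simp
  qed
  then show "\<forall>\<^sub>F N in sequentially. B (\<lambda>x. proj N v x - v x) (\<lambda>x. proj N v x - v x) \<le> 2 * B (\<lambda>x. proj N v x - f x) (\<lambda>x. proj N v x - f x)"
    by simp
qed

text \<open>What remains is completeness in L^2. On H_0^1 it follows from the minimum property and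
  the growth of the eigenvalues; in general, the difference between v and the limit of its
  projections is orthogonal to all eigenfunctions, hence to all test functions.\<close>

lemma eigenbasis_ex:
  assumes \<mu>: "\<mu> < 1 / 4"
  shows "\<exists>\<phi> \<Lambda>. eigenbasis \<mu> \<phi> \<Lambda>"
proof -
  interpret A: semi_inner sobolev_H10 "a_form \<mu>" by (rule a_form_semi_inner(1)[OF \<mu>])
  obtain K where "compact_form (Ltwo Omega) (Ltwo_inner Omega) sobolev_H10 (a_form \<mu>) K"
    using a_form_compact_form[OF \<mu>] by blast
  from compact_form.eigenbasis_exists[OF this] obtain \<phi> \<Lambda> where
    b: "(\<forall>n. \<phi> n \<in> sobolev_H10) \<and> (\<forall>m n. Ltwo_inner Omega (\<phi> m) (\<phi> n) = (if m = n then 1 else 0)) \<and>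
     (\<forall>n. \<forall>w\<in>sobolev_H10. a_form \<mu> (\<phi> n) w = \<Lambda> n * Ltwo_inner Omega (\<phi> n) w) \<and>
     (\<forall>n. \<forall>v\<in>sobolev_H10. (\<forall>i<n. Ltwo_inner Omega v (\<phi> i) = 0) \<longrightarrow> \<Lambda> n * Ltwo_inner Omega v v \<le> a_form \<mu> v v) \<and>
     0 < \<Lambda> 0 \<and> mono \<Lambda> \<and> filterlim \<Lambda> at_top sequentially" by (elim exE)
  have pV: "\<phi> n \<in> sobolev_H10" and on: "Ltwo_inner Omega (\<phi> m) (\<phi> n) = (if m = n then 1 else 0)"
    and eig: "w \<in> sobolev_H10 \<Longrightarrow> a_form \<mu> (\<phi> n) w = \<Lambda> n * Ltwo_inner Omega (\<phi> n) w"
    and min: "w \<in> sobolev_H10 \<Longrightarrow> (\<And>i. i < n \<Longrightarrow> Ltwo_inner Omega w (\<phi> i) = 0) \<Longrightarrow> \<Lambda> n * Ltwo_inner Omega w w \<le> a_form \<mu> w w"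
    for m n w using b by blast+
  have Lm: "0 < \<Lambda> 0" "mono \<Lambda>" "filterlim \<Lambda> at_top sequentially" using b by blast+
  have pL: "\<phi> n \<in> Ltwo Omega" for n by (rule H10_Ltwo[OF pV])
  interpret O: orthonormal_seq "Ltwo Omega" "Ltwo_inner Omega" \<phi>
    by unfold_locales (rule pL, rule on)
  have Lpos: "0 < \<Lambda> n" for n using Lm(1) monoD[OF Lm(2), of 0 n] by simp
  have projV: "O.proj N w \<in> sobolev_H10" for N w unfolding O.proj_def by (rule A.lincomb_mem) (rule pV)
  have convV: "Ltwo.conv Omega (\<lambda>N. O.proj N w) w" if w: "w \<in> sobolev_H10" for w
    unfolding Ltwo.conv_def
  proof (rule tendsto_sandwich[OF _ _ tendsto_const])
    note wL = H10_Ltwo[OF w]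
    \<comment> \<open>The residual is orthogonal to the first N eigenfunctions, so \<Lambda> N times
      its square is at most its energy, which is at most the energy of w.\<close>
    have le: "Ltwo_inner Omega (\<lambda>x. O.proj N w x - w x) (\<lambda>x. O.proj N w x - w x) \<le> a_form \<mu> w w / \<Lambda> N" for N
    proof -
      let ?r = "\<lambda>x. w x - O.proj N w x"
      have r: "?r \<in> sobolev_H10" by (rule A.diff_mem[OF w projV])
      have ro: "Ltwo_inner Omega ?r (\<phi> i) = 0" if "i < N" for i
        using that by (simp add: Ltwo.diff_left[OF wL H10_Ltwo[OF projV] pL] O.proj_coeff)
      have pa: "a_form \<mu> (O.proj N w) v = (\<Sum>n<N. Ltwo_inner Omega w (\<phi> n) * (\<Lambda> n * Ltwo_inner Omega (\<phi> n) v))" if "v \<in> sobolev_H10" for v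
        unfolding O.proj_def by (subst A.lincomb_left) (auto simp: pV eig that)
      have a0: "a_form \<mu> (O.proj N w) ?r = 0"
        unfolding pa[OF r] using ro Ltwo.sym[OF pL H10_Ltwo[OF r]] by (intro sum.neutral) auto
      have a1: "0 \<le> a_form \<mu> (O.proj N w) w"
        unfolding pa[OF w] using Ltwo.sym[OF pL wL] Lpos
        by (intro sum_nonneg) (auto simp: less_imp_le mult.left_commute intro!: mult_nonneg_nonneg)
      have "\<Lambda> N * Ltwo_inner Omega ?r ?r \<le> a_form \<mu> ?r ?r" by (rule min[OF r ro])
      also have "\<dots> = a_form \<mu> w ?r - a_form \<mu> (O.proj N w) ?r" by (rule A.diff_left[OF w projV r])
      also have "\<dots> = a_form \<mu> w w - a_form \<mu> (O.proj N w) w"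
        unfolding a0 A.diff_right[OF w projV w] A.sym[OF w projV] by simp
      also have "\<dots> \<le> a_form \<mu> w w" using a1 by simp
      finally have "Ltwo_inner Omega ?r ?r \<le> a_form \<mu> w w / \<Lambda> N"
        using Lpos[of N] by (simp add: pos_le_divide_eq mult.commute)
      then show ?thesis by (subst Ltwo.diff_square_commute[OF H10_Ltwo[OF projV] wL])
    qed
    show "\<forall>\<^sub>F N in sequentially. Ltwo_inner Omega (\<lambda>x. O.proj N w x - w x) (\<lambda>x. O.proj N w x - w x) \<le> a_form \<mu> w w / \<Lambda> N"
      by (rule always_eventually, rule allI, rule le)
    show "\<forall>\<^sub>F N in sequentially. 0 \<le> Ltwo_inner Omega (\<lambda>x. O.proj N w x - w x) (\<lambda>x. O.proj N w x - w x)"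
      by (rule always_eventually, rule allI, rule Ltwo.nonneg[OF Ltwo.diff_mem[OF O.proj_mem wL]])
    show "(\<lambda>N. a_form \<mu> w w / \<Lambda> N) \<longlonglongrightarrow> 0"
      by (rule tendsto_divide_0[OF tendsto_const]) (rule filterlim_at_top_imp_at_infinity[OF Lm(3)])
  qed
  have conv: "Ltwo.conv Omega (\<lambda>N. O.proj N v) v" if v: "v \<in> Ltwo Omega" for v
  proof -
    have "Ltwo.cauchy Omega (\<lambda>N. O.proj N v)"
      using O.lincomb_cauchy[OF O.Bessel_summable[OF v]] unfolding O.proj_def .
    then obtain f where f: "f \<in> Ltwo Omega" and c: "Ltwo.conv Omega (\<lambda>N. O.proj N v) f"
      using Omega.Ltwo_complete[of "\<lambda>N. O.proj N v", OF O.proj_mem] by blast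
    let ?r = "\<lambda>x. f x - v x"
    have r: "?r \<in> Ltwo Omega" by (rule Ltwo.diff_mem[OF f v])
    have rphi: "Ltwo_inner Omega ?r (\<phi> n) = 0" for n
    proof -
      have "(\<lambda>N. Ltwo_inner Omega (O.proj N v) (\<phi> n)) \<longlonglongrightarrow> Ltwo_inner Omega f (\<phi> n)"
        by (rule Ltwo.conv_inner[OF O.proj_mem f pL c])
      moreover have "(\<lambda>N. Ltwo_inner Omega (O.proj N v) (\<phi> n)) \<longlonglongrightarrow> Ltwo_inner Omega v (\<phi> n)"
        by (rule tendsto_eventually, rule eventually_sequentiallyI[of "Suc n"]) (simp add: O.proj_coeff)
      ultimately have "Ltwo_inner Omega f (\<phi> n) = Ltwo_inner Omega v (\<phi> n)" by (rule LIMSEQ_unique)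
      then show ?thesis by (simp add: Ltwo.diff_left[OF f v pL])
    qed
    \<comment> \<open>A test function is the limit of its projections by the case already treated,
      and these are orthogonal to the residual.\<close>
    have "AE x in Omega. ?r x = 0"
    proof (rule fundamental_lemma[OF Omega.Ltwo_integrable[OF r]])
      fix \<psi> assume \<psi>: "\<psi> \<in> test_functions 0 1"
      have p0: "Ltwo_inner Omega (O.proj N \<psi>) ?r = 0" for N
        unfolding O.proj_def by (subst Ltwo.lincomb_left) (auto simp: pL r Ltwo.sym[OF pL r] rphi)
      have "(\<lambda>N. Ltwo_inner Omega (O.proj N \<psi>) ?r) \<longlonglongrightarrow> Ltwo_inner Omega \<psi> ?r"
        by (rule Ltwo.conv_inner[OF O.proj_mem test_Ltwo(1)[OF \<psi>] r convV[OF test_H10[OF \<psi>]]])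
      then have "Ltwo_inner Omega \<psi> ?r = 0" by (simp only: p0 LIMSEQ_const_iff)
      then show "(\<integral>x. ?r x * \<psi> x \<partial>Omega) = 0"
        using Ltwo.sym[OF test_Ltwo(1)[OF \<psi>] r] by (simp add: Ltwo_inner_def)
    qed
    then have "Ltwo_inner Omega ?r ?r = 0" using Ltwo_null[OF r] by blast
    then show ?thesis by (rule O.conv_proj_of_limit[OF v f c])
  qed
  have "eigenbasis \<mu> \<phi> \<Lambda>"
    unfolding eigenbasis_def L_op_def
  proof (intro conjI allI ballI)
    show "a_form \<mu> (\<phi> n) w = Ltwo_inner Omega (\<lambda>x. \<Lambda> n * \<phi> n x) w" if "w \<in> sobolev_H10" for n w
      by (simp only: eig[OF that] Ltwo.scale_left[OF pL H10_Ltwo[OF that]])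
    show "(\<lambda>N. Ltwo_norm Omega (\<lambda>x. v x - (\<Sum>n<N. Ltwo_inner Omega v (\<phi> n) * \<phi> n x))) \<longlonglongrightarrow> 0" if v: "v \<in> Ltwo Omega" for v
    proof -
      have "Ltwo_norm Omega (\<lambda>x. v x - (\<Sum>n<N. Ltwo_inner Omega v (\<phi> n) * \<phi> n x)) =
          sqrt (Ltwo_inner Omega (\<lambda>x. O.proj N v x - v x) (\<lambda>x. O.proj N v x - v x))" for N
        unfolding Ltwo_norm_def by (subst Ltwo.diff_square_commute[OF O.proj_mem v]) (simp only: O.proj_def)
      then show ?thesis using tendsto_real_sqrt[OF conv[OF v, unfolded Ltwo.conv_def]] by simp
    qed
  qed (use pV on Lm Ltwo.scale_mem[OF pL] in auto)
  then show ?thesis by blast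
qed

lemma eigenbasis_the_basis: "\<mu> < 1 / 4 \<Longrightarrow> eigenbasis \<mu> (eigfun \<mu>) (eigval \<mu>)"
proof -
  assume "\<mu> < 1 / 4"
  then obtain \<phi> \<Lambda> where "eigenbasis \<mu> \<phi> \<Lambda>" using eigenbasis_ex by blast
  then have "eigenbasis \<mu> (fst (\<phi>, \<Lambda>)) (snd (\<phi>, \<Lambda>))" by simp
  then show ?thesis unfolding eigfun_def eigval_def the_basis_def by (rule someI)
qed

text \<open>Neither weak derivatives nor H^1 limits see null sets. This lets H_0^1 and the form be
  treated as if they consisted of classes of functions.\<close>

lemma H10_null:
  assumes n: "n \<in> Ltwo Omega" and z: "AE x in Omega. n x = 0"
  shows "has_weak_deriv n (\<lambda>x. 0)" "n \<in> sobolev_H10"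
proof -
  have "has_weak_deriv (\<lambda>x. 0) (\<lambda>x. 0)" unfolding has_weak_deriv_iff by (auto simp: Ltwo.zero_mem Ltwo_inner_def)
  then show w: "has_weak_deriv n (\<lambda>x. 0)" by (rule has_weak_deriv_cong_AE[OF _ Ltwo.zero_mem n z])
  have h: "n \<in> sobolev_H1" by (rule H1_I[OF n w])
  have "dirichlet n n = 0" unfolding dirichlet_eq[OF w w] by (simp add: Ltwo_inner_def)
  moreover have "Ltwo_inner Omega n n = 0" using Ltwo_null[OF n] z by blast
  ultimately have 0: "H1_inner n n = 0" by (simp add: H1_inner_def)
  obtain \<psi> where \<psi>: "\<And>k. \<psi> k \<in> test_functions 0 1" "H1.conv \<psi> (\<lambda>x. 0)" using H10_approx[OF Hardy.zero_mem] by blast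
  show "n \<in> sobolev_H10"
  proof (rule H10_I[OF h \<psi>(1)])
    have eq: "(\<lambda>x. \<psi> k x - n x) = (\<lambda>x. (\<psi> k x - 0) + (-1) * n x)" for k by auto
    have n1: "(\<lambda>x. (-1) * n x) \<in> sobolev_H1" by (rule H1_scale[OF h])
    have n0: "H1_inner (\<lambda>x. (-1) * n x) (\<lambda>x. (-1) * n x) = 0" by (simp only: H1.scale_left[OF h n1] H1.scale_right[OF h h] 0 mult_zero_right)
    note d = H1.diff_mem[OF test_H1[OF \<psi>(1)] H1.zero_mem]
    show "H1.conv \<psi> n" unfolding H1.conv_def eq
      by (rule H1_conv_sum_bound[OF H1.nonneg[OF H1_add[OF d n1]] H1_square_add_le[OF d n1] \<psi>(2)[unfolded H1.conv_def]])
         (simp only: n0 tendsto_const)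
  qed
qed

lemma form_eigenbasis_the_basis:
  assumes \<mu>: "\<mu> < 1 / 4"
  shows "\<exists>K. form_eigenbasis (Ltwo Omega) (Ltwo_inner Omega) sobolev_H10 (a_form \<mu>) (eigfun \<mu>) (eigval \<mu>) K"
proof -
  interpret A: semi_inner sobolev_H10 "a_form \<mu>" by (rule a_form_semi_inner(1)[OF \<mu>])
  obtain K where K: "0 < K" "\<And>v. v \<in> sobolev_H10 \<Longrightarrow> Ltwo_inner Omega v v \<le> K * a_form \<mu> v v"
    "\<And>v. v \<in> sobolev_H10 \<Longrightarrow> dirichlet v v \<le> K * a_form \<mu> v v" using a_form_coercive[OF \<mu>] by blast
  note b = eigenbasis_the_basis[OF \<mu>, unfolded eigenbasis_def L_op_def]
  have pV: "eigfun \<mu> n \<in> sobolev_H10" for n using b by blast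
  have pL: "eigfun \<mu> n \<in> Ltwo Omega" for n by (rule H10_Ltwo[OF pV])
  have eig: "a_form \<mu> (eigfun \<mu> n) w = eigval \<mu> n * Ltwo_inner Omega (eigfun \<mu> n) w" if "w \<in> sobolev_H10" for n w
    using b that Ltwo.scale_left[OF pL[of n] H10_Ltwo[OF that]] by simp
  have on: "Ltwo_inner Omega (eigfun \<mu> m) (eigfun \<mu> n) = (if m = n then 1 else 0)" for m n using b by blast
  have lim: "(\<lambda>N. Ltwo_norm Omega (\<lambda>x. v x - (\<Sum>n<N. Ltwo_inner Omega v (eigfun \<mu> n) * eigfun \<mu> n x))) \<longlonglongrightarrow> 0"
    if "v \<in> Ltwo Omega" for v using b that by blast
  have L: "0 < eigval \<mu> 0" "mono (eigval \<mu>)" using b by blast+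
  interpret O: orthonormal_seq "Ltwo Omega" "Ltwo_inner Omega" "eigfun \<mu>"
    by unfold_locales (rule pL, rule on)
  have "form_eigenbasis (Ltwo Omega) (Ltwo_inner Omega) sobolev_H10 (a_form \<mu>) (eigfun \<mu>) (eigval \<mu>) K"
  proof
    show "sobolev_H10 \<subseteq> Ltwo Omega" using H10_Ltwo by blast
    show "Ltwo_inner Omega v v \<le> K * a_form \<mu> v v" if "v \<in> sobolev_H10" for v by (rule K(2)[OF that])
    show "\<exists>v\<in>sobolev_H10. semi_inner.conv (a_form \<mu>) s v"
      if "\<And>n. s n \<in> sobolev_H10" "semi_inner.cauchy (a_form \<mu>) s" for s by (rule a_form_complete[OF \<mu> that])
    show "\<exists>v\<in>Ltwo Omega. Ltwo.conv Omega s v" if "\<And>n. s n \<in> Ltwo Omega" "Ltwo.cauchy Omega s" for s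
      by (rule Omega.Ltwo_complete[OF that])
    show "w \<in> sobolev_H10" if v: "v \<in> sobolev_H10" and w: "w \<in> Ltwo Omega" and z: "Ltwo_inner Omega (\<lambda>x. w x - v x) (\<lambda>x. w x - v x) = 0" for v w
    proof -
      have d: "(\<lambda>x. w x - v x) \<in> Ltwo Omega" by (rule Ltwo.diff_mem[OF w H10_Ltwo[OF v]])
      have "AE x in Omega. w x - v x = 0" using Ltwo_null[OF d] z by blast
      from H10_add[OF v H10_null(2)[OF d this]] show ?thesis by simp
    qed
    show "a_form \<mu> v w = 0" if v: "v \<in> sobolev_H10" and z: "Ltwo_inner Omega v v = 0" and w: "w \<in> sobolev_H10" for v w
    proof -
      have "AE x in Omega. v x = 0" using Ltwo_null[OF H10_Ltwo[OF v]] z by blast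
      note wd = H10_null(1)[OF H10_Ltwo[OF v] this]
      have D: "dirichlet v v = 0" unfolding dirichlet_eq[OF wd wd] by (simp add: Ltwo_inner_def)
      then have "hardy v v = 0" using Hardy(2)[OF v] Hardy.nonneg[OF v] unfolding hardy_def by simp
      then have "a_form \<mu> v v = 0" by (simp add: a_form_eq D)
      then have "(a_form \<mu> v w)\<^sup>2 \<le> 0" using A.Cauchy_Schwarz[OF v w] by simp
      then show ?thesis by simp
    qed
    show "eigfun \<mu> n \<in> sobolev_H10" for n by (rule pV)
    show "a_form \<mu> (eigfun \<mu> n) w = eigval \<mu> n * Ltwo_inner Omega (eigfun \<mu> n) w" if "w \<in> sobolev_H10" for n w by (rule eig[OF that])
    show "0 < eigval \<mu> n" for n using L(1) monoD[OF L(2), of 0 n] by simp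
    show "Ltwo.conv Omega (\<lambda>N. O.proj N v) v" if v: "v \<in> Ltwo Omega" for v
    proof -
      have "(Ltwo_norm Omega (\<lambda>x. v x - (\<Sum>n<N. Ltwo_inner Omega v (eigfun \<mu> n) * eigfun \<mu> n x)))\<^sup>2 =
          Ltwo_inner Omega (\<lambda>x. O.proj N v x - v x) (\<lambda>x. O.proj N v x - v x)" for N
        unfolding Ltwo_norm_power2 by (subst Ltwo.diff_square_commute[OF O.proj_mem v]) (simp only: O.proj_def)
      then show ?thesis unfolding Ltwo.conv_def using tendsto_power[OF lim[OF v], of 2] by simp
    qed
  qed
  then show ?thesis by blast
qed

section \<open>Fractional integration\<close>

text \<open>The Riemann-Liouville kernel, extended by zero so that convolution over the whole line
  is one-sided; order 1 is the Heaviside function.\<close>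

definition gk :: "real \<Rightarrow> real \<Rightarrow> real" where
  "gk a x = (if 0 < x then x powr (a - 1) / Gamma a else 0)"

text \<open>For h vanishing on the negative half-line this is the Riemann-Liouville integral of
  order a from 0 to t. The domain of integration does not depend on t, which suits Fubini and
  translations.\<close>

definition cv :: "real \<Rightarrow> (real \<Rightarrow> real) \<Rightarrow> real \<Rightarrow> real" where
  "cv a h t = (\<integral>s. gk a (t - s) * h s \<partial>lborel)"

lemma gk_measurable [measurable]: "gk a \<in> borel_measurable borel"
  unfolding gk_def[abs_def] by measurable

lemma gk_nonneg: "0 < a \<Longrightarrow> 0 \<le> gk a x"
  by (auto simp: gk_def intro!: divide_nonneg_pos Gamma_real_pos)

lemma gk_1: "gk 1 x = (if 0 < x then 1 else 0)"
  by (simp add: gk_def)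

lemma gk_mono: "1 \<le> a \<Longrightarrow> x \<le> y \<Longrightarrow> gk a x \<le> gk a y"
  by (auto simp: gk_def intro!: divide_right_mono powr_mono2 less_imp_le[OF Gamma_real_pos])

lemma gk_antimono: "0 < a \<Longrightarrow> a \<le> 1 \<Longrightarrow> 0 < x \<Longrightarrow> x \<le> y \<Longrightarrow> gk a y \<le> gk a x"
  by (auto simp: gk_def intro!: divide_right_mono powr_mono2' less_imp_le[OF Gamma_real_pos])

text \<open>The substitution s = t x turns the convolution into Euler's Beta integral; the Gamma
  factors in \<open>gk\<close> are those that make this a semigroup law.\<close>

lemma gk_beta:
  assumes a: "0 < a" and b: "0 < b"
  shows "has_bochner_integral lborel (\<lambda>s. gk a (t - s) * gk b s) (gk (a + b) t)"
proof (cases "0 < t")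
  case False
  then have "(\<lambda>s. gk a (t - s) * gk b s) = (\<lambda>s. 0)" by (auto simp: gk_def)
  then show ?thesis using False by (simp add: gk_def has_bochner_integral_zero)
next
  case t: True
  let ?f = "\<lambda>x. indicator {0..1} x *\<^sub>R (x powr (b - 1) * (1 - x) powr (a - 1)) :: real"
  have si: "set_integrable lborel {0..1} (\<lambda>x. x powr (b - 1) * (1 - x) powr (a - 1))"
    by (rule integrable_Beta[OF b a])
  have "(LINT x:{0..1}|lborel. x powr (b - 1) * (1 - x) powr (a - 1)) = Beta b a"
    using set_borel_integral_eq_integral(2)[OF si] has_integral_Beta_real[OF b a] by (simp add: integral_unique)
  then have "has_bochner_integral lborel ?f (Beta b a)"
    using si by (simp add: has_bochner_integral_iff set_integrable_def set_lebesgue_integral_def)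
  then have *: "has_bochner_integral lborel (\<lambda>x. (t powr (a + b - 2) / (Gamma a * Gamma b)) * ?f x)
      ((t powr (a + b - 2) / (Gamma a * Gamma b)) * Beta b a)"
    by (intro has_bochner_integral_mult_right)
  have eq: "(t powr (a + b - 2) / (Gamma a * Gamma b)) * ?f x = gk a (t - (0 + t * x)) * gk b (0 + t * x)" for x
  proof (cases "0 < x \<and> x < 1")
    case True
    have 1: "t - (0 + t * x) = t * (1 - x)" "0 + t * x = t * x" "t - t * x = t * (1 - x)" by (auto simp: algebra_simps)
    have 2: "0 < t * (1 - x)" "0 < t * x" using True t by auto
    have 3: "t powr (a + b - 2) = t powr (a - 1) * t powr (b - 1)"
      using t by (simp add: powr_add[symmetric] algebra_simps)
    have 4: "(t * (1 - x)) powr (a - 1) = t powr (a - 1) * (1 - x) powr (a - 1)"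
      "(t * x) powr (b - 1) = t powr (b - 1) * x powr (b - 1)"
      using True t by (auto intro!: powr_mult)
    have 5: "?f x = x powr (b - 1) * (1 - x) powr (a - 1)" using True by simp
    have 6: "gk a (t * (1 - x)) = t powr (a - 1) * (1 - x) powr (a - 1) / Gamma a"
      "gk b (t * x) = t powr (b - 1) * x powr (b - 1) / Gamma b"
      unfolding gk_def 4[symmetric] using 2 by (simp_all only: if_True)
    show ?thesis unfolding 1 3 5 6 by (simp only: divide_inverse inverse_mult_distrib mult_ac)
  next
    case False
    then have "?f x = 0" by (auto simp: indicator_def)
    moreover have "gk a (t - (0 + t * x)) * gk b (0 + t * x) = 0"
      using False t by (auto simp: gk_def not_less mult_le_0_iff zero_less_mult_iff)
    ultimately show ?thesis by (simp only: mult_zero_right)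
  qed
  have "t powr (a + b - 1) = t * t powr (a + b - 2)"
    using t powr_add[of t 1 "a + b - 2"] by simp
  then have val: "(t powr (a + b - 2) / (Gamma a * Gamma b)) * Beta b a = gk (a + b) t /\<^sub>R \<bar>t\<bar>"
    using t Gamma_real_pos[OF a, THEN less_imp_neq, symmetric] Gamma_real_pos[OF b, THEN less_imp_neq, symmetric]
    by (simp add: gk_def Beta_def add.commute field_simps)
  show ?thesis
    using * t unfolding eq val by (subst lborel_has_bochner_integral_real_affine_iff[of t _ _ 0]) auto
qed

lemma gk_beta_shift:
  assumes a: "0 < a" and b: "0 < b"
  shows "has_bochner_integral lborel (\<lambda>s. gk a (t - s) * gk b (s - r)) (gk (a + b) (t - r))"
  using gk_beta[OF a b, of "t - r"]
  by (subst (asm) lborel_has_bochner_integral_real_affine_iff[of 1 _ _ "- r"]) (simp_all add: algebra_simps)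

text \<open>Comparison with the constant M on the positive half-line, whose fractional integral is M
  times \<open>gk (a + 1)\<close>.\<close>

lemma cv_integrable:
  assumes a: "0 < a" and [measurable]: "h \<in> borel_measurable borel" and h0: "\<And>s. s \<le> 0 \<Longrightarrow> h s = 0"
    and hM: "\<And>s. s < t \<Longrightarrow> \<bar>h s\<bar> \<le> M"
  shows "integrable lborel (\<lambda>s. gk a (t - s) * h s)" "\<bar>cv a h t\<bar> \<le> M * gk (a + 1) t"
proof -
  have B: "has_bochner_integral lborel (\<lambda>s. M * (gk a (t - s) * gk 1 s)) (M * gk (a + 1) t)"
    using gk_beta[OF a, of 1 t] by (intro has_bochner_integral_mult_right) auto
  have le: "\<bar>gk a (t - s) * h s\<bar> \<le> M * (gk a (t - s) * gk 1 s)" for s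
  proof (cases "0 < s \<and> s < t")
    case True
    then show ?thesis
      using mult_left_mono[OF hM[of s] gk_nonneg[OF a, of "t - s"]] gk_nonneg[OF a, of "t - s"] by (simp add: abs_mult gk_1 mult_ac)
  next
    case False
    then have "gk a (t - s) * h s = 0" "gk a (t - s) * gk 1 s = 0" by (auto simp: gk_def h0 not_less)
    then show ?thesis by (simp only: abs_zero mult_zero_right order_refl)
  qed
  show int: "integrable lborel (\<lambda>s. gk a (t - s) * h s)"
    by (rule Bochner_Integration.integrable_bound[where f="\<lambda>s. M * (gk a (t - s) * gk 1 s)"])
       (use B le order_trans[OF le abs_ge_self] in \<open>auto simp: has_bochner_integral_iff intro!: AE_I2\<close>)
  have "\<bar>cv a h t\<bar> \<le> (\<integral>s. M * (gk a (t - s) * gk 1 s) \<partial>lborel)"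
    unfolding cv_def real_norm_def[symmetric]
    by (rule Bochner_Integration.integral_norm_bound_integral[OF int]) (use B le in \<open>auto simp: has_bochner_integral_iff\<close>)
  then show "\<bar>cv a h t\<bar> \<le> M * gk (a + 1) t" using B by (simp only: has_bochner_integral_iff)
qed

lemma cv_zero: "(\<And>s. s \<le> 0 \<Longrightarrow> h s = 0) \<Longrightarrow> t \<le> 0 \<Longrightarrow> cv a h t = 0"
proof -
  assume h: "\<And>s. s \<le> 0 \<Longrightarrow> h s = 0" and t: "t \<le> 0"
  have "gk a (t - s) * h s = 0" for s using h[of s] t by (cases "s \<le> 0") (auto simp: gk_def)
  then show ?thesis by (simp only: cv_def Bochner_Integration.integral_zero)
qed

lemma cv_cong: "(\<And>s. s < t \<Longrightarrow> h s = k s) \<Longrightarrow> cv a h t = cv a k t"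
proof -
  assume h: "\<And>s. s < t \<Longrightarrow> h s = k s"
  have "gk a (t - s) * h s = gk a (t - s) * k s" for s using h[of s] by (cases "s < t") (auto simp: gk_def)
  then show ?thesis by (simp only: cv_def)
qed

lemma cv_measurable [measurable]:
  assumes [measurable]: "h \<in> borel_measurable borel"
  shows "cv a h \<in> borel_measurable borel"
  unfolding cv_def[abs_def] by measurable

text \<open>Tonelli's criterion: iterated integrability of the absolute value in one order permits
  the exchange.\<close>

lemma integral_swap:
  fixes f :: "real \<Rightarrow> real \<Rightarrow> real"
  assumes m: "case_prod f \<in> borel_measurable (lborel \<Otimes>\<^sub>M lborel)"
    and i: "AE x in lborel. integrable lborel (f x)" and i2: "integrable lborel (\<lambda>x. \<integral>y. \<bar>f x y\<bar> \<partial>lborel)"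
  shows "(\<integral>x. \<integral>y. f x y \<partial>lborel \<partial>lborel) = (\<integral>y. \<integral>x. f x y \<partial>lborel \<partial>lborel)"
    "integrable lborel (\<lambda>y. \<integral>x. f x y \<partial>lborel)"
proof -
  have "integrable (lborel \<Otimes>\<^sub>M lborel) (case_prod f)"
    by (rule lborel_pair.Fubini_integrable) (use m i i2 in auto)
  then show "(\<integral>x. \<integral>y. f x y \<partial>lborel \<partial>lborel) = (\<integral>y. \<integral>x. f x y \<partial>lborel \<partial>lborel)"
    "integrable lborel (\<lambda>y. \<integral>x. f x y \<partial>lborel)"
    by (auto intro: lborel_pair.Fubini_integral[symmetric] lborel_pair.integrable_snd)
qed

text \<open>Fubini and the semigroup law of the kernels.\<close>

lemma cv_cv:
  assumes a: "0 < a" and b: "0 < b" and [measurable]: "h \<in> borel_measurable borel"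
    and h0: "\<And>s. s \<le> 0 \<Longrightarrow> h s = 0" and hM: "\<And>s. s < t \<Longrightarrow> \<bar>h s\<bar> \<le> M"
  shows "cv a (cv b h) t = cv (a + b) h t"
proof -
  let ?f = "\<lambda>r s. (gk a (t - s) * gk b (s - r)) * h r"
  have inner: "integrable lborel (?f r)" "(\<integral>s. ?f r s \<partial>lborel) = gk (a + b) (t - r) * h r"
    "(\<integral>s. \<bar>?f r s\<bar> \<partial>lborel) = gk (a + b) (t - r) * \<bar>h r\<bar>" for r
    using gk_beta_shift[OF a b, of t r] gk_nonneg[OF a] gk_nonneg[OF b]
    by (auto simp: has_bochner_integral_iff abs_mult)
  have "integrable lborel (\<lambda>r. gk (a + b) (t - r) * \<bar>h r\<bar>)"
    using cv_integrable(1)[of "a + b" "\<lambda>r. \<bar>h r\<bar>" t M] a b h0 hM by simp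
  then have "(\<integral>r. \<integral>s. ?f r s \<partial>lborel \<partial>lborel) = (\<integral>s. \<integral>r. ?f r s \<partial>lborel \<partial>lborel)"
  proof (intro integral_swap(1))
    show "(\<lambda>(r, s). gk a (t - s) * gk b (s - r) * h r) \<in> borel_measurable (lborel \<Otimes>\<^sub>M lborel)" by measurable
    show "AE r in lborel. integrable lborel (?f r)" by (intro AE_I2 inner(1))
  qed (simp only: inner)
  also have "\<dots> = (\<integral>s. gk a (t - s) * cv b h s \<partial>lborel)"
    by (simp add: cv_def mult.assoc)
  finally show ?thesis unfolding inner by (simp only: cv_def)
qed

lemma cv_diff:
  assumes "integrable lborel (\<lambda>s. gk a (t - s) * h s)" "integrable lborel (\<lambda>s. gk a (t - s) * k s)"
  shows "cv a (\<lambda>s. h s - k s) t = cv a h t - cv a k t"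
  using assms by (simp add: cv_def right_diff_distrib)

lemma cv_scale: "cv a (\<lambda>s. c * h s) t = c * cv a h t"
  by (simp add: cv_def mult.left_commute[of _ c])

lemma cv_1: "cv 1 h t = (\<integral>s. indicator {..<t} s * h s \<partial>lborel)"
  unfolding cv_def by (intro Bochner_Integration.integral_cong) (auto simp: gk_1)

text \<open>For a <= 1 the kernel at a fixed s decreases as the end point moves from t to t', so its
  absolute change over (0, t) has an explicit integral; the rest comes from (t, t').\<close>

lemma cv_Hoelder:
  assumes a: "0 < a" "a \<le> 1" and [measurable]: "h \<in> borel_measurable borel"
    and h0: "\<And>s. s \<le> 0 \<Longrightarrow> h s = 0" and hM: "\<And>s. s < t' \<Longrightarrow> \<bar>h s\<bar> \<le> M" and t: "0 \<le> t" "t \<le> t'"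
  shows "\<bar>cv a h t' - cv a h t\<bar> \<le> 2 * M * gk (a + 1) (t' - t)"
proof (cases "t = t'")
  case False
  then have tt: "t < t'" using t by simp
  have M: "0 \<le> M" using hM[of t] tt by linarith
  \<comment> \<open>A majorant with known integral. For s < t the last term vanishes and the first
    is the decrease of the kernel; for t < s < t' the first is minus the new piece, which the factor
    2 turns positive. At s = t the bound can fail, hence the exception of one point.\<close>
  let ?w = "\<lambda>s. (gk a (t - s) * gk 1 s - gk a (t' - s) * gk 1 s) + 2 * (gk a (t' - s) * gk 1 (s - t))"
  have W: "has_bochner_integral lborel ?w ((gk (a + 1) t - gk (a + 1) t') + 2 * gk (a + 1) (t' - t))"
    using gk_beta[OF a(1), of 1 t] gk_beta[OF a(1), of 1 t'] gk_beta_shift[OF a(1), of 1 t' t]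
    by (intro has_bochner_integral_add has_bochner_integral_diff has_bochner_integral_mult_right) auto
  have le: "\<bar>gk a (t' - s) * h s - gk a (t - s) * h s\<bar> \<le> M * ?w s" if st: "s \<noteq> t" for s
  proof -
    consider "s \<le> 0" | "0 < s" "s < t" | "0 < s" "t < s" "s < t'" | "0 < s" "t' \<le> s"
      using tt st[unfolded neq_iff] by (atomize_elim) linarith
    then show ?thesis
    proof cases
      case 1
      then show ?thesis using t by (simp add: h0 gk_1)
    next
      case 2
      then have "gk a (t' - s) \<le> gk a (t - s)" using a tt by (intro gk_antimono) auto
      then have "\<bar>gk a (t' - s) - gk a (t - s)\<bar> * \<bar>h s\<bar> \<le> (gk a (t - s) - gk a (t' - s)) * M"
        using hM[of s] 2 tt by (intro mult_mono) auto
      moreover have "\<bar>gk a (t' - s) * h s - gk a (t - s) * h s\<bar> = \<bar>gk a (t' - s) - gk a (t - s)\<bar> * \<bar>h s\<bar>"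
        by (simp only: left_diff_distrib[symmetric] abs_mult)
      ultimately show ?thesis using 2 by (simp add: gk_1 mult.commute)
    next
      case 3
      then have "gk a (t' - s) * \<bar>h s\<bar> \<le> gk a (t' - s) * M"
        using hM[of s] by (intro mult_left_mono gk_nonneg a) auto
      then show ?thesis using 3 gk_nonneg[OF a(1), of "t' - s"] by (simp add: gk_1 abs_mult mult.commute gk_def[of a "t - s"])
    next
      case 4
      then show ?thesis using tt M by (simp add: gk_def)
    qed
  qed
  have hM': "\<bar>h s\<bar> \<le> M" if "s < t" for s using hM[of s] that tt by simp
  note i = cv_integrable(1)[OF a(1) assms(3) h0 hM] cv_integrable(1)[OF a(1) assms(3) h0 hM']
  have "\<bar>cv a h t' - cv a h t\<bar> = \<bar>\<integral>s. gk a (t' - s) * h s - gk a (t - s) * h s \<partial>lborel\<bar>"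
    unfolding cv_def using i by simp
  also have "\<dots> \<le> (\<integral>s. \<bar>gk a (t' - s) * h s - gk a (t - s) * h s\<bar> \<partial>lborel)"
    by (rule integral_abs_bound)
  also have "\<dots> \<le> (\<integral>s. M * ?w s \<partial>lborel)"
  proof (rule integral_mono_AE)
    show "AE s in lborel. \<bar>gk a (t' - s) * h s - gk a (t - s) * h s\<bar> \<le> M * ?w s"
      using AE_lborel_singleton[of t] by eventually_elim (rule le)
    show "integrable lborel (\<lambda>s. M * ?w s)"
      using W unfolding has_bochner_integral_iff by (intro integrable_mult_right) blast
  qed (use i in auto)
  also have "\<dots> = M * ((gk (a + 1) t - gk (a + 1) t') + 2 * gk (a + 1) (t' - t))"
    using W unfolding has_bochner_integral_iff by (simp only: integral_mult_right_zero)
  also have "\<dots> \<le> M * (2 * gk (a + 1) (t' - t))"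
    using gk_mono[of "a + 1" t t'] a t M by (intro mult_left_mono) auto
  finally show ?thesis by simp
qed (auto simp: gk_def)

section \<open>Volterra equations with a fractional kernel\<close>

lemma gk_nat: "0 < s \<Longrightarrow> gk (real k + 1) s = s ^ k / fact k"
  by (simp add: gk_def powr_realpow Gamma_fact add.commute)

text \<open>The kernel with \<open>a \<ge> 1\<close> is bounded on \<open>(0,T]\<close>, so the iterates decay like those of Gronwall's inequality.\<close>

lemma cv_iterate_bound:
  assumes a: "1 \<le> a" and l: "0 \<le> l" and B: "0 \<le> B" and [measurable]: "v \<in> borel_measurable borel"
    and v: "\<And>s. 0 < s \<Longrightarrow> s < T \<Longrightarrow> \<bar>v s\<bar> \<le> B * (l * gk a T) ^ k * gk (real k + 1) s" and t: "t \<le> T"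
  shows "integrable lborel (\<lambda>s. gk a (t - s) * (indicator {0<..<T} s * v s))"
    "(\<integral>s. \<bar>l * (gk a (t - s) * (indicator {0<..<T} s * v s))\<bar> \<partial>lborel) \<le> B * (l * gk a T) ^ Suc k * gk (real (Suc k) + 1) t"
    "\<bar>l * cv a (\<lambda>s. indicator {0<..<T} s * v s) t\<bar> \<le> B * (l * gk a T) ^ Suc k * gk (real (Suc k) + 1) t"
proof -
  let ?f = "\<lambda>s. gk a (t - s) * (indicator {0<..<T} s * v s)"
  let ?c = "gk a T * (B * (l * gk a T) ^ k)"
  have a0: "0 < a" using a by simp
  have W: "has_bochner_integral lborel (\<lambda>s. ?c * (gk 1 (t - s) * gk (real k + 1) s)) (?c * gk (1 + (real k + 1)) t)"
    by (intro has_bochner_integral_mult_right gk_beta) auto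
  have le: "\<bar>?f s\<bar> \<le> ?c * (gk 1 (t - s) * gk (real k + 1) s)" for s
  proof (cases "0 < s \<and> s < t")
    case True
    have "gk a (t - s) * \<bar>v s\<bar> \<le> gk a T * (B * (l * gk a T) ^ k * gk (real k + 1) s)"
      using v[of s] True t a0 by (intro mult_mono gk_mono a gk_nonneg) auto
    then show ?thesis using True t gk_nonneg[OF a0, of "t - s"] by (simp add: abs_mult gk_1 mult_ac)
  next
    case False
    then have "?f s = 0" by (auto simp: gk_def)
    moreover have "0 \<le> ?c * (gk 1 (t - s) * gk (real k + 1) s)"
      using a0 B l by (intro mult_nonneg_nonneg gk_nonneg zero_le_power) auto
    ultimately show ?thesis by (simp only: abs_zero)
  qed
  show int: "integrable lborel ?f"
    by (rule Bochner_Integration.integrable_bound[where f="\<lambda>s. ?c * (gk 1 (t - s) * gk (real k + 1) s)"])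
       (use W le order_trans[OF le abs_ge_self] in \<open>auto simp: has_bochner_integral_iff intro!: AE_I2\<close>)
  have "(\<integral>s. \<bar>l * ?f s\<bar> \<partial>lborel) \<le> (\<integral>s. l * (?c * (gk 1 (t - s) * gk (real k + 1) s)) \<partial>lborel)"
  proof (rule integral_mono)
    show "integrable lborel (\<lambda>s. \<bar>l * ?f s\<bar>)" by (intro integrable_abs) (rule integrable_mult_right[OF int])
    show "integrable lborel (\<lambda>s. l * (?c * (gk 1 (t - s) * gk (real k + 1) s)))"
      using W unfolding has_bochner_integral_iff by (elim conjE) (rule integrable_mult_right)
    show "\<bar>l * ?f s\<bar> \<le> l * (?c * (gk 1 (t - s) * gk (real k + 1) s))" for s
      using mult_left_mono[OF le[of s] l] l by (simp add: abs_mult)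
  qed
  also have "\<dots> = l * (?c * gk (1 + (real k + 1)) t)"
    using W unfolding has_bochner_integral_iff by (simp only: integral_mult_right_zero)
  also have "\<dots> = B * (l * gk a T) ^ Suc k * gk (real (Suc k) + 1) t"
    by (simp add: algebra_simps)
  finally show *: "(\<integral>s. \<bar>l * ?f s\<bar> \<partial>lborel) \<le> B * (l * gk a T) ^ Suc k * gk (real (Suc k) + 1) t" .
  have "\<bar>l * cv a (\<lambda>s. indicator {0<..<T} s * v s) t\<bar> \<le> (\<integral>s. \<bar>l * ?f s\<bar> \<partial>lborel)"
    unfolding cv_def integral_mult_right_zero[symmetric] by (rule integral_abs_bound)
  then show "\<bar>l * cv a (\<lambda>s. indicator {0<..<T} s * v s) t\<bar> \<le> B * (l * gk a T) ^ Suc k * gk (real (Suc k) + 1) t"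
    using * by linarith
qed

lemma Volterra_bound_eq: "0 < t \<Longrightarrow> B * c ^ k * gk (real k + 1) t = B * ((c * t) ^ k / fact k)"
  by (simp add: gk_nat power_mult_distrib)

lemma Volterra_bound_summable: "0 < t \<Longrightarrow> summable (\<lambda>k. B * c ^ k * gk (real k + 1) t)"
proof -
  assume t: "0 < t"
  have "summable (\<lambda>k. (c * t) ^ k / fact k)"
    using summable_exp[of "c * t"] by (simp add: field_simps)
  then show ?thesis unfolding Volterra_bound_eq[OF t] by (rule summable_mult)
qed

text \<open>Inserting the equation into itself k times bounds z by the k-th term of an exponential
  series.\<close>

lemma Volterra_unique:
  assumes a: "1 \<le> a" and l: "0 \<le> l" and [measurable]: "z \<in> borel_measurable borel"
    and B: "\<And>s. 0 < s \<Longrightarrow> s < T \<Longrightarrow> \<bar>z s\<bar> \<le> B"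
    and eq: "\<And>s. 0 < s \<Longrightarrow> s < T \<Longrightarrow> z s = - (l * cv a (\<lambda>s. indicator {0<..<T} s * z s) s)"
    and t: "0 < t" "t < T"
  shows "z t = 0"
proof -
  have B0: "0 \<le> B" using B[OF t] by linarith
  have bd: "\<bar>z s\<bar> \<le> B * (l * gk a T) ^ k * gk (real k + 1) s" if "0 < s" "s < T" for s k
    using that
  proof (induction k arbitrary: s)
    case 0
    then show ?case using B[of s] by (simp add: gk_1)
  next
    case (Suc k)
    then have "s \<le> T" by simp
    from cv_iterate_bound(3)[OF a l B0 assms(3) Suc.IH this] eq[OF Suc.prems] show ?case by simp
  qed
  have "(\<lambda>k. B * (l * gk a T) ^ k * gk (real k + 1) t) \<longlonglongrightarrow> 0"
    by (rule summable_LIMSEQ_zero[OF Volterra_bound_summable[OF t(1)]])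
  then have "\<bar>z t\<bar> \<le> 0"
    using bd[OF t] by (intro LIMSEQ_le_const) auto
  then show ?thesis by simp
qed

text \<open>The Neumann series with terms \<open>W k\<close>, each the image of its predecessor
  under the integral operator. The factorial bounds make it converge on (0, T) and let sum and
  integral be exchanged.\<close>

lemma Volterra_exists:
  assumes a: "1 \<le> a" and l: "0 \<le> l" and T: "0 < T" and [measurable]: "G \<in> borel_measurable borel"
    and B: "\<And>s. 0 < s \<Longrightarrow> s < T \<Longrightarrow> \<bar>G s\<bar> \<le> B"
  shows "\<exists>u. u \<in> borel_measurable borel \<and> (\<exists>M. \<forall>s. 0 < s \<longrightarrow> s < T \<longrightarrow> \<bar>u s\<bar> \<le> M) \<and>
    (\<forall>t\<le>T. u t = G t - l * cv a (\<lambda>s. indicator {0<..<T} s * u s) t)"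
proof -
  define W where "W = rec_nat G (\<lambda>k v t. - (l * cv a (\<lambda>s. indicator {0<..<T} s * v s) t))"
  have W0: "W 0 = G" and WS: "\<And>k. W (Suc k) = (\<lambda>t. - (l * cv a (\<lambda>s. indicator {0<..<T} s * W k s) t))"
    by (simp_all add: W_def)
  have B0: "0 \<le> B" using B[of "T / 2"] T by auto
  have Wm [measurable]: "W k \<in> borel_measurable borel" for k
  proof (induction k)
    case (Suc k)
    then have [measurable]: "W k \<in> borel_measurable borel" .
    show ?case unfolding WS by measurable
  qed (simp add: W0)
  have Wb: "\<bar>W k s\<bar> \<le> B * (l * gk a T) ^ k * gk (real k + 1) s" if "0 < s" "s < T" for s k
    using that
  proof (induction k arbitrary: s)
    case 0
    then show ?case using B[of s] by (simp add: gk_1 W0)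
  next
    case (Suc k)
    then have "s \<le> T" by simp
    from cv_iterate_bound(3)[OF a l B0 Wm Suc.IH this] show ?case by (simp add: WS)
  qed
  define c where "c = l * gk a T"
  have c0: "0 \<le> c" using l gk_nonneg[of a T] a by (simp add: c_def)
  define v where "v t = (\<Sum>k. W k t)" for t
  have vm [measurable]: "v \<in> borel_measurable borel" unfolding v_def[abs_def] by measurable
  have Wsum: "summable (\<lambda>k. norm (W k s))" if "0 < s" "s < T" for s
    by (rule summable_comparison_test'[OF Volterra_bound_summable[OF that(1), of B c]])
       (use Wb[OF that] in \<open>simp add: c_def\<close>)
  have vb: "\<bar>v s\<bar> \<le> B * exp (c * T)" if s: "0 < s" "s < T" for s
  proof -
    have "\<bar>v s\<bar> \<le> (\<Sum>k. norm (W k s))" unfolding v_def using summable_norm[OF Wsum[OF s]] by simp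
    also have "\<dots> \<le> (\<Sum>k. B * ((c * s) ^ k /\<^sub>R fact k))"
      using Wb[OF s] unfolding Volterra_bound_eq[OF s(1)] c_def[symmetric]
      by (intro suminf_le Wsum s summable_mult summable_exp_generic) (auto simp: divide_inverse mult.commute)
    also have "\<dots> = B * exp (c * s)"
      unfolding exp_def by (rule suminf_mult[OF summable_exp_generic])
    also have "\<dots> \<le> B * exp (c * T)"
      using B0 c0 s by (intro mult_left_mono) (auto intro: mult_left_mono)
    finally show ?thesis .
  qed
  \<comment> \<open>The series is controlled on the open interval only. Defining u by the right-hand
    side makes the equation hold outside it too, in particular at both end points.\<close>
  define u where "u t = G t - l * cv a (\<lambda>s. indicator {0<..<T} s * v s) t" for t
  have um [measurable]: "u \<in> borel_measurable borel" unfolding u_def[abs_def] by measurable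
  have uv: "u t = v t" if t: "0 < t" "t < T" for t
  proof -
    let ?f = "\<lambda>k s. l * (gk a (t - s) * (indicator {0<..<T} s * W k s))"
    have i: "integrable lborel (?f k)" for k
      using t by (intro integrable_mult_right cv_iterate_bound(1)[OF a l B0 Wm Wb]) auto
    have "(\<Sum>k. \<integral>s. ?f k s \<partial>lborel) = (\<integral>s. (\<Sum>k. ?f k s) \<partial>lborel)"
    proof (rule integral_suminf[symmetric, OF i])
      show "AE s in lborel. summable (\<lambda>k. norm (?f k s))"
      proof (rule AE_I2)
        fix s
        show "summable (\<lambda>k. norm (?f k s))"
        proof (cases "0 < s \<and> s < T")
          case True
          then show ?thesis using summable_mult[OF Wsum[of s], of "\<bar>l * gk a (t - s)\<bar>"]
            by (simp add: abs_mult mult.assoc)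
        next
          case False
          then have "indicator {0<..<T} s = (0::real)" by auto
          then show ?thesis by (simp only: mult_zero_left mult_zero_right norm_zero summable_zero)
        qed
      qed
      have S: "summable (\<lambda>k. B * c ^ Suc k * gk (real (Suc k) + 1) t)"
        by (subst summable_Suc_iff[of "\<lambda>k. B * c ^ k * gk (real k + 1) t"]) (rule Volterra_bound_summable[OF t(1)])
      have "norm (\<integral>s. norm (?f k s) \<partial>lborel) \<le> B * c ^ Suc k * gk (real (Suc k) + 1) t" for k
      proof -
        have "(\<integral>s. norm (?f k s) \<partial>lborel) \<le> B * c ^ Suc k * gk (real (Suc k) + 1) t"
          using cv_iterate_bound(2)[OF a l B0 Wm, where k=k and t=t, OF Wb] t unfolding c_def real_norm_def by simp
        moreover have "0 \<le> (\<integral>s. norm (?f k s) \<partial>lborel)" by (rule Bochner_Integration.integral_nonneg) (rule norm_ge_zero)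
        ultimately show ?thesis by (simp only: real_norm_def abs_of_nonneg)
      qed
      note le = this
      show "summable (\<lambda>k. \<integral>s. norm (?f k s) \<partial>lborel)"
        by (rule summable_comparison_test'[OF S, of 0]) (rule le)
    qed
    also have "(\<integral>s. (\<Sum>k. ?f k s) \<partial>lborel) = (\<integral>s. l * (gk a (t - s) * (indicator {0<..<T} s * v s)) \<partial>lborel)"
    proof (rule Bochner_Integration.integral_cong[OF refl])
      fix s
      show "(\<Sum>k. ?f k s) = l * (gk a (t - s) * (indicator {0<..<T} s * v s))"
      proof (cases "0 < s \<and> s < T")
        case True
        then have 0: "0 < s" "s < T" by auto
        have 1: "?f k s = (l * gk a (t - s)) * W k s" for k using True by (simp add: mult.assoc)
        have 2: "(\<Sum>k. (l * gk a (t - s)) * W k s) = (l * gk a (t - s)) * (\<Sum>k. W k s)"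
          by (rule suminf_mult[OF summable_norm_cancel[OF Wsum[OF 0]]])
        show ?thesis unfolding 1 2 v_def[symmetric] using True by (simp add: mult.assoc)
      next
        case False
        then have "indicator {0<..<T} s = (0::real)" by auto
        then show ?thesis by (simp only: mult_zero_left mult_zero_right suminf_zero)
      qed
    qed
    finally have "l * cv a (\<lambda>s. indicator {0<..<T} s * v s) t = (\<Sum>k. - W (Suc k) t)"
      by (simp add: WS cv_def)
    also have "\<dots> = - (\<Sum>k. W (Suc k) t)"
      using summable_Suc_iff[THEN iffD2, OF summable_norm_cancel[OF Wsum[OF t]]] by (rule suminf_minus)
    also have "(\<Sum>k. W (Suc k) t) = v t - W 0 t"
      unfolding v_def by (rule suminf_split_head[OF summable_norm_cancel[OF Wsum[OF t]]])
    finally show ?thesis by (simp add: u_def W0)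
  qed
  have eq: "(\<lambda>s. indicator {0<..<T} s * v s) = (\<lambda>s. indicator {0<..<T} s * u s)"
    using uv by (auto simp: indicator_def fun_eq_iff)
  have "\<bar>u s\<bar> \<le> B * exp (c * T)" if "0 < s" "s < T" for s using vb[OF that] uv[OF that] by simp
  moreover have "u t = G t - l * cv a (\<lambda>s. indicator {0<..<T} s * u s) t" for t
    by (subst eq[symmetric]) (rule u_def)
  ultimately show ?thesis using um by blast
qed

section \<open>Continuity and differentiability of fractional integrals\<close>

lemma gk_tendsto_0: "0 < a \<Longrightarrow> ((\<lambda>x. gk (a + 1) \<bar>x - t\<bar>) \<longlongrightarrow> 0) (at t)"
proof -
  assume a: "0 < a"
  have "((\<lambda>x. \<bar>x - t\<bar> powr a / Gamma (a + 1)) \<longlongrightarrow> \<bar>t - t\<bar> powr a / Gamma (a + 1)) (at t)"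
    using a less_imp_neq[OF Gamma_real_pos[of "a + 1"]]
    by (intro tendsto_divide tendsto_powr' tendsto_rabs tendsto_diff tendsto_ident_at tendsto_const) auto
  moreover have "\<bar>x - t\<bar> powr a / Gamma (a + 1) = gk (a + 1) \<bar>x - t\<bar>" for x
    by (auto simp: gk_def)
  ultimately show ?thesis by simp
qed

text \<open>The Hoelder bound covers nonnegative arguments. Elsewhere the function vanishes, so a
  pair that straddles 0 is compared through 0.\<close>

lemma cv_continuous:
  assumes a: "0 < a" "a \<le> 1" and m [measurable]: "h \<in> borel_measurable borel"
    and h0: "\<And>s. s \<le> 0 \<Longrightarrow> h s = 0" and hM: "\<And>s. \<bar>h s\<bar> \<le> M"
  shows "continuous_on A (cv a h)"
proof -
  have M: "0 \<le> M" using hM[of 0] by linarith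
  have le: "\<bar>cv a h y - cv a h x\<bar> \<le> 2 * M * gk (a + 1) \<bar>y - x\<bar>" if "x \<le> y" for x y
  proof (cases "0 \<le> x")
    case True
    then show ?thesis using cv_Hoelder[OF a m h0 hM, of x y] that by simp
  next
    case False
    then have x: "cv a h x = 0" by (intro cv_zero h0) auto
    show ?thesis
    proof (cases "0 \<le> y")
      case True
      have "\<bar>cv a h y - cv a h 0\<bar> \<le> 2 * M * gk (a + 1) (y - 0)"
        using cv_Hoelder[OF a m h0 hM, of 0 y] True by simp
      also have "\<dots> \<le> 2 * M * gk (a + 1) \<bar>y - x\<bar>"
        using a M False True by (intro mult_left_mono gk_mono) auto
      finally show ?thesis using x cv_zero[of h 0 a] h0 by simp
    next
      case F: False
      then have "cv a h y = 0" by (intro cv_zero h0) auto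
      then show ?thesis using x M gk_nonneg[of "a + 1" "\<bar>y - x\<bar>"] a by simp
    qed
  qed
  have le': "norm (cv a h y - cv a h x) \<le> 2 * M * gk (a + 1) \<bar>y - x\<bar>" for x y
    using le[of x y] le[of y x] by (cases "x \<le> y") (auto simp: abs_minus_commute)
  have "isCont (cv a h) x" for x
  proof -
    have "((\<lambda>y. 2 * M * gk (a + 1) \<bar>y - x\<bar>) \<longlongrightarrow> 2 * M * 0) (at x)"
      by (intro tendsto_mult_left gk_tendsto_0 a)
    then have "((\<lambda>y. 2 * M * gk (a + 1) \<bar>y - x\<bar>) \<longlongrightarrow> 0) (at x)" by simp
    then have "((\<lambda>y. cv a h y - cv a h x) \<longlongrightarrow> 0) (at x)"
      by (rule Lim_null_comparison[OF always_eventually[OF allI[OF le']]])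
    then show ?thesis unfolding isCont_def by (simp add: LIM_zero_iff)
  qed
  then show ?thesis by (intro continuous_at_imp_continuous_on) auto
qed

lemma cv_1_integral:
  assumes y: "continuous_on UNIV y" and y0: "\<And>s. s \<le> 0 \<Longrightarrow> y s = 0"
  shows "cv 1 y t = integral {0..t} y"
proof -
  have [measurable]: "y \<in> borel_measurable borel" using y by (rule borel_measurable_continuous_onI)
  have si: "set_integrable lborel {0..t} y"
    by (rule borel_integrable_atLeastAtMost') (rule continuous_on_subset[OF y subset_UNIV])
  have "cv 1 y t = (\<integral>s. indicator {0..t} s *\<^sub>R y s \<partial>lborel)"
    unfolding cv_1
  proof (rule integral_cong_AE)
    show "AE s in lborel. indicator {..<t} s * y s = indicator {0..t} s *\<^sub>R y s"
      using AE_lborel_singleton[of t] by eventually_elim (auto simp: indicator_def y0)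
  qed measurable
  then show ?thesis
    using set_borel_integral_eq_integral(2)[OF si] unfolding set_lebesgue_integral_def by (simp only:)
qed

text \<open>By the semigroup law order 1 + b is the ordinary primitive of order b, which is
  continuous.\<close>

lemma cv_deriv:
  assumes b: "0 < b" "b \<le> 1" and m [measurable]: "h \<in> borel_measurable borel"
    and h0: "\<And>s. s \<le> 0 \<Longrightarrow> h s = 0" and hM: "\<And>s. \<bar>h s\<bar> \<le> M" and t: "t \<in> {0..T}"
  shows "(cv (1 + b) h has_real_derivative cv b h t) (at t within {0..T})"
proof -
  have c: "continuous_on A (cv b h)" for A by (rule cv_continuous[OF b m h0 hM])
  have "cv (1 + b) h s = integral {0..s} (cv b h)" for s
  proof -
    have "cv 1 (cv b h) s = cv (1 + b) h s"
      by (rule cv_cv[OF _ b(1) m h0 hM]) simp_all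
    moreover have "cv 1 (cv b h) s = integral {0..s} (cv b h)"
      by (rule cv_1_integral[OF c cv_zero[OF h0]])
    ultimately show ?thesis by (simp only:)
  qed
  then have "cv (1 + b) h = (\<lambda>s. integral {0..s} (cv b h))" by (rule ext)
  then show ?thesis
    using integral_has_real_derivative[OF c t] by (simp only:)
qed

section \<open>Positivity of fractional integration and the energy estimate\<close>

text \<open>On (0,1) the second factor is bounded and y^(b-1) is integrable; from 1 on the product
  is at most a multiple of y^(2b-2), integrable at infinity because b < 1/2.\<close>

lemma gk_overlap_integrable:
  assumes b: "0 < b" "b < 1 / 2"
  shows "integrable lborel (\<lambda>y. gk b y * gk b (y + 1))"
proof -
  have "((\<lambda>x. x powr (2 * b - 2)) has_integral -(1 powr (2 * b - 2 + 1)) / (2 * b - 2 + 1)) {1::real..}"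
    using b by (intro has_integral_powr_to_inf) auto
  then have "(\<lambda>x::real. x powr (2 * b - 2)) absolutely_integrable_on {1..}"
    by (intro nonnegative_absolutely_integrable_1) (auto simp: integrable_on_def)
  then have 1: "integrable lborel (\<lambda>x. indicator {1..} x * x powr (2 * b - 2) :: real)"
    unfolding set_integrable_def by (subst (asm) integrable_completion) auto
  have 2: "integrable lborel (\<lambda>y. gk 1 (1 - y) * gk b y)"
    using gk_beta[of 1 b 1] b by (simp add: has_bochner_integral_iff)
  let ?w = "\<lambda>y. gk b 1 * (gk 1 (1 - y) * gk b y) + (1 / (Gamma b)\<^sup>2) * (indicator {1..} y * y powr (2 * b - 2))"
  show ?thesis
  proof (rule Bochner_Integration.integrable_bound[where f="?w"])
    show "integrable lborel ?w"
      by (rule Bochner_Integration.integrable_add[OF integrable_mult_right[OF 2] integrable_mult_right[OF 1]])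
    have le: "gk b y * gk b (y + 1) \<le> ?w y" for y
    proof -
      consider "y \<le> 0" | "0 < y" "y < 1" | "1 \<le> y" by linarith
      then show ?thesis
      proof cases
        case 1
        then show ?thesis by (simp add: gk_def)
      next
        case 2
        have "gk b y * gk b (y + 1) \<le> gk b y * gk b 1"
          using 2 b by (intro mult_left_mono gk_antimono gk_nonneg) auto
        then show ?thesis using 2 by (simp add: gk_1 mult.commute)
      next
        case 3
        have "gk b y * gk b (y + 1) \<le> gk b y * gk b y"
          using 3 b by (intro mult_left_mono gk_antimono gk_nonneg) auto
        also have "gk b y * gk b y = (1 / (Gamma b)\<^sup>2) * y powr (2 * b - 2)"
          using 3 by (simp add: gk_def power2_eq_square powr_add[symmetric])
        finally show ?thesis using 3 by (simp add: gk_1)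
      qed
    qed
    have "norm (gk b y * gk b (y + 1)) \<le> norm (?w y)" for y
      using le[of y] gk_nonneg[OF b(1), of y] gk_nonneg[OF b(1), of "y + 1"] by simp
    then show "AE y in lborel. norm (gk b y * gk b (y + 1)) \<le> norm (?w y)" by simp
  qed measurable
qed

text \<open>The integral of the product of two kernels of order b whose starting points are at
  distance 1; other distances follow by scaling.\<close>

definition overlap :: "real \<Rightarrow> real" where
  "overlap b = (\<integral>y. gk b y * gk b (y + 1) \<partial>lborel)"

lemma overlap_pos:
  assumes b: "0 < b" "b < 1 / 2"
  shows "0 < overlap b"
proof -
  have nn: "0 \<le> gk b y * gk b (y + 1)" for y
    by (intro mult_nonneg_nonneg gk_nonneg b)
  have "overlap b \<noteq> 0"
  proof
    assume "overlap b = 0"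
    then have "AE y in lborel. gk b y * gk b (y + 1) = 0"
      unfolding overlap_def using integral_nonneg_eq_0_iff_AE[OF gk_overlap_integrable[OF b]] nn by simp
    then have "AE y in lborel. indicator {0<..<1::real} y = (0::real)"
    proof eventually_elim
      case (elim y)
      show ?case
      proof (rule ccontr)
        assume "indicator {0<..<1} y \<noteq> (0::real)"
        then have "0 < gk b y * gk b (y + 1)"
          using Gamma_real_pos[OF b(1)] by (auto simp: gk_def indicator_def split: if_splits)
        then show False using elim by simp
      qed
    qed
    then have "(\<integral>y. indicator {0<..<1::real} y \<partial>lborel) = (0::real)" by (rule integral_eq_zero_AE)
    then show False by simp
  qed
  moreover have "0 \<le> overlap b" unfolding overlap_def by (rule Bochner_Integration.integral_nonneg) (rule nn)
  ultimately show ?thesis by simp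
qed

text \<open>For r < s the substitution x = s + (s - r) y extracts the power (s - r)^(2b-1) by
  homogeneity. Of the two kernels of order 2 b on the right exactly one is nonzero; their sum is the
  symmetric power without a case distinction.\<close>

lemma gk_overlap_shift:
  assumes b: "0 < b" "b < 1 / 2" and "r \<noteq> s"
  shows "has_bochner_integral lborel (\<lambda>x. gk b (x - r) * gk b (x - s))
    (overlap b * Gamma (2 * b) * (gk (2 * b) (s - r) + gk (2 * b) (r - s)))"
proof -
  have *: "has_bochner_integral lborel (\<lambda>x. gk b (x - r) * gk b (x - s)) (overlap b * (s - r) powr (2 * b - 1))"
    if d: "r < s" for r s
  proof -
    have eq: "gk b (s + (s - r) * y - r) * gk b (s + (s - r) * y - s) = (s - r) powr (2 * b - 2) * (gk b y * gk b (y + 1))" for y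
    proof (cases "0 < y")
      case True
      have 1: "s + (s - r) * y - r = (s - r) * (y + 1)" "s + (s - r) * y - s = (s - r) * y" by (auto simp: algebra_simps)
      have 2: "0 < (s - r) * (y + 1)" "0 < (s - r) * y" using True d by auto
      have 3: "((s - r) * (y + 1)) powr (b - 1) = (s - r) powr (b - 1) * (y + 1) powr (b - 1)"
        "((s - r) * y) powr (b - 1) = (s - r) powr (b - 1) * y powr (b - 1)"
        using True d by (auto intro!: powr_mult)
      have 4: "(s - r) powr (2 * b - 2) = (s - r) powr (b - 1) * (s - r) powr (b - 1)"
        by (simp add: powr_add[symmetric])
      have 5: "0 < y + 1" using True by simp
      have 6: "gk b ((s - r) * (y + 1)) = (s - r) powr (b - 1) * (y + 1) powr (b - 1) / Gamma b"
        "gk b ((s - r) * y) = (s - r) powr (b - 1) * y powr (b - 1) / Gamma b"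
        "gk b y = y powr (b - 1) / Gamma b" "gk b (y + 1) = (y + 1) powr (b - 1) / Gamma b"
        unfolding 3[symmetric] gk_def using 2 True 5 by (simp_all only: if_True)
      show ?thesis unfolding 1 4 6 by (simp only: divide_inverse inverse_mult_distrib mult_ac)
    next
      case False
      then have "(s - r) * y \<le> 0" using d by (simp add: mult_le_0_iff)
      then show ?thesis using False by (simp add: gk_def)
    qed
    have val: "(s - r) powr (2 * b - 2) * overlap b = (overlap b * (s - r) powr (2 * b - 1)) /\<^sub>R \<bar>s - r\<bar>"
    proof -
      have "(s - r) powr (2 * b - 1) = (s - r) * (s - r) powr (2 * b - 2)"
        using d powr_add[of "s - r" 1 "2 * b - 2"] by simp
      moreover have "x * y = (y * (e * x)) /\<^sub>R \<bar>e\<bar>" if "0 < e" for e x y :: real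
        using that by (simp add: field_simps)
      ultimately show ?thesis using d by simp
    qed
    have "has_bochner_integral lborel (\<lambda>y. (s - r) powr (2 * b - 2) * (gk b y * gk b (y + 1))) ((s - r) powr (2 * b - 2) * overlap b)"
      using gk_overlap_integrable[OF b] unfolding overlap_def
      by (intro has_bochner_integral_mult_right has_bochner_integral_integrable)
    then show ?thesis
      using d unfolding val eq[symmetric]
      by (subst lborel_has_bochner_integral_real_affine_iff[of "s - r" _ _ s]) auto
  qed
  have "0 < Gamma (2 * b)" using b by (intro Gamma_real_pos) simp
  then have G: "Gamma (2 * b) \<noteq> 0" by (rule less_imp_neq[symmetric])
  show ?thesis
  proof (cases "r < s")
    case True
    have "overlap b * Gamma (2 * b) * (gk (2 * b) (s - r) + gk (2 * b) (r - s)) = overlap b * (s - r) powr (2 * b - 1)"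
      using True G by (simp add: gk_def)
    then show ?thesis using *[OF True] by (simp only:)
  next
    case False
    then have True: "s < r" using assms(3) by simp
    have "overlap b * Gamma (2 * b) * (gk (2 * b) (s - r) + gk (2 * b) (r - s)) = overlap b * (r - s) powr (2 * b - 1)"
      using True G by (simp add: gk_def)
    then show ?thesis using *[OF True] by (simp only: mult.commute[of "gk b (_ - r)"])
  qed
qed

text \<open>Since \<open>\<bar>r - s\<bar>\<^sup>2\<^sup>b\<^sup>-\<^sup>1\<close> is a multiple of the overlap of the kernels of order \<open>b\<close> at \<open>r\<close> and \<open>s\<close>, the
  quadratic form of the fractional integral of order \<open>2b\<close> is a multiple of a square.\<close>

lemma cv_energy:
  assumes b: "0 < b" "b < 1 / 2" and m [measurable]: "k \<in> borel_measurable borel"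
    and k0: "\<And>s. s \<le> 0 \<Longrightarrow> k s = 0" and kt: "\<And>s. t \<le> s \<Longrightarrow> k s = 0" and kM: "\<And>s. \<bar>k s\<bar> \<le> M"
  shows "integrable lborel (\<lambda>x. (cv b k x)\<^sup>2)"
    "(\<integral>x. (cv b k x)\<^sup>2 \<partial>lborel) = 2 * overlap b * Gamma (2 * b) * (\<integral>s. k s * cv (2 * b) k s \<partial>lborel)"
proof -
  define c where "c = overlap b * Gamma (2 * b)"
  have c: "0 < c" unfolding c_def using overlap_pos[OF b] Gamma_real_pos[of "2 * b"] b by simp
  have b2: "0 < 2 * b" using b by simp
  \<comment> \<open>Up to a constant the symmetric kernel |r - s|^(2b-1). Its halves are treated
    separately because \<open>cv\<close> covers only the one with r < s.\<close>
  define P where "P r s = gk (2 * b) (s - r) + gk (2 * b) (r - s)" for r s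
  have P0: "0 \<le> P r s" for r s unfolding P_def by (intro add_nonneg_nonneg gk_nonneg b2)
  have Pm [measurable]: "(\<lambda>r. P r s) \<in> borel_measurable borel" for s unfolding P_def by measurable
  have overlap: "has_bochner_integral lborel (\<lambda>x. gk b (x - r) * gk b (x - s)) (c * P r s)" if "r \<noteq> s" for r s
    using gk_overlap_shift[OF b that] by (simp only: c_def P_def)
  have AEne: "AE r in lborel. r \<noteq> s" for s :: real by (rule AE_lborel_singleton)
  \<comment> \<open>The half with r > s: as \<open>k\<close> vanishes beyond t, only r between s and
    t matters, and comparison with the constant M there gives the bound. It is stated for every h of
    the same absolute value, to serve both \<open>k\<close> and its modulus.\<close>
  have Bint: "integrable lborel (\<lambda>r. gk (2 * b) (r - s) * h r) \<and>
      (0 < s \<longrightarrow> \<bar>\<integral>r. gk (2 * b) (r - s) * h r \<partial>lborel\<bar> \<le> M * gk (2 * b + 1) t)"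
    if [measurable]: "h \<in> borel_measurable borel" and h: "\<And>r. \<bar>h r\<bar> = \<bar>k r\<bar>" for h :: "real \<Rightarrow> real" and s
  proof -
    have M: "0 \<le> M" using kM[of 0] by linarith
    have B: "has_bochner_integral lborel (\<lambda>r. M * (gk 1 (t - r) * gk (2 * b) (r - s))) (M * gk (1 + 2 * b) (t - s))"
      by (intro has_bochner_integral_mult_right gk_beta_shift b2) simp
    have le: "\<bar>gk (2 * b) (r - s) * h r\<bar> \<le> M * (gk 1 (t - r) * gk (2 * b) (r - s))" for r
    proof (cases "r < t")
      case True
      then show ?thesis using mult_left_mono[OF kM[of r] gk_nonneg[OF b2, of "r - s"]] gk_nonneg[OF b2, of "r - s"]
        by (simp add: abs_mult h gk_1 mult.commute)
    next
      case False
      then have "h r = 0" using kt[of r] h[of r] by simp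
      then show ?thesis using False by (simp add: gk_1)
    qed
    have int: "integrable lborel (\<lambda>r. gk (2 * b) (r - s) * h r)"
      by (rule Bochner_Integration.integrable_bound[where f="\<lambda>r. M * (gk 1 (t - r) * gk (2 * b) (r - s))"])
         (use B order_trans[OF le abs_ge_self] in \<open>auto simp: has_bochner_integral_iff intro!: AE_I2\<close>)
    moreover have "\<bar>\<integral>r. gk (2 * b) (r - s) * h r \<partial>lborel\<bar> \<le> M * gk (2 * b + 1) t" if "0 < s"
    proof -
      have "\<bar>\<integral>r. gk (2 * b) (r - s) * h r \<partial>lborel\<bar> \<le> (\<integral>r. M * (gk 1 (t - r) * gk (2 * b) (r - s)) \<partial>lborel)"
        unfolding real_norm_def[symmetric]
        by (rule Bochner_Integration.integral_norm_bound_integral[OF int]) (use B le in \<open>auto simp: has_bochner_integral_iff\<close>)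
      also have "\<dots> = M * gk (2 * b + 1) (t - s)" using B by (simp only: has_bochner_integral_iff add.commute)
      also have "\<dots> \<le> M * gk (2 * b + 1) t" using M b that by (intro mult_left_mono gk_mono) auto
      finally show ?thesis .
    qed
    ultimately show ?thesis by blast
  qed
  have Aint: "integrable lborel (\<lambda>r. gk (2 * b) (s - r) * h r)"
    if "h \<in> borel_measurable borel" and h: "\<And>r. \<bar>h r\<bar> = \<bar>k r\<bar>" for h :: "real \<Rightarrow> real" and s
  proof (rule cv_integrable(1)[OF b2 that(1)])
    show "h r = 0" if "r \<le> 0" for r using h[of r] k0[OF that] by simp
    show "\<bar>h r\<bar> \<le> M" for r using h[of r] kM[of r] by simp
  qed
  have PI: "integrable lborel (\<lambda>r. P r s * h r)"
    "(\<integral>r. P r s * h r \<partial>lborel) = cv (2 * b) h s + (\<integral>r. gk (2 * b) (r - s) * h r \<partial>lborel)"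
    if "h \<in> borel_measurable borel" and "\<And>r. \<bar>h r\<bar> = \<bar>k r\<bar>" for h :: "real \<Rightarrow> real" and s
    using Aint[OF that, of s] Bint[OF that, of s] by (simp_all add: P_def cv_def distrib_right)
  \<comment> \<open>First use of Fubini: integrating the product of two kernels over x produces
    their overlap, that is, c times \<open>P\<close>.\<close>
  have step1: "integrable lborel (\<lambda>x. gk b (x - s) * cv b h x) \<and>
      (\<integral>x. gk b (x - s) * cv b h x \<partial>lborel) = c * (\<integral>r. P r s * h r \<partial>lborel)"
    if hm [measurable]: "h \<in> borel_measurable borel" and h: "\<And>r. \<bar>h r\<bar> = \<bar>k r\<bar>" for h :: "real \<Rightarrow> real" and s
  proof -
    let ?f = "\<lambda>r x. (gk b (x - r) * gk b (x - s)) * h r"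
    have i: "integrable lborel (?f r)" "(\<integral>x. ?f r x \<partial>lborel) = c * (P r s * h r)"
      "(\<integral>x. \<bar>?f r x\<bar> \<partial>lborel) = c * (P r s * \<bar>h r\<bar>)" if "r \<noteq> s" for r
      using overlap[OF that] gk_nonneg[OF b(1)] by (auto simp: has_bochner_integral_iff abs_mult)
    have sw: "(\<lambda>(r, x). ?f r x) \<in> borel_measurable (lborel \<Otimes>\<^sub>M lborel)" by measurable
    have ai: "AE r in lborel. integrable lborel (?f r)" using AEne[of s] by eventually_elim (rule i)
    have i2: "integrable lborel (\<lambda>r. \<integral>x. \<bar>?f r x\<bar> \<partial>lborel)"
    proof (rule integrable_cong_AE_imp)
      show "integrable lborel (\<lambda>r. c * (P r s * \<bar>h r\<bar>))"
        by (rule integrable_mult_right[OF PI(1)]) (auto simp: h)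
      show "AE r in lborel. c * (P r s * \<bar>h r\<bar>) = (\<integral>x. \<bar>?f r x\<bar> \<partial>lborel)"
        using AEne[of s] by eventually_elim (rule i(3)[symmetric])
    qed measurable
    have eq: "(\<integral>r. ?f r x \<partial>lborel) = gk b (x - s) * cv b h x" for x
    proof -
      have "(\<integral>r. ?f r x \<partial>lborel) = (\<integral>r. gk b (x - s) * (gk b (x - r) * h r) \<partial>lborel)"
        by (rule Bochner_Integration.integral_cong) auto
      then show ?thesis by (simp only: cv_def integral_mult_right_zero)
    qed
    have "(\<integral>r. \<integral>x. ?f r x \<partial>lborel \<partial>lborel) = (\<integral>r. c * (P r s * h r) \<partial>lborel)"
    proof (rule integral_cong_AE)
      show "AE r in lborel. (\<integral>x. ?f r x \<partial>lborel) = c * (P r s * h r)"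
        using AEne[of s] by eventually_elim (rule i(2))
    qed measurable
    then show ?thesis
      using integral_swap[OF sw ai i2] by (simp only: eq integral_mult_right_zero)
  qed
  let ?z = "cv b k" and ?k' = "\<lambda>s. \<bar>k s\<bar>"
  \<comment> \<open>A bound, uniform in s, for the inner integrals of absolute values; it licenses
    the second use of Fubini.\<close>
  define D where "D = c * (2 * (M * gk (2 * b + 1) t))"
  have M: "0 \<le> M" using kM[of 0] by linarith
  have zle: "\<bar>?z x\<bar> \<le> cv b ?k' x" for x
  proof -
    have "\<bar>?z x\<bar> \<le> (\<integral>s. \<bar>gk b (x - s) * k s\<bar> \<partial>lborel)" unfolding cv_def by (rule integral_abs_bound)
    also have "\<dots> = cv b ?k' x" unfolding cv_def using gk_nonneg[OF b(1)] by (simp add: abs_mult)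
    finally show ?thesis .
  qed
  note s1k = step1[OF m refl] and s1k' = step1[of ?k', simplified]
  let ?f2 = "\<lambda>s x. (gk b (x - s) * ?z x) * k s"
  have f2m: "(\<lambda>(s, x). ?f2 s x) \<in> borel_measurable (lborel \<Otimes>\<^sub>M lborel)" by measurable
  have f2i: "integrable lborel (?f2 s)" for s
    by (rule integrable_mult_left) (use s1k[of s] in blast)
  have D: "(\<integral>x. \<bar>gk b (x - s) * ?z x\<bar> \<partial>lborel) \<le> D" if s: "0 < s" "s < t" for s
  proof -
    have "(\<integral>x. \<bar>gk b (x - s) * ?z x\<bar> \<partial>lborel) \<le> (\<integral>x. gk b (x - s) * cv b ?k' x \<partial>lborel)"
    proof (rule integral_mono)
      show "integrable lborel (\<lambda>x. \<bar>gk b (x - s) * ?z x\<bar>)" using s1k[of s] by (intro integrable_abs) blast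
      show "integrable lborel (\<lambda>x. gk b (x - s) * cv b ?k' x)" using s1k' by simp
      show "\<bar>gk b (x - s) * ?z x\<bar> \<le> gk b (x - s) * cv b ?k' x" for x
        using mult_left_mono[OF zle[of x] gk_nonneg[OF b(1), of "x - s"]] gk_nonneg[OF b(1), of "x - s"] by (simp add: abs_mult)
    qed
    also have "\<dots> = c * (cv (2 * b) ?k' s + (\<integral>r. gk (2 * b) (r - s) * ?k' r \<partial>lborel))"
      using s1k'[of s] PI(2)[of ?k' s] by simp
    also have "\<dots> \<le> D"
    proof -
      have "cv (2 * b) ?k' s \<le> M * gk (2 * b + 1) s"
        using cv_integrable(2)[OF b2, of ?k' s M] k0 kM by simp
      also have "\<dots> \<le> M * gk (2 * b + 1) t" using M b s by (intro mult_left_mono gk_mono) auto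
      finally have 1: "cv (2 * b) ?k' s \<le> M * gk (2 * b + 1) t" .
      have 2: "(\<integral>r. gk (2 * b) (r - s) * ?k' r \<partial>lborel) \<le> M * gk (2 * b + 1) t"
        by (rule order_trans[OF abs_ge_self]) (use Bint[of ?k' s] s(1) in simp)
      show ?thesis unfolding D_def using c 1 2 by (intro mult_left_mono) auto
    qed
    finally show ?thesis .
  qed
  have indi: "integrable lborel (indicator {0<..<t} :: real \<Rightarrow> real)"
    by (cases "0 \<le> t") auto
  have f2i2: "integrable lborel (\<lambda>s. \<integral>x. \<bar>?f2 s x\<bar> \<partial>lborel)"
  proof (rule Bochner_Integration.integrable_bound[where f="\<lambda>s. (D * M) * indicator {0<..<t} s"])
    show "integrable lborel (\<lambda>s. (D * M) * indicator {0<..<t} s)" by (rule integrable_mult_right[OF indi])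
    have "norm (\<integral>x. \<bar>?f2 s x\<bar> \<partial>lborel) \<le> norm ((D * M) * indicator {0<..<t} s)" for s
    proof (cases "0 < s \<and> s < t")
      case True
      have "(\<integral>x. \<bar>?f2 s x\<bar> \<partial>lborel) = (\<integral>x. \<bar>gk b (x - s) * ?z x\<bar> \<partial>lborel) * \<bar>k s\<bar>"
        by (simp add: abs_mult)
      moreover have "0 \<le> (\<integral>x. \<bar>gk b (x - s) * ?z x\<bar> \<partial>lborel)" by (rule Bochner_Integration.integral_nonneg) simp
      moreover have "(\<integral>x. \<bar>gk b (x - s) * ?z x\<bar> \<partial>lborel) \<le> D" using D True by blast
      ultimately have "(\<integral>x. \<bar>?f2 s x\<bar> \<partial>lborel) \<le> D * M"
        using mult_mono[of "\<integral>x. \<bar>gk b (x - s) * ?z x\<bar> \<partial>lborel" D "\<bar>k s\<bar>" M] kM[of s] by linarith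
      moreover have "0 \<le> (\<integral>x. \<bar>?f2 s x\<bar> \<partial>lborel)" by (rule Bochner_Integration.integral_nonneg) simp
      ultimately show ?thesis using True by simp
    next
      case False
      then have "k s = 0" using k0[of s] kt[of s] by auto
      then show ?thesis by simp
    qed
    then show "AE s in lborel. norm (\<integral>x. \<bar>?f2 s x\<bar> \<partial>lborel) \<le> norm ((D * M) * indicator {0<..<t} s)" by simp
  qed measurable
  note sw2 = integral_swap[OF f2m AE_I2[OF f2i] f2i2]
  have inner2: "(\<integral>s. ?f2 s x \<partial>lborel) = (?z x)\<^sup>2" for x
  proof -
    have "(\<integral>s. ?f2 s x \<partial>lborel) = (\<integral>s. ?z x * (gk b (x - s) * k s) \<partial>lborel)"
      by (rule Bochner_Integration.integral_cong) auto
    also have "\<dots> = ?z x * cv b k x" by (simp only: cv_def[of b k x, symmetric] integral_mult_right_zero)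
    finally show ?thesis by (simp only: power2_eq_square)
  qed
  show "integrable lborel (\<lambda>x. (?z x)\<^sup>2)" using sw2(2) by (simp only: inner2)
  define Q where "Q s = (\<integral>r. gk (2 * b) (r - s) * k r \<partial>lborel)" for s
  have Qm [measurable]: "Q \<in> borel_measurable borel" unfolding Q_def[abs_def] by measurable
  have ind: "integrable lborel (\<lambda>s. k s * g s)"
    if [measurable]: "g \<in> borel_measurable borel" and g: "\<And>s. 0 < s \<Longrightarrow> s < t \<Longrightarrow> \<bar>g s\<bar> \<le> M * gk (2 * b + 1) t" for g :: "real \<Rightarrow> real"
  proof (rule Bochner_Integration.integrable_bound[where f="\<lambda>s. (M * (M * gk (2 * b + 1) t)) * indicator {0<..<t} s"])
    have "norm (k s * g s) \<le> norm ((M * (M * gk (2 * b + 1) t)) * indicator {0<..<t} s)" for s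
    proof (cases "0 < s \<and> s < t")
      case True
      then have "\<bar>k s\<bar> * \<bar>g s\<bar> \<le> M * (M * gk (2 * b + 1) t)" using g kM[of s] M by (intro mult_mono) auto
      then have "norm (k s * g s) \<le> M * (M * gk (2 * b + 1) t)" by (simp add: abs_mult)
      also have "\<dots> \<le> norm ((M * (M * gk (2 * b + 1) t)) * indicator {0<..<t} s)"
        using True abs_ge_self[of "M * (M * gk (2 * b + 1) t)"] by simp
      finally show ?thesis .
    next
      case False
      then have "k s = 0" using k0[of s] kt[of s] by auto
      then show ?thesis by simp
    qed
    then show "AE s in lborel. norm (k s * g s) \<le> norm ((M * (M * gk (2 * b + 1) t)) * indicator {0<..<t} s)" by simp
    show "integrable lborel (\<lambda>s. (M * (M * gk (2 * b + 1) t)) * indicator {0<..<t} s)"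
      by (rule integrable_mult_right[OF indi])
  qed measurable
  have cvb: "\<bar>cv (2 * b) k s\<bar> \<le> M * gk (2 * b + 1) t" if "0 < s" "s < t" for s
  proof -
    have "\<bar>cv (2 * b) k s\<bar> \<le> M * gk (2 * b + 1) s" by (rule cv_integrable(2)[OF b2 m k0 kM])
    also have "\<dots> \<le> M * gk (2 * b + 1) t" using M b that by (intro mult_left_mono gk_mono) auto
    finally show ?thesis .
  qed
  have i1: "integrable lborel (\<lambda>s. k s * cv (2 * b) k s)" by (rule ind[OF _ cvb]) measurable
  have Qb: "\<bar>Q s\<bar> \<le> M * gk (2 * b + 1) t" if "0 < s" for s
    unfolding Q_def using Bint[OF m refl, of s] that by blast
  have i3: "integrable lborel (\<lambda>s. k s * Q s)" by (rule ind[OF _ Qb]) measurable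
  \<comment> \<open>The half with r > s is the adjoint of \<open>cv (2 * b)\<close>, so both halves
    of \<open>P\<close> contribute equally; hence the factor 2.\<close>
  have symm: "(\<integral>s. k s * Q s \<partial>lborel) = (\<integral>s. k s * cv (2 * b) k s \<partial>lborel)"
  proof -
    let ?f3 = "\<lambda>s r. (gk (2 * b) (r - s) * k r) * k s"
    have f3i: "integrable lborel (?f3 s)" for s
      by (rule integrable_mult_left) (use Bint[OF m refl, of s] in blast)
    have m3: "(\<lambda>(s, r). ?f3 s r) \<in> borel_measurable (lborel \<Otimes>\<^sub>M lborel)" by measurable
    let ?Q' = "\<lambda>s. \<integral>r. gk (2 * b) (r - s) * \<bar>k r\<bar> \<partial>lborel"
    have "integrable lborel (\<lambda>s. \<bar>k s * ?Q' s\<bar>)"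
      by (rule integrable_abs, rule ind) (use Bint[of ?k'] in simp_all)
    moreover have "(\<integral>r. \<bar>?f3 s r\<bar> \<partial>lborel) = \<bar>k s * ?Q' s\<bar>" for s
    proof -
      have "0 \<le> ?Q' s" using gk_nonneg[OF b2] by (intro Bochner_Integration.integral_nonneg) simp
      then show ?thesis using gk_nonneg[OF b2] by (simp add: abs_mult mult.commute)
    qed
    ultimately have f3i2: "integrable lborel (\<lambda>s. \<integral>r. \<bar>?f3 s r\<bar> \<partial>lborel)" by (simp only:)
    have 1: "(\<integral>s. \<integral>r. ?f3 s r \<partial>lborel \<partial>lborel) = (\<integral>s. k s * Q s \<partial>lborel)"
      by (simp only: Q_def integral_mult_left_zero mult.commute[of "k _"])
    have 2: "(\<integral>r. \<integral>s. ?f3 s r \<partial>lborel \<partial>lborel) = (\<integral>r. k r * cv (2 * b) k r \<partial>lborel)"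
    proof (rule Bochner_Integration.integral_cong[OF refl])
      fix r
      have "(\<integral>s. ?f3 s r \<partial>lborel) = (\<integral>s. k r * (gk (2 * b) (r - s) * k s) \<partial>lborel)"
        by (rule Bochner_Integration.integral_cong) auto
      then show "(\<integral>s. ?f3 s r \<partial>lborel) = k r * cv (2 * b) k r"
        by (simp only: cv_def integral_mult_right_zero)
    qed
    show ?thesis using integral_swap(1)[OF m3 AE_I2[OF f3i] f3i2] unfolding 1 2 .
  qed
  have "(\<integral>x. (?z x)\<^sup>2 \<partial>lborel) = (\<integral>s. \<integral>x. ?f2 s x \<partial>lborel \<partial>lborel)"
    using sw2(1) by (simp only: inner2)
  also have "\<dots> = (\<integral>s. c * (k s * cv (2 * b) k s + k s * Q s) \<partial>lborel)"
  proof (rule Bochner_Integration.integral_cong[OF refl])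
    fix s
    have e: "(\<integral>x. ?f2 s x \<partial>lborel) = c * (\<integral>r. P r s * k r \<partial>lborel) * k s"
      using s1k[of s] by (simp only: integral_mult_left_zero)
    show "(\<integral>x. ?f2 s x \<partial>lborel) = c * (k s * cv (2 * b) k s + k s * Q s)"
      unfolding e PI(2)[OF m refl] Q_def[symmetric] by (simp add: algebra_simps)
  qed
  also have "\<dots> = c * ((\<integral>s. k s * cv (2 * b) k s \<partial>lborel) + (\<integral>s. k s * Q s \<partial>lborel))"
    using i1 i3 by simp
  also have "\<dots> = 2 * overlap b * Gamma (2 * b) * (\<integral>s. k s * cv (2 * b) k s \<partial>lborel)"
    unfolding symm c_def by simp
  finally show "(\<integral>x. (?z x)\<^sup>2 \<partial>lborel) = 2 * overlap b * Gamma (2 * b) * (\<integral>s. k s * cv (2 * b) k s \<partial>lborel)" .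
qed


text \<open>Young's inequality with a free weight, without a sharp constant: twice the product is
  bounded by the completed square.\<close>

lemma abs_le_square_bound:
  fixes x y e :: real
  assumes "0 < e"
  shows "\<bar>x * y\<bar> \<le> e * y\<^sup>2 + x\<^sup>2 / e"
proof -
  have "2 * (e * \<bar>y\<bar>) * \<bar>x\<bar> \<le> (e * \<bar>y\<bar>)\<^sup>2 + \<bar>x\<bar>\<^sup>2" by (rule sum_squares_bound)
  moreover have "0 \<le> (e * \<bar>y\<bar>) * \<bar>x\<bar>" using assms by simp
  ultimately have "\<bar>x\<bar> * \<bar>y\<bar> * e \<le> (e * \<bar>y\<bar>)\<^sup>2 + \<bar>x\<bar>\<^sup>2" by (simp only: mult_ac)
  then have "\<bar>x\<bar> * \<bar>y\<bar> \<le> ((e * \<bar>y\<bar>)\<^sup>2 + \<bar>x\<bar>\<^sup>2) / e" using assms by (simp only: pos_le_divide_eq)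
  also have "\<dots> = e * y\<^sup>2 + x\<^sup>2 / e"
    using assms by (simp add: add_divide_distrib power_mult_distrib power2_eq_square)
  finally show ?thesis by (simp only: abs_mult)
qed

text \<open>Testing the equation with \<open>w = u'\<close> bounds \<open>u\<close>; the term with the initial velocity is absorbed because
  \<open>\<integral>h\<close> is the fractional integral of order \<open>1 - b\<close> of \<open>z\<close>, whose kernel is square integrable.\<close>

theorem fractional_energy_estimate:
  assumes T: "0 < T" and \<beta>: "0 < \<beta>" "\<beta> < 1"
  shows "\<exists>C>0. \<forall>l f F u0 u1 u h M t. 0 \<le> l \<longrightarrow> f \<in> borel_measurable borel \<longrightarrow> (\<forall>s. \<bar>f s\<bar> \<le> F) \<longrightarrow>
    h \<in> borel_measurable borel \<longrightarrow> (\<forall>s. \<bar>h s\<bar> \<le> M) \<longrightarrow> (\<forall>s\<le>0. h s = 0) \<longrightarrow>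
    (\<forall>s. 0 < s \<longrightarrow> s < T \<longrightarrow> h s = f s - l * u s) \<longrightarrow> (\<forall>s\<in>{0..T}. u s = u0 + u1 * s + cv (1 + \<beta>) h s) \<longrightarrow>
    t \<in> {0..T} \<longrightarrow> l * (u t)\<^sup>2 \<le> l * u0\<^sup>2 + C * (u1\<^sup>2 + F\<^sup>2)"
proof -
  define b where "b = \<beta> / 2"
  have b: "0 < b" "b < 1 / 2" and \<beta>b: "\<beta> = 2 * b" "b + b = \<beta>" using \<beta> by (auto simp: b_def)
  \<comment> \<open>Chosen so that pairing k with its fractional integral of order \<beta> gives A
    times the squared L^2 norm of z.\<close>
  define A where "A = 1 / (2 * overlap b * Gamma (2 * b))"
  have A: "0 < A" unfolding A_def using overlap_pos[OF b] Gamma_real_pos[of "2 * b"] b by simp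
  \<comment> \<open>The square of the kernel of order 1 - b is c1 times the kernel of order 1 - 2 b,
    and this order is positive.\<close>
  define c1 where "c1 = Gamma (1 - 2 * b) / (Gamma (1 - b))\<^sup>2"
  have c1: "0 \<le> c1" unfolding c1_def using b Gamma_real_pos[of "1 - 2 * b"] by simp
  define D1 where "D1 = c1 * gk (2 - 2 * b) T"
  \<comment> \<open>An upper bound for the squared L^2 norm on (0, T) of the kernel of order 1 + b,
    which is increasing.\<close>
  define D2 where "D2 = (gk (1 + b) T)\<^sup>2 * T"
  have D: "0 \<le> D1" "0 \<le> D2" using c1 b T by (auto simp: D1_def D2_def intro!: mult_nonneg_nonneg gk_nonneg)
  \<comment> \<open>Two terms will cost e Z each; the coercive term A Z = 4 e Z absorbs
    both.\<close>
  define e where "e = A / 4"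
  have e: "0 < e" using A by (simp add: e_def)
  define C where "C = 2 * (D1 / e + D2 / e + T) + 1"
  have C: "0 < C" unfolding C_def using D e T by (simp add: add_nonneg_pos)
  have main: "l * (u t)\<^sup>2 \<le> l * u0\<^sup>2 + C * (u1\<^sup>2 + F\<^sup>2)"
    if l: "0 \<le> l" and fm [measurable]: "f \<in> borel_measurable borel" and fF: "\<And>s. \<bar>f s\<bar> \<le> F"
      and hm [measurable]: "h \<in> borel_measurable borel" and hM: "\<And>s. \<bar>h s\<bar> \<le> M" and h0: "\<And>s. s \<le> 0 \<Longrightarrow> h s = 0"
      and hf: "\<And>s. 0 < s \<Longrightarrow> s < T \<Longrightarrow> h s = f s - l * u s"
      and ueq: "\<And>s. s \<in> {0..T} \<Longrightarrow> u s = u0 + u1 * s + cv (1 + \<beta>) h s" and t: "0 < t" "t \<le> T" for l f F u0 u1 u h M t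
  proof -
    have F: "0 \<le> F" using fF[of 0] by linarith
    have M: "0 \<le> M" using hM[of 0] by linarith
    define w where "w s = u1 + cv \<beta> h s" for s
    have cvc: "continuous_on X (cv \<beta> h)" for X by (rule cv_continuous[OF \<beta>(1) less_imp_le[OF \<beta>(2)] hm h0 hM])
    have wc: "continuous_on X w" for X unfolding w_def by (intro continuous_intros cvc)
    have [measurable]: "w \<in> borel_measurable borel" unfolding w_def[abs_def] by measurable
    have deriv: "(u has_real_derivative w s) (at s within {0..t})" if s: "s \<in> {0..t}" for s
    proof (rule has_field_derivative_transform_within[OF _ zero_less_one s])
      have "s \<in> {0..T}" using s t by auto
      note cv_deriv[OF \<beta>(1) less_imp_le[OF \<beta>(2)] hm h0 hM this]
      then have "(cv (1 + \<beta>) h has_real_derivative cv \<beta> h s) (at s within {0..t})"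
        by (rule DERIV_subset) (use t in auto)
      then show "((\<lambda>s. u0 + u1 * s + cv (1 + \<beta>) h s) has_real_derivative w s) (at s within {0..t})"
        unfolding w_def by (auto intro!: derivative_eq_intros)
      show "u0 + u1 * x + cv (1 + \<beta>) h x = u x" if "x \<in> {0..t}" for x
        using ueq[of x] that t by auto
    qed
    have uc: "continuous_on {0..t} u" by (rule DERIV_continuous_on[OF deriv])
    have u00: "u 0 = u0" using ueq[of 0] T cv_zero[of h 0 "1 + \<beta>"] h0 by simp
    have FTC: "has_bochner_integral lborel (\<lambda>s. indicator {0..t} s *\<^sub>R (u s * w s)) ((u t)\<^sup>2 / 2 - (u 0)\<^sup>2 / 2)"
    proof (rule has_bochner_integral_FTC_Icc)
      show "((\<lambda>s. (u s)\<^sup>2 / 2) has_vector_derivative u s * w s) (at s within {0..t})" if "0 \<le> s" "s \<le> t" for s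
        using deriv[of s] that unfolding has_real_derivative_iff_has_vector_derivative[symmetric]
        by (auto intro!: derivative_eq_intros simp: power2_eq_square)
      show "continuous_on {0..t} (\<lambda>s. u s * w s)" by (intro continuous_on_mult uc wc)
    qed (use t in simp)
    \<comment> \<open>Cutting h off at t changes no fractional integral up to time t and provides
      the bounded support that \<open>cv_energy\<close> asks for.\<close>
    define k where "k s = indicator {0<..<t} s * h s" for s
    have km [measurable]: "k \<in> borel_measurable borel" unfolding k_def[abs_def] by measurable
    have k0: "k s = 0" if "s \<le> 0" for s using that by (simp add: k_def)
    have kt: "k s = 0" if "t \<le> s" for s using that by (simp add: k_def)
    have kM: "\<bar>k s\<bar> \<le> M" for s using hM[of s] M by (auto simp: k_def indicator_def)
    have kh: "cv a k s = cv a h s" if "s \<le> t" for a s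
      by (rule cv_cong) (use that h0 in \<open>auto simp: k_def indicator_def\<close>)
    define z where "z = cv b k"
    have zm [measurable]: "z \<in> borel_measurable borel" unfolding z_def by measurable
    have z0: "z s = 0" if "s \<le> 0" for s unfolding z_def by (rule cv_zero[OF k0 that])
    have zb: "\<bar>z s\<bar> \<le> M * gk (b + 1) T" if "s < T" for s
    proof -
      have "\<bar>z s\<bar> \<le> M * gk (b + 1) s" unfolding z_def by (rule cv_integrable(2)[OF b(1) km k0 kM])
      also have "\<dots> \<le> M * gk (b + 1) T" using M b that by (intro mult_left_mono gk_mono) auto
      finally show ?thesis .
    qed
    have zi: "integrable lborel (\<lambda>s. (z s)\<^sup>2)" unfolding z_def by (rule cv_energy(1)[OF b km k0 kt kM])
    define Z where "Z = (\<integral>s. (z s)\<^sup>2 \<partial>lborel)"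
    have kk: "(\<integral>s. k s * cv \<beta> k s \<partial>lborel) = A * Z"
      using cv_energy(2)[OF b km k0 kt kM] A unfolding A_def Z_def z_def \<beta>b(1) by (auto simp: field_simps)
    have bint: "integrable lborel (\<lambda>s. indicator {0<..<t} s * g s)"
      if [measurable]: "g \<in> borel_measurable borel" and g: "\<And>s. 0 < s \<Longrightarrow> s < t \<Longrightarrow> \<bar>g s\<bar> \<le> B" for g :: "real \<Rightarrow> real" and B
    proof (rule Bochner_Integration.integrable_bound[where f="\<lambda>s. B * indicator {0<..<t} s"])
      show "integrable lborel (\<lambda>s. B * indicator {0<..<t} s)" by (rule integrable_mult_right) (use t in simp)
      show "AE s in lborel. norm (indicator {0<..<t} s * g s) \<le> norm (B * indicator {0<..<t} s)"
        using g by (intro AE_I2) (fastforce simp: indicator_def)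
    qed measurable
    have ki: "integrable lborel k" unfolding k_def[abs_def] by (rule bint[OF hm hM])
    have kcvi: "integrable lborel (\<lambda>s. indicator {0<..<t} s * (h s * cv \<beta> h s))"
    proof (rule bint)
      show "\<bar>h s * cv \<beta> h s\<bar> \<le> M * (M * gk (\<beta> + 1) t)" if "0 < s" "s < t" for s
      proof -
        have "\<bar>cv \<beta> h s\<bar> \<le> M * gk (\<beta> + 1) s" by (rule cv_integrable(2)[OF \<beta>(1) hm h0 hM])
        also have "\<dots> \<le> M * gk (\<beta> + 1) t" using M \<beta> that by (intro mult_left_mono gk_mono) auto
        finally show ?thesis unfolding abs_mult using hM[of s] M by (intro mult_mono) auto
      qed
    qed measurable
    have kcv: "k s * cv \<beta> k s = indicator {0<..<t} s * (h s * cv \<beta> h s)" for s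
      using kh[of s \<beta>] by (auto simp: k_def indicator_def)
    have hw: "(\<integral>s. indicator {0<..<t} s * (h s * w s) \<partial>lborel) = u1 * (\<integral>s. k s \<partial>lborel) + A * Z"
    proof -
      have "(\<integral>s. indicator {0<..<t} s * (h s * w s) \<partial>lborel) = (\<integral>s. u1 * k s + k s * cv \<beta> k s \<partial>lborel)"
        unfolding kcv by (intro Bochner_Integration.integral_cong refl) (auto simp: w_def k_def indicator_def algebra_simps)
      also have "\<dots> = (\<integral>s. u1 * k s \<partial>lborel) + (\<integral>s. k s * cv \<beta> k s \<partial>lborel)"
        by (rule Bochner_Integration.integral_add[OF integrable_mult_right[OF ki]]) (unfold kcv, rule kcvi)
      finally show ?thesis by (simp only: kk integral_mult_right_zero)
    qed
    have wb: "\<exists>B. \<forall>s\<in>{0..t}. \<bar>w s\<bar> \<le> B"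
      using compact_imp_bounded[OF compact_continuous_image[OF wc compact_Icc]] unfolding bounded_iff by fastforce
    then obtain B where B: "\<And>s. s \<in> {0..t} \<Longrightarrow> \<bar>w s\<bar> \<le> B" by blast
    have fwi: "integrable lborel (\<lambda>s. indicator {0<..<t} s * (f s * w s))"
      by (rule bint[of _ "F * B"]) (use fF B F in \<open>auto simp: abs_mult intro!: mult_mono\<close>)
    have uwi: "has_bochner_integral lborel (\<lambda>s. indicator {0<..<t} s * (u s * w s)) ((u t)\<^sup>2 / 2 - u0\<^sup>2 / 2)"
    proof -
      have m: "(\<lambda>s. indicator {0..t} s *\<^sub>R (u s * w s)) \<in> borel_measurable lborel"
        using FTC unfolding has_bochner_integral_iff by (elim conjE) (rule borel_measurable_integrable)
      have eq: "indicator {0<..<t} s * (u s * w s) = indicator {0<..<t} s * (indicator {0..t} s *\<^sub>R (u s * w s))" for s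
        by (auto simp: indicator_def)
      have m2: "(\<lambda>s. indicator {0<..<t} s * (u s * w s)) \<in> borel_measurable lborel"
        unfolding eq by (rule borel_measurable_times[OF borel_measurable_indicator m]) simp
      have ae: "AE s in lborel. indicator {0..t} s *\<^sub>R (u s * w s) = indicator {0<..<t} s * (u s * w s)"
        using AE_lborel_singleton[of 0] AE_lborel_singleton[of t] by eventually_elim (auto simp: indicator_def)
      show ?thesis using FTC has_bochner_integral_cong_AE[OF m m2 ae] unfolding u00 by (simp only:)
    qed
    have hfu: "(\<integral>s. indicator {0<..<t} s * (h s * w s) \<partial>lborel) =
        (\<integral>s. indicator {0<..<t} s * (f s * w s) \<partial>lborel) - l * ((u t)\<^sup>2 / 2 - u0\<^sup>2 / 2)"
    proof -
      have "(\<integral>s. indicator {0<..<t} s * (h s * w s) \<partial>lborel) =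
          (\<integral>s. indicator {0<..<t} s * (f s * w s) - l * (indicator {0<..<t} s * (u s * w s)) \<partial>lborel)"
      proof (rule Bochner_Integration.integral_cong[OF refl])
        fix s
        show "indicator {0<..<t} s * (h s * w s) = indicator {0<..<t} s * (f s * w s) - l * (indicator {0<..<t} s * (u s * w s))"
        proof (cases "0 < s \<and> s < t")
          case True
          then have "h s = f s - l * u s" using hf[of s] t by simp
          then show ?thesis using True by (simp add: left_diff_distrib)
        qed (auto simp: indicator_def)
      qed
      also have "\<dots> = (\<integral>s. indicator {0<..<t} s * (f s * w s) \<partial>lborel) - (\<integral>s. l * (indicator {0<..<t} s * (u s * w s)) \<partial>lborel)"
        using uwi by (intro Bochner_Integration.integral_diff fwi integrable_mult_right) (simp add: has_bochner_integral_iff)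
      finally show ?thesis using uwi by (simp only: has_bochner_integral_iff integral_mult_right_zero)
    qed
    \<comment> \<open>The integral of k is I^(1-b) z by the semigroup law; Young's inequality is
      applied under the integral.\<close>
    have K: "\<bar>u1 * (\<integral>s. k s \<partial>lborel)\<bar> \<le> e * Z + u1\<^sup>2 * D1 / e"
    proof -
      have "(\<integral>s. k s \<partial>lborel) = cv 1 k t"
        unfolding cv_1 by (intro Bochner_Integration.integral_cong refl) (auto simp: indicator_def kt)
      also have "\<dots> = cv (1 - b) z t"
        unfolding z_def using cv_cv[of "1 - b" b k t M] b km k0 kM by simp
      finally have eq: "u1 * (\<integral>s. k s \<partial>lborel) = (\<integral>s. u1 * (gk (1 - b) (t - s) * z s) \<partial>lborel)"
        by (simp only: cv_def integral_mult_right_zero)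
      have zi': "integrable lborel (\<lambda>s. gk (1 - b) (t - s) * z s)"
        by (rule cv_integrable(1)[OF _ zm z0 zb]) (use b t in auto)
      have g2: "has_bochner_integral lborel (\<lambda>s. (u1\<^sup>2 * c1 / e) * (gk (1 - 2 * b) (t - s) * gk 1 s)) ((u1\<^sup>2 * c1 / e) * gk (1 - 2 * b + 1) t)"
        using b by (intro has_bochner_integral_mult_right gk_beta) auto
      have le: "\<bar>u1 * (gk (1 - b) (t - s) * z s)\<bar> \<le> e * (z s)\<^sup>2 + (u1\<^sup>2 * c1 / e) * (gk (1 - 2 * b) (t - s) * gk 1 s)" for s
      proof (cases "s \<le> 0")
        case True
        then show ?thesis by (simp add: z0 gk_1)
      next
        case False
        have sq: "(gk (1 - b) (t - s))\<^sup>2 = c1 * gk (1 - 2 * b) (t - s)"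
        proof (cases "s < t")
          case True
          have "((t - s) powr (- b))\<^sup>2 = (t - s) powr (- 2 * b)"
            using True by (simp add: power2_eq_square powr_add[symmetric])
          moreover have "0 < Gamma (1 - 2 * b)" using b by (intro Gamma_real_pos) simp
          ultimately show ?thesis using True by (simp add: gk_def c1_def power_divide)
        qed (simp add: gk_def)
        have "\<bar>(u1 * gk (1 - b) (t - s)) * z s\<bar> \<le> e * (z s)\<^sup>2 + (u1 * gk (1 - b) (t - s))\<^sup>2 / e"
          by (rule abs_le_square_bound[OF e])
        then show ?thesis using False by (simp add: power_mult_distrib sq gk_1 mult.assoc)
      qed
      have "\<bar>\<integral>s. u1 * (gk (1 - b) (t - s) * z s) \<partial>lborel\<bar> \<le>
          (\<integral>s. e * (z s)\<^sup>2 + (u1\<^sup>2 * c1 / e) * (gk (1 - 2 * b) (t - s) * gk 1 s) \<partial>lborel)"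
        unfolding real_norm_def[symmetric]
        by (rule Bochner_Integration.integral_norm_bound_integral[OF integrable_mult_right[OF zi']
              Bochner_Integration.integrable_add[OF integrable_mult_right[OF zi]]])
           (use g2 le in \<open>auto simp: has_bochner_integral_iff\<close>)
      also have "\<dots> = (\<integral>s. e * (z s)\<^sup>2 \<partial>lborel) + (\<integral>s. (u1\<^sup>2 * c1 / e) * (gk (1 - 2 * b) (t - s) * gk 1 s) \<partial>lborel)"
        by (rule Bochner_Integration.integral_add[OF integrable_mult_right[OF zi]]) (use g2 in \<open>auto simp: has_bochner_integral_iff\<close>)
      also have "\<dots> = e * Z + (u1\<^sup>2 * c1 / e) * gk (1 - 2 * b + 1) t"
        using g2 unfolding Z_def by (simp only: has_bochner_integral_iff integral_mult_right_zero)
      also have "\<dots> \<le> e * Z + (u1\<^sup>2 * c1 / e) * gk (2 - 2 * b) T"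
        using b t c1 e gk_mono[of "2 - 2 * b" t T] by (intro add_left_mono mult_left_mono) auto
      finally show ?thesis unfolding eq D1_def by simp
    qed
    \<comment> \<open>Here w = u1 + I^b z, so the forcing term is at most F |u1| t + F I^(1+b) |z|;
      the semigroup law merges the time integral with I^b.\<close>
    have W: "(\<integral>s. indicator {0<..<t} s * (f s * w s) \<partial>lborel) \<le> T * (u1\<^sup>2 + F\<^sup>2) + (e * Z + F\<^sup>2 * D2 / e)"
    proof -
      let ?az = "\<lambda>s. \<bar>z s\<bar>"
      have az0: "?az s = 0" if "s \<le> 0" for s using z0[OF that] by simp
      have azb: "\<bar>?az s\<bar> \<le> M * gk (b + 1) T" if "s < T" for s using zb[OF that] by simp
      have azb': "\<bar>?az s\<bar> \<le> M * gk (b + 1) T" if "s < t" for s using azb[of s] that t by simp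
      have azm: "?az \<in> borel_measurable borel" by measurable
      have b1: "0 < 1 + b" using b by simp
      have cvz: "\<bar>cv \<beta> h s\<bar> \<le> cv b ?az s" if "s \<le> t" for s
      proof -
        have "cv \<beta> h s = cv \<beta> k s" using kh[OF that] by simp
        also have "\<dots> = cv b z s" using cv_cv[OF b(1) b(1) km k0 kM, of s] unfolding z_def \<beta>b(2) by simp
        finally have "\<bar>cv \<beta> h s\<bar> \<le> (\<integral>r. \<bar>gk b (s - r) * z r\<bar> \<partial>lborel)"
          unfolding cv_def using integral_abs_bound by metis
        also have "\<dots> = cv b ?az s" unfolding cv_def using gk_nonneg[OF b(1)] by (simp add: abs_mult)
        finally show ?thesis .
      qed
      have cvaz0: "0 \<le> cv b ?az s" for s
        unfolding cv_def using gk_nonneg[OF b(1)] by (intro Bochner_Integration.integral_nonneg) simp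
      have azi: "integrable lborel (\<lambda>s. indicator {..<t} s * cv b ?az s)"
      proof -
        have "integrable lborel (\<lambda>s. gk 1 (t - s) * cv b ?az s)"
        proof (rule cv_integrable(1)[of _ _ _ "M * gk (b + 1) T * gk (b + 1) T"])
          show "cv b ?az s = 0" if "s \<le> 0" for s by (rule cv_zero[OF az0 that])
          show "\<bar>cv b ?az s\<bar> \<le> M * gk (b + 1) T * gk (b + 1) T" if s: "s < t" for s
          proof -
            have "\<bar>cv b ?az s\<bar> \<le> M * gk (b + 1) T * gk (b + 1) s"
              by (rule cv_integrable(2)[OF b(1) azm az0 azb]) (use s t in auto)
            also have "\<dots> \<le> M * gk (b + 1) T * gk (b + 1) T"
              using M b s t gk_nonneg[of "b + 1" T] by (intro mult_left_mono gk_mono mult_nonneg_nonneg) auto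
            finally show ?thesis .
          qed
        qed measurable
        moreover have "gk 1 (t - s) * cv b ?az s = indicator {..<t} s * cv b ?az s" for s
          by (auto simp: gk_1 indicator_def)
        ultimately show ?thesis by (simp only:)
      qed
      \<comment> \<open>Young's inequality is applied with the factor F inside, which is then
        divided out; this is why F = 0 is treated apart.\<close>
      have c: "cv (1 + b) ?az t \<le> (e * Z + F\<^sup>2 * D2 / e) / F" if "0 < F"
      proof -
        let ?G = "gk (1 + b) T"
        have i: "integrable lborel (\<lambda>s. gk (1 + b) (t - s) * ?az s)"
          by (rule cv_integrable(1)[OF b1 azm az0 azb'])
        have g2: "has_bochner_integral lborel (\<lambda>s. (F\<^sup>2 * ?G\<^sup>2 / e) * indicator {0<..<T} s) ((F\<^sup>2 * ?G\<^sup>2 / e) * T)"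
          using T by (intro has_bochner_integral_mult_right) (simp add: has_bochner_integral_iff)
        have le: "\<bar>F * (gk (1 + b) (t - s) * ?az s)\<bar> \<le> e * (z s)\<^sup>2 + (F\<^sup>2 * ?G\<^sup>2 / e) * indicator {0<..<T} s" for s
        proof (cases "0 < s \<and> s < t")
          case True
          have "\<bar>F * (gk (1 + b) (t - s) * ?az s)\<bar> \<le> \<bar>(F * ?G) * z s\<bar>"
            using True t b F gk_nonneg[OF b1, of "t - s"] gk_nonneg[OF b1, of T] gk_mono[of "1 + b" "t - s" T]
            by (auto simp: abs_mult mult.assoc intro!: mult_left_mono mult_right_mono)
          also have "\<dots> \<le> e * (z s)\<^sup>2 + (F * ?G)\<^sup>2 / e" by (rule abs_le_square_bound[OF e])
          finally show ?thesis using True t by (simp add: power_mult_distrib)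
        next
          case False
          then have "gk (1 + b) (t - s) * ?az s = 0" using z0[of s] by (auto simp: gk_def)
          then have "\<bar>F * (gk (1 + b) (t - s) * ?az s)\<bar> = 0" by (simp only: mult_zero_right abs_zero)
          also have "0 \<le> e * (z s)\<^sup>2 + (F\<^sup>2 * ?G\<^sup>2 / e) * indicator {0<..<T} s" using e by (intro add_nonneg_nonneg mult_nonneg_nonneg) auto
          finally show ?thesis .
        qed
        have "F * cv (1 + b) ?az t = (\<integral>s. F * (gk (1 + b) (t - s) * ?az s) \<partial>lborel)"
          by (simp only: cv_def integral_mult_right_zero)
        also have "\<dots> \<le> (\<integral>s. e * (z s)\<^sup>2 + (F\<^sup>2 * ?G\<^sup>2 / e) * indicator {0<..<T} s \<partial>lborel)"
          by (rule integral_mono[OF integrable_mult_right[OF i] Bochner_Integration.integrable_add[OF integrable_mult_right[OF zi]]])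
             (use g2 order_trans[OF abs_ge_self le] in \<open>auto simp: has_bochner_integral_iff\<close>)
        also have "\<dots> = (\<integral>s. e * (z s)\<^sup>2 \<partial>lborel) + (\<integral>s. (F\<^sup>2 * ?G\<^sup>2 / e) * indicator {0<..<T} s \<partial>lborel)"
          by (rule Bochner_Integration.integral_add[OF integrable_mult_right[OF zi]]) (use g2 in \<open>auto simp: has_bochner_integral_iff\<close>)
        also have "\<dots> = e * Z + (F\<^sup>2 * ?G\<^sup>2 / e) * T"
          using g2 unfolding Z_def by (simp only: has_bochner_integral_iff integral_mult_right_zero)
        also have "\<dots> = e * Z + F\<^sup>2 * D2 / e" unfolding D2_def by simp
        finally show ?thesis using that by (simp add: pos_le_divide_eq mult.commute)
      qed
      have Z0: "0 \<le> Z" unfolding Z_def by (rule Bochner_Integration.integral_nonneg) simp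
      have "(\<integral>s. indicator {0<..<t} s * (f s * w s) \<partial>lborel) \<le>
          (\<integral>s. (F * \<bar>u1\<bar>) * indicator {0<..<t} s + F * (indicator {..<t} s * cv b ?az s) \<partial>lborel)"
      proof (rule integral_mono[OF fwi])
        show "integrable lborel (\<lambda>s. (F * \<bar>u1\<bar>) * indicator {0<..<t} s + F * (indicator {..<t} s * cv b ?az s))"
          by (rule Bochner_Integration.integrable_add[OF integrable_mult_right integrable_mult_right[OF azi]]) (use t in simp)
        show "indicator {0<..<t} s * (f s * w s) \<le> (F * \<bar>u1\<bar>) * indicator {0<..<t} s + F * (indicator {..<t} s * cv b ?az s)" for s
        proof (cases "0 < s \<and> s < t")
          case True
          have "f s * w s \<le> \<bar>f s\<bar> * \<bar>w s\<bar>" by (metis abs_ge_self abs_mult)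
          also have "\<dots> \<le> F * (\<bar>u1\<bar> + cv b ?az s)"
            using fF[of s] F cvz[of s] True cvaz0[of s] abs_triangle_ineq[of u1 "cv \<beta> h s"]
            by (intro mult_mono) (auto simp: w_def)
          finally show ?thesis using True by (simp add: distrib_left)
        next
          case False
          then show ?thesis using F cvaz0[of s] by (auto simp: indicator_def)
        qed
      qed
      also have "\<dots> = (\<integral>s. (F * \<bar>u1\<bar>) * indicator {0<..<t} s \<partial>lborel) + (\<integral>s. F * (indicator {..<t} s * cv b ?az s) \<partial>lborel)"
        by (rule Bochner_Integration.integral_add[OF integrable_mult_right integrable_mult_right[OF azi]]) (use t in simp)
      also have "\<dots> = F * \<bar>u1\<bar> * t + F * cv 1 (cv b ?az) t"
        using t by (simp add: cv_1)
      also have "cv 1 (cv b ?az) t = cv (1 + b) ?az t"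
        by (rule cv_cv[OF _ b(1) azm az0 azb']) simp_all
      also have "F * cv (1 + b) ?az t \<le> e * Z + F\<^sup>2 * D2 / e"
        using c F e D Z0 by (cases "F = 0") (auto simp: pos_le_divide_eq mult.commute)
      also have "F * \<bar>u1\<bar> * t \<le> T * (u1\<^sup>2 + F\<^sup>2)"
      proof -
        have "F * \<bar>u1\<bar> \<le> \<bar>F * \<bar>u1\<bar>\<bar>" by (rule abs_ge_self)
        also have "\<dots> \<le> 1 * \<bar>u1\<bar>\<^sup>2 + F\<^sup>2 / 1" by (rule abs_le_square_bound) simp
        finally have 1: "F * \<bar>u1\<bar> \<le> u1\<^sup>2 + F\<^sup>2" by simp
        have "F * \<bar>u1\<bar> * t \<le> (u1\<^sup>2 + F\<^sup>2) * T" using 1 t F by (intro mult_mono) auto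
        then show ?thesis by (simp only: mult.commute)
      qed
      finally show ?thesis by simp
    qed
    have Z0: "0 \<le> Z" unfolding Z_def by (rule Bochner_Integration.integral_nonneg) simp
    have AZ: "A * Z = 4 * (e * Z)" unfolding e_def by simp
    have eZ: "0 \<le> e * Z" using e Z0 by simp
    have "l * ((u t)\<^sup>2 / 2 - u0\<^sup>2 / 2) \<le> u1\<^sup>2 * D1 / e + F\<^sup>2 * D2 / e + T * (u1\<^sup>2 + F\<^sup>2)"
      using hw hfu K W AZ eZ by linarith
    moreover have "l * (u t)\<^sup>2 = 2 * (l * ((u t)\<^sup>2 / 2 - u0\<^sup>2 / 2)) + l * u0\<^sup>2" by (simp add: algebra_simps)
    moreover have "2 * (u1\<^sup>2 * D1 / e + F\<^sup>2 * D2 / e + T * (u1\<^sup>2 + F\<^sup>2)) \<le> C * (u1\<^sup>2 + F\<^sup>2)"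
    proof -
      define X where "X = u1\<^sup>2 + F\<^sup>2"
      have 1: "u1\<^sup>2 * D1 / e \<le> X * D1 / e" "F\<^sup>2 * D2 / e \<le> X * D2 / e"
        unfolding X_def using D e by (auto intro!: divide_right_mono mult_right_mono)
      have 2: "C * X = 2 * (X * D1 / e + X * D2 / e + T * X) + X"
        unfolding C_def by (simp add: add_divide_distrib algebra_simps)
      have 3: "0 \<le> X" by (simp add: X_def)
      have "2 * (a + b + c) \<le> 2 * (a' + b' + c) + d" if "a \<le> a'" "b \<le> b'" "0 \<le> d" for a b c d a' b' :: real
        by (rule add_increasing2[OF that(3)]) (intro mult_left_mono add_right_mono add_mono that, simp)
      from this[OF 1 3] show ?thesis unfolding X_def[symmetric] 2 .
    qed
    moreover have "p \<le> q + r" if "a \<le> b" "p = 2 * a + q" "2 * b \<le> r" for p q r a b :: real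
      using that by linarith
    ultimately show ?thesis by blast
  qed
  \<comment> \<open>At t = 0 the interval of integration degenerates; there u equals u0 and the
    claim only needs C to be positive.\<close>
  have main0: "l * (u t)\<^sup>2 \<le> l * u0\<^sup>2 + C * (u1\<^sup>2 + F\<^sup>2)"
    if "\<And>s. s \<le> 0 \<Longrightarrow> h s = 0" "\<And>s. s \<in> {0..T} \<Longrightarrow> u s = u0 + u1 * s + cv (1 + \<beta>) h s" "t = 0" for l u0 u1 F t :: real and u h
    using that(2)[of 0] that(3) T C cv_zero[of h 0 "1 + \<beta>", OF that(1)] by simp
  show ?thesis
  proof (intro exI[of _ C] conjI C allI impI)
    fix l f F u0 u1 u h M t
    assume a: "0 \<le> l" "f \<in> borel_measurable borel" "\<forall>s. \<bar>f s\<bar> \<le> F" "h \<in> borel_measurable borel" "\<forall>s. \<bar>h s\<bar> \<le> M"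
      "\<forall>s\<le>0. h s = 0" "\<forall>s. 0 < s \<longrightarrow> s < T \<longrightarrow> h s = f s - l * u s"
      "\<forall>s\<in>{0..T}. u s = u0 + u1 * s + cv (1 + \<beta>) h s" "t \<in> {0..T}"
    show "l * (u t)\<^sup>2 \<le> l * u0\<^sup>2 + C * (u1\<^sup>2 + F\<^sup>2)"
    proof (cases "t = 0")
      case True
      then show ?thesis using a by (intro main0) auto
    next
      case False
      then show ?thesis using a by (intro main[of l f F h M u u0 u1 t]) auto
    qed
  qed
qed

section \<open>The spectral scale in coefficients\<close>

abbreviation fcoeff :: "real \<Rightarrow> (real \<Rightarrow> real) \<Rightarrow> nat \<Rightarrow> real" where
  "fcoeff \<mu> v n \<equiv> Ltwo_inner Omega v (eigfun \<mu> n)"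

locale hardy_potential =
  fixes \<mu> :: real
  assumes subcritical: "\<mu> < 1 / 4"
begin

lemma eigval_pos: "0 < eigval \<mu> n" and eigval_ge: "eigval \<mu> 0 \<le> eigval \<mu> n"
proof -
  have L: "0 < eigval \<mu> 0" "mono (eigval \<mu>)"
    using eigenbasis_the_basis[OF subcritical] by (auto simp: eigenbasis_def)
  then show "eigval \<mu> 0 \<le> eigval \<mu> n" by (simp add: monoD)
  with L(1) show "0 < eigval \<mu> n" by linarith
qed

lemma basis_obtain:
  obtains K where "form_eigenbasis (Ltwo Omega) (Ltwo_inner Omega) sobolev_H10 (a_form \<mu>) (eigfun \<mu>) (eigval \<mu>) K"
  using form_eigenbasis_the_basis[OF subcritical] by blast

lemma Hs1_iff: "v \<in> Hs \<mu> 1 \<longleftrightarrow> v \<in> Ltwo Omega \<and> summable (\<lambda>n. eigval \<mu> n * (fcoeff \<mu> v n)\<^sup>2)"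
  unfolding Hs_def using eigval_pos by (simp add: less_imp_le)

lemma Hs1_eq: "Hs \<mu> 1 = sobolev_H10"
proof -
  obtain K where "form_eigenbasis (Ltwo Omega) (Ltwo_inner Omega) sobolev_H10 (a_form \<mu>) (eigfun \<mu>) (eigval \<mu>) K" by (rule basis_obtain)
  then interpret E: form_eigenbasis "Ltwo Omega" "Ltwo_inner Omega" sobolev_H10 "a_form \<mu>" "eigfun \<mu>" "eigval \<mu>" K .
  show ?thesis using Hs1_iff E.mem_V_iff by blast
qed

lemma Hs1_Ltwo: "v \<in> Hs \<mu> 1 \<Longrightarrow> v \<in> Ltwo Omega"
  and Hs1_summable: "v \<in> Hs \<mu> 1 \<Longrightarrow> summable (\<lambda>n. eigval \<mu> n * (fcoeff \<mu> v n)\<^sup>2)"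
  by (simp_all add: Hs1_iff)

lemma Hs_norm_eq: "Hs_norm \<mu> 1 v = sqrt (\<Sum>n. eigval \<mu> n * (fcoeff \<mu> v n)\<^sup>2)"
  unfolding Hs_norm_def using eigval_pos by (simp add: less_imp_le)

lemma Hdual_norm_eq: "Hdual_norm \<mu> 1 F = sqrt (\<Sum>n. (F (eigfun \<mu> n))\<^sup>2 / eigval \<mu> n)"
  unfolding Hdual_norm_def using eigval_pos by (simp add: powr_minus less_imp_le divide_inverse mult.commute)

lemma Hs1_add: "v \<in> Hs \<mu> 1 \<Longrightarrow> w \<in> Hs \<mu> 1 \<Longrightarrow> (\<lambda>x. v x + w x) \<in> Hs \<mu> 1"
  and Hs1_diff: "v \<in> Hs \<mu> 1 \<Longrightarrow> w \<in> Hs \<mu> 1 \<Longrightarrow> (\<lambda>x. v x - w x) \<in> Hs \<mu> 1"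
  and Hs1_scale: "v \<in> Hs \<mu> 1 \<Longrightarrow> (\<lambda>x. c * v x) \<in> Hs \<mu> 1"
  unfolding Hs1_eq by (rule H10_add Hardy.diff_mem H10_scale; assumption)+

lemma eigfun_Hs1: "eigfun \<mu> n \<in> Hs \<mu> 1"
  and eigfun_Ltwo: "eigfun \<mu> n \<in> Ltwo Omega"
  and fcoeff_eigfun: "fcoeff \<mu> (eigfun \<mu> m) n = (if m = n then 1 else 0)"
proof -
  obtain K where "form_eigenbasis (Ltwo Omega) (Ltwo_inner Omega) sobolev_H10 (a_form \<mu>) (eigfun \<mu>) (eigval \<mu>) K" by (rule basis_obtain)
  then interpret E: form_eigenbasis "Ltwo Omega" "Ltwo_inner Omega" sobolev_H10 "a_form \<mu>" "eigfun \<mu>" "eigval \<mu>" K .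
  show "eigfun \<mu> n \<in> Hs \<mu> 1" "eigfun \<mu> n \<in> Ltwo Omega" unfolding Hs1_eq by (rule E.phi_V, rule E.phi_mem)
  show "fcoeff \<mu> (eigfun \<mu> m) n = (if m = n then 1 else 0)" by (rule E.orthonormal)
qed

lemma a_form_sums: "v \<in> Hs \<mu> 1 \<Longrightarrow> w \<in> Hs \<mu> 1 \<Longrightarrow> (\<lambda>n. eigval \<mu> n * fcoeff \<mu> v n * fcoeff \<mu> w n) sums a_form \<mu> v w"
  and Parseval_sums: "f \<in> Ltwo Omega \<Longrightarrow> g \<in> Ltwo Omega \<Longrightarrow> (\<lambda>n. fcoeff \<mu> f n * fcoeff \<mu> g n) sums Ltwo_inner Omega f g"
  and fcoeff_zero_AE: "f \<in> Ltwo Omega \<Longrightarrow> (\<And>n. fcoeff \<mu> f n = 0) \<Longrightarrow> AE x in Omega. f x = 0"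
proof -
  obtain K where "form_eigenbasis (Ltwo Omega) (Ltwo_inner Omega) sobolev_H10 (a_form \<mu>) (eigfun \<mu>) (eigval \<mu>) K" by (rule basis_obtain)
  then interpret E: form_eigenbasis "Ltwo Omega" "Ltwo_inner Omega" sobolev_H10 "a_form \<mu>" "eigfun \<mu>" "eigval \<mu>" K .
  show "v \<in> Hs \<mu> 1 \<Longrightarrow> w \<in> Hs \<mu> 1 \<Longrightarrow> (\<lambda>n. eigval \<mu> n * fcoeff \<mu> v n * fcoeff \<mu> w n) sums a_form \<mu> v w"
    unfolding Hs1_eq by (rule E.A_sums)
  show "f \<in> Ltwo Omega \<Longrightarrow> g \<in> Ltwo Omega \<Longrightarrow> (\<lambda>n. fcoeff \<mu> f n * fcoeff \<mu> g n) sums Ltwo_inner Omega f g"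
    by (rule E.Parseval)
  show "f \<in> Ltwo Omega \<Longrightarrow> (\<And>n. fcoeff \<mu> f n = 0) \<Longrightarrow> AE x in Omega. f x = 0"
    using E.null_if_coeff_zero Ltwo_null by blast
qed

text \<open>Eigenvalues are bounded below by the first one, so weighted summability implies square
  summability, and Riesz-Fischer applies.\<close>

lemma Hs1_synthesis:
  assumes s: "summable (\<lambda>n. eigval \<mu> n * (c n)\<^sup>2)"
  shows "\<exists>v\<in>Hs \<mu> 1. \<forall>n. fcoeff \<mu> v n = c n"
proof -
  obtain K where "form_eigenbasis (Ltwo Omega) (Ltwo_inner Omega) sobolev_H10 (a_form \<mu>) (eigfun \<mu>) (eigval \<mu>) K" by (rule basis_obtain)
  then interpret E: form_eigenbasis "Ltwo Omega" "Ltwo_inner Omega" sobolev_H10 "a_form \<mu>" "eigfun \<mu>" "eigval \<mu>" K .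
  have "norm ((c n)\<^sup>2) \<le> 1 / eigval \<mu> 0 * (eigval \<mu> n * (c n)\<^sup>2)" for n
    using mult_right_mono[OF eigval_ge[of n] zero_le_power2[of "c n"]] eigval_pos[of 0] by (simp add: pos_le_divide_eq mult.commute)
  then have "summable (\<lambda>n. (c n)\<^sup>2)"
    by (rule summable_comparison_test'[OF summable_mult[OF s], of 0])
  from E.Riesz_Fischer[OF this] obtain v where "v \<in> Ltwo Omega" "\<forall>n. fcoeff \<mu> v n = c n" by blast
  then show ?thesis using s by (intro bexI[of _ v]) (auto simp: Hs1_iff)
qed

section \<open>Functionals on H^1 in terms of their coefficients\<close>

lemma pair_abs_le: "\<bar>c * x\<bar> \<le> c\<^sup>2 / eigval \<mu> n + eigval \<mu> n * x\<^sup>2"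
  using abs_le_square_bound[OF eigval_pos, of c x n] by simp

lemma pair_summable:
  assumes c: "summable (\<lambda>n. (c n)\<^sup>2 / eigval \<mu> n)" and v: "v \<in> Hs \<mu> 1"
  shows "summable (\<lambda>n. norm (c n * fcoeff \<mu> v n))"
  by (rule summable_comparison_test'[OF summable_add[OF c Hs1_summable[OF v]], of 0]) (use pair_abs_le in simp)

text \<open>The functional with prescribed values on the eigenfunctions. On
  \<open>Hs \<mu> 1\<close> the series converges absolutely when the squares of the coefficients,
  divided by the eigenvalues, are summable.\<close>

definition synth :: "(nat \<Rightarrow> real) \<Rightarrow> functional" where
  "synth c v = (\<Sum>n. c n * fcoeff \<mu> v n)"

lemma synth_eigfun: "synth c (eigfun \<mu> n) = c n"
proof -
  have "(\<lambda>k. c k * fcoeff \<mu> (eigfun \<mu> n) k) = (\<lambda>k. if k = n then c n else 0)"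
    by (auto simp: fcoeff_eigfun)
  then show ?thesis unfolding synth_def using sums_If_finite_set[of "{n}" "\<lambda>_. c n"] by (simp add: sums_iff)
qed

lemma weighted_Cauchy_Schwarz:
  assumes c: "summable (\<lambda>n. (c n)\<^sup>2 / eigval \<mu> n)" and v: "v \<in> Hs \<mu> 1"
  shows "\<bar>synth c v\<bar> \<le> sqrt (\<Sum>n. (c n)\<^sup>2 / eigval \<mu> n) * Hs_norm \<mu> 1 v"
proof -
  let ?s = "\<lambda>N. \<Sum>n<N. c n * fcoeff \<mu> v n"
  have "\<bar>?s N\<bar> \<le> sqrt (\<Sum>n. (c n)\<^sup>2 / eigval \<mu> n) * Hs_norm \<mu> 1 v" for N
  proof -
    have "\<bar>?s N\<bar> = \<bar>\<Sum>n<N. (c n / sqrt (eigval \<mu> n)) * (sqrt (eigval \<mu> n) * fcoeff \<mu> v n)\<bar>"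
      using eigval_pos by (intro arg_cong[where f=abs] sum.cong refl) (simp add: less_imp_neq[symmetric])
    also have "\<dots> \<le> (\<Sum>n<N. \<bar>c n / sqrt (eigval \<mu> n)\<bar> * \<bar>sqrt (eigval \<mu> n) * fcoeff \<mu> v n\<bar>)"
      by (rule order_trans[OF sum_abs]) (simp only: abs_mult order_refl)
    also have "\<dots> \<le> L2_set (\<lambda>n. c n / sqrt (eigval \<mu> n)) {..<N} * L2_set (\<lambda>n. sqrt (eigval \<mu> n) * fcoeff \<mu> v n) {..<N}"
      by (rule L2_set_mult_ineq)
    also have "\<dots> = sqrt (\<Sum>n<N. (c n)\<^sup>2 / eigval \<mu> n) * sqrt (\<Sum>n<N. eigval \<mu> n * (fcoeff \<mu> v n)\<^sup>2)"
      unfolding L2_set_def using eigval_pos by (simp add: power_divide power_mult_distrib less_imp_le)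
    also have "\<dots> \<le> sqrt (\<Sum>n. (c n)\<^sup>2 / eigval \<mu> n) * sqrt (\<Sum>n. eigval \<mu> n * (fcoeff \<mu> v n)\<^sup>2)"
    proof -
      have n1: "0 \<le> (c n)\<^sup>2 / eigval \<mu> n" and n2: "0 \<le> eigval \<mu> n * (fcoeff \<mu> v n)\<^sup>2" for n
        using eigval_pos[of n] by simp_all
      have "(\<Sum>n<N. (c n)\<^sup>2 / eigval \<mu> n) \<le> (\<Sum>n. (c n)\<^sup>2 / eigval \<mu> n)"
        by (rule sum_le_suminf[OF c]) (use n1 in auto)
      moreover have "(\<Sum>n<N. eigval \<mu> n * (fcoeff \<mu> v n)\<^sup>2) \<le> (\<Sum>n. eigval \<mu> n * (fcoeff \<mu> v n)\<^sup>2)"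
        by (rule sum_le_suminf[OF Hs1_summable[OF v]]) (use n2 in auto)
      ultimately show ?thesis
        by (intro mult_mono real_sqrt_le_mono real_sqrt_ge_zero sum_nonneg suminf_nonneg[OF c] n1 n2)
    qed
    finally show ?thesis by (simp only: Hs_norm_eq)
  qed
  moreover have "(\<lambda>N. \<bar>?s N\<bar>) \<longlonglongrightarrow> \<bar>synth c v\<bar>"
    unfolding synth_def by (intro tendsto_rabs summable_LIMSEQ summable_norm_cancel[OF pair_summable[OF c v]])
  ultimately show ?thesis by (intro LIMSEQ_le_const2) auto
qed

lemma synth_Hdual:
  assumes c: "summable (\<lambda>n. (c n)\<^sup>2 / eigval \<mu> n)"
  shows "synth c \<in> Hdual \<mu> 1"
proof -
  have "synth c (\<lambda>x. v x + w x) = synth c v + synth c w" if v: "v \<in> Hs \<mu> 1" and w: "w \<in> Hs \<mu> 1" for v w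
    unfolding synth_def
    by (subst suminf_add[OF summable_norm_cancel[OF pair_summable[OF c v]] summable_norm_cancel[OF pair_summable[OF c w]]])
       (simp add: Ltwo.add_left[OF Hs1_Ltwo[OF v] Hs1_Ltwo[OF w] eigfun_Ltwo] distrib_left)
  moreover have "synth c (\<lambda>x. a * v x) = a * synth c v" if v: "v \<in> Hs \<mu> 1" for v a
    unfolding synth_def
    by (subst suminf_mult[OF summable_norm_cancel[OF pair_summable[OF c v]], symmetric])
       (simp add: Ltwo.scale_left[OF Hs1_Ltwo[OF v] eigfun_Ltwo] mult.left_commute)
  ultimately show ?thesis unfolding Hdual_def using weighted_Cauchy_Schwarz[OF c] by blast
qed

lemma Hdual_add: "F \<in> Hdual \<mu> 1 \<Longrightarrow> v \<in> Hs \<mu> 1 \<Longrightarrow> w \<in> Hs \<mu> 1 \<Longrightarrow> F (\<lambda>x. v x + w x) = F v + F w"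
  and Hdual_scale: "F \<in> Hdual \<mu> 1 \<Longrightarrow> v \<in> Hs \<mu> 1 \<Longrightarrow> F (\<lambda>x. c * v x) = c * F v"
  by (auto simp: Hdual_def)

lemma Hdual_bound: "F \<in> Hdual \<mu> 1 \<Longrightarrow> \<exists>B. \<forall>v\<in>Hs \<mu> 1. \<bar>F v\<bar> \<le> B * Hs_norm \<mu> 1 v"
  unfolding Hdual_def by blast

text \<open>Boundedness on finite combinations of eigenfunctions controls the coefficients; then the
  expansion follows because the tails of v tend to 0 in H^1.\<close>

lemma Hdual_expand:
  assumes F: "F \<in> Hdual \<mu> 1"
  shows "summable (\<lambda>n. (F (eigfun \<mu> n))\<^sup>2 / eigval \<mu> n)" "v \<in> Hs \<mu> 1 \<Longrightarrow> F v = synth (\<lambda>n. F (eigfun \<mu> n)) v"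
proof -
  obtain B where B: "\<And>v. v \<in> Hs \<mu> 1 \<Longrightarrow> \<bar>F v\<bar> \<le> B * Hs_norm \<mu> 1 v" using Hdual_bound[OF F] by blast
  have H0: "(\<lambda>x. 0) \<in> Hs \<mu> 1" unfolding Hs1_eq by (rule Hardy.zero_mem)
  have F0: "F (\<lambda>x. 0) = 0" using Hdual_scale[OF F H0, of 0] by simp
  have Lm: "(\<lambda>x. \<Sum>n<N. c n * eigfun \<mu> n x) \<in> Hs \<mu> 1" for N c
    unfolding Hs1_eq by (rule Hardy.lincomb_mem) (rule eigfun_Hs1[unfolded Hs1_eq])
  have Fl: "F (\<lambda>x. \<Sum>n<N. c n * eigfun \<mu> n x) = (\<Sum>n<N. c n * F (eigfun \<mu> n))" for N c
  proof (induction N)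
    case (Suc N)
    show ?case using Hdual_add[OF F Lm[of c N] Hs1_scale[OF eigfun_Hs1, of "c N" N]] Hdual_scale[OF F eigfun_Hs1, of "c N" N] Suc by simp
  qed (simp add: F0)
  have Lc: "fcoeff \<mu> (\<lambda>x. \<Sum>n<N. c n * eigfun \<mu> n x) k = (if k < N then c k else 0)" for N c k
    by (subst Ltwo.lincomb_left) (auto simp: eigfun_Ltwo fcoeff_eigfun if_distrib cong: if_cong)
  have Ln: "Hs_norm \<mu> 1 (\<lambda>x. \<Sum>n<N. c n * eigfun \<mu> n x) = sqrt (\<Sum>n<N. eigval \<mu> n * (c n)\<^sup>2)" for N c
  proof -
    have "(\<Sum>n. eigval \<mu> n * (if n < N then c n else 0)\<^sup>2) = (\<Sum>n<N. eigval \<mu> n * (if n < N then c n else 0)\<^sup>2)"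
      by (rule suminf_finite) auto
    then show ?thesis unfolding Hs_norm_eq Lc by simp
  qed
  have "(\<Sum>n<N. (F (eigfun \<mu> n))\<^sup>2 / eigval \<mu> n) \<le> B\<^sup>2" for N
  proof -
    let ?S = "\<Sum>n<N. (F (eigfun \<mu> n))\<^sup>2 / eigval \<mu> n"
    have S0: "0 \<le> ?S" using eigval_pos by (intro sum_nonneg divide_nonneg_pos) auto
    \<comment> \<open>F is tested with its truncated Riesz representative, which has coefficients F
      / lambda; the pairing with F and the squared norm both equal the partial sum, so its root is
      at most B.\<close>
    have e: "(\<Sum>n<N. F (eigfun \<mu> n) / eigval \<mu> n * F (eigfun \<mu> n)) = ?S" by (simp add: power2_eq_square)
    have e2: "(\<Sum>n<N. eigval \<mu> n * (F (eigfun \<mu> n) / eigval \<mu> n)\<^sup>2) = ?S"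
      using eigval_pos by (intro sum.cong refl) (simp add: power2_eq_square less_imp_neq[symmetric])
    have "?S \<le> B * sqrt ?S"
      using B[OF Lm[of "\<lambda>n. F (eigfun \<mu> n) / eigval \<mu> n" N]] unfolding Fl Ln e e2 by simp
    then have "sqrt ?S * sqrt ?S \<le> B * sqrt ?S" using S0 by simp
    then have "sqrt ?S \<le> B \<or> sqrt ?S = 0" using S0 mult_right_le_imp_le[of "sqrt ?S" "sqrt ?S" B]
      by (metis less_le real_sqrt_ge_zero)
    then have "sqrt ?S \<le> \<bar>B\<bar>" by linarith
    then have "(sqrt ?S)\<^sup>2 \<le> \<bar>B\<bar>\<^sup>2" by (intro power_mono) (use S0 in auto)
    then show ?thesis using S0 by simp
  qed
  then show sF: "summable (\<lambda>n. (F (eigfun \<mu> n))\<^sup>2 / eigval \<mu> n)"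
    by (intro summableI_nonneg_bounded) (use eigval_pos in \<open>auto intro: divide_nonneg_pos\<close>)
  assume v: "v \<in> Hs \<mu> 1"
  let ?p = "\<lambda>N x. \<Sum>n<N. fcoeff \<mu> v n * eigfun \<mu> n x"
  have vp: "(\<lambda>x. v x - ?p N x) \<in> Hs \<mu> 1" for N by (rule Hs1_diff[OF v Lm])
  have nrm: "Hs_norm \<mu> 1 (\<lambda>x. v x - ?p N x) = sqrt (\<Sum>n. eigval \<mu> (n + N) * (fcoeff \<mu> v (n + N))\<^sup>2)" for N
  proof -
    have c: "fcoeff \<mu> (\<lambda>x. v x - ?p N x) n = (if n < N then 0 else fcoeff \<mu> v n)" for n
      by (simp add: Ltwo.diff_left[OF Hs1_Ltwo[OF v] Hs1_Ltwo[OF Lm] eigfun_Ltwo] Lc)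
    have s: "summable (\<lambda>n. eigval \<mu> n * (if n < N then 0 else fcoeff \<mu> v n)\<^sup>2)" using Hs1_summable[OF vp[of N]] unfolding c .
    show ?thesis unfolding Hs_norm_eq c using suminf_split_initial_segment[OF s, of N] by simp
  qed
  have "(\<lambda>N. B * Hs_norm \<mu> 1 (\<lambda>x. v x - ?p N x)) \<longlonglongrightarrow> B * sqrt 0"
    unfolding nrm by (intro tendsto_mult_left tendsto_real_sqrt suminf_exist_split2 Hs1_summable[OF v])
  then have lim: "(\<lambda>N. B * Hs_norm \<mu> 1 (\<lambda>x. v x - ?p N x)) \<longlonglongrightarrow> 0" by simp
  have Fd: "F (\<lambda>x. v x - ?p N x) = F v - (\<Sum>n<N. F (eigfun \<mu> n) * fcoeff \<mu> v n)" for N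
  proof -
    have "F (\<lambda>x. (v x - ?p N x) + ?p N x) = F (\<lambda>x. v x - ?p N x) + F (?p N)" by (rule Hdual_add[OF F vp Lm])
    then show ?thesis unfolding Fl by (simp add: mult.commute)
  qed
  have "norm (F v - (\<Sum>n<N. F (eigfun \<mu> n) * fcoeff \<mu> v n)) \<le> B * Hs_norm \<mu> 1 (\<lambda>x. v x - ?p N x)" for N
    using B[OF vp[of N]] unfolding Fd by simp
  then have "(\<lambda>N. F v - (\<Sum>n<N. F (eigfun \<mu> n) * fcoeff \<mu> v n)) \<longlonglongrightarrow> 0"
    by (intro Lim_null_comparison[OF always_eventually lim]) blast
  then have "(\<lambda>N. \<Sum>n<N. F (eigfun \<mu> n) * fcoeff \<mu> v n) \<longlonglongrightarrow> F v"
    using tendsto_diff[OF tendsto_const[of "F v"], of "\<lambda>N. F v - (\<Sum>n<N. F (eigfun \<mu> n) * fcoeff \<mu> v n)" 0 sequentially] by simp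
  then have "(\<lambda>n. F (eigfun \<mu> n) * fcoeff \<mu> v n) sums F v" by (simp only: sums_def)
  then show "F v = synth (\<lambda>n. F (eigfun \<mu> n)) v" by (simp add: synth_def sums_iff)
qed

lemma Hdual_cong:
  assumes F: "F \<in> Hdual \<mu> 1" and eq: "\<And>v. v \<in> Hs \<mu> 1 \<Longrightarrow> G v = F v"
  shows "G \<in> Hdual \<mu> 1"
proof -
  obtain B where B: "\<And>v. v \<in> Hs \<mu> 1 \<Longrightarrow> \<bar>F v\<bar> \<le> B * Hs_norm \<mu> 1 v" using Hdual_bound[OF F] by blast
  show ?thesis unfolding Hdual_def mem_Collect_eq
    by (intro conjI ballI allI exI[of _ B])
      (simp_all add: B eq Hs1_add Hs1_scale Hdual_add[OF F] Hdual_scale[OF F])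
qed

lemma pivot_Hdual:
  assumes u: "u \<in> Hs \<mu> 1"
  shows "pivot u \<in> Hdual \<mu> 1"
proof (rule Hdual_cong[OF synth_Hdual[of "fcoeff \<mu> u"]])
  have "(fcoeff \<mu> u n)\<^sup>2 / eigval \<mu> n \<le> 1 / (eigval \<mu> 0)\<^sup>2 * (eigval \<mu> n * (fcoeff \<mu> u n)\<^sup>2)" for n
  proof -
    have "(eigval \<mu> 0)\<^sup>2 \<le> (eigval \<mu> n)\<^sup>2" using eigval_ge[of n] eigval_pos[of 0] by (intro power_mono) auto
    from mult_right_mono[OF this zero_le_power2[of "fcoeff \<mu> u n"]] show ?thesis
      using eigval_pos[of 0] eigval_pos[of n] by (simp add: field_simps power2_eq_square)
  qed
  then have "norm ((fcoeff \<mu> u n)\<^sup>2 / eigval \<mu> n) \<le> 1 / (eigval \<mu> 0)\<^sup>2 * (eigval \<mu> n * (fcoeff \<mu> u n)\<^sup>2)" for n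
    using eigval_pos[of n] by (simp only: real_norm_def abs_of_nonneg zero_le_divide_iff zero_le_power2 less_imp_le simp_thms)
  then show "summable (\<lambda>n. (fcoeff \<mu> u n)\<^sup>2 / eigval \<mu> n)"
    by (rule summable_comparison_test'[OF summable_mult[OF Hs1_summable[OF u], of "1 / (eigval \<mu> 0)\<^sup>2"], of 0])
  show "pivot u v = synth (fcoeff \<mu> u) v" if "v \<in> Hs \<mu> 1" for v
    using Parseval_sums[OF Hs1_Ltwo[OF u] Hs1_Ltwo[OF that]] by (simp add: pivot_def synth_def sums_iff)
qed

text \<open>The shape is that of a difference quotient minus a candidate for the derivative.\<close>

lemma Hdual_lincomb:
  assumes F: "F \<in> Hdual \<mu> 1" and G: "G \<in> Hdual \<mu> 1" and H: "H \<in> Hdual \<mu> 1"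
  shows "(\<lambda>v. (F v - G v) / r - H v) \<in> Hdual \<mu> 1"
proof -
  have aux: "(\<lambda>v. F v - a * G v) \<in> Hdual \<mu> 1" if F: "F \<in> Hdual \<mu> 1" and G: "G \<in> Hdual \<mu> 1" for F G and a :: real
  proof -
    obtain B where B: "\<And>v. v \<in> Hs \<mu> 1 \<Longrightarrow> \<bar>F v\<bar> \<le> B * Hs_norm \<mu> 1 v" using Hdual_bound[OF F] by blast
    obtain C where C: "\<And>v. v \<in> Hs \<mu> 1 \<Longrightarrow> \<bar>G v\<bar> \<le> C * Hs_norm \<mu> 1 v" using Hdual_bound[OF G] by blast
    have "\<bar>F v - a * G v\<bar> \<le> (B + \<bar>a\<bar> * C) * Hs_norm \<mu> 1 v" if v: "v \<in> Hs \<mu> 1" for v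
    proof -
      have "\<bar>F v - a * G v\<bar> \<le> \<bar>F v\<bar> + \<bar>a\<bar> * \<bar>G v\<bar>" using abs_triangle_ineq4[of "F v" "a * G v"] by (simp add: abs_mult)
      also have "\<dots> \<le> B * Hs_norm \<mu> 1 v + \<bar>a\<bar> * (C * Hs_norm \<mu> 1 v)" by (intro add_mono mult_left_mono B C v) simp
      finally show ?thesis by (simp add: distrib_right mult.assoc)
    qed
    then show ?thesis unfolding Hdual_def mem_Collect_eq
      by (intro conjI ballI allI exI[of _ "B + \<bar>a\<bar> * C"])
        (simp_all add: Hdual_add[OF F] Hdual_add[OF G] Hdual_scale[OF F] Hdual_scale[OF G] algebra_simps)
  qed
  have Z: "(\<lambda>v. 0) \<in> Hdual \<mu> 1" using aux[OF F F, of 1] by simp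
  have "(\<lambda>v. (0 - (- 1 / r) * (F v - 1 * G v)) - 1 * H v) \<in> Hdual \<mu> 1"
    by (rule aux[OF aux[OF Z aux[OF F G]] H])
  then show ?thesis by simp
qed

text \<open>The right-hand side keeps all terms of a nonnegative series, the left-hand side one. It
  passes limits in the dual norm on to single coefficients.\<close>

lemma Hdual_coeff_le:
  assumes F: "F \<in> Hdual \<mu> 1"
  shows "\<bar>F (eigfun \<mu> n)\<bar> \<le> sqrt (eigval \<mu> n) * Hdual_norm \<mu> 1 F"
proof -
  let ?t = "\<lambda>n. (F (eigfun \<mu> n))\<^sup>2 / eigval \<mu> n"
  have nn: "0 \<le> ?t k" for k using eigval_pos by (intro divide_nonneg_pos) auto
  have "?t n = sum ?t {n}" by simp
  also have "\<dots> \<le> suminf ?t" by (rule sum_le_suminf[OF Hdual_expand(1)[OF F]]) (use nn in auto)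
  finally have "(F (eigfun \<mu> n))\<^sup>2 \<le> eigval \<mu> n * suminf ?t" using eigval_pos[of n] by (simp add: pos_divide_le_eq mult.commute)
  then have "sqrt ((F (eigfun \<mu> n))\<^sup>2) \<le> sqrt (eigval \<mu> n * suminf ?t)" by (rule real_sqrt_le_mono)
  then show ?thesis by (simp add: real_sqrt_mult Hdual_norm_eq)
qed

end

section \<open>Scalar fractional problems\<close>

lemma borel_lebesgue_on: "f \<in> borel_measurable borel \<Longrightarrow> f \<in> borel_measurable (lebesgue_on A)"
  by (intro measurable_restrict_space1 measurable_completion) simp

lemma AE_lebesgue_on: "AE x in lborel. P x \<Longrightarrow> A \<in> sets lebesgue \<Longrightarrow> AE x in lebesgue_on A. P x"
  by (simp add: AE_restrict_space_iff AE_completion_iff) (erule eventually_mono, simp)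

lemma integral_lebesgue_on_borel:
  fixes f :: "real \<Rightarrow> real"
  assumes [measurable]: "f \<in> borel_measurable borel" "A \<in> sets borel"
  shows "(\<integral>x. f x \<partial>lebesgue_on A) = (\<integral>x. indicator A x * f x \<partial>lborel)"
proof -
  have "(\<integral>x. f x \<partial>lebesgue_on A) = (\<integral>x. indicator A x *\<^sub>R f x \<partial>lebesgue)"
    by (rule integral_restrict_space) simp
  also have "\<dots> = (\<integral>x. indicator A x *\<^sub>R f x \<partial>lborel)"
    by (rule integral_completion) simp
  finally show ?thesis by simp
qed

text \<open>The bridge between \<open>frac_int\<close>, an integral over (0, t) for Lebesgue
  measure, and the convolution \<open>cv\<close> of a Borel extension by zero.\<close>

lemma cv_fractional_integral:
  assumes [measurable]: "Y \<in> borel_measurable borel" and Y0: "\<And>s. s \<le> 0 \<Longrightarrow> Y s = 0"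
    and Y: "\<And>s. 0 < s \<Longrightarrow> s < t \<Longrightarrow> Y s = y s"
  shows "1 / Gamma b * (\<integral>s. (t - s) powr (b - 1) * y s \<partial>lebesgue_on {0<..<t}) = cv b Y t"
proof -
  have "(\<integral>s. (t - s) powr (b - 1) * y s \<partial>lebesgue_on {0<..<t}) = (\<integral>s. (t - s) powr (b - 1) * Y s \<partial>lebesgue_on {0<..<t})"
    by (intro Bochner_Integration.integral_cong refl) (simp add: Y)
  also have "\<dots> = (\<integral>s. indicator {0<..<t} s * ((t - s) powr (b - 1) * Y s) \<partial>lborel)"
    by (rule integral_lebesgue_on_borel) measurable
  finally have "1 / Gamma b * (\<integral>s. (t - s) powr (b - 1) * y s \<partial>lebesgue_on {0<..<t}) =
      (\<integral>s. 1 / Gamma b * (indicator {0<..<t} s * ((t - s) powr (b - 1) * Y s)) \<partial>lborel)" by simp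
  also have "\<dots> = cv b Y t"
    unfolding cv_def
    by (intro Bochner_Integration.integral_cong refl) (auto simp: gk_def indicator_def Y0 not_less)
  finally show ?thesis .
qed

text \<open>H is merely bounded and measurable, so its primitive is not differentiated: Fubini on
  the triangle s < t moves the integration to the derivative of \<psi>, whose integral from s to T
  is -\<psi>(s).\<close>

lemma cv_1_weak_deriv:
  assumes \<psi>: "\<psi> \<in> test_functions 0 T" and T: "0 < T" and Hm [measurable]: "H \<in> borel_measurable borel"
    and H0: "\<And>s. s \<le> 0 \<Longrightarrow> H s = 0" and HM: "\<And>s. \<bar>H s\<bar> \<le> M"
  shows "(\<integral>t. deriv \<psi> t * cv 1 H t \<partial>lebesgue_on {0<..<T}) = - (\<integral>t. \<psi> t * H t \<partial>lebesgue_on {0<..<T})"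
proof -
  note cont = test_function_continuous[OF \<psi>]
  have [measurable]: "\<psi> \<in> borel_measurable borel" "deriv \<psi> \<in> borel_measurable borel"
    by (rule borel_measurable_continuous_onI, rule cont)+
  have "bounded (deriv \<psi> ` {0..T})" by (intro compact_imp_bounded compact_continuous_image cont) simp
  then obtain B where B: "\<And>t. t \<in> {0..T} \<Longrightarrow> \<bar>deriv \<psi> t\<bar> \<le> B" unfolding bounded_iff real_norm_def by blast
  have B0: "0 \<le> B" using B[of 0] T by auto
  have M0: "0 \<le> M" using HM[of 0] by linarith
  define f where "f t s = indicator {0<..<T} t * deriv \<psi> t * (gk 1 (t - s) * H s)" for t s
  have fm [measurable]: "case_prod f \<in> borel_measurable (lborel \<Otimes>\<^sub>M lborel)" unfolding f_def by measurable
  have fb: "\<bar>f t s\<bar> \<le> (B * M * indicator {0<..<T} t) * indicator {0<..<T} s" for t s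
  proof (cases "t \<in> {0<..<T} \<and> s \<in> {0<..<t}")
    case True
    then have "\<bar>deriv \<psi> t\<bar> * \<bar>H s\<bar> \<le> B * M" using B[of t] HM[of s] B0 by (intro mult_mono) auto
    then show ?thesis using True by (simp add: f_def gk_1 abs_mult)
  next
    case False
    then have "f t s = 0" by (auto simp: f_def gk_1 indicator_def H0 not_less)
    then show ?thesis using B0 M0 by simp
  qed
  have ii: "integrable lborel (\<lambda>s. c * indicator {0<..<T} s :: real)" for c
  proof -
    have "integrable lborel (indicator {0<..<T} :: real \<Rightarrow> real)" by (rule integrable_real_indicator) (use T in auto)
    then show ?thesis by (rule integrable_mult_right)
  qed
  have i1: "integrable lborel (f t)" for t
  proof (rule Bochner_Integration.integrable_bound[OF ii[of "B * M * indicator {0<..<T} t"]])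
    show "f t \<in> borel_measurable lborel" unfolding f_def by measurable
    show "AE s in lborel. norm (f t s) \<le> norm (B * M * indicator {0<..<T} t * indicator {0<..<T} s)"
      using fb[of t] B0 M0 by (intro AE_I2) (simp add: abs_mult)
  qed
  have i2: "integrable lborel (\<lambda>t. \<integral>s. \<bar>f t s\<bar> \<partial>lborel)"
  proof (rule Bochner_Integration.integrable_bound[OF ii[of "B * M * T"]])
    show "(\<lambda>t. \<integral>s. \<bar>f t s\<bar> \<partial>lborel) \<in> borel_measurable lborel" by measurable
    have "(\<integral>s. \<bar>f t s\<bar> \<partial>lborel) \<le> (\<integral>s. (B * M * indicator {0<..<T} t) * indicator {0<..<T} s \<partial>lborel)" for t
      by (intro integral_mono ii integrable_abs i1) (rule fb)
    then show "AE t in lborel. norm (\<integral>s. \<bar>f t s\<bar> \<partial>lborel) \<le> norm (B * M * T * indicator {0<..<T} t)"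
      using B0 M0 T by (intro AE_I2) (simp add: abs_mult mult_ac)
  qed
  have "(\<integral>t. deriv \<psi> t * cv 1 H t \<partial>lebesgue_on {0<..<T}) = (\<integral>t. indicator {0<..<T} t * (deriv \<psi> t * cv 1 H t) \<partial>lborel)"
    by (rule integral_lebesgue_on_borel) measurable
  also have "\<dots> = (\<integral>t. \<integral>s. f t s \<partial>lborel \<partial>lborel)" by (simp add: f_def cv_def mult.assoc)
  also have "\<dots> = (\<integral>s. \<integral>t. f t s \<partial>lborel \<partial>lborel)" by (rule integral_swap[OF fm _ i2]) (simp add: i1)
  also have "\<dots> = (\<integral>s. indicator {0<..<T} s * (- (\<psi> s * H s)) \<partial>lborel)"
  proof (intro Bochner_Integration.integral_cong refl)
    fix s
    consider "s \<le> 0" | "0 < s" "s < T" | "T \<le> s" by linarith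
    then show "(\<integral>t. f t s \<partial>lborel) = indicator {0<..<T} s * (- (\<psi> s * H s))"
    proof cases
      case 1
      then show ?thesis by (simp add: f_def H0)
    next
      case 2
      have "(\<integral>t. f t s \<partial>lborel) = (\<integral>t. H s * (indicator {s<..<T} t * deriv \<psi> t) \<partial>lborel)"
        using 2 by (intro Bochner_Integration.integral_cong refl) (auto simp: f_def gk_1 indicator_def)
      also have "\<dots> = H s * (\<integral>t. deriv \<psi> t \<partial>lebesgue_on {s<..<T})"
        by (subst integral_lebesgue_on_borel) simp_all
      also have "\<dots> = H s * (\<psi> T - \<psi> s)"
        by (subst interval_FTC(2)[of s T \<psi> "deriv \<psi>"]) (use 2 cont in auto)
      finally show ?thesis using 2 test_function_outside[OF \<psi>, of T] by (simp add: mult.commute)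
    next
      case 3
      then have "(\<lambda>t. f t s) = (\<lambda>t. 0)" by (auto simp: f_def gk_1 indicator_def)
      then show ?thesis using 3 by simp
    qed
  qed
  also have "\<dots> = - (\<integral>t. \<psi> t * H t \<partial>lebesgue_on {0<..<T})"
    by (subst integral_lebesgue_on_borel) simp_all
  finally show ?thesis .
qed

section \<open>Existence, uniqueness and uniform bounds for a single mode\<close>

lemma square_add_le: "(x + y)\<^sup>2 \<le> 2 * x\<^sup>2 + 2 * (y::real)\<^sup>2"
  using zero_le_power2[of "x - y"] by (simp add: power2_sum power2_diff)

lemma square_diff_le_double: "(x - y)\<^sup>2 \<le> 2 * x\<^sup>2 + 2 * (y::real)\<^sup>2"
  using zero_le_power2[of "x + y"] by (simp add: power2_sum power2_diff)

text \<open>The sources are compared rather than the solutions: their difference solves the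
  homogeneous Volterra equation, and since it vanishes off the interval the truncation in
  \<open>Volterra_unique\<close> changes nothing.\<close>

lemma mode_unique:
  assumes \<alpha>: "1 \<le> \<alpha>" and l: "0 \<le> l" and [measurable]: "h \<in> borel_measurable borel" "k \<in> borel_measurable borel"
    and hb: "\<And>s. \<bar>h s\<bar> \<le> M" and kb: "\<And>s. \<bar>k s\<bar> \<le> N"
    and h0: "\<And>s. s \<notin> {0<..<T} \<Longrightarrow> h s = 0" and k0: "\<And>s. s \<notin> {0<..<T} \<Longrightarrow> k s = 0"
    and eq: "\<And>s. s \<in> {0<..<T} \<Longrightarrow> h s - k s = - (l * (cv \<alpha> h s - cv \<alpha> k s))"
  shows "h = k"
proof
  fix t
  have ind: "(\<lambda>s. indicator {0<..<T} s * (h s - k s)) = (\<lambda>s. h s - k s)"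
    by (rule ext) (metis h0 k0 diff_self indicator_simps(1,2) mult_1 mult_zero_left)
  have d: "cv \<alpha> (\<lambda>s. h s - k s) s = cv \<alpha> h s - cv \<alpha> k s" for s
    using \<alpha> h0 k0 by (intro cv_diff cv_integrable(1)[OF _ _ _ hb] cv_integrable(1)[OF _ _ _ kb]) auto
  show "h t = k t"
  proof (cases "t \<in> {0<..<T}")
    case True
    have "h t - k t = 0"
    proof (rule Volterra_unique[OF \<alpha> l, where z="\<lambda>s. h s - k s" and T=T and B="M + N"])
      show "(\<lambda>s. h s - k s) \<in> borel_measurable borel" by measurable
      show "\<bar>h s - k s\<bar> \<le> M + N" for s using hb[of s] kb[of s] by linarith
      show "h s - k s = - (l * cv \<alpha> (\<lambda>s. indicator {0<..<T} s * (h s - k s)) s)" if "0 < s" "s < T" for s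
        unfolding ind d using eq that by simp
    qed (use True in auto)
    then show ?thesis by simp
  qed (simp add: h0 k0)
qed

text \<open>The Volterra solution satisfies the energy estimate, from which the sizes of h = f - l U
  and of the derivative of U follow. The lower bound l0, later the first eigenvalue, makes C the
  same for all modes.\<close>

lemma mode_solution:
  assumes T: "0 < T" and \<alpha>: "1 < \<alpha>" "\<alpha> < 2" and l0: "0 < l0"
  shows "\<exists>C>0. \<forall>l a b f F. l0 \<le> l \<longrightarrow> f \<in> borel_measurable borel \<longrightarrow> (\<forall>s. \<bar>f s\<bar> \<le> F) \<longrightarrow>
    (\<exists>U h. h \<in> borel_measurable borel \<and> (\<forall>s. s \<notin> {0<..<T} \<longrightarrow> h s = 0) \<and> (\<forall>s\<in>{0<..<T}. h s = f s - l * U s) \<and>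
      (\<forall>s. (h s)\<^sup>2 \<le> C * (l * a\<^sup>2 + b\<^sup>2 + F\<^sup>2) * l) \<and>
      (\<forall>t\<in>{0..T}. U t = a + b * t + cv \<alpha> h t \<and> l * (U t)\<^sup>2 \<le> C * (l * a\<^sup>2 + b\<^sup>2 + F\<^sup>2) \<and>
        (b + cv (\<alpha> - 1) h t)\<^sup>2 \<le> C * (l * a\<^sup>2 + b\<^sup>2 + F\<^sup>2) * l))"
proof -
  have "\<exists>C>0. \<forall>l f F u0 u1 u h M t. 0 \<le> l \<longrightarrow> f \<in> borel_measurable borel \<longrightarrow> (\<forall>s. \<bar>f s\<bar> \<le> F) \<longrightarrow>
    h \<in> borel_measurable borel \<longrightarrow> (\<forall>s. \<bar>h s\<bar> \<le> M) \<longrightarrow> (\<forall>s\<le>0. h s = 0) \<longrightarrow>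
    (\<forall>s. 0 < s \<longrightarrow> s < T \<longrightarrow> h s = f s - l * u s) \<longrightarrow> (\<forall>s\<in>{0..T}. u s = u0 + u1 * s + cv (1 + (\<alpha> - 1)) h s) \<longrightarrow>
    t \<in> {0..T} \<longrightarrow> l * (u t)\<^sup>2 \<le> l * u0\<^sup>2 + C * (u1\<^sup>2 + F\<^sup>2)"
    by (rule fractional_energy_estimate[OF T]) (use \<alpha> in auto)
  then obtain C0 where "C0 > 0" and C0': "\<forall>l f F u0 u1 u h M t. 0 \<le> l \<longrightarrow> f \<in> borel_measurable borel \<longrightarrow> (\<forall>s. \<bar>f s\<bar> \<le> F) \<longrightarrow>
    h \<in> borel_measurable borel \<longrightarrow> (\<forall>s. \<bar>h s\<bar> \<le> M) \<longrightarrow> (\<forall>s\<le>0. h s = 0) \<longrightarrow>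
    (\<forall>s. 0 < s \<longrightarrow> s < T \<longrightarrow> h s = f s - l * u s) \<longrightarrow> (\<forall>s\<in>{0..T}. u s = u0 + u1 * s + cv (1 + (\<alpha> - 1)) h s) \<longrightarrow>
    t \<in> {0..T} \<longrightarrow> l * (u t)\<^sup>2 \<le> l * u0\<^sup>2 + C0 * (u1\<^sup>2 + F\<^sup>2)"
    by (elim exE conjE) (rule that)
  note C0 = C0'[rule_format]
  \<comment> \<open>At least 1, so that the initial energy, which enters the estimate with factor 1,
    is covered as well.\<close>
  define C1 where "C1 = max 1 C0"
  have C1: "1 \<le> C1" "C0 \<le> C1" by (auto simp: C1_def)
  \<comment> \<open>From h = f - l U: twice the squares of f and of l U, the former absorbed through
    R <= R l / l0.\<close>
  define C2 where "C2 = 2 / l0 + 2 * C1"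
  define g where "g = gk \<alpha> T"
  have g: "0 \<le> g" unfolding g_def using \<alpha> by (intro gk_nonneg) simp
  \<comment> \<open>From b + I^(\<alpha>-1) h: the square of h is at most C2 R l, and the fractional
    integral of order \<alpha> - 1 of the constant 1 is at most g.\<close>
  define C3 where "C3 = 2 / l0 + 2 * (C2 * g\<^sup>2)"
  have C2: "0 < C2" unfolding C2_def using l0 C1 by (simp add: add_pos_pos)
  have C3: "0 < C3" unfolding C3_def using l0 C2 by (simp add: add_pos_nonneg)
  define C where "C = C1 + C2 + C3"
  have C: "0 < C" "C1 \<le> C" "C2 \<le> C" "C3 \<le> C" using C1 C2 C3 by (auto simp: C_def)
  show ?thesis
  proof (intro exI[of _ C] conjI allI impI C)
    fix l a b :: real and f :: "real \<Rightarrow> real" and F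
    assume l: "l0 \<le> l" and fm [measurable]: "f \<in> borel_measurable borel" and fF: "\<forall>s. \<bar>f s\<bar> \<le> F"
    have lp: "0 < l" using l l0 by linarith
    have F0: "0 \<le> F" using fF[rule_format, of 0] by linarith
    define R where "R = l * a\<^sup>2 + b\<^sup>2 + F\<^sup>2"
    have R: "0 \<le> R" "b\<^sup>2 \<le> R" "F\<^sup>2 \<le> R" unfolding R_def using lp by auto
    define f1 where "f1 s = indicator {0<..<T} s * f s" for s
    have f1m [measurable]: "f1 \<in> borel_measurable borel" unfolding f1_def by measurable
    have f10: "s \<le> 0 \<Longrightarrow> f1 s = 0" and f1F: "\<bar>f1 s\<bar> \<le> F" for s
      using fF F0 by (auto simp: f1_def indicator_def)
    define G where "G t = a + b * t + cv \<alpha> f1 t" for t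
    have Gm: "G \<in> borel_measurable borel" unfolding G_def by measurable
    have GB: "\<bar>G s\<bar> \<le> \<bar>a\<bar> + \<bar>b\<bar> * T + F * gk (\<alpha> + 1) T" if "0 < s" "s < T" for s
    proof -
      have "\<bar>cv \<alpha> f1 s\<bar> \<le> F * gk (\<alpha> + 1) s" by (rule cv_integrable(2)) (use \<alpha> f10 f1F in auto)
      also have "\<dots> \<le> F * gk (\<alpha> + 1) T" using F0 \<alpha> that by (intro mult_left_mono gk_mono) auto
      finally have "\<bar>cv \<alpha> f1 s\<bar> \<le> F * gk (\<alpha> + 1) T" .
      moreover have "\<bar>b * s\<bar> \<le> \<bar>b\<bar> * T" using that by (simp add: abs_mult mult_left_mono)
      ultimately show ?thesis unfolding G_def by linarith
    qed
    have "1 \<le> \<alpha>" using \<alpha> by simp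
    from Volterra_exists[OF this less_imp_le[OF lp] T Gm GB]
    obtain U M where Um [measurable]: "U \<in> borel_measurable borel" and UM: "\<And>s. 0 < s \<Longrightarrow> s < T \<Longrightarrow> \<bar>U s\<bar> \<le> M"
      and U: "\<And>t. t \<le> T \<Longrightarrow> U t = G t - l * cv \<alpha> (\<lambda>s. indicator {0<..<T} s * U s) t" by blast
    define U1 where "U1 s = indicator {0<..<T} s * U s" for s
    have U1m [measurable]: "U1 \<in> borel_measurable borel" unfolding U1_def by measurable
    have U10: "s \<le> 0 \<Longrightarrow> U1 s = 0" and U1M: "\<bar>U1 s\<bar> \<le> \<bar>M\<bar>" for s
      using UM[of s] by (auto simp: U1_def indicator_def)
    define h where "h s = f1 s - l * U1 s" for s
    have hm [measurable]: "h \<in> borel_measurable borel" unfolding h_def by measurable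
    have h0: "s \<notin> {0<..<T} \<Longrightarrow> h s = 0" for s by (auto simp: h_def f1_def U1_def)
    have hf: "s \<in> {0<..<T} \<Longrightarrow> h s = f s - l * U s" for s by (auto simp: h_def f1_def U1_def)
    have hM: "\<bar>h s\<bar> \<le> F + l * \<bar>M\<bar>" for s
    proof -
      have "\<bar>l * U1 s\<bar> \<le> l * \<bar>M\<bar>" using U1M[of s] lp by (simp add: abs_mult)
      then show ?thesis unfolding h_def using f1F[of s] by linarith
    qed
    have Ueq: "U t = a + b * t + cv \<alpha> h t" if "t \<le> T" for t
    proof -
      have i1: "integrable lborel (\<lambda>s. gk \<alpha> (t - s) * f1 s)"
        using \<alpha> f10 by (intro cv_integrable(1)[OF _ _ _ f1F]) auto
      have i2: "integrable lborel (\<lambda>s. gk \<alpha> (t - s) * U1 s)"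
        using \<alpha> U10 by (intro cv_integrable(1)[OF _ _ _ U1M]) auto
      have i3: "integrable lborel (\<lambda>s. gk \<alpha> (t - s) * (l * U1 s))"
        using integrable_mult_right[of l, OF i2] by (simp add: mult_ac)
      have "cv \<alpha> h t = cv \<alpha> f1 t - l * cv \<alpha> U1 t"
        unfolding h_def using cv_diff[OF i1 i3] by (simp add: cv_scale)
      then show ?thesis using U[OF that] by (simp add: G_def U1_def[abs_def])
    qed
    have UR: "l * (U t)\<^sup>2 \<le> C1 * R" if t: "t \<in> {0..T}" for t
    proof -
      have "l * (U t)\<^sup>2 \<le> l * a\<^sup>2 + C0 * (b\<^sup>2 + F\<^sup>2)"
        using lp fF hM h0 hf Ueq t by (intro C0[of l f F h "F + l * \<bar>M\<bar>"]) auto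
      also have "\<dots> \<le> C1 * (l * a\<^sup>2) + C1 * (b\<^sup>2 + F\<^sup>2)"
        using C1 lp mult_right_mono[OF C1(1), of "l * a\<^sup>2"] by (intro add_mono mult_right_mono) auto
      finally show ?thesis by (simp add: R_def distrib_left)
    qed
    have lR: "R \<le> R * l / l0" using R(1) l l0 by (simp add: pos_le_divide_eq mult_left_mono)
    have hR: "(h s)\<^sup>2 \<le> C2 * R * l" for s
    proof (cases "s \<in> {0<..<T}")
      case True
      have "(h s)\<^sup>2 \<le> 2 * (f s)\<^sup>2 + 2 * (l * U s)\<^sup>2" unfolding hf[OF True] by (rule square_diff_le_double)
      moreover have "(f s)\<^sup>2 \<le> F\<^sup>2" using fF F0 by (metis abs_of_nonneg abs_le_square_iff)
      moreover have "(l * U s)\<^sup>2 \<le> C1 * R * l"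
        using mult_left_mono[OF UR[of s], of l] True lp by (simp add: power_mult_distrib power2_eq_square mult_ac)
      moreover have "C2 * R * l = 2 * (R * l / l0) + 2 * (C1 * R * l)" by (simp add: C2_def algebra_simps)
      ultimately show ?thesis using lR R(3) by linarith
    qed (use h0 C2 R lp in simp)
    have wR: "(b + cv (\<alpha> - 1) h t)\<^sup>2 \<le> C3 * R * l" if t: "t \<in> {0..T}" for t
    proof -
      have hs: "\<bar>h s\<bar> \<le> sqrt (C2 * R * l)" for s using real_sqrt_le_mono[OF hR[of s]] by simp
      have "\<bar>cv (\<alpha> - 1) h t\<bar> \<le> sqrt (C2 * R * l) * gk (\<alpha> - 1 + 1) t"
        by (rule cv_integrable(2)) (use \<alpha> h0 hs in auto)
      also have "\<dots> \<le> sqrt (C2 * R * l) * g"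
        unfolding g_def using \<alpha> t C2 R lp by (intro mult_left_mono) (auto intro: gk_mono)
      finally have "\<bar>cv (\<alpha> - 1) h t\<bar>\<^sup>2 \<le> (sqrt (C2 * R * l) * g)\<^sup>2" by (rule power_mono) simp
      then have "(cv (\<alpha> - 1) h t)\<^sup>2 \<le> C2 * R * l * g\<^sup>2" using C2 R lp by (simp add: power_mult_distrib)
      moreover have "C3 * R * l = 2 * (R * l / l0) + 2 * (C2 * R * l * g\<^sup>2)" by (simp add: C3_def algebra_simps)
      ultimately show ?thesis using square_add_le[of b "cv (\<alpha> - 1) h t"] lR R(2) by linarith
    qed
    have Rl: "0 \<le> R * l" using R lp by simp
    have "(h s)\<^sup>2 \<le> C * R * l" for s using hR[of s] mult_right_mono[OF C(3) Rl] by (simp add: mult.assoc)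
    moreover have "(b + cv (\<alpha> - 1) h t)\<^sup>2 \<le> C * R * l" if "t \<in> {0..T}" for t
      using wR[OF that] mult_right_mono[OF C(4) Rl] by (simp add: mult.assoc)
    moreover have "l * (U t)\<^sup>2 \<le> C * R" if "t \<in> {0..T}" for t
      using UR[OF that] mult_right_mono[OF C(2) R(1)] by simp
    ultimately show "\<exists>U h. h \<in> borel_measurable borel \<and> (\<forall>s. s \<notin> {0<..<T} \<longrightarrow> h s = 0) \<and> (\<forall>s\<in>{0<..<T}. h s = f s - l * U s) \<and>
      (\<forall>s. (h s)\<^sup>2 \<le> C * (l * a\<^sup>2 + b\<^sup>2 + F\<^sup>2) * l) \<and>
      (\<forall>t\<in>{0..T}. U t = a + b * t + cv \<alpha> h t \<and> l * (U t)\<^sup>2 \<le> C * (l * a\<^sup>2 + b\<^sup>2 + F\<^sup>2) \<and>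
        (b + cv (\<alpha> - 1) h t)\<^sup>2 \<le> C * (l * a\<^sup>2 + b\<^sup>2 + F\<^sup>2) * l)"
      using hm h0 hf Ueq unfolding R_def by (intro exI[of _ U] exI[of _ h]) auto
  qed
qed

text \<open>Truncation at Q makes the bound hold at every time and changes nothing almost everywhere
  on the interval.\<close>

lemma borel_representative:
  fixes T :: real
  assumes q: "q \<in> borel_measurable (lebesgue_on {0<..<T})" and b: "AE t in lebesgue_on {0<..<T}. \<bar>q t\<bar> \<le> Q" and Q: "0 \<le> (Q::real)"
  shows "\<exists>q'. q' \<in> borel_measurable borel \<and> (\<forall>t. \<bar>q' t\<bar> \<le> Q) \<and> (AE t in lebesgue_on {0<..<T}. q t = q' t)"
proof -
  have "(\<lambda>t. indicator {0<..<T} t *\<^sub>R q t) \<in> borel_measurable lebesgue"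
    using q borel_measurable_restrict_space_iff[of "{0<..<T}" lebesgue q] by simp
  from completion_ex_borel_measurable_real[OF this]
  obtain g where g [measurable]: "g \<in> borel_measurable borel" and e: "AE t in lborel. indicator {0<..<T} t *\<^sub>R q t = g t" by auto
  define q' where "q' t = max (- Q) (min Q (g t))" for t
  have "q' \<in> borel_measurable borel" unfolding q'_def by measurable
  moreover have "\<bar>q' t\<bar> \<le> Q" for t using Q by (auto simp: q'_def)
  moreover have "AE t in lebesgue_on {0<..<T}. q t = q' t"
  proof -
    have "AE t in lebesgue_on {0<..<T}. indicator {0<..<T} t *\<^sub>R q t = g t" by (rule AE_lebesgue_on[OF e], rule sets_completionI_sets) simp
    moreover have "AE t in lebesgue_on {0<..<T}. t \<in> {0<..<T}" by (rule AE_I2) simp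
    ultimately show ?thesis using b by eventually_elim (auto simp: q'_def)
  qed
  ultimately show ?thesis by blast
qed

section \<open>Convergence and measurability in the dual scale\<close>

text \<open>Tannery's theorem. The filter is arbitrary, so it serves limits in time as well as
  limits of sequences.\<close>

lemma sqrt_suminf_tendsto_0:
  fixes a :: "nat \<Rightarrow> 'b \<Rightarrow> real"
  assumes lim: "\<And>n. (a n \<longlongrightarrow> 0) F" and bound: "eventually (\<lambda>s. \<forall>n. \<bar>a n s\<bar> \<le> M n) F" and M: "summable M"
  shows "((\<lambda>s. sqrt (\<Sum>n. a n s)) \<longlongrightarrow> 0) F"
proof (cases "F = bot")
  case False
  have ev: "eventually (\<lambda>(k, s). norm (a k s) \<le> M k) (at_top \<times>\<^sub>F F)"
    unfolding eventually_prod_filter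
    by (intro exI[of _ "\<lambda>_. True"] exI[of _ "\<lambda>s. \<forall>n. \<bar>a n s\<bar> \<le> M n"]) (use bound in auto)
  have "((\<lambda>s. \<Sum>k. a k s) \<longlongrightarrow> (\<Sum>k. 0)) F"
    using tannerys_theorem[OF lim ev M False] by blast
  from tendsto_real_sqrt[OF this] show ?thesis by simp
qed simp

text \<open>Lebesgue measure is complete, so a function that agrees almost everywhere with a
  measurable limit is measurable itself.\<close>

lemma borel_measurable_lebesgue_limit_AE:
  fixes f :: "nat \<Rightarrow> real \<Rightarrow> real"
  assumes A: "A \<in> sets lebesgue" and f: "\<And>k. f k \<in> borel_measurable (lebesgue_on A)"
    and lim: "AE x in lebesgue_on A. (\<lambda>k. f k x) \<longlonglongrightarrow> g x"
  shows "g \<in> borel_measurable (lebesgue_on A)"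
proof -
  have f': "(\<lambda>x. indicator A x *\<^sub>R f k x) \<in> borel_measurable lebesgue" for k
    using f[of k] A borel_measurable_restrict_space_iff[of A lebesgue "f k"] by simp
  have L: "(\<lambda>x. lim (\<lambda>k. indicator A x *\<^sub>R f k x)) \<in> borel_measurable lebesgue"
    by (rule borel_measurable_lim_metric) (rule f')
  have "AE x in lebesgue. x \<in> A \<longrightarrow> (\<lambda>k. f k x) \<longlonglongrightarrow> g x"
    using lim A by (simp add: AE_restrict_space_iff)
  then have "AE x in lebesgue. lim (\<lambda>k. indicator A x *\<^sub>R f k x) = indicator A x *\<^sub>R g x"
  proof (rule eventually_mono)
    fix x assume x: "x \<in> A \<longrightarrow> (\<lambda>k. f k x) \<longlonglongrightarrow> g x"
    show "lim (\<lambda>k. indicator A x *\<^sub>R f k x) = indicator A x *\<^sub>R g x"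
      by (rule limI) (use x in \<open>cases "x \<in> A"; simp\<close>)
  qed
  from borel_measurable_AE[OF L this] show ?thesis
    using A borel_measurable_restrict_space_iff[of A lebesgue g] by simp
qed

lemma test_Ltwo_interval:
  assumes \<psi>: "\<psi> \<in> test_functions a b"
  shows "\<psi> \<in> Ltwo (lebesgue_on {a<..<b})"
proof -
  note c = test_function_continuous(1)[OF \<psi>]
  have "integrable (lebesgue_on {a..b}) (\<lambda>x. (\<psi> x)\<^sup>2)"
    by (rule continuous_imp_integrable_real) (intro continuous_on_power c)
  then have "integrable (lebesgue_on {a<..<b}) (\<lambda>x. (\<psi> x)\<^sup>2)"
    by (rule integrable_lebesgue_on_subset) auto
  moreover have "\<psi> \<in> borel_measurable (lebesgue_on {a<..<b})"
    by (rule borel_lebesgue_on[OF borel_measurable_continuous_onI[OF c]])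
  ultimately show ?thesis by (simp add: Ltwo_def)
qed

lemma eventually_within: "eventually (\<lambda>s. s \<in> S \<and> s \<noteq> t) (at t within S)"
  by (simp add: eventually_at_filter)

context hardy_potential
begin

lemma Hdual_norm_tendsto:
  assumes "\<And>n. ((\<lambda>s. G s (eigfun \<mu> n)) \<longlongrightarrow> 0) F"
    and bound: "eventually (\<lambda>s. \<forall>n. (G s (eigfun \<mu> n))\<^sup>2 / eigval \<mu> n \<le> M n) F" and "summable M"
  shows "((\<lambda>s. Hdual_norm \<mu> 1 (G s)) \<longlongrightarrow> 0) F"
  unfolding Hdual_norm_eq
proof (rule sqrt_suminf_tendsto_0[where M=M])
  fix n
  have "((\<lambda>s. (G s (eigfun \<mu> n))\<^sup>2 / eigval \<mu> n) \<longlongrightarrow> 0\<^sup>2 / eigval \<mu> n) F"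
    using eigval_pos[of n] by (intro tendsto_divide tendsto_power assms(1) tendsto_const) simp
  then show "((\<lambda>s. (G s (eigfun \<mu> n))\<^sup>2 / eigval \<mu> n) \<longlongrightarrow> 0) F" by simp
next
  show "eventually (\<lambda>s. \<forall>n. \<bar>(G s (eigfun \<mu> n))\<^sup>2 / eigval \<mu> n\<bar> \<le> M n) F"
    using bound by eventually_elim (use eigval_pos in \<open>simp add: less_imp_le\<close>)
qed fact

lemma Hs_norm_tendsto:
  assumes "\<And>n. ((\<lambda>s. fcoeff \<mu> (v s) n) \<longlongrightarrow> 0) F"
    and bound: "eventually (\<lambda>s. \<forall>n. eigval \<mu> n * (fcoeff \<mu> (v s) n)\<^sup>2 \<le> M n) F" and "summable M"
  shows "((\<lambda>s. Hs_norm \<mu> 1 (v s)) \<longlongrightarrow> 0) F"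
  unfolding Hs_norm_eq
proof (rule sqrt_suminf_tendsto_0[where M=M])
  fix n
  have "((\<lambda>s. eigval \<mu> n * (fcoeff \<mu> (v s) n)\<^sup>2) \<longlongrightarrow> eigval \<mu> n * 0\<^sup>2) F"
    by (intro tendsto_mult tendsto_power assms(1) tendsto_const)
  then show "((\<lambda>s. eigval \<mu> n * (fcoeff \<mu> (v s) n)\<^sup>2) \<longlongrightarrow> 0) F" by simp
next
  show "eventually (\<lambda>s. \<forall>n. \<bar>eigval \<mu> n * (fcoeff \<mu> (v s) n)\<^sup>2\<bar> \<le> M n) F"
    using bound by eventually_elim (use eigval_pos in \<open>simp add: less_imp_le\<close>)
qed fact

lemma Hdual_eqI:
  assumes "F \<in> Hdual \<mu> 1" "G \<in> Hdual \<mu> 1" and e: "\<And>n. F (eigfun \<mu> n) = G (eigfun \<mu> n)" and v: "v \<in> Hs \<mu> 1"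
  shows "F v = G v"
proof -
  have "F v = synth (\<lambda>n. F (eigfun \<mu> n)) v" by (rule Hdual_expand(2)) fact+
  also have "\<dots> = synth (\<lambda>n. G (eigfun \<mu> n)) v" by (simp only: e)
  also have "\<dots> = G v" by (rule Hdual_expand(2)[symmetric]) fact+
  finally show ?thesis .
qed

lemma Hdual_zero: "(\<lambda>v. 0) \<in> Hdual \<mu> 1"
  using synth_Hdual[of "\<lambda>_. 0"] by (simp add: synth_def[abs_def])

lemma Hdual_diff: "F \<in> Hdual \<mu> 1 \<Longrightarrow> G \<in> Hdual \<mu> 1 \<Longrightarrow> (\<lambda>v. F v - G v) \<in> Hdual \<mu> 1"
  using Hdual_lincomb[OF _ _ Hdual_zero, of F G 1] by simp

lemma has_dual_deriv_coeff:
  assumes d: "has_dual_deriv \<mu> T (\<lambda>s. pivot (u s)) F t" and u: "\<And>s. s \<in> {0..T} \<Longrightarrow> u s \<in> Hs \<mu> 1" and t: "t \<in> {0..T}"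
  shows "((\<lambda>s. fcoeff \<mu> (u s) n) has_real_derivative F (eigfun \<mu> n)) (at t within {0..T})"
proof -
  let ?Q = "\<lambda>s v. (pivot (u s) v - pivot (u t) v) / (s - t) - F v"
  have F: "F \<in> Hdual \<mu> 1" and lim: "((\<lambda>s. Hdual_norm \<mu> 1 (?Q s)) \<longlongrightarrow> 0) (at t within {0..T})"
    using d by (auto simp: has_dual_deriv_def)
  have "eventually (\<lambda>s. norm (?Q s (eigfun \<mu> n)) \<le> sqrt (eigval \<mu> n) * Hdual_norm \<mu> 1 (?Q s)) (at t within {0..T})"
    using eventually_within
    by (rule eventually_mono) (simp only: real_norm_def, intro Hdual_coeff_le Hdual_lincomb pivot_Hdual u t F, simp)
  moreover have "((\<lambda>s. sqrt (eigval \<mu> n) * Hdual_norm \<mu> 1 (?Q s)) \<longlongrightarrow> 0) (at t within {0..T})"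
    using tendsto_mult_left[OF lim] by simp
  ultimately have "((\<lambda>s. ?Q s (eigfun \<mu> n)) \<longlongrightarrow> 0) (at t within {0..T})"
    by (rule Lim_null_comparison)
  then show ?thesis unfolding has_field_derivative_iff pivot_def by (rule LIM_zero_cancel)
qed

text \<open>\<open>Dt\<close> is chosen among functionals that may differ off
  \<open>Hs \<mu> 1\<close>. On \<open>Hs \<mu> 1\<close> they agree, because each coefficient of a
  derivative in the dual norm is an ordinary derivative, unique on a nondegenerate interval.\<close>

lemma Dt_eqI:
  assumes d: "has_dual_deriv \<mu> T (\<lambda>s. pivot (u s)) F t" and u: "\<And>s. s \<in> {0..T} \<Longrightarrow> u s \<in> Hs \<mu> 1" and t: "t \<in> {0..T}"
    and T: "0 < T"
  shows "has_dual_deriv \<mu> T (\<lambda>s. pivot (u s)) (Dt \<mu> T u t) t" "v \<in> Hs \<mu> 1 \<Longrightarrow> Dt \<mu> T u t v = F v"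
proof -
  show d': "has_dual_deriv \<mu> T (\<lambda>s. pivot (u s)) (Dt \<mu> T u t) t"
    unfolding Dt_def by (rule someI[of "\<lambda>F. has_dual_deriv \<mu> T (\<lambda>s. pivot (u s)) F t", OF d])
  have nb: "at t within {0..T} \<noteq> bot" using t T by (simp add: trivial_limit_within islimpt_Icc)
  have e: "Dt \<mu> T u t (eigfun \<mu> n) = F (eigfun \<mu> n)" for n
    using has_dual_deriv_coeff[OF d' u t, of n] has_dual_deriv_coeff[OF d u t, of n] nb
    unfolding has_field_derivative_iff by (blast intro: tendsto_unique)
  have "Dt \<mu> T u t \<in> Hdual \<mu> 1" "F \<in> Hdual \<mu> 1" using d d' by (auto simp: has_dual_deriv_def)
  then show "v \<in> Hs \<mu> 1 \<Longrightarrow> Dt \<mu> T u t v = F v" using e by (rule Hdual_eqI)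
qed

lemma cont_dual_coeff:
  assumes U: "cont_dual \<mu> T U"
  shows "continuous_on {0..T} (\<lambda>t. U t (eigfun \<mu> n))"
  unfolding continuous_on_def
proof
  fix t assume t: "t \<in> {0..T}"
  have lim: "((\<lambda>s. Hdual_norm \<mu> 1 (\<lambda>v. U s v - U t v)) \<longlongrightarrow> 0) (at t within {0..T})"
    and UH: "s \<in> {0..T} \<Longrightarrow> U s \<in> Hdual \<mu> 1" for s using U t by (auto simp: cont_dual_def)
  have "eventually (\<lambda>s. norm (U s (eigfun \<mu> n) - U t (eigfun \<mu> n)) \<le> sqrt (eigval \<mu> n) * Hdual_norm \<mu> 1 (\<lambda>v. U s v - U t v)) (at t within {0..T})"
    using eventually_within
    by (rule eventually_mono) (simp only: real_norm_def, intro Hdual_coeff_le[OF Hdual_diff] UH t, simp)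
  moreover have "((\<lambda>s. sqrt (eigval \<mu> n) * Hdual_norm \<mu> 1 (\<lambda>v. U s v - U t v)) \<longlongrightarrow> 0) (at t within {0..T})"
    using tendsto_mult_left[OF lim] by simp
  ultimately have "((\<lambda>s. U s (eigfun \<mu> n) - U t (eigfun \<mu> n)) \<longlongrightarrow> 0) (at t within {0..T})"
    by (rule Lim_null_comparison)
  then show "((\<lambda>s. U s (eigfun \<mu> n)) \<longlongrightarrow> U t (eigfun \<mu> n)) (at t within {0..T})" by (rule LIM_zero_cancel)
qed

section \<open>Coefficients in the Bochner space and uniqueness of the Caputo derivative\<close>

lemma L2_dual_Hdual: "G \<in> L2_dual \<mu> T \<Longrightarrow> AE t in time_interval T. G t \<in> Hdual \<mu> 1"
  and L2_dual_integrable: "G \<in> L2_dual \<mu> T \<Longrightarrow> integrable (time_interval T) (\<lambda>t. (Hdual_norm \<mu> 1 (G t))\<^sup>2)"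
  and L2_dual_approx: "G \<in> L2_dual \<mu> T \<Longrightarrow> \<exists>S::nat \<Rightarrow> real \<Rightarrow> functional.
    (\<forall>n. simple_function (time_interval T) (S n) \<and> (\<forall>t\<in>{0<..<T}. S n t \<in> Hdual \<mu> 1)) \<and>
    (AE t in time_interval T. (\<lambda>n. Hdual_norm \<mu> 1 (\<lambda>v. S n t v - G t v)) \<longlonglongrightarrow> 0)"
proof -
  assume "G \<in> L2_dual \<mu> T"
  note D = this[unfolded L2_dual_def mem_Collect_eq]
  show "AE t in time_interval T. G t \<in> Hdual \<mu> 1" by (rule D[THEN conjunct1])
  show "integrable (time_interval T) (\<lambda>t. (Hdual_norm \<mu> 1 (G t))\<^sup>2)" by (rule D[THEN conjunct2, THEN conjunct2])
  show "\<exists>S::nat \<Rightarrow> real \<Rightarrow> functional.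
    (\<forall>n. simple_function (time_interval T) (S n) \<and> (\<forall>t\<in>{0<..<T}. S n t \<in> Hdual \<mu> 1)) \<and>
    (AE t in time_interval T. (\<lambda>n. Hdual_norm \<mu> 1 (\<lambda>v. S n t v - G t v)) \<longlonglongrightarrow> 0)"
    by (rule D[THEN conjunct2, THEN conjunct1])
qed

lemma has_caputo_L2: "has_caputo \<mu> \<alpha> T u G \<Longrightarrow> G \<in> L2_dual \<mu> T"
  unfolding has_caputo_def by (rule conjunct1)

lemma has_caputo_integral:
  assumes "has_caputo \<mu> \<alpha> T u G" "\<psi> \<in> test_functions 0 T" "v \<in> Hs \<mu> 1"
  shows "(\<integral>t. deriv \<psi> t * frac_int (2 - \<alpha>) (\<lambda>s v. Dt \<mu> T u s v - Dt \<mu> T u 0 v) t v \<partial>time_interval T)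
    = - (\<integral>t. \<psi> t * G t v \<partial>time_interval T)"
  by (rule assms(1)[unfolded has_caputo_def has_distr_deriv_def, THEN conjunct2, rule_format, OF assms(2,3)])

text \<open>Evaluation at an eigenfunction maps the approximating simple functions to simple
  functions and is bounded in the dual norm, so the coefficient is a measurable limit and inherits
  square integrability.\<close>

lemma L2_dual_coeff:
  assumes G: "G \<in> L2_dual \<mu> T"
  shows "(\<lambda>t. G t (eigfun \<mu> n)) \<in> Ltwo (time_interval T)"
proof -
  let ?M = "lebesgue_on {0<..<T}"
  note GH = L2_dual_Hdual[OF G] and int = L2_dual_integrable[OF G]
  from L2_dual_approx[OF G] obtain S where S': "\<forall>k. simple_function ?M (S k) \<and> (\<forall>t\<in>{0<..<T}. S k t \<in> Hdual \<mu> 1)"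
      and lim: "AE t in ?M. (\<lambda>k. Hdual_norm \<mu> 1 (\<lambda>v. S k t v - G t v)) \<longlonglongrightarrow> 0"
    by (elim exE conjE) (rule that)
  have S: "simple_function ?M (S k)" for k using S'[THEN spec, of k] by (rule conjunct1)
  have SH: "S k t \<in> Hdual \<mu> 1" if "t \<in> {0<..<T}" for k t using S'[THEN spec, of k, THEN conjunct2] that by (rule bspec)
  have tM: "AE t in ?M. t \<in> {0<..<T}" by (rule AE_I2) simp
  have m: "(\<lambda>t. G t (eigfun \<mu> n)) \<in> borel_measurable ?M"
  proof (rule borel_measurable_lebesgue_limit_AE)
    show "(\<lambda>t. S k t (eigfun \<mu> n)) \<in> borel_measurable ?M" for k
      by (rule borel_measurable_simple_function[OF simple_function_compose1[OF S]])
    show "AE t in ?M. (\<lambda>k. S k t (eigfun \<mu> n)) \<longlonglongrightarrow> G t (eigfun \<mu> n)"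
      using lim GH tM
    proof eventually_elim
      case (elim t)
      have "norm (S k t (eigfun \<mu> n) - G t (eigfun \<mu> n)) \<le> sqrt (eigval \<mu> n) * Hdual_norm \<mu> 1 (\<lambda>v. S k t v - G t v)" for k
        unfolding real_norm_def by (rule Hdual_coeff_le[OF Hdual_diff[OF SH[OF elim(3)] elim(2)]])
      moreover have "(\<lambda>k. sqrt (eigval \<mu> n) * Hdual_norm \<mu> 1 (\<lambda>v. S k t v - G t v)) \<longlonglongrightarrow> 0"
        using tendsto_mult_left[OF elim(1)] by simp
      ultimately have "(\<lambda>k. S k t (eigfun \<mu> n) - G t (eigfun \<mu> n)) \<longlonglongrightarrow> 0"
        by (rule Lim_null_comparison[OF always_eventually[OF allI]])
      then show ?case by (rule LIM_zero_cancel)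
    qed
  qed simp
  have "integrable ?M (\<lambda>t. (G t (eigfun \<mu> n))\<^sup>2)"
  proof (rule Bochner_Integration.integrable_bound[OF integrable_mult_right[OF int, of "eigval \<mu> n"]])
    show "(\<lambda>t. (G t (eigfun \<mu> n))\<^sup>2) \<in> borel_measurable ?M" by (rule borel_measurable_power[OF m])
    show "AE t in ?M. norm ((G t (eigfun \<mu> n))\<^sup>2) \<le> norm (eigval \<mu> n * (Hdual_norm \<mu> 1 (G t))\<^sup>2)"
      using GH
    proof eventually_elim
      case (elim t)
      have "\<bar>G t (eigfun \<mu> n)\<bar>\<^sup>2 \<le> (sqrt (eigval \<mu> n) * Hdual_norm \<mu> 1 (G t))\<^sup>2"
        by (rule power_mono[OF Hdual_coeff_le[OF elim]]) simp
      then show ?case using eigval_pos[of n] by (simp add: power_mult_distrib less_imp_le)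
    qed
  qed
  with m show ?thesis by (simp add: Ltwo_def)
qed

lemma L2_dual_pairing_integrable:
  assumes G: "G \<in> L2_dual \<mu> T" and \<psi>: "\<psi> \<in> test_functions 0 T"
  shows "integrable (time_interval T) (\<lambda>t. \<psi> t * G t (eigfun \<mu> n))"
  by (rule Ltwo_mult_integrable[OF test_Ltwo_interval[OF \<psi>] L2_dual_coeff[OF G]])

text \<open>The fundamental lemma leaves an exceptional null set for each test element. Using only
  the countably many eigenfunctions gives one null set, off which the expansion of functionals
  covers all v.\<close>

lemma has_caputo_unique:
  assumes G: "has_caputo \<mu> \<alpha> T u G" and G': "has_caputo \<mu> \<alpha> T u G'"
  shows "AE t in time_interval T. \<forall>v\<in>Hs \<mu> 1. G t v = G' t v"
proof -
  let ?M = "lebesgue_on {0<..<T}"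
  have L: "G \<in> L2_dual \<mu> T" "G' \<in> L2_dual \<mu> T" by (rule has_caputo_L2, fact)+
  interpret M: finite_measure ?M by (rule finite_measure_lebesgue_on) simp
  have "AE t in ?M. G t (eigfun \<mu> n) - G' t (eigfun \<mu> n) = 0" for n
  proof (rule fundamental_lemma)
    show "integrable ?M (\<lambda>t. G t (eigfun \<mu> n) - G' t (eigfun \<mu> n))"
      by (rule Bochner_Integration.integrable_diff[OF M.Ltwo_integrable[OF L2_dual_coeff[OF L(1)]] M.Ltwo_integrable[OF L2_dual_coeff[OF L(2)]]])
    fix \<psi> assume \<psi>: "\<psi> \<in> test_functions 0 T"
    have "(\<integral>t. \<psi> t * G t (eigfun \<mu> n) \<partial>?M) = (\<integral>t. \<psi> t * G' t (eigfun \<mu> n) \<partial>?M)"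
      using trans[OF has_caputo_integral[OF G \<psi> eigfun_Hs1, symmetric] has_caputo_integral[OF G' \<psi> eigfun_Hs1]]
      by (simp only: neg_equal_iff_equal)
    then show "(\<integral>t. (G t (eigfun \<mu> n) - G' t (eigfun \<mu> n)) * \<psi> t \<partial>?M) = 0"
      using Bochner_Integration.integral_diff[OF L2_dual_pairing_integrable[OF L(1) \<psi>] L2_dual_pairing_integrable[OF L(2) \<psi>], of n n]
      by (simp add: algebra_simps)
  qed
  then have "AE t in ?M. \<forall>n. G t (eigfun \<mu> n) - G' t (eigfun \<mu> n) = 0" by (simp add: AE_all_countable)
  moreover have "AE t in ?M. G t \<in> Hdual \<mu> 1" "AE t in ?M. G' t \<in> Hdual \<mu> 1" by (rule L2_dual_Hdual, rule L)+
  ultimately show ?thesis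
  proof eventually_elim
    case (elim t)
    show ?case
    proof
      fix v assume v: "v \<in> Hs \<mu> 1"
      show "G t v = G' t v" by (rule Hdual_eqI[OF elim(2,3) _ v]) (use elim(1) in simp)
    qed
  qed
qed

end

section \<open>Synthesis of the solution from its modes\<close>

text \<open>\<open>R n\<close> collects the squared size of the data in mode n. The bounds with the
  factor \<open>eigval \<mu> n\<close> are those that remain summable after the dual norm divides by
  the eigenvalue.\<close>

locale mode_family = hardy_potential +
  fixes T \<alpha> C :: real and a b R :: "nat \<Rightarrow> real" and h U :: "nat \<Rightarrow> real \<Rightarrow> real"
  assumes T: "0 < T" and order: "1 < \<alpha>" "\<alpha> < 2" and C_pos: "0 < C"
    and R_summable: "summable R" and R_nonneg: "\<And>n. 0 \<le> R n"
    and h_measurable [measurable]: "\<And>n. h n \<in> borel_measurable borel"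
    and h_outside: "\<And>n s. s \<notin> {0<..<T} \<Longrightarrow> h n s = 0"
    and h_bound: "\<And>n s. (h n s)\<^sup>2 \<le> C * R n * eigval \<mu> n"
    and U_eq: "\<And>n t. t \<in> {0..T} \<Longrightarrow> U n t = a n + b n * t + cv \<alpha> (h n) t"
    and U_bound: "\<And>n t. t \<in> {0..T} \<Longrightarrow> eigval \<mu> n * (U n t)\<^sup>2 \<le> C * R n"
    and w_bound: "\<And>n t. t \<in> {0..T} \<Longrightarrow> (b n + cv (\<alpha> - 1) (h n) t)\<^sup>2 \<le> C * R n * eigval \<mu> n"
begin

definition w :: "nat \<Rightarrow> real \<Rightarrow> real" where "w n t = b n + cv (\<alpha> - 1) (h n) t"

text \<open>The coefficients determine the function only up to a null function, hence the
  choice.\<close>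

definition u :: "real \<Rightarrow> real \<Rightarrow> real" where "u t = (SOME v. v \<in> Hs \<mu> 1 \<and> (\<forall>n. fcoeff \<mu> v n = U n t))"

definition G :: "real \<Rightarrow> functional" where "G t = synth (\<lambda>n. h n t)"

lemma CR_summable: "summable (\<lambda>n. c * R n)" and CR_nonneg: "0 \<le> C * R n"
  using R_summable R_nonneg C_pos by (auto intro: summable_mult)

lemma divide_eigval_le: "x\<^sup>2 \<le> y * eigval \<mu> n \<Longrightarrow> x\<^sup>2 / eigval \<mu> n \<le> y"
  using eigval_pos[of n] by (simp add: pos_divide_le_eq)

lemma divide_eigval_summable:
  assumes "\<And>n. (c n)\<^sup>2 \<le> C * R n * eigval \<mu> n"
  shows "summable (\<lambda>n. (c n)\<^sup>2 / eigval \<mu> n)" "(\<Sum>n. (c n)\<^sup>2 / eigval \<mu> n) \<le> C * suminf R"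
proof -
  have le: "(c n)\<^sup>2 / eigval \<mu> n \<le> C * R n" for n by (rule divide_eigval_le[OF assms])
  moreover have "0 \<le> (c n)\<^sup>2 / eigval \<mu> n" for n using eigval_pos[of n] by simp
  ultimately have "norm ((c n)\<^sup>2 / eigval \<mu> n) \<le> C * R n" for n by (simp only: real_norm_def abs_of_nonneg)
  then show s: "summable (\<lambda>n. (c n)\<^sup>2 / eigval \<mu> n)" by (rule summable_comparison_test'[OF CR_summable, of 0])
  have "(\<Sum>n. (c n)\<^sup>2 / eigval \<mu> n) \<le> (\<Sum>n. C * R n)" by (rule suminf_le[OF le s CR_summable])
  then show "(\<Sum>n. (c n)\<^sup>2 / eigval \<mu> n) \<le> C * suminf R" by (simp add: suminf_mult R_summable)
qed

lemma h_abs: "\<bar>h n s\<bar> \<le> sqrt (C * R n * eigval \<mu> n)"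
  using real_sqrt_le_mono[OF h_bound[of n s]] by simp

lemma h_nonpos: "s \<le> 0 \<Longrightarrow> h n s = 0"
  by (rule h_outside) simp

lemma u_coeff_Hs:
  assumes t: "t \<in> {0..T}"
  shows "u t \<in> Hs \<mu> 1" "fcoeff \<mu> (u t) n = U n t"
proof -
  have "norm (eigval \<mu> n * (U n t)\<^sup>2) \<le> C * R n" for n
    using U_bound[OF t, of n] eigval_pos[of n] by simp
  then have "summable (\<lambda>n. eigval \<mu> n * (U n t)\<^sup>2)" by (rule summable_comparison_test'[OF CR_summable, of 0])
  from Hs1_synthesis[OF this] have "\<exists>v. v \<in> Hs \<mu> 1 \<and> (\<forall>n. fcoeff \<mu> v n = U n t)" by blast
  from someI_ex[OF this] show "u t \<in> Hs \<mu> 1" "fcoeff \<mu> (u t) n = U n t" unfolding u_def by blast+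
qed

lemma U_deriv:
  assumes t: "t \<in> {0..T}"
  shows "(U n has_real_derivative w n t) (at t within {0..T})"
proof (rule has_field_derivative_transform_within[OF _ zero_less_one t])
  have "(cv (1 + (\<alpha> - 1)) (h n) has_real_derivative cv (\<alpha> - 1) (h n) t) (at t within {0..T})"
    using order t by (intro cv_deriv[where M="sqrt (C * R n * eigval \<mu> n)"] h_abs h_nonpos h_measurable) auto
  then have "(cv \<alpha> (h n) has_real_derivative cv (\<alpha> - 1) (h n) t) (at t within {0..T})" by simp
  then show "((\<lambda>t. a n + b n * t + cv \<alpha> (h n) t) has_real_derivative w n t) (at t within {0..T})"
    unfolding w_def by (auto intro!: derivative_eq_intros)
qed (simp add: U_eq)

lemma w_abs: "t \<in> {0..T} \<Longrightarrow> (w n t)\<^sup>2 \<le> C * R n * eigval \<mu> n"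
  using w_bound by (simp add: w_def)

text \<open>By the bound on \<open>w\<close>. It dominates the difference quotients uniformly in s,
  which the passage to the derivative under the sum requires.\<close>

lemma U_Lipschitz:
  assumes "s \<in> {0..T}" "t \<in> {0..T}"
  shows "\<bar>U n s - U n t\<bar> \<le> sqrt (C * R n * eigval \<mu> n) * \<bar>s - t\<bar>"
proof -
  have "norm (U n s - U n t) \<le> sqrt (C * R n * eigval \<mu> n) * norm (s - t)"
  proof (rule field_differentiable_bound[of "{0..T}" _ "w n"])
    show "norm (w n z) \<le> sqrt (C * R n * eigval \<mu> n)" if "z \<in> {0..T}" for z
      using real_sqrt_le_mono[OF w_abs[OF that, of n]] by simp
  qed (use U_deriv assms in auto)
  then show ?thesis by simp
qed

lemma w_continuous: "continuous_on {0..T} (w n)"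
  unfolding w_def[abs_def]
  using order by (intro continuous_on_add continuous_on_const cv_continuous[where M="sqrt (C * R n * eigval \<mu> n)"] h_abs h_nonpos h_measurable) auto

lemma U_tendsto: "t \<in> {0..T} \<Longrightarrow> ((\<lambda>s. U n s - U n t) \<longlongrightarrow> 0) (at t within {0..T})"
  using DERIV_continuous[OF U_deriv] by (simp add: continuous_within LIM_zero)

lemma w_tendsto: "t \<in> {0..T} \<Longrightarrow> ((\<lambda>s. w n s - w n t) \<longlongrightarrow> 0) (at t within {0..T})"
  using w_continuous[of n] by (simp add: continuous_on_def LIM_zero)

lemma u_cont: "cont_H1 \<mu> T u"
  unfolding cont_H1_def
proof (intro ballI conjI)
  fix t assume t: "t \<in> {0..T}"
  show "u t \<in> Hs \<mu> 1" by (rule u_coeff_Hs[OF t])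
  have c: "fcoeff \<mu> (\<lambda>x. u s x - u t x) n = U n s - U n t" if "s \<in> {0..T}" for s n
    using u_coeff_Hs[OF that] u_coeff_Hs[OF t] by (simp add: Ltwo.diff_left Hs1_Ltwo eigfun_Ltwo)
  have ev: "eventually (\<lambda>s. s \<in> {0..T}) (at t within {0..T})"
    using eventually_within[of "{0..T}" t] by (rule eventually_mono) simp
  show "((\<lambda>s. Hs_norm \<mu> 1 (\<lambda>x. u s x - u t x)) \<longlongrightarrow> 0) (at t within {0..T})"
  proof (rule Hs_norm_tendsto[where M="\<lambda>n. (4 * C) * R n", OF _ _ CR_summable])
    show "((\<lambda>s. fcoeff \<mu> (\<lambda>x. u s x - u t x) n) \<longlongrightarrow> 0) (at t within {0..T})" for n
      by (rule Lim_transform_eventually[OF U_tendsto[OF t]]) (use ev in \<open>eventually_elim, simp add: c\<close>)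
    show "eventually (\<lambda>s. \<forall>n. eigval \<mu> n * (fcoeff \<mu> (\<lambda>x. u s x - u t x) n)\<^sup>2 \<le> (4 * C) * R n) (at t within {0..T})"
      using ev
    proof (eventually_elim, intro allI)
      fix s n assume s: "s \<in> {0..T}"
      have "eigval \<mu> n * (U n s - U n t)\<^sup>2 \<le> eigval \<mu> n * (2 * (U n s)\<^sup>2 + 2 * (U n t)\<^sup>2)"
        by (rule mult_left_mono[OF square_diff_le_double]) (use eigval_pos[of n] in simp)
      also have "\<dots> \<le> (4 * C) * R n" using U_bound[OF s, of n] U_bound[OF t, of n] by (simp add: algebra_simps)
      finally show "eigval \<mu> n * (fcoeff \<mu> (\<lambda>x. u s x - u t x) n)\<^sup>2 \<le> (4 * C) * R n" by (simp only: c[OF s])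
    qed
  qed
qed

text \<open>Each coefficient of the difference quotient converges, since \<open>w n\<close> is the
  derivative of \<open>U n\<close>. Quotient and limit both have squares at most C R lambda, so the
  difference is dominated by 4 C R in the dual norm.\<close>

lemma u_dual_deriv:
  assumes t: "t \<in> {0..T}"
  shows "has_dual_deriv \<mu> T (\<lambda>s. pivot (u s)) (synth (\<lambda>n. w n t)) t"
  unfolding has_dual_deriv_def
proof
  show "synth (\<lambda>n. w n t) \<in> Hdual \<mu> 1" by (rule synth_Hdual[OF divide_eigval_summable(1)]) (rule w_abs[OF t])
  have ev: "eventually (\<lambda>s. s \<in> {0..T} \<and> s \<noteq> t) (at t within {0..T})" by (rule eventually_within)
  have c: "(pivot (u s) (eigfun \<mu> n) - pivot (u t) (eigfun \<mu> n)) / (s - t) - synth (\<lambda>n. w n t) (eigfun \<mu> n) = (U n s - U n t) / (s - t) - w n t"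
    if "s \<in> {0..T}" for s n
    using u_coeff_Hs(2)[OF that] u_coeff_Hs(2)[OF t] by (simp add: pivot_def synth_eigfun)
  show "((\<lambda>s. Hdual_norm \<mu> 1 (\<lambda>v. (pivot (u s) v - pivot (u t) v) / (s - t) - synth (\<lambda>n. w n t) v)) \<longlongrightarrow> 0) (at t within {0..T})"
  proof (rule Hdual_norm_tendsto[where M="\<lambda>n. (4 * C) * R n", OF _ _ CR_summable])
    fix n
    have "((\<lambda>s. (U n s - U n t) / (s - t) - w n t) \<longlongrightarrow> 0) (at t within {0..T})"
      using U_deriv[OF t, of n] unfolding has_field_derivative_iff by (rule LIM_zero)
    then show "((\<lambda>s. (pivot (u s) (eigfun \<mu> n) - pivot (u t) (eigfun \<mu> n)) / (s - t) - synth (\<lambda>n. w n t) (eigfun \<mu> n)) \<longlongrightarrow> 0) (at t within {0..T})"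
      by (rule Lim_transform_eventually) (use ev in \<open>eventually_elim, simp only: c\<close>)
  next
    show "eventually (\<lambda>s. \<forall>n. ((pivot (u s) (eigfun \<mu> n) - pivot (u t) (eigfun \<mu> n)) / (s - t) - synth (\<lambda>n. w n t) (eigfun \<mu> n))\<^sup>2 / eigval \<mu> n \<le> (4 * C) * R n) (at t within {0..T})"
      using ev
    proof (eventually_elim, intro allI)
      fix s n assume s: "s \<in> {0..T} \<and> s \<noteq> t"
      have "\<bar>(U n s - U n t) / (s - t)\<bar> \<le> sqrt (C * R n * eigval \<mu> n)"
        using U_Lipschitz[of s t n] s t by (simp add: abs_divide pos_divide_le_eq)
      then have "\<bar>(U n s - U n t) / (s - t)\<bar>\<^sup>2 \<le> (sqrt (C * R n * eigval \<mu> n))\<^sup>2" by (rule power_mono) simp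
      then have q: "((U n s - U n t) / (s - t))\<^sup>2 \<le> C * R n * eigval \<mu> n"
        using CR_nonneg[of n] eigval_pos[of n] by (simp only: power2_abs real_sqrt_pow2 mult_nonneg_nonneg less_imp_le)
      have "((U n s - U n t) / (s - t) - w n t)\<^sup>2 \<le> 2 * ((U n s - U n t) / (s - t))\<^sup>2 + 2 * (w n t)\<^sup>2" by (rule square_diff_le_double)
      also have "\<dots> \<le> (4 * C) * R n * eigval \<mu> n" using q w_abs[OF t, of n] by linarith
      finally show "((pivot (u s) (eigfun \<mu> n) - pivot (u t) (eigfun \<mu> n)) / (s - t) - synth (\<lambda>n. w n t) (eigfun \<mu> n))\<^sup>2 / eigval \<mu> n \<le> (4 * C) * R n"
        using s by (simp only: c divide_eigval_le)
    qed
  qed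
qed

lemma Dt_u:
  assumes t: "t \<in> {0..T}"
  shows "has_dual_deriv \<mu> T (\<lambda>s. pivot (u s)) (Dt \<mu> T u t) t" "Dt \<mu> T u t \<in> Hdual \<mu> 1"
    "v \<in> Hs \<mu> 1 \<Longrightarrow> Dt \<mu> T u t v = synth (\<lambda>n. w n t) v"
proof -
  show d: "has_dual_deriv \<mu> T (\<lambda>s. pivot (u s)) (Dt \<mu> T u t) t"
    by (rule Dt_eqI(1)[OF u_dual_deriv[OF t] u_coeff_Hs(1) t T])
  then show "Dt \<mu> T u t \<in> Hdual \<mu> 1" by (simp add: has_dual_deriv_def)
  show "v \<in> Hs \<mu> 1 \<Longrightarrow> Dt \<mu> T u t v = synth (\<lambda>n. w n t) v"
    by (rule Dt_eqI(2)[OF u_dual_deriv[OF t] u_coeff_Hs(1) t T])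
qed

lemma Dt_u_eigfun: "t \<in> {0..T} \<Longrightarrow> Dt \<mu> T u t (eigfun \<mu> n) = w n t"
  by (simp add: Dt_u(3) eigfun_Hs1 synth_eigfun)

lemma u_C1: "C1_dual \<mu> T u"
  unfolding C1_dual_def
proof (intro conjI ballI)
  show "\<exists>F. has_dual_deriv \<mu> T (\<lambda>s. pivot (u s)) F t" if "t \<in> {0..T}" for t using u_dual_deriv[OF that] by blast
  have ev: "eventually (\<lambda>s. s \<in> {0..T}) (at t within {0..T})" for t
    using eventually_within[of "{0..T}" t] by (rule eventually_mono) simp
  show "cont_dual \<mu> T (\<lambda>t. pivot (u t))"
    unfolding cont_dual_def
  proof (intro ballI conjI)
    fix t assume t: "t \<in> {0..T}"
    show "pivot (u t) \<in> Hdual \<mu> 1" by (rule pivot_Hdual[OF u_coeff_Hs(1)[OF t]])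
    have c: "pivot (u s) (eigfun \<mu> n) - pivot (u t) (eigfun \<mu> n) = U n s - U n t" if "s \<in> {0..T}" for s n
      using u_coeff_Hs(2)[OF that] u_coeff_Hs(2)[OF t] by (simp add: pivot_def)
    show "((\<lambda>s. Hdual_norm \<mu> 1 (\<lambda>v. pivot (u s) v - pivot (u t) v)) \<longlongrightarrow> 0) (at t within {0..T})"
    proof (rule Hdual_norm_tendsto[where M="\<lambda>n. (T\<^sup>2 * C) * R n", OF _ _ CR_summable])
      show "((\<lambda>s. pivot (u s) (eigfun \<mu> n) - pivot (u t) (eigfun \<mu> n)) \<longlongrightarrow> 0) (at t within {0..T})" for n
        by (rule Lim_transform_eventually[OF U_tendsto[OF t]]) (use ev[of t] in \<open>eventually_elim, simp only: c\<close>)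
      show "eventually (\<lambda>s. \<forall>n. (pivot (u s) (eigfun \<mu> n) - pivot (u t) (eigfun \<mu> n))\<^sup>2 / eigval \<mu> n \<le> (T\<^sup>2 * C) * R n) (at t within {0..T})"
        using ev[of t]
      proof (eventually_elim, intro allI)
        fix s n assume s: "s \<in> {0..T}"
        have "\<bar>U n s - U n t\<bar> \<le> sqrt (C * R n * eigval \<mu> n) * T"
          by (rule order_trans[OF U_Lipschitz[OF s t] mult_left_mono[OF _ real_sqrt_ge_zero[OF mult_nonneg_nonneg[OF CR_nonneg less_imp_le[OF eigval_pos]]]]])
            (use s t in auto)
        then have "\<bar>U n s - U n t\<bar>\<^sup>2 \<le> (sqrt (C * R n * eigval \<mu> n) * T)\<^sup>2" by (rule power_mono) simp
        also have "\<dots> = (T\<^sup>2 * C) * R n * eigval \<mu> n"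
          unfolding power_mult_distrib
          by (subst real_sqrt_pow2[OF mult_nonneg_nonneg[OF CR_nonneg less_imp_le[OF eigval_pos]]]) (simp add: mult_ac)
        finally have "(U n s - U n t)\<^sup>2 \<le> (T\<^sup>2 * C) * R n * eigval \<mu> n" by (simp only: power2_abs)
        then show "(pivot (u s) (eigfun \<mu> n) - pivot (u t) (eigfun \<mu> n))\<^sup>2 / eigval \<mu> n \<le> (T\<^sup>2 * C) * R n"
          using s by (simp only: c divide_eigval_le)
      qed
    qed
  qed
  show "cont_dual \<mu> T (Dt \<mu> T u)"
    unfolding cont_dual_def
  proof (intro ballI conjI)
    fix t assume t: "t \<in> {0..T}"
    show "Dt \<mu> T u t \<in> Hdual \<mu> 1" by (rule Dt_u(2)[OF t])
    show "((\<lambda>s. Hdual_norm \<mu> 1 (\<lambda>v. Dt \<mu> T u s v - Dt \<mu> T u t v)) \<longlongrightarrow> 0) (at t within {0..T})"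
    proof (rule Hdual_norm_tendsto[where M="\<lambda>n. (4 * C) * R n", OF _ _ CR_summable])
      show "((\<lambda>s. Dt \<mu> T u s (eigfun \<mu> n) - Dt \<mu> T u t (eigfun \<mu> n)) \<longlongrightarrow> 0) (at t within {0..T})" for n
        by (rule Lim_transform_eventually[OF w_tendsto[OF t]]) (use ev[of t] in \<open>eventually_elim, simp only: Dt_u_eigfun t\<close>)
      show "eventually (\<lambda>s. \<forall>n. (Dt \<mu> T u s (eigfun \<mu> n) - Dt \<mu> T u t (eigfun \<mu> n))\<^sup>2 / eigval \<mu> n \<le> (4 * C) * R n) (at t within {0..T})"
        using ev[of t]
      proof (eventually_elim, intro allI)
        fix s n assume s: "s \<in> {0..T}"
        have "(w n s - w n t)\<^sup>2 \<le> (4 * C) * R n * eigval \<mu> n"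
          using square_diff_le_double[of "w n s" "w n t"] w_abs[OF s, of n] w_abs[OF t, of n] by linarith
        then show "(Dt \<mu> T u s (eigfun \<mu> n) - Dt \<mu> T u t (eigfun \<mu> n))\<^sup>2 / eigval \<mu> n \<le> (4 * C) * R n"
          by (simp only: Dt_u_eigfun s t divide_eigval_le)
      qed
    qed
  qed
qed

section \<open>The Caputo derivative of the synthesised function\<close>

lemma G_eigfun: "G t (eigfun \<mu> n) = h n t"
  by (simp add: G_def synth_eigfun)

lemma G_Hdual: "G t \<in> Hdual \<mu> 1"
  unfolding G_def by (rule synth_Hdual[OF divide_eigval_summable(1)]) (rule h_bound)

lemma G_norm: "(Hdual_norm \<mu> 1 (G t))\<^sup>2 = (\<Sum>n. (h n t)\<^sup>2 / eigval \<mu> n)" "(Hdual_norm \<mu> 1 (G t))\<^sup>2 \<le> C * suminf R"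
proof -
  have "0 \<le> (\<Sum>n. (h n t)\<^sup>2 / eigval \<mu> n)"
    by (rule suminf_nonneg[OF divide_eigval_summable(1)]) (use h_bound eigval_pos in \<open>simp_all add: less_imp_le\<close>)
  then show e: "(Hdual_norm \<mu> 1 (G t))\<^sup>2 = (\<Sum>n. (h n t)\<^sup>2 / eigval \<mu> n)" by (simp add: Hdual_norm_eq G_eigfun)
  show "(Hdual_norm \<mu> 1 (G t))\<^sup>2 \<le> C * suminf R" unfolding e by (rule divide_eigval_summable(2)) (rule h_bound)
qed

lemma G_norm_integrable: "integrable (time_interval T) (\<lambda>t. (Hdual_norm \<mu> 1 (G t))\<^sup>2)"
proof (rule integrable_bounded_interval)
  show "(\<lambda>t. (Hdual_norm \<mu> 1 (G t))\<^sup>2) \<in> borel_measurable (lebesgue_on {0<..<T})"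
    unfolding G_norm(1) by (rule borel_lebesgue_on) measurable
  show "\<bar>(Hdual_norm \<mu> 1 (G t))\<^sup>2\<bar> \<le> C * suminf R" for t using G_norm(2)[of t] by simp
qed

text \<open>Strong measurability by a diagonal construction: the k-th approximation keeps the first
  k modes and takes the k-th simple approximation of each. These are at most twice as large as
  \<open>h n\<close>, so errors are at most three times as large; hence the majorant 9 C R.\<close>

lemma G_L2: "G \<in> L2_dual \<mu> T"
  unfolding L2_dual_def mem_Collect_eq
proof (intro conjI G_norm_integrable)
  let ?M = "lebesgue_on {0<..<T}"
  show "AE t in ?M. G t \<in> Hdual \<mu> 1" by (simp add: G_Hdual)
  have "\<forall>n. \<exists>F. (\<forall>i. simple_function ?M (F i)) \<and> (\<forall>x\<in>space ?M. (\<lambda>i. F i x) \<longlonglongrightarrow> h n x) \<and>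
      (\<forall>i. \<forall>x\<in>space ?M. dist (F i x) 0 \<le> 2 * dist (h n x) 0)"
    by (rule allI, rule borel_measurable_implies_sequence_metric) (rule borel_lebesgue_on[OF h_measurable])
  from choice[OF this] obtain s where s': "\<forall>n. (\<forall>i. simple_function ?M (s n i)) \<and> (\<forall>x\<in>space ?M. (\<lambda>i. s n i x) \<longlonglongrightarrow> h n x) \<and>
      (\<forall>i. \<forall>x\<in>space ?M. dist (s n i x) 0 \<le> 2 * dist (h n x) 0)" by (elim exE) (rule that)
  note s'' = s'[THEN spec]
  have s: "simple_function ?M (s n k)" for n k using s''[of n, THEN conjunct1] by (rule spec)
  have slim: "(\<lambda>k. s n k t) \<longlonglongrightarrow> h n t" if "t \<in> {0<..<T}" for n t
    using s''[of n, THEN conjunct2, THEN conjunct1, THEN bspec, of t] that by simp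
  have sle: "\<bar>s n k t\<bar> \<le> 2 * \<bar>h n t\<bar>" if "t \<in> {0<..<T}" for n k t
    using s''[of n, THEN conjunct2, THEN conjunct2, THEN spec, of k, THEN bspec, of t] that by simp
  define S :: "nat \<Rightarrow> real \<Rightarrow> functional" where "S k t v = (\<Sum>n<k. s n k t * fcoeff \<mu> v n)" for k t v
  have S: "S k t = synth (\<lambda>n. if n < k then s n k t else 0)" for k t
  proof
    fix v
    have "(\<Sum>n. (if n < k then s n k t else 0) * fcoeff \<mu> v n) = (\<Sum>n<k. (if n < k then s n k t else 0) * fcoeff \<mu> v n)"
      by (rule suminf_finite) auto
    then show "S k t v = synth (\<lambda>n. if n < k then s n k t else 0) v" by (simp add: S_def synth_def)
  qed
  show "\<exists>S. (\<forall>k. simple_function ?M (S k) \<and> (\<forall>t\<in>{0<..<T}. S k t \<in> Hdual \<mu> 1)) \<and>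
      (AE t in ?M. (\<lambda>k. Hdual_norm \<mu> 1 (\<lambda>v. S k t v - G t v)) \<longlonglongrightarrow> 0)"
  proof (intro exI[of _ S] conjI allI ballI)
    fix k
    \<comment> \<open>A map into functionals is simple if it takes finitely many values; this is
      preserved when one more mode is added.\<close>
    have "simple_function ?M (\<lambda>t. (\<lambda>v. \<Sum>n<m. s n k t * fcoeff \<mu> v n))" for m
    proof (induction m)
      case (Suc m)
      from simple_function_compose2[OF Suc s[of m k], where h="\<lambda>F c v. F v + c * fcoeff \<mu> v m"]
      show ?case by simp
    qed simp
    then show "simple_function ?M (S k)" unfolding S_def[abs_def] .
    show "S k t \<in> Hdual \<mu> 1" for t
      unfolding S by (intro synth_Hdual summable_finite[of "{..<k}"]) auto
  next
    have "(\<lambda>k. Hdual_norm \<mu> 1 (\<lambda>v. S k t v - G t v)) \<longlonglongrightarrow> 0" if t: "t \<in> {0<..<T}" for t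
    proof (rule Hdual_norm_tendsto[where M="\<lambda>n. (9 * C) * R n", OF _ _ CR_summable])
      have e: "S k t (eigfun \<mu> n) - G t (eigfun \<mu> n) = (if n < k then s n k t else 0) - h n t" for k n
        by (simp add: S synth_eigfun G_eigfun)
      show "(\<lambda>k. S k t (eigfun \<mu> n) - G t (eigfun \<mu> n)) \<longlonglongrightarrow> 0" for n
        by (rule Lim_transform_eventually[OF LIM_zero[OF slim[OF t, of n]]])
          (use eventually_gt_at_top[of n] in \<open>eventually_elim, simp add: e\<close>)
      show "\<forall>\<^sub>F k in sequentially. \<forall>n. (S k t (eigfun \<mu> n) - G t (eigfun \<mu> n))\<^sup>2 / eigval \<mu> n \<le> (9 * C) * R n"
      proof (intro always_eventually allI divide_eigval_le)
        fix k n
        have "\<bar>S k t (eigfun \<mu> n) - G t (eigfun \<mu> n)\<bar> \<le> 3 * \<bar>h n t\<bar>"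
          unfolding e using sle[OF t, of n k] by (auto split: if_splits)
        then have "\<bar>S k t (eigfun \<mu> n) - G t (eigfun \<mu> n)\<bar>\<^sup>2 \<le> (3 * \<bar>h n t\<bar>)\<^sup>2" by (rule power_mono) simp
        also have "\<dots> = 9 * (h n t)\<^sup>2" by (simp add: power_mult_distrib)
        finally show "(S k t (eigfun \<mu> n) - G t (eigfun \<mu> n))\<^sup>2 \<le> 9 * C * R n * eigval \<mu> n"
          using h_bound[of n t] by simp
      qed
    qed
    then show "AE t in ?M. (\<lambda>k. Hdual_norm \<mu> 1 (\<lambda>v. S k t v - G t v)) \<longlonglongrightarrow> 0" by (intro AE_I2) simp
  qed
qed

lemma G_L2_norm: "L2_dual_norm \<mu> T G \<le> sqrt (T * (C * suminf R))"
proof -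
  interpret M: finite_measure "lebesgue_on {0<..<T}" by (rule finite_measure_lebesgue_on) simp
  have "(\<integral>t. (Hdual_norm \<mu> 1 (G t))\<^sup>2 \<partial>lebesgue_on {0<..<T}) \<le> (\<integral>t. C * suminf R \<partial>lebesgue_on {0<..<T})"
    by (rule integral_mono[OF G_norm_integrable]) (simp_all add: G_norm(2))
  also have "\<dots> = T * (C * suminf R)" using T by (simp add: measure_restrict_space)
  finally show ?thesis unfolding L2_dual_norm_def by (rule real_sqrt_le_mono)
qed

text \<open>Paired with v, the increment of the time derivative is I^(\<alpha>-1) H with H the
  pairing of \<open>G\<close>. Applying I^(2-\<alpha>) gives the primitive of H, whose
  distributional derivative is H.\<close>

lemma G_caputo: "has_caputo \<mu> \<alpha> T u G"
  unfolding has_caputo_def has_distr_deriv_def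
proof (intro conjI G_L2 ballI)
  fix \<psi> v assume \<psi>: "\<psi> \<in> test_functions 0 T" and v: "v \<in> Hs \<mu> 1"
  define c where "c n = fcoeff \<mu> v n" for n
  \<comment> \<open>A summable majorant of the terms of the pairing that does not depend on time, by
    Young's inequality with weight lambda.\<close>
  define B where "B n = C * R n + eigval \<mu> n * (c n)\<^sup>2" for n
  have B: "summable B" unfolding B_def c_def by (intro summable_add CR_summable Hs1_summable[OF v])
  have hB: "\<bar>h n s * c n\<bar> \<le> B n" for n s
    using pair_abs_le[of "h n s" "c n" n] divide_eigval_le[OF h_bound[of n s]] unfolding B_def by linarith
  have hs: "summable (\<lambda>n. norm (h n s * c n))" for s
    by (rule summable_comparison_test'[OF B, of 0]) (use hB in simp)
  have hm: "(\<lambda>s. h n s * c n) \<in> borel_measurable borel" for n by measurable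
  have hz: "s \<le> 0 \<Longrightarrow> h n s * c n = 0" for s n by (simp add: h_nonpos)
  have \<beta>: "0 < \<alpha> - 1" "0 < 2 - \<alpha>" using order by auto
  define H where "H s = (\<Sum>n. h n s * c n)" for s
  have HG: "G s v = H s" for s by (simp add: G_def synth_def H_def c_def)
  have Hm [measurable]: "H \<in> borel_measurable borel" unfolding H_def by measurable
  have H0: "s \<le> 0 \<Longrightarrow> H s = 0" for s by (simp add: H_def h_nonpos)
  have HM: "\<bar>H s\<bar> \<le> suminf B" for s
    unfolding H_def using hB[of _ s] hs[of s] B
    by (intro order_trans[OF summable_rabs suminf_le]) auto
  \<comment> \<open>The series is summed under the fractional integral, which \<open>B\<close>
    permits; the initial velocities cancel.\<close>
  have Dd: "Dt \<mu> T u s v - Dt \<mu> T u 0 v = cv (\<alpha> - 1) H s" if s: "s \<in> {0..T}" for s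
  proof -
    have z: "0 \<in> {0..T}" using T by simp
    note ws = summable_norm_cancel[OF pair_summable[OF divide_eigval_summable(1)[OF w_abs] v]]
    have "Dt \<mu> T u s v - Dt \<mu> T u 0 v = (\<Sum>n. w n s * c n) - (\<Sum>n. w n 0 * c n)"
      by (simp add: Dt_u(3)[OF s v] Dt_u(3)[OF z v] synth_def c_def)
    also have "\<dots> = (\<Sum>n. w n s * c n - w n 0 * c n)"
      unfolding c_def by (rule suminf_diff[OF ws[OF s] ws[OF z]])
    also have "\<dots> = (\<Sum>n. \<integral>r. gk (\<alpha> - 1) (s - r) * (h n r * c n) \<partial>lborel)"
    proof (intro suminf_cong)
      fix n
      have "cv (\<alpha> - 1) (h n) 0 = 0" by (rule cv_zero) (simp_all add: h_nonpos)
      then have "w n s * c n - w n 0 * c n = cv (\<alpha> - 1) (h n) s * c n" by (simp add: w_def algebra_simps)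
      then show "w n s * c n - w n 0 * c n = (\<integral>r. gk (\<alpha> - 1) (s - r) * (h n r * c n) \<partial>lborel)"
        by (simp add: cv_def mult.assoc[symmetric])
    qed
    also have "\<dots> = (\<integral>r. (\<Sum>n. gk (\<alpha> - 1) (s - r) * (h n r * c n)) \<partial>lborel)"
    proof (rule integral_suminf[symmetric])
      show "integrable lborel (\<lambda>r. gk (\<alpha> - 1) (s - r) * (h n r * c n))" for n
        by (rule cv_integrable(1)[OF \<beta>(1) hm hz hB])
      show "AE r in lborel. summable (\<lambda>n. norm (gk (\<alpha> - 1) (s - r) * (h n r * c n)))"
      proof (rule AE_I2)
        fix r
        have "summable (\<lambda>n. \<bar>gk (\<alpha> - 1) (s - r)\<bar> * norm (h n r * c n))" by (rule summable_mult[OF hs])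
        then show "summable (\<lambda>n. norm (gk (\<alpha> - 1) (s - r) * (h n r * c n)))" by (simp add: abs_mult)
      qed
      show "summable (\<lambda>n. \<integral>r. norm (gk (\<alpha> - 1) (s - r) * (h n r * c n)) \<partial>lborel)"
      proof (rule summable_comparison_test'[OF summable_mult2[OF B, of "gk (\<alpha> - 1 + 1) s"], of 0])
        fix n
        have e: "norm (gk (\<alpha> - 1) (s - r) * (h n r * c n)) = gk (\<alpha> - 1) (s - r) * \<bar>h n r * c n\<bar>" for r
          using gk_nonneg[OF \<beta>(1), of "s - r"] by (simp add: abs_mult)
        have "\<bar>cv (\<alpha> - 1) (\<lambda>r. \<bar>h n r * c n\<bar>) s\<bar> \<le> B n * gk (\<alpha> - 1 + 1) s"
          by (rule cv_integrable(2)[OF \<beta>(1)]) (use hm hz hB in auto)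
        then show "norm (\<integral>r. norm (gk (\<alpha> - 1) (s - r) * (h n r * c n)) \<partial>lborel) \<le> B n * gk (\<alpha> - 1 + 1) s"
          unfolding e cv_def by simp
      qed
    qed
    also have "\<dots> = cv (\<alpha> - 1) H s"
      unfolding cv_def H_def by (intro Bochner_Integration.integral_cong refl suminf_mult summable_norm_cancel[OF hs])
    finally show ?thesis .
  qed
  have fi: "frac_int (2 - \<alpha>) (\<lambda>s v. Dt \<mu> T u s v - Dt \<mu> T u 0 v) t v = cv 1 H t" if t: "t \<in> {0<..<T}" for t
  proof -
    have "frac_int (2 - \<alpha>) (\<lambda>s v. Dt \<mu> T u s v - Dt \<mu> T u 0 v) t v = cv (2 - \<alpha>) (cv (\<alpha> - 1) H) t"
      unfolding frac_int_def
    proof (rule cv_fractional_integral)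
      show "cv (\<alpha> - 1) H \<in> borel_measurable borel" by measurable
      show "s \<le> 0 \<Longrightarrow> cv (\<alpha> - 1) H s = 0" for s by (rule cv_zero[OF H0])
      show "0 < s \<Longrightarrow> s < t \<Longrightarrow> cv (\<alpha> - 1) H s = Dt \<mu> T u s v - Dt \<mu> T u 0 v" for s using Dd[of s] t by simp
    qed
    also have "\<dots> = cv (2 - \<alpha> + (\<alpha> - 1)) H t" by (rule cv_cv[OF \<beta>(2,1) Hm H0 HM])
    finally show ?thesis by simp
  qed
  have "(\<integral>t. deriv \<psi> t * frac_int (2 - \<alpha>) (\<lambda>s v. Dt \<mu> T u s v - Dt \<mu> T u 0 v) t v \<partial>lebesgue_on {0<..<T})
      = (\<integral>t. deriv \<psi> t * cv 1 H t \<partial>lebesgue_on {0<..<T})"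
    by (intro Bochner_Integration.integral_cong refl) (simp add: fi)
  also have "\<dots> = - (\<integral>t. \<psi> t * H t \<partial>lebesgue_on {0<..<T})" by (rule cv_1_weak_deriv[OF \<psi> T Hm H0 HM])
  finally show "(\<integral>t. deriv \<psi> t * frac_int (2 - \<alpha>) (\<lambda>s v. Dt \<mu> T u s v - Dt \<mu> T u 0 v) t v \<partial>lebesgue_on {0<..<T})
      = - (\<integral>t. \<psi> t * G t v \<partial>lebesgue_on {0<..<T})" by (simp only: HG)
qed

lemma u_caputo: "has_caputo \<mu> \<alpha> T u (caputo \<mu> \<alpha> T u)"
  unfolding caputo_def by (rule someI[of "has_caputo \<mu> \<alpha> T u", OF G_caputo])

lemma caputo_u: "AE t in time_interval T. \<forall>v\<in>Hs \<mu> 1. caputo \<mu> \<alpha> T u t v = G t v"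
  by (rule has_caputo_unique[OF u_caputo G_caputo])

lemma caputo_u_norm: "L2_dual_norm \<mu> T (caputo \<mu> \<alpha> T u) \<le> sqrt (T * (C * suminf R))"
proof -
  let ?M = "lebesgue_on {0<..<T}"
  have "integrable ?M (\<lambda>t. (Hdual_norm \<mu> 1 (caputo \<mu> \<alpha> T u t))\<^sup>2)"
    by (rule L2_dual_integrable[OF has_caputo_L2[OF u_caputo]])
  moreover have "AE t in ?M. (Hdual_norm \<mu> 1 (caputo \<mu> \<alpha> T u t))\<^sup>2 = (Hdual_norm \<mu> 1 (G t))\<^sup>2"
    using caputo_u by eventually_elim (simp add: Hdual_norm_eq eigfun_Hs1)
  ultimately have "(\<integral>t. (Hdual_norm \<mu> 1 (caputo \<mu> \<alpha> T u t))\<^sup>2 \<partial>?M) = (\<integral>t. (Hdual_norm \<mu> 1 (G t))\<^sup>2 \<partial>?M)"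
    by (intro integral_cong_AE borel_measurable_integrable G_norm_integrable) auto
  then show ?thesis using G_L2_norm by (simp add: L2_dual_norm_def)
qed

lemma u_norm: "t \<in> {0..T} \<Longrightarrow> Hs_norm \<mu> 1 (u t) \<le> sqrt (C * suminf R)"
  and Dt_u_norm: "t \<in> {0..T} \<Longrightarrow> Hdual_norm \<mu> 1 (Dt \<mu> T u t) \<le> sqrt (C * suminf R)"
proof -
  assume t: "t \<in> {0..T}"
  have "(\<Sum>n. eigval \<mu> n * (fcoeff \<mu> (u t) n)\<^sup>2) \<le> (\<Sum>n. C * R n)"
    by (intro suminf_le CR_summable Hs1_summable u_coeff_Hs(1) t) (simp add: u_coeff_Hs(2)[OF t] U_bound[OF t])
  then show "Hs_norm \<mu> 1 (u t) \<le> sqrt (C * suminf R)"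
    unfolding Hs_norm_eq by (intro real_sqrt_le_mono) (simp add: suminf_mult R_summable)
  show "Hdual_norm \<mu> 1 (Dt \<mu> T u t) \<le> sqrt (C * suminf R)"
    unfolding Hdual_norm_eq Dt_u_eigfun[OF t] by (intro real_sqrt_le_mono divide_eigval_summable(2) w_abs t)
qed

end

section \<open>Uniqueness\<close>

lemma continuous_bounded_interval:
  fixes f :: "real \<Rightarrow> real"
  assumes "continuous_on {a..b} f"
  shows "\<exists>B. \<forall>t\<in>{a..b}. \<bar>f t\<bar> \<le> B"
  using compact_imp_bounded[OF compact_continuous_image[OF assms compact_Icc]]
  unfolding bounded_iff real_norm_def by blast

lemma continuous_integrable_interval:
  fixes f :: "real \<Rightarrow> real"
  assumes "continuous_on UNIV f"
  shows "integrable (lebesgue_on {a<..<b}) f"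
proof -
  have "integrable (lebesgue_on {a..b}) f"
    by (rule continuous_imp_integrable_real) (rule continuous_on_subset[OF assms], simp)
  then show ?thesis by (rule integrable_lebesgue_on_subset) auto
qed

text \<open>Du Bois-Reymond gives constancy on the open interval only; this identifies the constant
  with the value at the left end point, where fractional integrals vanish.\<close>

lemma continuous_const_right:
  fixes W :: "real \<Rightarrow> real"
  assumes W: "continuous_on UNIV W" and c: "\<And>s. s \<in> {a<..<b} \<Longrightarrow> W s = c" and ab: "a < b"
  shows "W a = c"
proof -
  have "(W \<longlongrightarrow> W a) (at a within UNIV)" using W unfolding continuous_on_def by blast
  then have l: "(W \<longlongrightarrow> W a) (at_right a)" by (rule tendsto_within_subset) simp
  have "eventually (\<lambda>s. W s = c) (at_right a)"
    using eventually_at_right_real[OF ab] by (rule eventually_mono) (rule c)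
  then have "(W \<longlongrightarrow> c) (at_right a)" by (rule tendsto_eventually)
  from tendsto_unique[OF trivial_limit_at_right_real l this] show ?thesis .
qed

text \<open>The essential supremum is finite by membership and nonnegative because the interval has
  positive measure, so its conversion to a real number loses nothing.\<close>

lemma Linf_bound:
  assumes q: "q \<in> Linf (time_interval T)" and T: "0 < T"
  shows "0 \<le> Linf_norm (time_interval T) q" "AE t in time_interval T. \<bar>q t\<bar> \<le> Linf_norm (time_interval T) q"
proof -
  let ?M = "lebesgue_on {0<..<T}" and ?e = "esssup (lebesgue_on {0<..<T}) (\<lambda>x. ereal \<bar>q x\<bar>)"
  have m: "q \<in> borel_measurable ?M" and fin: "?e < \<infinity>" using q by (simp_all add: Linf_def)
  have ne: "emeasure ?M (space ?M) \<noteq> 0" using T by (simp add: emeasure_restrict_space)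
  have "esssup ?M (\<lambda>x. ereal 0) \<le> ?e" by (rule esssup_mono) simp_all
  then have e0: "0 \<le> ?e" using esssup_const[OF ne, of "ereal 0"] by (simp add: zero_ereal_def)
  have r: "ereal (Linf_norm ?M q) = ?e"
    unfolding Linf_norm_def using e0 fin by (intro ereal_real') auto
  then show "0 \<le> Linf_norm ?M q" using e0 unfolding r[symmetric] by simp
  have "AE t in ?M. ereal \<bar>q t\<bar> \<le> ?e" by (rule esssup_AE)
  then show "AE t in ?M. \<bar>q t\<bar> \<le> Linf_norm ?M q"
    unfolding r[symmetric] by (rule eventually_mono) simp
qed

lemma (in hardy_potential) a_form_eigfun:
  assumes v: "v \<in> Hs \<mu> 1"
  shows "a_form \<mu> v (eigfun \<mu> n) = eigval \<mu> n * fcoeff \<mu> v n"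
proof -
  have e: "(\<lambda>k. eigval \<mu> k * fcoeff \<mu> v k * fcoeff \<mu> (eigfun \<mu> n) k) = (\<lambda>k. if k = n then eigval \<mu> k * fcoeff \<mu> v k else 0)"
    by (auto simp: fcoeff_eigfun)
  have "(\<lambda>k. eigval \<mu> k * fcoeff \<mu> v k * fcoeff \<mu> (eigfun \<mu> n) k) sums (eigval \<mu> n * fcoeff \<mu> v n)"
    unfolding e by (rule sums_single)
  then show ?thesis by (rule sums_unique2[OF a_form_sums[OF v eigfun_Hs1]])
qed

text \<open>Tested with the n-th eigenfunction, the distributional equation says that I^(2-\<alpha>)
  (Z' - Z'(0)) and I^1 k have the same derivative, where Z is the coefficient of z and k = f -
  lambda Z. Both are continuous and vanish at 0, so they agree; applying I^(\<alpha>-1) gives the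
  Volterra equation for Z, whose solution is unique.\<close>

lemma (in mode_family) weak_solution_coeff:
  assumes fm [measurable]: "\<And>n. f n \<in> borel_measurable borel" and fF: "\<And>n s. \<bar>f n s\<bar> \<le> F n"
    and h_eq: "\<And>n s. s \<in> {0<..<T} \<Longrightarrow> h n s = f n s - eigval \<mu> n * U n s"
    and zH: "\<And>t. t \<in> {0..T} \<Longrightarrow> z t \<in> Hs \<mu> 1" and C1: "C1_dual \<mu> T z"
    and z0: "fcoeff \<mu> (z 0) n = a n" and z1: "Dt \<mu> T z 0 (eigfun \<mu> n) = b n"
    and cap: "has_caputo \<mu> \<alpha> T z g"
    and eq: "AE t in time_interval T. g t (eigfun \<mu> n) = f n t - eigval \<mu> n * fcoeff \<mu> (z t) n"
    and t: "t \<in> {0..T}"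
  shows "fcoeff \<mu> (z t) n = U n t"
proof -
  let ?M = "lebesgue_on {0<..<T}"
  define Z where "Z s = fcoeff \<mu> (z s) n" for s
  define D where "D s = Dt \<mu> T z s (eigfun \<mu> n)" for s
  have Zd: "(Z has_real_derivative D s) (at s within {0..T})" if s: "s \<in> {0..T}" for s
  proof -
    obtain F where F: "has_dual_deriv \<mu> T (\<lambda>s. pivot (z s)) F s" using C1[unfolded C1_dual_def, THEN conjunct2, THEN conjunct1, THEN bspec, OF s] by (elim exE) (rule that)
    show ?thesis unfolding Z_def[abs_def] D_def by (rule has_dual_deriv_coeff[OF Dt_eqI(1)[OF F zH s T] zH s])
  qed
  have Dc: "continuous_on {0..T} D" unfolding D_def[abs_def] by (rule cont_dual_coeff[OF C1[unfolded C1_dual_def, THEN conjunct2, THEN conjunct2]])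
  have Zc: "continuous_on {0..T} Z" by (rule DERIV_continuous_on[OF Zd])
  obtain BD where BD: "\<forall>s\<in>{0..T}. \<bar>D s\<bar> \<le> BD" using continuous_bounded_interval[OF Dc] by blast
  obtain BZ where BZ: "\<forall>s\<in>{0..T}. \<bar>Z s\<bar> \<le> BZ" using continuous_bounded_interval[OF Zc] by blast
  \<comment> \<open>Clamping time to [0, T] extends Z and its derivative to bounded continuous
    functions on the line.\<close>
  define cl where "cl s = max 0 (min s T)" for s
  have cl: "cl s \<in> {0..T}" for s using T by (auto simp: cl_def)
  have cl_id: "s \<in> {0..T} \<Longrightarrow> cl s = s" and cl_0: "s \<le> 0 \<Longrightarrow> cl s = 0" for s using T by (auto simp: cl_def)
  have clc: "continuous_on UNIV cl" unfolding cl_def[abs_def] by (intro continuous_intros)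
  define Y where "Y s = D (cl s) - D 0" for s
  have Yc: "continuous_on UNIV Y"
    unfolding Y_def[abs_def] by (intro continuous_on_diff continuous_on_const continuous_on_compose2[OF Dc clc]) (use cl in blast)
  have Ym: "Y \<in> borel_measurable borel" by (rule borel_measurable_continuous_onI[OF Yc])
  have Y0: "s \<le> 0 \<Longrightarrow> Y s = 0" for s by (simp add: Y_def cl_0)
  have YM: "\<bar>Y s\<bar> \<le> 2 * BD" for s
  proof -
    have "\<bar>D (cl s)\<bar> \<le> BD" "\<bar>D 0\<bar> \<le> BD" using BD cl[of s] T by auto
    then show ?thesis unfolding Y_def by linarith
  qed
  have Zcm: "(\<lambda>s. Z (cl s)) \<in> borel_measurable borel"
    by (rule borel_measurable_continuous_onI) (rule continuous_on_compose2[OF Zc clc], use cl in blast)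
  \<comment> \<open>The right-hand side f - lambda Z, which the equation identifies with the
    coefficient of the Caputo derivative almost everywhere on the interval.\<close>
  define k where "k s = indicator {0<..<T} s * (f n s - eigval \<mu> n * Z (cl s))" for s
  have km: "k \<in> borel_measurable borel" unfolding k_def[abs_def] using Zcm fm[of n] by simp
  have kout: "s \<notin> {0<..<T} \<Longrightarrow> k s = 0" for s by (simp add: k_def)
  have k0: "s \<le> 0 \<Longrightarrow> k s = 0" for s by (simp add: kout)
  have kM: "\<bar>k s\<bar> \<le> F n + eigval \<mu> n * BZ" for s
  proof -
    have "\<bar>eigval \<mu> n * Z (cl s)\<bar> \<le> eigval \<mu> n * BZ"
      using BZ cl[of s] eigval_pos[of n] by (simp add: abs_mult)
    then have "\<bar>f n s - eigval \<mu> n * Z (cl s)\<bar> \<le> F n + eigval \<mu> n * BZ" using fF[of n s] by linarith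
    then show ?thesis unfolding k_def by (cases "s \<in> {0<..<T}") auto
  qed
  have ord: "0 < 2 - \<alpha>" "2 - \<alpha> \<le> 1" "0 < \<alpha> - 1" using order by auto
  have c1: "continuous_on UNIV (cv (2 - \<alpha>) Y)" by (rule cv_continuous[OF ord(1,2) Ym Y0 YM])
  have c2: "continuous_on UNIV (cv 1 k)" by (rule cv_continuous[OF _ _ km k0 kM]) simp_all
  have cc: "continuous_on UNIV (\<lambda>s. cv (2 - \<alpha>) Y s - cv 1 k s)" by (rule continuous_on_diff[OF c1 c2])
  have orth: "(\<integral>s. deriv \<psi> s * (cv (2 - \<alpha>) Y s - cv 1 k s) \<partial>?M) = 0" if \<psi>: "\<psi> \<in> test_functions 0 T" for \<psi>
  proof -
    note \<psi>c = test_function_continuous[OF \<psi>]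
    have fi: "frac_int (2 - \<alpha>) (\<lambda>s v. Dt \<mu> T z s v - Dt \<mu> T z 0 v) s (eigfun \<mu> n) = cv (2 - \<alpha>) Y s" if s: "s \<in> {0<..<T}" for s
      unfolding frac_int_def
    proof (rule cv_fractional_integral[OF Ym Y0])
      show "0 < r \<Longrightarrow> r < s \<Longrightarrow> Y r = Dt \<mu> T z r (eigfun \<mu> n) - Dt \<mu> T z 0 (eigfun \<mu> n)" for r
        using s by (simp add: Y_def D_def cl_id)
    qed
    have "(\<integral>s. deriv \<psi> s * cv (2 - \<alpha>) Y s \<partial>?M) =
        (\<integral>s. deriv \<psi> s * frac_int (2 - \<alpha>) (\<lambda>s v. Dt \<mu> T z s v - Dt \<mu> T z 0 v) s (eigfun \<mu> n) \<partial>?M)"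
      by (intro Bochner_Integration.integral_cong refl) (simp add: fi)
    also have "\<dots> = - (\<integral>s. \<psi> s * g s (eigfun \<mu> n) \<partial>?M)" by (rule has_caputo_integral[OF cap \<psi> eigfun_Hs1])
    also have "(\<integral>s. \<psi> s * g s (eigfun \<mu> n) \<partial>?M) = (\<integral>s. \<psi> s * k s \<partial>?M)"
    proof (rule integral_cong_AE)
      show "(\<lambda>s. \<psi> s * g s (eigfun \<mu> n)) \<in> borel_measurable ?M"
        by (rule borel_measurable_integrable[OF L2_dual_pairing_integrable[OF has_caputo_L2[OF cap] \<psi>]])
      show "(\<lambda>s. \<psi> s * k s) \<in> borel_measurable ?M"
        by (rule borel_lebesgue_on, rule borel_measurable_times[OF borel_measurable_continuous_onI[OF \<psi>c(1)] km])
      have "AE s in ?M. s \<in> {0<..<T}" by (rule AE_I2) simp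
      with eq show "AE s in ?M. \<psi> s * g s (eigfun \<mu> n) = \<psi> s * k s"
        by eventually_elim (simp add: k_def Z_def cl_id)
    qed
    also have "- (\<integral>s. \<psi> s * k s \<partial>?M) = (\<integral>s. deriv \<psi> s * cv 1 k s \<partial>?M)"
      by (rule cv_1_weak_deriv[OF \<psi> T km k0 kM, symmetric])
    finally have e: "(\<integral>s. deriv \<psi> s * cv (2 - \<alpha>) Y s \<partial>?M) = (\<integral>s. deriv \<psi> s * cv 1 k s \<partial>?M)" .
    have "(\<integral>s. deriv \<psi> s * cv (2 - \<alpha>) Y s - deriv \<psi> s * cv 1 k s \<partial>?M) = 0"
      by (subst Bochner_Integration.integral_diff[OF continuous_integrable_interval[OF continuous_on_mult[OF \<psi>c(2) c1]]
            continuous_integrable_interval[OF continuous_on_mult[OF \<psi>c(2) c2]]]) (simp add: e)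
    then show ?thesis by (simp only: right_diff_distrib)
  qed
  \<comment> \<open>The difference is constant on the open interval by du Bois-Reymond; the constant
    is its value at 0, which is zero.\<close>
  have W: "cv (2 - \<alpha>) Y s = cv 1 k s" if s: "s < T" for s
  proof (cases "s \<le> 0")
    case True
    then show ?thesis using cv_zero[OF Y0 True] cv_zero[OF k0 True] by simp
  next
    case False
    then have s': "s \<in> {0<..<T}" using s by simp
    have "cv (2 - \<alpha>) Y r - cv 1 k r = cv (2 - \<alpha>) Y s - cv 1 k s" if "r \<in> {0<..<T}" for r
      by (rule du_Bois_Reymond[where G="\<lambda>s. cv (2 - \<alpha>) Y s - cv 1 k s", OF continuous_on_subset[OF cc] orth that s']) simp_all
    from continuous_const_right[OF cc this T]
    have "cv (2 - \<alpha>) Y 0 - cv 1 k 0 = cv (2 - \<alpha>) Y s - cv 1 k s" .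
    moreover have "cv (2 - \<alpha>) Y 0 = 0" by (rule cv_zero[OF Y0]) simp_all
    moreover have "cv 1 k 0 = 0" by (rule cv_zero[OF k0]) simp_all
    ultimately show ?thesis by linarith
  qed
  have Zeq: "Z s = a n + b n * s + cv \<alpha> k s" if s: "s \<in> {0..T}" for s
  proof -
    \<comment> \<open>Order \<alpha> - 1 on top of 2 - \<alpha> is plain integration, which recovers
      Z from its derivative.\<close>
    have "cv 1 Y s = cv (\<alpha> - 1 + (2 - \<alpha>)) Y s" by simp
    also have "\<dots> = cv (\<alpha> - 1) (cv (2 - \<alpha>) Y) s" by (rule cv_cv[OF ord(3,1) Ym Y0 YM, symmetric])
    also have "\<dots> = cv (\<alpha> - 1) (cv 1 k) s" by (rule cv_cong) (use W s in auto)
    also have "\<dots> = cv (\<alpha> - 1 + 1) k s" by (rule cv_cv[OF ord(3) zero_less_one km k0 kM])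
    finally have e: "cv 1 Y s = cv \<alpha> k s" by simp
    have "((\<lambda>r. D r - D 0) has_integral (Z s - D 0 * s) - (Z 0 - D 0 * 0)) {0..s}"
    proof (rule fundamental_theorem_of_calculus)
      fix r assume r: "r \<in> {0..s}"
      have "(Z has_real_derivative D r) (at r within {0..s})"
        by (rule DERIV_subset[OF Zd]) (use r s in auto)
      then have "((\<lambda>r. Z r - D 0 * r) has_real_derivative D r - D 0) (at r within {0..s})"
        by (auto intro!: derivative_eq_intros)
      then show "((\<lambda>r. Z r - D 0 * r) has_vector_derivative D r - D 0) (at r within {0..s})"
        by (simp add: has_real_derivative_iff_has_vector_derivative)
    qed (use s in simp)
    then have "integral {0..s} (\<lambda>r. D r - D 0) = Z s - Z 0 - D 0 * s" by (simp add: integral_unique)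
    moreover have "integral {0..s} Y = integral {0..s} (\<lambda>r. D r - D 0)"
      by (rule integral_cong) (use s in \<open>simp add: Y_def cl_id\<close>)
    moreover have "Z 0 = a n" "D 0 = b n" by (simp_all add: Z_def D_def z0 z1)
    ultimately show ?thesis using cv_1_integral[OF Yc Y0, of s] e by simp
  qed
  have "k = h n"
  proof (rule mode_unique[OF _ _ km h_measurable kM h_abs kout h_outside])
    show "1 \<le> \<alpha>" using order by simp
    show "0 \<le> eigval \<mu> n" using eigval_pos[of n] by simp
    fix s assume s: "s \<in> {0<..<T}"
    then have s': "s \<in> {0..T}" by simp
    have "Z s - U n s = cv \<alpha> k s - cv \<alpha> (h n) s" using Zeq[OF s'] U_eq[OF s', of n] by simp
    moreover have "k s - h n s = - (eigval \<mu> n * (Z s - U n s))"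
      using s h_eq[OF s, of n] cl_id[OF s'] by (simp add: k_def algebra_simps)
    ultimately show "k s - h n s = - (eigval \<mu> n * (cv \<alpha> k s - cv \<alpha> (h n) s))" by simp
  qed
  then show ?thesis using Zeq[OF t] U_eq[OF t, of n] by (simp add: Z_def)
qed

theorem theorem1:
  fixes T \<alpha> \<mu> :: real
  assumes "T > 0" and "1 < \<alpha>" and "\<alpha> < 2" and "\<mu> < 1 / 4"
  shows "\<exists>C>0. \<forall>p q u0 u1.
    p \<in> Ltwo Omega \<longrightarrow> q \<in> Linf (time_interval T) \<longrightarrow> u0 \<in> Hs \<mu> 1 \<longrightarrow> u1 \<in> Ltwo Omega \<longrightarrow>
    (\<exists>u. weak_solution \<mu> \<alpha> T p q u0 u1 u \<and>
      (\<forall>w. weak_solution \<mu> \<alpha> T p q u0 u1 w \<longrightarrow> (\<forall>t\<in>{0..T}. AE x in Omega. w t x = u t x)) \<and>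
      cont_H1 \<mu> T u \<and> C1_dual \<mu> T u \<and> caputo_in_L2_dual \<mu> \<alpha> T u \<and>
      (SUP t\<in>{0..T}. Hs_norm \<mu> 1 (u t)) + (SUP t\<in>{0..T}. Hdual_norm \<mu> 1 (Dt \<mu> T u t))
        + L2_dual_norm \<mu> T (caputo \<mu> \<alpha> T u)
      \<le> C * (Hs_norm \<mu> 1 u0 + Ltwo_norm Omega u1
               + Ltwo_norm Omega p * Linf_norm (time_interval T) q))"
proof -
  interpret hardy_potential \<mu> by standard fact
  \<comment> \<open>The conclusion of \<open>mode_solution\<close> as one predicate, so that
    \<open>choice\<close> can pick U and h for all modes.\<close>
  define \<P> where "\<P> C l a b f F U h \<longleftrightarrow> h \<in> borel_measurable borel \<and> (\<forall>s. s \<notin> {0<..<T} \<longrightarrow> h s = 0) \<and> (\<forall>s\<in>{0<..<T}. h s = f s - l * U s) \<and>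
      (\<forall>s. (h s)\<^sup>2 \<le> C * (l * a\<^sup>2 + b\<^sup>2 + F\<^sup>2) * l) \<and>
      (\<forall>t\<in>{0..T}. U t = a + b * t + cv \<alpha> h t \<and> l * (U t)\<^sup>2 \<le> C * (l * a\<^sup>2 + b\<^sup>2 + F\<^sup>2) \<and>
        (b + cv (\<alpha> - 1) h t)\<^sup>2 \<le> C * (l * a\<^sup>2 + b\<^sup>2 + F\<^sup>2) * l)" for C l a b F :: real and f U h :: "real \<Rightarrow> real"
  have "\<exists>C>0. \<forall>l a b f F. eigval \<mu> 0 \<le> l \<longrightarrow> f \<in> borel_measurable borel \<longrightarrow> (\<forall>s. \<bar>f s\<bar> \<le> F) \<longrightarrow> (\<exists>U h. \<P> C l a b f F U h)"
    unfolding \<P>_def by (rule mode_solution[OF assms(1-3) eigval_pos])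
  then obtain C where C: "0 < C" and modes': "\<forall>l a b f F. eigval \<mu> 0 \<le> l \<longrightarrow> f \<in> borel_measurable borel \<longrightarrow> (\<forall>s. \<bar>f s\<bar> \<le> F) \<longrightarrow> (\<exists>U h. \<P> C l a b f F U h)"
    by (elim exE conjE) (rule that)
  note modes = modes'[rule_format]
  \<comment> \<open>Each of the two suprema contributes sqrt C, the L^2 norm over (0, T) contributes
    sqrt (T C).\<close>
  define K where "K = 2 * sqrt C + sqrt (T * C)"
  have K: "0 < K" unfolding K_def using C assms(1) by (intro add_pos_pos) simp_all
  show ?thesis
  proof (rule exI[of _ K], intro conjI allI impI K)
    fix p q u0 u1
    assume p: "p \<in> Ltwo Omega" and q: "q \<in> Linf (time_interval T)" and u0: "u0 \<in> Hs \<mu> 1" and u1: "u1 \<in> Ltwo Omega"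
    let ?M = "lebesgue_on {0<..<T}"
    define Q where "Q = Linf_norm ?M q"
    have Q: "0 \<le> Q" "AE t in ?M. \<bar>q t\<bar> \<le> Q" unfolding Q_def by (rule Linf_bound[OF q assms(1)])+
    have "q \<in> borel_measurable ?M" using q by (simp add: Linf_def)
    \<comment> \<open>The scalar results ask for a source that is Borel and bounded at every time; q
      is only so up to a null set.\<close>
    from borel_representative[OF this Q(2,1)] obtain q' where q'm: "q' \<in> borel_measurable borel"
      and q'Q: "\<And>t. \<bar>q' t\<bar> \<le> Q" and qq': "AE t in ?M. q t = q' t" by blast
    define a where "a n = fcoeff \<mu> u0 n" for n
    define b where "b n = fcoeff \<mu> u1 n" for n
    define f where "f n t = fcoeff \<mu> p n * q' t" for n t
    define F where "F n = \<bar>fcoeff \<mu> p n\<bar> * Q" for n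
    \<comment> \<open>Its sum is the sum of the squares of the three data norms: by the definition
      of the norm for u0, by Parseval for u1 and p.\<close>
    define R where "R n = eigval \<mu> n * (a n)\<^sup>2 + (b n)\<^sup>2 + (F n)\<^sup>2" for n
    have fm: "f n \<in> borel_measurable borel" for n unfolding f_def[abs_def] using q'm by simp
    have fF: "\<bar>f n s\<bar> \<le> F n" for n s unfolding f_def F_def abs_mult by (intro mult_left_mono q'Q) simp
    have "\<forall>n. \<exists>U h. \<P> C (eigval \<mu> n) (a n) (b n) (f n) (F n) U h"
      by (intro allI modes eigval_ge fm fF)
    from choice[OF this] obtain U where "\<forall>n. \<exists>h. \<P> C (eigval \<mu> n) (a n) (b n) (f n) (F n) (U n) h" by blast
    from choice[OF this] obtain h where "\<forall>n. \<P> C (eigval \<mu> n) (a n) (b n) (f n) (F n) (U n) (h n)" by blast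
    note PP = this[unfolded \<P>_def, folded R_def, THEN spec]
    note h1 = PP[THEN conjunct1] and h2 = PP[THEN conjunct2, THEN conjunct1, rule_format]
      and h_eq = PP[THEN conjunct2, THEN conjunct2, THEN conjunct1, THEN bspec]
      and h3 = PP[THEN conjunct2, THEN conjunct2, THEN conjunct2, THEN conjunct1, THEN spec]
      and U1 = PP[THEN conjunct2, THEN conjunct2, THEN conjunct2, THEN conjunct2, THEN bspec]
    have sa: "(\<lambda>n. eigval \<mu> n * (a n)\<^sup>2) sums (Hs_norm \<mu> 1 u0)\<^sup>2"
    proof -
      have s: "summable (\<lambda>n. eigval \<mu> n * (a n)\<^sup>2)" unfolding a_def by (rule Hs1_summable[OF u0])
      have "0 \<le> (\<Sum>n. eigval \<mu> n * (a n)\<^sup>2)" by (rule suminf_nonneg[OF s]) (simp add: eigval_pos less_imp_le)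
      then show ?thesis using summable_sums[OF s] by (simp add: Hs_norm_eq a_def)
    qed
    have sb: "(\<lambda>n. (b n)\<^sup>2) sums (Ltwo_norm Omega u1)\<^sup>2"
      using Parseval_sums[OF u1 u1] by (simp only: b_def Ltwo_norm_power2) (simp only: power2_eq_square)
    have sF: "(\<lambda>n. (F n)\<^sup>2) sums (Ltwo_norm Omega p * Q)\<^sup>2"
      using sums_mult2[OF Parseval_sums[OF p p], of "Q\<^sup>2"]
      by (simp only: F_def power_mult_distrib Ltwo_norm_power2 power2_abs) (simp only: power2_eq_square)
    define X where "X = Hs_norm \<mu> 1 u0 + Ltwo_norm Omega u1 + Ltwo_norm Omega p * Q"
    have R: "R sums ((Hs_norm \<mu> 1 u0)\<^sup>2 + (Ltwo_norm Omega u1)\<^sup>2 + (Ltwo_norm Omega p * Q)\<^sup>2)"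
      unfolding R_def[abs_def] by (intro sums_add sa sb sF)
    have n0: "0 \<le> Hs_norm \<mu> 1 u0" "0 \<le> Ltwo_norm Omega u1" "0 \<le> Ltwo_norm Omega p * Q"
    proof -
      show "0 \<le> Hs_norm \<mu> 1 u0" unfolding Hs_norm_eq
        by (intro real_sqrt_ge_zero suminf_nonneg[OF Hs1_summable[OF u0]]) (simp add: eigval_pos less_imp_le)
      have "0 \<le> Ltwo_norm Omega v" for v unfolding Ltwo_norm_def Ltwo_inner_self by simp
      then show "0 \<le> Ltwo_norm Omega u1" "0 \<le> Ltwo_norm Omega p * Q" using Q by simp_all
    qed
    \<comment> \<open>The root of a sum of three squares is at most the sum of the three nonnegative
      norms.\<close>
    have RX: "sqrt (suminf R) \<le> X"
    proof -
      have "suminf R = (Hs_norm \<mu> 1 u0)\<^sup>2 + (Ltwo_norm Omega u1)\<^sup>2 + (Ltwo_norm Omega p * Q)\<^sup>2" using R by (rule sums_unique[symmetric])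
      also have "\<dots> \<le> X\<^sup>2"
        unfolding X_def power2_sum using n0 mult_nonneg_nonneg[OF n0(1,2)] mult_nonneg_nonneg[OF n0(1,3)] mult_nonneg_nonneg[OF n0(2,3)]
        by (simp add: algebra_simps)
      finally have "sqrt (suminf R) \<le> sqrt (X\<^sup>2)" by (rule real_sqrt_le_mono)
      also have "\<dots> = X" using n0 by (simp add: X_def)
      finally show ?thesis .
    qed
    interpret M: mode_family \<mu> T \<alpha> C a b R h U
    proof
      show "summable R" using R by (rule sums_summable)
      show "0 \<le> R n" for n unfolding R_def using eigval_pos[of n] by simp
      show "h n \<in> borel_measurable borel" for n by (rule h1)
      show "s \<notin> {0<..<T} \<Longrightarrow> h n s = 0" for n s by (rule h2)
      show "(h n s)\<^sup>2 \<le> C * R n * eigval \<mu> n" for n s by (rule h3)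
      show "t \<in> {0..T} \<Longrightarrow> U n t = a n + b n * t + cv \<alpha> (h n) t" for n t by (rule U1[THEN conjunct1])
      show "t \<in> {0..T} \<Longrightarrow> eigval \<mu> n * (U n t)\<^sup>2 \<le> C * R n" for n t by (rule U1[THEN conjunct2, THEN conjunct1])
      show "t \<in> {0..T} \<Longrightarrow> (b n + cv (\<alpha> - 1) (h n) t)\<^sup>2 \<le> C * R n * eigval \<mu> n" for n t by (rule U1[THEN conjunct2, THEN conjunct2])
    qed (use assms C in auto)
    have z: "0 \<in> {0..T}" using assms(1) by simp
    have cap: "caputo_in_L2_dual \<mu> \<alpha> T M.u" unfolding caputo_in_L2_dual_def using M.G_caputo by blast
    have U0: "U n 0 = a n" for n proof -
      have "cv \<alpha> (h n) 0 = 0" by (rule cv_zero[OF M.h_nonpos]) simp_all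
      then show ?thesis using M.U_eq[OF z, of n] by simp
    qed
    have w0: "M.w n 0 = b n" for n proof -
      have "cv (\<alpha> - 1) (h n) 0 = 0" by (rule cv_zero[OF M.h_nonpos]) simp_all
      then show ?thesis by (simp add: M.w_def)
    qed
    have AEI: "AE x in Omega. v x = v' x" if v: "v \<in> Ltwo Omega" and v': "v' \<in> Ltwo Omega" and e: "\<And>n. fcoeff \<mu> v n = fcoeff \<mu> v' n" for v v'
    proof -
      have "AE x in Omega. v x - v' x = 0"
        by (rule fcoeff_zero_AE[OF Ltwo.diff_mem[OF v v']]) (simp add: Ltwo.diff_left[OF v v' eigfun_Ltwo] e)
      then show ?thesis by (rule eventually_mono) simp
    qed
    have inner_q: "Ltwo_inner Omega (\<lambda>x. p x * c) v = c * Ltwo_inner Omega p v" if "v \<in> Ltwo Omega" for v c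
      using Ltwo.scale_left[OF p that, of c] by (simp only: mult.commute)
    have weak: "weak_solution \<mu> \<alpha> T p q u0 u1 M.u"
      unfolding weak_solution_def
    proof (intro conjI M.u_cont M.u_C1 cap ballI)
      show "AE x in Omega. M.u 0 x = u0 x"
        by (rule AEI[OF Hs1_Ltwo[OF M.u_coeff_Hs(1)[OF z]] Hs1_Ltwo[OF u0]]) (simp only: M.u_coeff_Hs(2)[OF z] U0 a_def)
      show "Dt \<mu> T M.u 0 v = pivot u1 v" if v: "v \<in> Hs \<mu> 1" for v
        using sums_unique[OF Parseval_sums[OF u1 Hs1_Ltwo[OF v]]]
        by (simp only: M.Dt_u(3)[OF z v] w0 synth_def b_def pivot_def)
      have "AE t in ?M. t \<in> {0<..<T}" by (rule AE_I2) simp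
      with M.caputo_u qq' show "AE t in ?M. \<forall>v\<in>Hs \<mu> 1. caputo \<mu> \<alpha> T M.u t v + a_form \<mu> (M.u t) v = Ltwo_inner Omega (\<lambda>x. p x * q t) v"
      proof eventually_elim
        case (elim t)
        show ?case
        proof
          fix v assume v: "v \<in> Hs \<mu> 1"
          have t: "t \<in> {0..T}" using elim(3) by simp
          have "(\<lambda>n. q t * (fcoeff \<mu> p n * fcoeff \<mu> v n) - eigval \<mu> n * fcoeff \<mu> (M.u t) n * fcoeff \<mu> v n) sums
              (q t * Ltwo_inner Omega p v - a_form \<mu> (M.u t) v)"
            by (intro sums_diff sums_mult Parseval_sums[OF p Hs1_Ltwo[OF v]] a_form_sums M.u_coeff_Hs(1) t v)
          moreover have "q t * (fcoeff \<mu> p n * fcoeff \<mu> v n) - eigval \<mu> n * fcoeff \<mu> (M.u t) n * fcoeff \<mu> v n = h n t * fcoeff \<mu> v n" for n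
            by (simp add: h_eq[OF elim(3)] M.u_coeff_Hs(2)[OF t] f_def elim(2) algebra_simps)
          ultimately have "M.G t v = q t * Ltwo_inner Omega p v - a_form \<mu> (M.u t) v"
            by (simp add: M.G_def synth_def sums_iff)
          moreover have "caputo \<mu> \<alpha> T M.u t v = M.G t v" using elim(1) v by blast
          ultimately show "caputo \<mu> \<alpha> T M.u t v + a_form \<mu> (M.u t) v = Ltwo_inner Omega (\<lambda>x. p x * q t) v"
            by (simp add: inner_q Hs1_Ltwo[OF v])
        qed
      qed
    qed
    have unique: "AE x in Omega. w t x = M.u t x" if w: "weak_solution \<mu> \<alpha> T p q u0 u1 w" and t: "t \<in> {0..T}" for w t
    proof -
      note W = w[unfolded weak_solution_def]
      have wH: "w s \<in> Hs \<mu> 1" if "s \<in> {0..T}" for s by (rule W[THEN conjunct1, unfolded cont_H1_def, THEN bspec, OF that, THEN conjunct1])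
      have wC: "C1_dual \<mu> T w" by (rule W[THEN conjunct2, THEN conjunct1])
      have "\<exists>G. has_caputo \<mu> \<alpha> T w G" by (rule W[THEN conjunct2, THEN conjunct2, THEN conjunct1, unfolded caputo_in_L2_dual_def])
      then have wcap: "has_caputo \<mu> \<alpha> T w (caputo \<mu> \<alpha> T w)" unfolding caputo_def by (rule someI_ex)
      have weq: "AE s in ?M. \<forall>v\<in>Hs \<mu> 1. caputo \<mu> \<alpha> T w s v + a_form \<mu> (w s) v = Ltwo_inner Omega (\<lambda>x. p x * q s) v" by (rule W[THEN conjunct2, THEN conjunct2, THEN conjunct2, THEN conjunct2, THEN conjunct2])
      have w0: "AE x in Omega. w 0 x = u0 x" by (rule W[THEN conjunct2, THEN conjunct2, THEN conjunct2, THEN conjunct1])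
      have w1: "Dt \<mu> T w 0 v = pivot u1 v" if "v \<in> Hs \<mu> 1" for v by (rule W[THEN conjunct2, THEN conjunct2, THEN conjunct2, THEN conjunct2, THEN conjunct1, THEN bspec, OF that])
      have "fcoeff \<mu> (w t) n = U n t" for n
      proof (rule M.weak_solution_coeff[OF fm fF h_eq wH wC _ _ wcap _ t])
        show "fcoeff \<mu> (w 0) n = a n"
          unfolding a_def by (rule Ltwo_inner_cong_AE[OF Hs1_Ltwo[OF wH[OF z]] Hs1_Ltwo[OF u0] eigfun_Ltwo eigfun_Ltwo w0]) simp
        show "Dt \<mu> T w 0 (eigfun \<mu> n) = b n" by (simp add: w1 eigfun_Hs1 pivot_def b_def)
        have "AE s in ?M. s \<in> {0<..<T}" by (rule AE_I2) simp
        with weq qq' show "AE s in ?M. caputo \<mu> \<alpha> T w s (eigfun \<mu> n) = f n s - eigval \<mu> n * fcoeff \<mu> (w s) n"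
        proof eventually_elim
          case (elim s)
          have s: "s \<in> {0..T}" using elim(3) by simp
          have "caputo \<mu> \<alpha> T w s (eigfun \<mu> n) + a_form \<mu> (w s) (eigfun \<mu> n) = Ltwo_inner Omega (\<lambda>x. p x * q s) (eigfun \<mu> n)"
            using elim(1) eigfun_Hs1 by blast
          then show ?case
            by (simp add: a_form_eigfun[OF wH[OF s]] inner_q[OF eigfun_Ltwo] f_def elim(2) algebra_simps)
        qed
      qed
      then show ?thesis
        by (intro AEI Hs1_Ltwo wH M.u_coeff_Hs(1) t) (simp add: M.u_coeff_Hs(2)[OF t])
    qed
    have S0: "sqrt (T * (C * suminf R)) = sqrt (T * C) * sqrt (suminf R)" "sqrt (C * suminf R) = sqrt C * sqrt (suminf R)"
      by (simp_all add: real_sqrt_mult mult.assoc)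
    have "(SUP t\<in>{0..T}. Hs_norm \<mu> 1 (M.u t)) \<le> sqrt (C * suminf R)"
      by (rule cSUP_least) (use z M.u_norm in auto)
    moreover have "(SUP t\<in>{0..T}. Hdual_norm \<mu> 1 (Dt \<mu> T M.u t)) \<le> sqrt (C * suminf R)"
      by (rule cSUP_least) (use z M.Dt_u_norm in auto)
    moreover have "L2_dual_norm \<mu> T (caputo \<mu> \<alpha> T M.u) \<le> sqrt (T * (C * suminf R))" by (rule M.caputo_u_norm)
    moreover have "K * sqrt (suminf R) = 2 * (sqrt C * sqrt (suminf R)) + sqrt (T * C) * sqrt (suminf R)" by (simp add: K_def algebra_simps)
    moreover have "K * sqrt (suminf R) \<le> K * X" by (rule mult_left_mono[OF RX]) (use K in simp)
    ultimately have bound: "(SUP t\<in>{0..T}. Hs_norm \<mu> 1 (M.u t)) + (SUP t\<in>{0..T}. Hdual_norm \<mu> 1 (Dt \<mu> T M.u t))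
        + L2_dual_norm \<mu> T (caputo \<mu> \<alpha> T M.u) \<le> K * X" unfolding S0 by linarith
    show "\<exists>u. weak_solution \<mu> \<alpha> T p q u0 u1 u \<and>
      (\<forall>w. weak_solution \<mu> \<alpha> T p q u0 u1 w \<longrightarrow> (\<forall>t\<in>{0..T}. AE x in Omega. w t x = u t x)) \<and>
      cont_H1 \<mu> T u \<and> C1_dual \<mu> T u \<and> caputo_in_L2_dual \<mu> \<alpha> T u \<and>
      (SUP t\<in>{0..T}. Hs_norm \<mu> 1 (u t)) + (SUP t\<in>{0..T}. Hdual_norm \<mu> 1 (Dt \<mu> T u t))
        + L2_dual_norm \<mu> T (caputo \<mu> \<alpha> T u)
      \<le> K * (Hs_norm \<mu> 1 u0 + Ltwo_norm Omega u1
               + Ltwo_norm Omega p * Linf_norm (time_interval T) q)"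
    proof (intro exI[of _ M.u] conjI allI impI ballI)
    qed (use weak unique M.u_cont M.u_C1 cap bound in \<open>simp_all only: X_def Q_def\<close>)
  qed
qed

end
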